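(* Let $F:\mathbb{W}\to\mathbb{R}$ be a measurable function such that $$\int_{\mathbb{W}}e^{F}\,d\mathcal{W}<\infty\qquad\text{and}\qquad \int_{\mathbb{W}}F_{-}\,d\mathcal{W}<\infty,$$ where $F_{-}(w):=\max\{-F(w),0\}$. Then $$\log\mathbb{E}\left[e^{F(B)}\right]=\sup_{v\in\mathcal{V}}\mathbb{E}\left[F\left(B+\int_{0}^{\cdot}v_{t}\,dt\right)-\frac12\int_{0}^{\infty}|v_{t}|^{2}\,dt\right].$$
   Context: Fix a positive integer $d$. $B=\{B_t\}_{t\ge0}$ is a standard $d$-dimensional Brownian motion (started at the origin) on a probability space with probability measure $\mathbb{P}$ and expectation $\mathbb{E}$. $\mathcal{F}^{B}_{t}:=\sigma(B_s,0\le s\le t)\vee\mathcal{N}$ for $t\ge0$, where $\mathcal{N}$ is the set of all $\mathbb{P}$-null events. A drift is a $d$-dimensional process $v=\{v_t\}_{t\ge0}$ on the same probability space that is progressively measurable with respect to $\{\mathcal{F}^B_t\}_{t\ge0}$. $\mathcal{V}$ denotes the set of drifts $v$ with $\mathbb{E}\left[\int_0^\infty|v_t|^2\,dt\right]<\infty$, where $|\cdot|$ is the Euclidean norm. $\mathbb{W}$ is the space of $\mathbb{R}^d$-valued continuous functions on $[0,\infty)$ vanishing at the origin, with the topology of uniform convergence on compact subsets of $[0,\infty)$ and its Borel $\sigma$-field $\mathcal{B}(\mathbb{W})$; $\mathcal{W}$ is the Wiener measure on $(\mathbb{W},\mathcal{B}(\mathbb{W}))$. The expectations on the right-hand side are well-defined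 in $[-\infty,\infty)$: under $\int e^F\,d\mathcal{W}<\infty$, the positive part $\max\{F,0\}$ evaluated at $B+\int_0^\cdot v_t\,dt$ has finite expectation for every $v\in\mathcal{V}$, while the negative part may have infinite expectation. *)

theory Defs
  imports "HOL-Probability.Probability"
begin

definition path_space :: "(real \<Rightarrow> real^'d) set" where
  "path_space = {w \<in> extensional {0..}. continuous_on {0..} w \<and> w 0 = 0}"

text \<open>Uniform convergence on compact subsets of the half-line.\<close>

definition path_topology :: "(real \<Rightarrow> real^'d) topology" where
  "path_topology = topology (\<lambda>U. U \<subseteq> path_space \<and>
     (\<forall>w\<in>U. \<exists>K e. compact K \<and> K \<subseteq> {0..} \<and> e > 0 \<and>
        {w' \<in> path_space. \<forall>t\<in>K. dist (w' t) (w t) < e} \<subseteq> U))"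

lemma openin_path_topology:
  fixes U :: "(real \<Rightarrow> real^'d) set"
  shows "openin path_topology U \<longleftrightarrow> U \<subseteq> path_space \<and>
     (\<forall>w\<in>U. \<exists>K e. compact K \<and> K \<subseteq> {0..} \<and> e > 0 \<and>
        {w' \<in> path_space. \<forall>t\<in>K. dist (w' t) (w t) < e} \<subseteq> U)"
proof -
  define N where "N w K e = {w' \<in> path_space. \<forall>t\<in>K. dist (w' t) (w t) < e}"
    for w :: "real \<Rightarrow> real^'d" and K :: "real set" and e :: real
  define P where "P U w K e \<longleftrightarrow> compact K \<and> K \<subseteq> {0..} \<and> e > 0 \<and> N w K e \<subseteq> U"
    for U :: "(real \<Rightarrow> real^'d) set" and w K e
  have mono: "P T w K e" if "P S w K e" "S \<subseteq> T" for S T w K e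
    using that unfolding P_def by blast
  have Int: "P (S \<inter> T) w (K \<union> L) (min e f)" if "P S w K e" "P T w L f" for S T w K L e f
  proof -
    have "N w (K \<union> L) (min e f) \<subseteq> N w K e \<inter> N w L f"
      unfolding N_def by simp blast
    moreover have "compact (K \<union> L)"
      using that unfolding P_def by (intro compact_Un) simp_all
    ultimately show ?thesis
      using that unfolding P_def by (auto dest: subsetD)
  qed
  have "istopology (\<lambda>U. U \<subseteq> path_space \<and> (\<forall>w\<in>U. \<exists>K e. P U w K e))"
    unfolding istopology_def
  proof (rule conjI; intro allI impI)
    fix S T :: "(real \<Rightarrow> real^'d) set"
    assume "S \<subseteq> path_space \<and> (\<forall>w\<in>S. \<exists>K e. P S w K e)"
      and "T \<subseteq> path_space \<and> (\<forall>w\<in>T. \<exists>K e. P T w K e)"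
    then show "S \<inter> T \<subseteq> path_space \<and> (\<forall>w\<in>S \<inter> T. \<exists>K e. P (S \<inter> T) w K e)"
      using Int by (meson IntD1 IntD2 le_infI1)
  next
    fix \<K> :: "(real \<Rightarrow> real^'d) set set"
    assume "\<forall>S\<in>\<K>. S \<subseteq> path_space \<and> (\<forall>w\<in>S. \<exists>K e. P S w K e)"
    then show "\<Union>\<K> \<subseteq> path_space \<and> (\<forall>w\<in>\<Union>\<K>. \<exists>K e. P (\<Union>\<K>) w K e)"
      using mono by (meson Sup_least UnionE Union_upper)
  qed
  then show ?thesis
    unfolding path_topology_def P_def N_def by (rule fun_cong[OF topology_inverse'])
qed

definition borel_path_space :: "(real \<Rightarrow> real^'d) measure" where
  "borel_path_space = sigma path_space {U. openin path_topology U}"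

locale standard_brownian_motion = prob_space M
  for M :: "'o measure" and B :: "real \<Rightarrow> 'o \<Rightarrow> real^'d" +
  assumes starts_at_0: "\<And>\<omega>. \<omega> \<in> space M \<Longrightarrow> B 0 \<omega> = 0"
    and continuous_paths: "\<And>\<omega>. \<omega> \<in> space M \<Longrightarrow> continuous_on {0..} (\<lambda>t. B t \<omega>)"
    and measurable_marginals: "\<And>t. 0 \<le> t \<Longrightarrow> B t \<in> borel_measurable M"
    and independent_increments: "\<And>(\<tau> :: nat \<Rightarrow> real) n. 0 \<le> \<tau> 0 \<Longrightarrow> mono \<tau> \<Longrightarrow>
      indep_vars (\<lambda>_. borel) (\<lambda>i \<omega>. B (\<tau> (Suc i)) \<omega> - B (\<tau> i) \<omega>) {..<n}"
    and gaussian_increments: "\<And>s t. 0 \<le> s \<Longrightarrow> s < t \<Longrightarrow>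
      distributed M lborel (\<lambda>\<omega>. B t \<omega> - B s \<omega>)
        (\<lambda>x. ennreal (\<Prod>i\<in>UNIV. normal_density 0 (sqrt (t - s)) (x $ i)))"

definition wiener_measure :: "(real \<Rightarrow> real^'d) measure \<Rightarrow> bool" where
  "wiener_measure W \<longleftrightarrow>
     sets W = sets borel_path_space \<and> standard_brownian_motion W (\<lambda>t w. w t)"

definition augmented_filtration ::
    "'o measure \<Rightarrow> (real \<Rightarrow> 'o \<Rightarrow> real^'d) \<Rightarrow> real \<Rightarrow> 'o measure" where
  "augmented_filtration M B t = sigma (space M)
     ({B s -` A \<inter> space M | s A. 0 \<le> s \<and> s \<le> t \<and> A \<in> sets borel} \<union> null_sets M)"

definition progressively_measurable ::
    "(real \<Rightarrow> 'o measure) \<Rightarrow> (real \<Rightarrow> 'o \<Rightarrow> real^'d) \<Rightarrow> bool" where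
  "progressively_measurable \<F> v \<longleftrightarrow> (\<forall>t\<ge>0.
     (\<lambda>(s, \<omega>). v s \<omega>) \<in> borel_measurable (restrict_space borel {0..t} \<Otimes>\<^sub>M \<F> t))"

definition energy :: "(real \<Rightarrow> 'o \<Rightarrow> real^'d) \<Rightarrow> 'o \<Rightarrow> ennreal" where
  "energy v \<omega> = (\<integral>\<^sup>+t\<in>{0..}. ennreal ((norm (v t \<omega>))\<^sup>2) \<partial>lborel)"

definition finite_energy_drifts ::
    "'o measure \<Rightarrow> (real \<Rightarrow> 'o \<Rightarrow> real^'d) \<Rightarrow> (real \<Rightarrow> 'o \<Rightarrow> real^'d) set" where
  "finite_energy_drifts M B =
     {v. progressively_measurable (augmented_filtration M B) v \<and>
         (\<integral>\<^sup>+\<omega>. energy v \<omega> \<partial>M) < \<infinity>}"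

definition sample_path :: "(real \<Rightarrow> 'o \<Rightarrow> real^'d) \<Rightarrow> 'o \<Rightarrow> real \<Rightarrow> real^'d" where
  "sample_path X \<omega> = (\<lambda>t\<in>{0..}. X t \<omega>)"

text \<open>For a drift of finite expected energy, \<open>\<lambda>t. v t \<omega>\<close> is almost surely square integrable, so that
  \<open>sample_path (drifted B v) \<omega>\<close> lies in \<^const>\<open>path_space\<close> for almost every \<open>\<omega>\<close>. On the
  exceptional null set the Bochner integral below may be a junk value.\<close>

definition drifted ::
    "(real \<Rightarrow> 'o \<Rightarrow> real^'d) \<Rightarrow> (real \<Rightarrow> 'o \<Rightarrow> real^'d) \<Rightarrow> real \<Rightarrow> 'o \<Rightarrow> real^'d" where
  "drifted B v t \<omega> = B t \<omega> + (LINT s:{0..t}|lborel. v s \<omega>)"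

text \<open>Expectation of an extended-real random variable as \<open>E[X\<^sup>+] - E[X\<^sup>-]\<close>; \<^const>\<open>e2ennreal\<close>
  sends negative values to \<open>0\<close>. Changing \<open>X\<close> on a null set does not change the value, even if
  measurability is lost on it. If both parts are infinite, the value is \<open>\<infinity>\<close>.\<close>

definition extended_expectation :: "'o measure \<Rightarrow> ('o \<Rightarrow> ereal) \<Rightarrow> ereal" where
  "extended_expectation M X =
     enn2ereal (\<integral>\<^sup>+\<omega>. e2ennreal (X \<omega>) \<partial>M) - enn2ereal (\<integral>\<^sup>+\<omega>. e2ennreal (- X \<omega>) \<partial>M)"

end

theory Submission
  imports Defs
begin

text \<open>The formula is a duality between exponential means and relative entropy in which measures
  are replaced by drifts. Both inequalities come from a Girsanov formula on dyadic grids. If every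
  increment of \<open>B\<close> over a grid cell is shifted by a control that depends on the past only, then an
  explicit weight turns the shifted increments back into independent Gaussian variables
  (\<open>girsanov_grid\<close>): an increment is independent of the augmented past, so that one may freeze the
  past and apply the Cameron--Martin formula to one increment at a time.

  Grids suffice because of a class of test functions. Sums of shifted cosines of Wiener integrals of
  step functions, the \<open>trig_polys\<close>, read a path on one grid only, are preserved by the Gaussian mean
  over one increment, and are an algebra that generates the Borel sets of path space. Hence they
  approximate every bounded measurable functional in mean with respect to finitely many laws at once
  (\<open>trig_polys_dense\<close>, \<open>trig_polys_dense_in_two_means\<close>).

  For the upper bound a drift is replaced by the grid control that spends on each cell the
  displacement of the preceding cell. The delay makes it adapted, Cauchy--Schwarz shows that it has
  no more energy than the drift, and its paths converge to the driven path as the grid is refined.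
  Jensen's inequality for the Girsanov weight bounds a trigonometric polynomial
  (\<open>upper_bound_trig\<close>); approximation under the law of \<open>B\<close> and the law of the driven path together
  gives bounded functionals, and truncation the others (\<open>upper_bound\<close>).

  For the lower bound let \<open>f\<close> be a trigonometric polynomial with a positive lower bound, close to
  \<open>e\<^sup>F\<close>. Dynamic programming with the conditional means of \<open>f\<close> gives a grid control whose loss is of
  order \<open>h\<^sup>2\<close> on each of the order \<open>1 / h\<close> cells (\<open>gaussian_step\<close>, \<open>lower_bound_trig\<close>). It is nearly
  optimal for \<open>ln f\<close>, but \<open>ln f\<close> is close to \<open>F\<close> only in mean under the law of \<open>B\<close>, while the value of
  the control is a mean under the law of the driven path. Therefore the control is stopped when its
  density reaches a level \<open>e\<^sup>\<kappa>\<close> of at least twice the maximum of \<open>f\<close> divided by its mean. Stopping bounds the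
  density of the law of the driven path by \<open>e\<^sup>\<kappa>\<close> (\<open>stopped_law\<close>), and by the upper bound itself a
  nearly optimal control rarely reaches that level (\<open>stopping_probability\<close>), so that little is lost
  (\<open>bounded_density_drift\<close>). The bound on the density transfers smallness in mean from \<open>B\<close> to the
  driven path; applied to the truncation error of \<open>F\<close> from below it uses that \<open>F\<^sub>-\<close> has finite mean
  (\<open>near_optimal_drift\<close>).\<close>

section \<open>Path space\<close>

definition dyadic_floor :: "nat \<Rightarrow> real \<Rightarrow> real" where
  "dyadic_floor m t = real (nat \<lfloor>t * 2 ^ m\<rfloor>) / 2 ^ m"

lemma dyadic_floor_le: "0 \<le> t \<Longrightarrow> dyadic_floor m t \<le> t"
  unfolding dyadic_floor_def by (simp add: field_simps)

lemma dyadic_floor_gt: "0 \<le> t \<Longrightarrow> t < dyadic_floor m t + 1 / 2 ^ m"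
  unfolding dyadic_floor_def by (simp add: field_simps) linarith

lemma dyadic_floor_nonneg: "0 \<le> dyadic_floor m t"
  unfolding dyadic_floor_def by simp

lemma dyadic_floor_ge:
  assumes "n \<le> m" "real i / 2 ^ n \<le> t"
  shows "real i / 2 ^ n \<le> dyadic_floor m t"
proof -
  have eq: "real i / 2 ^ n = real (i * 2 ^ (m - n)) / 2 ^ m"
    using assms(1) by (auto simp: le_iff_add power_add)
  have "real (i * 2 ^ (m - n)) \<le> t * 2 ^ m"
    using assms(2) unfolding eq by (simp add: field_simps)
  then have "i * 2 ^ (m - n) \<le> nat \<lfloor>t * 2 ^ m\<rfloor>"
    by (metis le_nat_floor)
  then have "real (i * 2 ^ (m - n)) \<le> real (nat \<lfloor>t * 2 ^ m\<rfloor>)"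
    by (rule of_nat_mono)
  then show ?thesis
    unfolding eq dyadic_floor_def by (rule divide_right_mono) simp
qed

lemma dyadic_floor_tendsto:
  assumes "0 \<le> t"
  shows "(\<lambda>m. dyadic_floor m t) \<longlonglongrightarrow> t"
proof (rule LIMSEQ_I)
  fix e :: real assume "0 < e"
  obtain N where N: "(1/2::real) ^ N < e"
    using real_arch_pow_inv[OF \<open>0 < e\<close>, of "1/2"] by auto
  have "norm (dyadic_floor m t - t) < e" if "N \<le> m" for m
  proof -
    have "(1/2::real) ^ m \<le> (1/2) ^ N"
      using that by (intro power_decreasing) auto
    then show ?thesis
      using N dyadic_floor_le[OF assms, of m] dyadic_floor_gt[OF assms, of m]
      by (simp add: power_one_over)
  qed
  then show "\<exists>no. \<forall>m\<ge>no. norm (dyadic_floor m t - t) < e" by blast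
qed

lemma path_spaceD:
  assumes "w \<in> path_space"
  shows "continuous_on {0..} w" "w 0 = 0" "w \<in> extensional {0..}"
  using assms unfolding path_space_def by auto

lemma path_at_dyadic_floor_tendsto:
  fixes w :: "real \<Rightarrow> 'b::topological_space"
  assumes "continuous_on {0..} w" "0 \<le> t"
  shows "(\<lambda>m. w (dyadic_floor m t)) \<longlonglongrightarrow> w t"
  using assms(1) dyadic_floor_tendsto[OF assms(2)] unfolding continuous_on_sequentially
  using assms(2) dyadic_floor_nonneg by (auto simp: comp_def)

lemma space_borel_path_space [simp]: "space borel_path_space = path_space"
  unfolding borel_path_space_def by (intro space_measure_of) (auto simp: openin_path_topology)

lemma sets_borel_path_space:
  "sets borel_path_space = sigma_sets path_space {U. openin path_topology U}"
  unfolding borel_path_space_def by (intro sets_measure_of) (auto simp: openin_path_topology)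

lemma evaluation_measurable [measurable]:
  assumes "0 \<le> t"
  shows "(\<lambda>w. w t) \<in> borel_measurable (borel_path_space :: (real \<Rightarrow> real^'d) measure)"
proof (rule borel_measurableI)
  fix S :: "(real^'d) set" assume S: "open S"
  let ?U = "{w \<in> path_space. w t \<in> S}"
  have "\<exists>K e. compact K \<and> K \<subseteq> {0..} \<and> e > 0 \<and>
          {w' \<in> path_space. \<forall>t\<in>K. dist (w' t) (w t) < e} \<subseteq> ?U" if w: "w \<in> ?U" for w
  proof -
    obtain e where "e > 0" "\<forall>y. dist y (w t) < e \<longrightarrow> y \<in> S"
      using S w unfolding open_dist by blast
    then show ?thesis
      using assms by (intro exI[of _ "{t}"] exI[of _ e]) auto
  qed
  then have "openin path_topology ?U"
    unfolding openin_path_topology by auto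
  then have "?U \<in> sets borel_path_space"
    unfolding sets_borel_path_space by auto
  also have "?U = (\<lambda>w. w t) -` S \<inter> space borel_path_space" by auto
  finally show "(\<lambda>w. w t) -` S \<inter> space borel_path_space \<in> sets borel_path_space" .
qed

text \<open>Closed tubes of rational radius around dyadic step functions form a countable family that
  refines every neighbourhood. Membership in such a tube can be tested at dyadic times only, which
  is why dyadic evaluations generate all Borel sets of path space.\<close>

lemma borel_path_space_dyadic:
  fixes \<Sigma> :: "(real \<Rightarrow> real^'d) measure"
  assumes space: "space \<Sigma> = path_space"
    and ev: "\<And>i n. (\<lambda>w. w (real i / 2 ^ n)) \<in> borel_measurable \<Sigma>"
  shows "sets borel_path_space \<subseteq> sets \<Sigma>"
proof -
  obtain D :: "(real^'d) set" where D: "countable D" "\<And>X. open X \<Longrightarrow> X \<noteq> {} \<Longrightarrow> \<exists>d\<in>D. d \<in> X"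
    using countable_dense_exists by metis
  then have "D \<noteq> {}" by (metis empty_iff open_UNIV UNIV_not_empty)
  define c where "c = from_nat_into D"
  have c: "\<exists>j. dist (c j) x < e" if e: "e > 0" for x e
  proof -
    obtain d where "d \<in> D" "d \<in> ball x e"
      using D(2)[of "ball x e"] e by (metis centre_in_ball empty_iff open_ball)
    then show ?thesis
      unfolding c_def using from_nat_into_to_nat_on[OF D(1) \<open>d \<in> D\<close>]
      by (metis dist_commute mem_ball)
  qed
  \<comment> \<open>The tube of radius \<open>1 / (k + 1)\<close> around the step function that takes the value \<open>c (cs ! i)\<close> on the
    \<open>i\<close>-th cell of length \<open>1 / 2 ^ n\<close>; only dyadic times are tested.\<close>
  define S where "S n k cs = {w \<in> path_space. \<forall>i<length cs. \<forall>j m.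
      real i / 2 ^ n \<le> real j / 2 ^ m \<and> real j / 2 ^ m \<le> real (Suc i) / 2 ^ n \<longrightarrow>
      dist (w (real j / 2 ^ m)) (c (cs ! i)) \<le> 1 / real (Suc k)}" for n k and cs :: "nat list"
  have S_meas: "S n k cs \<in> sets \<Sigma>" for n k cs
    unfolding S_def space[symmetric] using ev by measurable
  have S_all: "dist (w t) (c (cs ! i)) \<le> 1 / real (Suc k)"
    if w: "w \<in> S n k cs" "i < length cs" "real i / 2 ^ n \<le> t" "t \<le> real (Suc i) / 2 ^ n"
    for w n k cs i t
  proof -
    have t0: "0 \<le> t" using that(3) by (rule order_trans[rotated]) simp
    have cont: "continuous_on {0..} w" using w(1) path_spaceD(1) unfolding S_def by blast
    have "(\<lambda>m. dist (w (dyadic_floor m t)) (c (cs ! i))) \<longlonglongrightarrow> dist (w t) (c (cs ! i))"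
      by (intro tendsto_dist path_at_dyadic_floor_tendsto cont t0) auto
    moreover have "dist (w (dyadic_floor m t)) (c (cs ! i)) \<le> 1 / real (Suc k)" if "m \<ge> n" for m
      using w(1,2) dyadic_floor_ge[OF that w(3)] dyadic_floor_le[OF t0, of m] w(4)
      unfolding S_def dyadic_floor_def by fastforce
    ultimately show ?thesis
      by (intro LIMSEQ_le_const2[where X="\<lambda>m. dist (w (dyadic_floor m t)) (c (cs ! i))"]) auto
  qed
  have "U \<in> sets \<Sigma>" if U: "openin path_topology U" for U
  proof -
    have "\<exists>n k cs. w \<in> S n k cs \<and> S n k cs \<subseteq> U" if wU: "w \<in> U" for w
    proof -
      obtain K e where K: "compact K" "K \<subseteq> {0..}" "e > 0"
        and sub: "{w' \<in> path_space. \<forall>t\<in>K. dist (w' t) (w t) < e} \<subseteq> U"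
        using U wU unfolding openin_path_topology by blast
      have wP: "w \<in> path_space" using U wU unfolding openin_path_topology by blast
      obtain b where "b > 0" "\<forall>x\<in>K. norm x \<le> b"
        using compact_imp_bounded[OF K(1)] unfolding bounded_pos by blast
      then obtain T :: nat where T: "\<forall>x\<in>K. x \<le> real T"
        using real_arch_simple[of b] by (metis abs_le_D1 order_trans real_norm_def)
      obtain k where k: "1 / real (Suc k) < e / 2"
        using K(3) nat_approx_posE[of "e/2"] by auto
      define q where "q = 1 / real (Suc k)"
      have q: "q > 0" unfolding q_def by simp
      have "continuous_on {0..real T} w"
        using path_spaceD(1)[OF wP] by (rule continuous_on_subset) auto
      then have "uniformly_continuous_on {0..real T} w"
        by (rule compact_uniformly_continuous) auto
      then obtain d where d: "d > 0"
        "\<And>x y. x \<in> {0..real T} \<Longrightarrow> y \<in> {0..real T} \<Longrightarrow> dist x y < d \<Longrightarrow> dist (w x) (w y) < q / 2"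
        unfolding uniformly_continuous_on_def using q by (metis half_gt_zero)
      obtain n where "(1/2::real) ^ n < d"
        using real_arch_pow_inv[OF d(1), of "1/2"] by auto
      then have n: "1 / 2 ^ n < d" by (simp add: power_one_over)
      define N where "N = T * 2 ^ n"
      have "\<exists>j. dist (c j) (w (real i / 2 ^ n)) < q / 2" for i
        using c[of "q / 2" "w (real i / 2 ^ n)" for i] q by simp
      then obtain j where j: "\<And>i. dist (c (j i)) (w (real i / 2 ^ n)) < q / 2" by metis
      let ?cs = "map j [0..<N]"
      have "w \<in> S n k ?cs"
        unfolding S_def
      proof (intro CollectI conjI wP allI impI)
        fix i j' m
        assume i: "i < length ?cs" and b: "real i / 2 ^ n \<le> real j' / 2 ^ m \<and> real j' / 2 ^ m \<le> real (Suc i) / 2 ^ n"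
        let ?t = "real j' / 2 ^ m"
        have "real (Suc i) \<le> real T * 2 ^ n"
          using i unfolding N_def by (simp add: of_nat_mono[of "Suc i" "T * 2 ^ n", simplified])
        then have SiT: "real (Suc i) / 2 ^ n \<le> real T" by (simp add: field_simps)
        have "dist (w ?t) (w (real i / 2 ^ n)) \<le> q / 2"
        proof (rule order_less_imp_le, cases "?t = real (Suc i) / 2 ^ n")
          case True
          show "dist (w ?t) (w (real i / 2 ^ n)) < q / 2"
            using SiT b n by (intro d(2)) (auto simp: dist_real_def True field_simps)
        next
          case False
          show "dist (w ?t) (w (real i / 2 ^ n)) < q / 2"
          proof (intro d(2))
            show "?t \<in> {0..real T}" "real i / 2 ^ n \<in> {0..real T}"
              using SiT b by auto
            have "real (Suc i) / 2 ^ n = real i / 2 ^ n + 1 / 2 ^ n" by (simp add: field_simps)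
            then show "dist ?t (real i / 2 ^ n) < d"
              using b n by (auto simp: dist_real_def)
          qed
        qed
        moreover have "dist (w (real i / 2 ^ n)) (c (j i)) \<le> q / 2"
          using j[of i] by (simp add: dist_commute)
        ultimately have "dist (w ?t) (c (j i)) \<le> q / 2 + q / 2"
          using dist_triangle[of "w ?t" "c (j i)" "w (real i / 2 ^ n)"] by linarith
        then have "dist (w ?t) (c (j i)) \<le> q" by simp
        then show "dist (w ?t) (c (?cs ! i)) \<le> 1 / real (Suc k)"
          using i unfolding q_def by simp
      qed
      moreover have "S n k ?cs \<subseteq> U"
      proof (rule order_trans[OF _ sub], rule subsetI, intro CollectI conjI ballI)
        fix w' t assume w': "w' \<in> S n k ?cs"
        then show "w' \<in> path_space" unfolding S_def by blast
        assume t: "t \<in> K"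
        then have tb: "0 \<le> t" "t \<le> real T" using K(2) T by auto
        show "dist (w' t) (w t) < e"
        proof (cases "t = 0")
          case True
          have "w' \<in> path_space" using w' unfolding S_def by blast
          then show ?thesis using path_spaceD(2)[OF wP] path_spaceD(2)[of w'] K(3) True by simp
        next
          case False
          \<comment> \<open>The cell that contains \<open>t\<close> inside or as its right end, since the last cell ends at \<open>T\<close>.\<close>
          define i where "i = nat (\<lceil>t * 2 ^ n\<rceil> - 1)"
          have pos: "t * 2 ^ n > 0" using tb False by simp
          then have i: "real i < t * 2 ^ n" "t * 2 ^ n \<le> real i + 1"
            unfolding i_def by linarith+
          have "t * 2 ^ n \<le> real N" using tb unfolding N_def by simp
          then have "i < N" using i by linarith
          then have il: "i < length ?cs" by simp
          have ti: "real i / 2 ^ n \<le> t" "t \<le> real (Suc i) / 2 ^ n"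
            using i by (auto simp: field_simps)
          have "dist (w' t) (c (?cs ! i)) \<le> q" "dist (w t) (c (?cs ! i)) \<le> q"
            unfolding q_def using S_all[OF w' il ti] S_all[OF \<open>w \<in> S n k ?cs\<close> il ti] by auto
          then have "dist (w' t) (w t) \<le> q + q"
            using dist_triangle2[of "w' t" "w t" "c (?cs ! i)"] by linarith
          then show ?thesis using k unfolding q_def by auto
        qed
      qed
      ultimately show ?thesis by blast
    qed
    then have "U = (\<Union>n k cs. if S n k cs \<subseteq> U then S n k cs else {})"
      by (fastforce split: if_splits)
    moreover have "(\<Union>n k cs. if S n k cs \<subseteq> U then S n k cs else {}) \<in> sets \<Sigma>"
      by (intro sets.countable_UN'' countableI_type) (auto simp: S_meas)
    ultimately show ?thesis by metis
  qed
  then show ?thesis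
    unfolding sets_borel_path_space using space sets.sigma_sets_subset[of "{U. openin path_topology U}" \<Sigma>]
    by auto
qed

lemma measurable_into_path_space:
  fixes Y :: "'o \<Rightarrow> real \<Rightarrow> real^'d"
  assumes "\<And>\<omega>. \<omega> \<in> space M \<Longrightarrow> Y \<omega> \<in> path_space"
    and "\<And>t. 0 \<le> t \<Longrightarrow> (\<lambda>\<omega>. Y \<omega> t) \<in> borel_measurable M"
  shows "Y \<in> measurable M borel_path_space"
proof -
  let ?G = "{(\<lambda>w. w (real i / 2 ^ n)) -` A \<inter> path_space | i n A. A \<in> sets (borel :: (real^'d) measure)}"
  let ?\<Sigma> = "sigma path_space ?G"
  have G: "?G \<subseteq> Pow path_space" by auto
  have sp: "space ?\<Sigma> = path_space" using G by (rule space_measure_of)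
  have "(\<lambda>w. w (real i / 2 ^ n)) \<in> borel_measurable ?\<Sigma>" for i n
    unfolding measurable_def by (auto simp: sp sets_measure_of[OF G])
  then have "sets borel_path_space \<subseteq> sets ?\<Sigma>"
    by (intro borel_path_space_dyadic sp)
  moreover have "Y \<in> measurable M ?\<Sigma>"
  proof (rule measurable_measure_of[OF G])
    show "Y \<in> space M \<rightarrow> path_space" using assms(1) by auto
    fix y assume "y \<in> ?G"
    then obtain i n A where y: "y = (\<lambda>w. w (real i / 2 ^ n)) -` A \<inter> path_space" "A \<in> sets borel" by blast
    have "Y -` y \<inter> space M = (\<lambda>\<omega>. Y \<omega> (real i / 2 ^ n)) -` A \<inter> space M"
      using assms(1) y(1) by auto
    then show "Y -` y \<inter> space M \<in> sets M"
      using measurable_sets[OF assms(2) y(2), of "real i / 2 ^ n"] by simp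
  qed
  ultimately show ?thesis
    using assms(1) unfolding measurable_def by (auto simp: sp)
qed

section \<open>Algebras of bounded functions are dense in mean\<close>

lemma polynomial_of_algebra_member:
  fixes p :: "real \<Rightarrow> real"
  assumes "real_polynomial_function p"
    and const: "\<And>c::real. (\<lambda>_. c) \<in> \<A>"
    and add: "\<And>f g. f \<in> \<A> \<Longrightarrow> g \<in> \<A> \<Longrightarrow> (\<lambda>x. f x + g x) \<in> \<A>"
    and mult: "\<And>f g. f \<in> \<A> \<Longrightarrow> g \<in> \<A> \<Longrightarrow> (\<lambda>x. f x * g x) \<in> \<A>"
    and f: "f \<in> \<A>"
  shows "(\<lambda>x. p (f x)) \<in> \<A>"
  using assms(1)
proof induction
  case (linear g)
  then obtain c where "g = (\<lambda>x. x * c)" unfolding real_bounded_linear by blast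
  then show ?case using mult[OF f const[of c]] by simp
qed (auto intro: const add mult)

lemma continuous_of_algebra_member:
  fixes \<phi> :: "real \<Rightarrow> real"
  assumes const: "\<And>c::real. (\<lambda>_. c) \<in> \<A>"
    and add: "\<And>f g. f \<in> \<A> \<Longrightarrow> g \<in> \<A> \<Longrightarrow> (\<lambda>x. f x + g x) \<in> \<A>"
    and mult: "\<And>f g. f \<in> \<A> \<Longrightarrow> g \<in> \<A> \<Longrightarrow> (\<lambda>x. f x * g x) \<in> \<A>"
    and bdd: "\<forall>x\<in>S. \<bar>f x\<bar> \<le> C"
    and f: "f \<in> \<A>" and \<phi>: "continuous_on UNIV \<phi>" and e: "e > 0"
  shows "\<exists>g\<in>\<A>. \<forall>x\<in>S. \<bar>g x - \<phi> (f x)\<bar> < e"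
proof -
  have "continuous_on {-C..C} \<phi>" using \<phi> continuous_on_subset by blast
  then obtain p where p: "real_polynomial_function p" "\<And>t. t \<in> {-C..C} \<Longrightarrow> \<bar>\<phi> t - p t\<bar> < e"
    using Stone_Weierstrass_real_polynomial_function[of "{-C..C}" \<phi> e] e by auto
  have "(\<lambda>x. p (f x)) \<in> \<A>"
    by (rule polynomial_of_algebra_member[OF p(1) const add mult f])
  moreover have "\<bar>p (f x) - \<phi> (f x)\<bar> < e" if "x \<in> S" for x
    using p(2)[of "f x"] bdd that by (simp add: abs_minus_commute abs_le_iff minus_le_iff)
  ultimately show ?thesis by (intro bexI[of _ "\<lambda>x. p (f x)"] ballI)
qed

text \<open>The closure of the algebra in mean contains the indicators of the sublevel sets of its
  members, since composing with a continuous function stays in the uniform closure by Weierstrass;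
  the Dynkin argument extends this to all measurable sets. A last composition with a clipping
  function restores the bounds that approximation in mean loses.\<close>

theorem bounded_algebra_dense_in_mean:
  fixes \<nu> :: "'a measure" and F :: "'a \<Rightarrow> real"
  assumes "finite_measure \<nu>"
    and const: "\<And>c::real. (\<lambda>_. c) \<in> \<A>"
    and add: "\<And>f g. f \<in> \<A> \<Longrightarrow> g \<in> \<A> \<Longrightarrow> (\<lambda>x. f x + g x) \<in> \<A>"
    and mult: "\<And>f g. f \<in> \<A> \<Longrightarrow> g \<in> \<A> \<Longrightarrow> (\<lambda>x. f x * g x) \<in> \<A>"
    and meas: "\<And>f. f \<in> \<A> \<Longrightarrow> f \<in> borel_measurable \<nu>"
    and bdd: "\<And>f. f \<in> \<A> \<Longrightarrow> \<exists>C. \<forall>x\<in>space \<nu>. \<bar>f x\<bar> \<le> C"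
    and gen: "sets \<nu> \<subseteq> sigma_sets (space \<nu>) {{x \<in> space \<nu>. f x \<le> a} | f a. f \<in> \<A>}"
    and F: "F \<in> borel_measurable \<nu>" "\<And>x. x \<in> space \<nu> \<Longrightarrow> a \<le> F x \<and> F x \<le> b"
    and e: "\<epsilon> > 0"
  shows "\<exists>f\<in>\<A>. (\<forall>x\<in>space \<nu>. a - \<epsilon> \<le> f x \<and> f x \<le> b + \<epsilon>) \<and> (\<integral>x. \<bar>f x - F x\<bar> \<partial>\<nu>) < \<epsilon>"
proof -
  interpret finite_measure \<nu> by fact
  have integ: "integrable \<nu> f" if "f \<in> \<A>" for f
  proof -
    obtain C where "\<forall>x\<in>space \<nu>. \<bar>f x\<bar> \<le> C" using bdd[OF \<open>f \<in> \<A>\<close>] by blast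
    then show ?thesis using meas[OF \<open>f \<in> \<A>\<close>] by (intro integrable_const_bound[where B=C]) auto
  qed
  define L where "L g \<longleftrightarrow> integrable \<nu> g \<and> (\<forall>e>0. \<exists>f\<in>\<A>. (\<integral>x. \<bar>f x - g x\<bar> \<partial>\<nu>) < e)"
    for g :: "'a \<Rightarrow> real"
  have L_D: "\<exists>f\<in>\<A>. (\<integral>x. \<bar>f x - g x\<bar> \<partial>\<nu>) < e" if "L g" "e > 0" for g e
    using that unfolding L_def by blast
  have L_A: "L f" if "f \<in> \<A>" for f
    using integ[OF that] that unfolding L_def by (auto intro!: bexI[of _ f])
  have L_close: "L g" if g: "integrable \<nu> g" and *: "\<And>e. e > 0 \<Longrightarrow> \<exists>k. L k \<and> (\<integral>x. \<bar>k x - g x\<bar> \<partial>\<nu>) < e" for g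
    unfolding L_def
  proof (intro conjI g allI impI)
    fix e :: real assume e: "e > 0"
    obtain k where k: "L k" "(\<integral>x. \<bar>k x - g x\<bar> \<partial>\<nu>) < e/2" using *[of "e/2"] e by auto
    obtain f where f: "f \<in> \<A>" "(\<integral>x. \<bar>f x - k x\<bar> \<partial>\<nu>) < e/2" using L_D[OF k(1), of "e/2"] e by auto
    have ki: "integrable \<nu> k" using k(1) unfolding L_def by blast
    have "(\<integral>x. \<bar>f x - g x\<bar> \<partial>\<nu>) \<le> (\<integral>x. \<bar>f x - k x\<bar> + \<bar>k x - g x\<bar> \<partial>\<nu>)"
      using integ[OF f(1)] ki g by (intro integral_mono) auto
    also have "\<dots> = (\<integral>x. \<bar>f x - k x\<bar> \<partial>\<nu>) + (\<integral>x. \<bar>k x - g x\<bar> \<partial>\<nu>)"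
      using integ[OF f(1)] ki g by (intro Bochner_Integration.integral_add) auto
    finally show "\<exists>f\<in>\<A>. (\<integral>x. \<bar>f x - g x\<bar> \<partial>\<nu>) < e" using f k(2) by (intro bexI[of _ f]) auto
  qed
  have L_add: "L (\<lambda>x. f x + g x)" if fL: "L f" and gL: "L g" for f g
    unfolding L_def
  proof (intro conjI allI impI)
    have i: "integrable \<nu> f" "integrable \<nu> g" using fL gL unfolding L_def by auto
    then show "integrable \<nu> (\<lambda>x. f x + g x)" by auto
    fix e :: real assume e: "e > 0"
    obtain f' where f': "f' \<in> \<A>" "(\<integral>x. \<bar>f' x - f x\<bar> \<partial>\<nu>) < e/2" using L_D[OF fL, of "e/2"] e by auto
    obtain g' where g': "g' \<in> \<A>" "(\<integral>x. \<bar>g' x - g x\<bar> \<partial>\<nu>) < e/2" using L_D[OF gL, of "e/2"] e by auto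
    have "(\<integral>x. \<bar>(f' x + g' x) - (f x + g x)\<bar> \<partial>\<nu>) \<le> (\<integral>x. \<bar>f' x - f x\<bar> + \<bar>g' x - g x\<bar> \<partial>\<nu>)"
      using integ[OF f'(1)] integ[OF g'(1)] i by (intro integral_mono) auto
    also have "\<dots> = (\<integral>x. \<bar>f' x - f x\<bar> \<partial>\<nu>) + (\<integral>x. \<bar>g' x - g x\<bar> \<partial>\<nu>)"
      using integ[OF f'(1)] integ[OF g'(1)] i by (intro Bochner_Integration.integral_add) auto
    finally show "\<exists>k\<in>\<A>. (\<integral>x. \<bar>k x - (f x + g x)\<bar> \<partial>\<nu>) < e"
      using f' g' add[OF f'(1) g'(1)] by (intro bexI[of _ "\<lambda>x. f' x + g' x"]) auto
  qed
  have L_scale: "L (\<lambda>x. c * f x)" if fL: "L f" for f c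
    unfolding L_def
  proof (intro conjI allI impI)
    have i: "integrable \<nu> f" using fL unfolding L_def by auto
    then show "integrable \<nu> (\<lambda>x. c * f x)" by auto
    fix e :: real assume e: "e > 0"
    obtain f' where f': "f' \<in> \<A>" "(\<integral>x. \<bar>f' x - f x\<bar> \<partial>\<nu>) < e / (\<bar>c\<bar> + 1)"
      using L_D[OF fL, of "e / (\<bar>c\<bar> + 1)"] e by (auto simp: add_nonneg_pos)
    have "(\<integral>x. \<bar>c * f' x - c * f x\<bar> \<partial>\<nu>) = \<bar>c\<bar> * (\<integral>x. \<bar>f' x - f x\<bar> \<partial>\<nu>)"
      by (simp add: abs_mult flip: right_diff_distrib)
    also have "\<dots> \<le> (\<bar>c\<bar> + 1) * (\<integral>x. \<bar>f' x - f x\<bar> \<partial>\<nu>)"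
      by (intro mult_right_mono) auto
    also have "\<dots> < e" using f'(2) by (simp add: field_simps)
    finally show "\<exists>k\<in>\<A>. (\<integral>x. \<bar>k x - c * f x\<bar> \<partial>\<nu>) < e"
      using mult[OF const[of c] f'(1)] by (intro bexI[of _ "\<lambda>x. c * f' x"]) auto
  qed
  have L_lim: "L g" if s: "\<And>n. L (s n)" and lim: "\<And>x. x \<in> space \<nu> \<Longrightarrow> (\<lambda>n. s n x) \<longlonglongrightarrow> g x"
    and w: "integrable \<nu> w" "\<And>n x. x \<in> space \<nu> \<Longrightarrow> \<bar>s n x\<bar> \<le> w x" for s g w
  proof -
    have si: "\<And>n. integrable \<nu> (s n)" using s unfolding L_def by blast
    have gm: "g \<in> borel_measurable \<nu>"
      by (rule borel_measurable_LIMSEQ_real[OF lim]) (use si in auto)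
    have gw: "\<bar>g x\<bar> \<le> w x" if "x \<in> space \<nu>" for x
      by (rule LIMSEQ_le_const2[OF tendsto_rabs[OF lim[OF that]]]) (use w(2)[OF that] in auto)
    have gi: "integrable \<nu> g"
      using gw by (intro Bochner_Integration.integrable_bound[OF w(1) gm]) (auto intro!: AE_I2 intro: order_trans[OF _ abs_ge_self])
    have "(\<lambda>n. \<integral>x. \<bar>s n x - g x\<bar> \<partial>\<nu>) \<longlonglongrightarrow> (\<integral>x. 0 \<partial>\<nu>)"
    proof (rule integral_dominated_convergence[where w="\<lambda>x. 2 * w x"])
      show "AE x in \<nu>. (\<lambda>n. \<bar>s n x - g x\<bar>) \<longlonglongrightarrow> 0"
        using lim by (auto intro!: AE_I2 tendsto_rabs_zero simp: LIM_zero_iff)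
      show "AE x in \<nu>. norm \<bar>s n x - g x\<bar> \<le> 2 * w x" for n
      proof (rule AE_I2)
        fix x assume "x \<in> space \<nu>"
        then show "norm \<bar>s n x - g x\<bar> \<le> 2 * w x"
          using gw[of x] w(2)[of x n] by simp
      qed
    qed (use si gm w in auto)
    then have z: "(\<lambda>n. \<integral>x. \<bar>s n x - g x\<bar> \<partial>\<nu>) \<longlonglongrightarrow> 0" by simp
    show ?thesis
    proof (rule L_close[OF gi])
      fix e :: real assume "e > 0"
      then obtain n where "(\<integral>x. \<bar>s n x - g x\<bar> \<partial>\<nu>) < e"
        using order_tendstoD(2)[OF z] unfolding eventually_sequentially by blast
      then show "\<exists>k. L k \<and> (\<integral>x. \<bar>k x - g x\<bar> \<partial>\<nu>) < e" using s by blast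
    qed
  qed
  define G where "G = {E \<in> sets \<nu>. \<exists>g C. (\<forall>n. g n \<in> \<A>) \<and> (\<forall>n. \<forall>x\<in>space \<nu>. \<bar>g n x\<bar> \<le> C)
      \<and> (\<forall>x\<in>space \<nu>. (\<lambda>n. g n x) \<longlonglongrightarrow> indicator E x)}"
  have GI: "E \<in> G" if "E \<in> sets \<nu>" "\<And>n. g n \<in> \<A>" "\<And>n x. x \<in> space \<nu> \<Longrightarrow> \<bar>g n x\<bar> \<le> C"
    "\<And>x. x \<in> space \<nu> \<Longrightarrow> (\<lambda>n. g n x) \<longlonglongrightarrow> indicator E x" for E g C
    unfolding G_def using that by blast
  have GD: "\<exists>g C. (\<forall>n. g n \<in> \<A>) \<and> (\<forall>n. \<forall>x\<in>space \<nu>. \<bar>g n x\<bar> \<le> C)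
      \<and> (\<forall>x\<in>space \<nu>. (\<lambda>n. g n x) \<longlonglongrightarrow> indicator E x)" "E \<in> sets \<nu>" if "E \<in> G" for E
    using that unfolding G_def by blast+
  have sub: "{{x \<in> space \<nu>. f x \<le> a} | f a. f \<in> \<A>} \<subseteq> G"
  proof safe
    fix f a assume f: "f \<in> \<A>"
    obtain C where C: "\<forall>x\<in>space \<nu>. \<bar>f x\<bar> \<le> C" using bdd[OF f] by blast
    \<comment> \<open>Continuous ramps that decrease to the indicator of \<open>{..a}\<close>.\<close>
    define \<phi> where "\<phi> n t = max 0 (min 1 (1 - real n * (t - a)))" for n t
    have "continuous_on UNIV (\<phi> n)" for n unfolding \<phi>_def by (intro continuous_intros)
    then have "\<exists>g\<in>\<A>. \<forall>x\<in>space \<nu>. \<bar>g x - \<phi> n (f x)\<bar> < 1 / real (Suc n)" for n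
      by (intro continuous_of_algebra_member[OF const add mult C f]) auto
    then obtain g where g: "\<And>n. g n \<in> \<A>" "\<And>n x. x \<in> space \<nu> \<Longrightarrow> \<bar>g n x - \<phi> n (f x)\<bar> < 1 / real (Suc n)"
      by metis
    have b: "\<bar>g n x\<bar> \<le> 2" if "x \<in> space \<nu>" for n x
    proof -
      have "\<bar>\<phi> n (f x)\<bar> \<le> 1" unfolding \<phi>_def by auto
      moreover have "1 / real (Suc n) \<le> 1" by simp
      ultimately show ?thesis using g(2)[OF that, of n] by linarith
    qed
    have lim: "(\<lambda>n. g n x) \<longlonglongrightarrow> indicator {x \<in> space \<nu>. f x \<le> a} x" if x: "x \<in> space \<nu>" for x
    proof -
      have "(\<lambda>n. g n x - \<phi> n (f x)) \<longlonglongrightarrow> 0"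
      proof (rule Lim_null_comparison[OF _ LIMSEQ_inverse_real_of_nat])
        show "\<forall>\<^sub>F n in sequentially. norm (g n x - \<phi> n (f x)) \<le> inverse (real (Suc n))"
          using g(2)[OF x] by (auto simp: inverse_eq_divide intro!: always_eventually less_imp_le)
      qed
      moreover have "(\<lambda>n. \<phi> n (f x)) \<longlonglongrightarrow> indicator {x \<in> space \<nu>. f x \<le> a} x"
      proof (cases "f x \<le> a")
        case True
        then have "1 - real n * (f x - a) \<ge> 1" for n by (simp add: mult_nonneg_nonpos)
        then have "\<phi> n (f x) = 1" for n unfolding \<phi>_def by (simp add: min_absorb1)
        then show ?thesis using True x by simp
      next
        case False
        then have p: "f x - a > 0" by simp
        obtain N where N: "1 < real N * (f x - a)" using reals_Archimedean3[OF p] by blast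
        have "\<phi> n (f x) = 0" if "n \<ge> N" for n
        proof -
          have "real N * (f x - a) \<le> real n * (f x - a)" using that p by (intro mult_right_mono) auto
          then show ?thesis using N unfolding \<phi>_def by simp
        qed
        then have "eventually (\<lambda>n. \<phi> n (f x) = 0) sequentially"
          unfolding eventually_sequentially by blast
        then show ?thesis using False by (simp add: tendsto_eventually)
      qed
      ultimately show ?thesis using tendsto_add by fastforce
    qed
    show "{x \<in> space \<nu>. f x \<le> a} \<in> G"
    proof (rule GI[where g=g and C=2])
      show "{x \<in> space \<nu>. f x \<le> a} \<in> sets \<nu>" using meas[OF f] by measurable
      show "g n \<in> \<A>" for n by (rule g(1))
      show "\<bar>g n x\<bar> \<le> 2" if "x \<in> space \<nu>" for n x by (rule b[OF that])
      show "(\<lambda>n. g n x) \<longlonglongrightarrow> indicator {x \<in> space \<nu>. f x \<le> a} x" if "x \<in> space \<nu>" for x by (rule lim[OF that])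
    qed
  qed
  have G_sets: "G \<subseteq> sets \<nu>" unfolding G_def by blast
  have Gs: "sigma_sets (space \<nu>) G \<subseteq> sets \<nu>" by (rule sets.sigma_sets_subset[OF G_sets])
  have stable: "Int_stable G"
  proof (rule Int_stableI)
    fix E E' assume E: "E \<in> G" "E' \<in> G"
    obtain g C where
      g: "\<And>n. g n \<in> \<A>" "\<And>n x. x\<in>space \<nu> \<Longrightarrow> \<bar>g n x\<bar> \<le> C" "\<And>x. x\<in>space \<nu> \<Longrightarrow> (\<lambda>n. g n x) \<longlonglongrightarrow> indicator E x"
      using GD(1)[OF E(1)] by metis
    obtain g' C' where
      g': "\<And>n. g' n \<in> \<A>" "\<And>n x. x\<in>space \<nu> \<Longrightarrow> \<bar>g' n x\<bar> \<le> C'" "\<And>x. x\<in>space \<nu> \<Longrightarrow> (\<lambda>n. g' n x) \<longlonglongrightarrow> indicator E' x"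
      using GD(1)[OF E(2)] by metis
    have bd: "\<bar>g n x * g' n x\<bar> \<le> \<bar>C\<bar> * \<bar>C'\<bar>" if "x \<in> space \<nu>" for n x
      unfolding abs_mult using g(2)[OF that, of n] g'(2)[OF that, of n] by (intro mult_mono) auto
    have lim: "(\<lambda>n. g n x * g' n x) \<longlonglongrightarrow> indicator (E \<inter> E') x" if "x \<in> space \<nu>" for x
      using tendsto_mult[OF g(3)[OF that] g'(3)[OF that]] by (simp add: indicator_inter_arith)
    show "E \<inter> E' \<in> G"
    proof (rule GI[where g="\<lambda>n x. g n x * g' n x" and C="\<bar>C\<bar> * \<bar>C'\<bar>"])
      show "E \<inter> E' \<in> sets \<nu>" using GD(2)[OF E(1)] GD(2)[OF E(2)] by (rule sets.Int)
      show "(\<lambda>x. g n x * g' n x) \<in> \<A>" for n by (rule mult[OF g(1) g'(1)])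
      show "\<bar>g n x * g' n x\<bar> \<le> \<bar>C\<bar> * \<bar>C'\<bar>" if "x \<in> space \<nu>" for n x by (rule bd[OF that])
      show "(\<lambda>n. g n x * g' n x) \<longlonglongrightarrow> indicator (E \<inter> E') x" if "x \<in> space \<nu>" for x by (rule lim[OF that])
    qed
  qed
  have ind: "L (indicator E)" if "E \<in> sets \<nu>" for E
  proof -
    have EG: "E \<in> sigma_sets (space \<nu>) G" using that gen sigma_sets_mono'[OF sub] by blast
    have PG: "G \<subseteq> Pow (space \<nu>)" using G_sets sets.sets_into_space by blast
    from stable PG EG show ?thesis
    proof (induction rule: sigma_sets_induct_disjoint)
      case (basic E)
      obtain g C where g: "\<And>n. g n \<in> \<A>" "\<And>n x. x\<in>space \<nu> \<Longrightarrow> \<bar>g n x\<bar> \<le> C" "\<And>x. x\<in>space \<nu> \<Longrightarrow> (\<lambda>n. g n x) \<longlonglongrightarrow> indicator E x"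
        using GD(1)[OF basic] by metis
      show ?case by (rule L_lim[where s=g and w="\<lambda>_. C"]) (use g L_A in auto)
    next
      case empty
      show ?case using L_A[OF const[of 0]] by (simp add: indicator_def)
    next
      case (compl E)
      have "L (\<lambda>x. 1 + (-1) * indicator E x)"
        by (intro L_add L_scale compl L_A const)
      then show ?case
        by (rule L_lim[where w="\<lambda>_. 1" and s="\<lambda>_ x. 1 + (-1) * indicator E x"]) (auto split: split_indicator)
    next
      case (union A)
      have "L (\<lambda>x. \<Sum>i<n. indicator (A i) x)" for n
      proof (induction n)
        case 0 show ?case using L_A[OF const[of 0]] by simp
      next
        case (Suc n) then show ?case using L_add[OF Suc union(3)[of n]] by simp
      qed
      moreover have "(\<lambda>n. \<Sum>i<n. indicator (A i) x) \<longlonglongrightarrow> (indicator (\<Union>i. A i) x :: real)" for x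
        using indicator_sums[of A x] union(1) unfolding sums_def disjoint_family_on_def by blast
      moreover have "\<bar>\<Sum>i<n. indicator (A i) x :: real\<bar> \<le> 1" for n x
      proof -
        have "(\<Sum>i<n. indicator (A i) x :: real) = indicator (\<Union>i\<in>{..<n}. A i) x"
          using union(1) by (subst indicator_UN_disjoint) (auto simp: disjoint_family_on_def)
        then show ?thesis by simp
      qed
      ultimately show ?case
        by (intro L_lim[where w="\<lambda>_. 1" and s="\<lambda>n x. \<Sum>i<n. indicator (A i) x" and g="indicator (\<Union>i. A i)"]) auto
    qed
  qed
  have L_all: "L f" if "integrable \<nu> f" for f
    using that
  proof (induction rule: integrable_induct)
    case (base A c)
    then show ?case using L_scale[OF ind[OF base(1)], of c] by (simp add: mult.commute)
  next
    case (add f g) then show ?case by (intro L_add)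
  next
    case (lim f s)
    then show ?case by (intro L_lim[where s=s and g=f and w="\<lambda>x. 2 * \<bar>f x\<bar>"]) auto
  qed
  show ?thesis
  proof (cases "space \<nu> = {}")
    case True
    then have "(\<integral>x. \<bar>0 - F x\<bar> \<partial>\<nu>) = 0"
      by (metis (no_types, lifting) Bochner_Integration.integral_cong empty_iff integral_zero)
    then show ?thesis using True e const[of 0] by (intro bexI[of _ "\<lambda>_. 0"]) auto
  next
    case False
    then have ab: "a \<le> b" using F(2) by force
    have Fi: "integrable \<nu> F"
      using F by (intro integrable_const_bound[where B="max \<bar>a\<bar> \<bar>b\<bar>"]) (auto intro!: AE_I2 dest!: F(2))
    obtain f where f: "f \<in> \<A>" "(\<integral>x. \<bar>f x - F x\<bar> \<partial>\<nu>) < \<epsilon>/2"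
      using L_D[OF L_all[OF Fi], of "\<epsilon>/2"] e by auto
    define m where "m = measure \<nu> (space \<nu>)"
    have m: "m \<ge> 0" unfolding m_def by simp
    define \<delta> where "\<delta> = \<epsilon> / (2 * (1 + m))"
    have \<delta>: "\<delta> > 0" "\<delta> \<le> \<epsilon>" "\<delta> * m \<le> \<epsilon> / 2"
      using e m mult_nonneg_nonneg[of \<epsilon> m] unfolding \<delta>_def by (auto simp: field_simps)
    \<comment> \<open>Clipping to \<open>{a..b}\<close> does not increase the distance to F.\<close>
    define \<phi> where "\<phi> t = max a (min b t)" for t
    obtain C where C: "\<forall>x\<in>space \<nu>. \<bar>f x\<bar> \<le> C" using bdd[OF f(1)] by blast
    have "continuous_on UNIV \<phi>" unfolding \<phi>_def by (intro continuous_intros)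
    then obtain g where g: "g \<in> \<A>" "\<And>x. x \<in> space \<nu> \<Longrightarrow> \<bar>g x - \<phi> (f x)\<bar> < \<delta>"
      using continuous_of_algebra_member[OF const add mult C f(1) _ \<delta>(1)] by blast
    have "a - \<epsilon> \<le> g x \<and> g x \<le> b + \<epsilon>" if "x \<in> space \<nu>" for x
    proof -
      have "a \<le> \<phi> (f x)" "\<phi> (f x) \<le> b" unfolding \<phi>_def using ab by auto
      then show ?thesis using g(2)[OF that] \<delta>(2) by linarith
    qed
    moreover have "(\<integral>x. \<bar>g x - F x\<bar> \<partial>\<nu>) < \<epsilon>"
    proof -
      have "(\<integral>x. \<bar>g x - F x\<bar> \<partial>\<nu>) \<le> (\<integral>x. \<delta> + \<bar>f x - F x\<bar> \<partial>\<nu>)"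
      proof (rule integral_mono)
        fix x assume x: "x \<in> space \<nu>"
        have "\<bar>\<phi> (f x) - F x\<bar> \<le> \<bar>f x - F x\<bar>" unfolding \<phi>_def using F(2)[OF x] by auto
        then show "\<bar>g x - F x\<bar> \<le> \<delta> + \<bar>f x - F x\<bar>" using g(2)[OF x] by linarith
      qed (use integ[OF g(1)] integ[OF f(1)] Fi in auto)
      also have "\<dots> = \<delta> * m + (\<integral>x. \<bar>f x - F x\<bar> \<partial>\<nu>)"
        using integ[OF f(1)] Fi by (subst Bochner_Integration.integral_add) (auto simp: m_def)
      finally show ?thesis using f(2) \<delta>(3) by linarith
    qed
    ultimately show ?thesis using g(1) by blast
  qed
qed

section \<open>Trigonometric polynomials of Wiener integrals of step functions\<close>

definition wiener_sum :: "(real \<Rightarrow> real^'d) \<Rightarrow> nat \<Rightarrow> nat \<Rightarrow> (real \<Rightarrow> real^'d) \<Rightarrow> real" where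
  "wiener_sum lam T p w = (\<Sum>i<T * 2 ^ p. lam (real i / 2 ^ p) \<bullet> (w (real (Suc i) / 2 ^ p) - w (real i / 2 ^ p)))"

text \<open>Wiener integrals of deterministic step functions on the grid of level \<open>n\<close>. They are written as
  sums over every finer grid, because functionals and controls are compared on grids that are refined
  later. The condition at time 0 lets values of a path be written as sums of increments.\<close>

definition wiener_functionals :: "((real \<Rightarrow> real^'d) \<Rightarrow> real) set" where
  "wiener_functionals = {l. \<exists>lam T n R. (\<forall>t. norm (lam t) \<le> R) \<and> (\<forall>t\<ge>real T. lam t = 0) \<and>
     (\<forall>p\<ge>n. \<forall>w. w 0 = 0 \<longrightarrow> l w = wiener_sum lam T p w)}"

lemma wiener_functionalsI:
  assumes "\<And>t. norm (lam t) \<le> R" "\<And>t. t \<ge> real T \<Longrightarrow> lam t = 0"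
    "\<And>p w. p \<ge> n \<Longrightarrow> w 0 = 0 \<Longrightarrow> l w = wiener_sum lam T p w"
  shows "l \<in> wiener_functionals"
  unfolding wiener_functionals_def using assms by blast

lemma wiener_functionalsE:
  assumes "l \<in> wiener_functionals"
  obtains lam T n R where "\<And>t. norm (lam t) \<le> R" "\<And>t. t \<ge> real T \<Longrightarrow> lam t = 0"
    "\<And>p w. p \<ge> n \<Longrightarrow> w 0 = 0 \<Longrightarrow> l w = wiener_sum lam T p w"
proof -
  from assms obtain lam T n R where *: "\<forall>t. norm (lam t) \<le> R" "\<forall>t\<ge>real T. lam t = 0"
    "\<forall>p\<ge>n. \<forall>w. w 0 = 0 \<longrightarrow> l w = wiener_sum lam T p w"
    unfolding wiener_functionals_def by (elim CollectE exE conjE)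
  show thesis by (rule that[of lam R T n]) (simp_all add: *)
qed

lemma wiener_sum_extend:
  assumes "\<And>t. t \<ge> real T \<Longrightarrow> lam t = 0" "T \<le> T'"
  shows "wiener_sum lam T' p w = wiener_sum lam T p w"
  unfolding wiener_sum_def
proof (rule sum.mono_neutral_right)
  show "{..<T * 2 ^ p} \<subseteq> {..<T' * 2 ^ p}" using assms(2) by (auto intro: less_le_trans)
  show "\<forall>i\<in>{..<T' * 2 ^ p} - {..<T * 2 ^ p}.
      lam (real i / 2 ^ p) \<bullet> (w (real (Suc i) / 2 ^ p) - w (real i / 2 ^ p)) = 0"
  proof
    fix i assume "i \<in> {..<T' * 2 ^ p} - {..<T * 2 ^ p}"
    then have "T * 2 ^ p \<le> i" by simp
    then have "real (T * 2 ^ p) \<le> real i" by (rule of_nat_mono)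
    then have "real T \<le> real i / 2 ^ p" by (simp add: field_simps)
    then show "lam (real i / 2 ^ p) \<bullet> (w (real (Suc i) / 2 ^ p) - w (real i / 2 ^ p)) = 0"
      using assms(1) by simp
  qed
qed simp

lemma wiener_functionals_zero: "(\<lambda>_. 0) \<in> wiener_functionals"
  by (rule wiener_functionalsI[of "\<lambda>_. 0" 0 0 0]) (auto simp: wiener_sum_def)

lemma wiener_functionals_uminus:
  assumes "l \<in> wiener_functionals" shows "(\<lambda>w. - l w) \<in> wiener_functionals"
  using assms
proof (rule wiener_functionalsE)
  fix lam T n R assume *: "\<And>t. norm (lam t) \<le> R" "\<And>t. t \<ge> real T \<Longrightarrow> lam t = 0"
    "\<And>p w. p \<ge> n \<Longrightarrow> w 0 = 0 \<Longrightarrow> l w = wiener_sum lam T p w"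
  show ?thesis
    by (rule wiener_functionalsI[of "\<lambda>t. - lam t" R T n]) (auto simp: * wiener_sum_def sum_negf)
qed

lemma wiener_functionals_add:
  assumes "l \<in> wiener_functionals" "l' \<in> wiener_functionals"
  shows "(\<lambda>w. l w + l' w) \<in> wiener_functionals"
proof -
  obtain lam T n R where *: "\<And>t. norm (lam t) \<le> R" "\<And>t. t \<ge> real T \<Longrightarrow> lam t = 0"
    "\<And>p w. p \<ge> n \<Longrightarrow> w 0 = 0 \<Longrightarrow> l w = wiener_sum lam T p w"
    using assms(1) by (rule wiener_functionalsE) blast
  obtain lam' T' n' R' where **: "\<And>t. norm (lam' t) \<le> R'" "\<And>t. t \<ge> real T' \<Longrightarrow> lam' t = 0"
    "\<And>p w. p \<ge> n' \<Longrightarrow> w 0 = 0 \<Longrightarrow> l' w = wiener_sum lam' T' p w"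
    using assms(2) by (rule wiener_functionalsE) blast
  show ?thesis
  proof (rule wiener_functionalsI[of "\<lambda>t. lam t + lam' t" "R + R'" "max T T'" "max n n'"])
    show "norm (lam t + lam' t) \<le> R + R'" for t by (intro norm_triangle_mono * **)
    show "lam t + lam' t = 0" if "t \<ge> real (max T T')" for t using that * ** by simp
    fix p and w :: "real \<Rightarrow> real^'a" assume "p \<ge> max n n'" "w 0 = 0"
    then have "l w = wiener_sum lam (max T T') p w" "l' w = wiener_sum lam' (max T T') p w"
      using *(3) **(3) wiener_sum_extend[of T lam "max T T'", OF *(2)] wiener_sum_extend[of T' lam' "max T T'", OF **(2)]
      by auto
    then show "l w + l' w = wiener_sum (\<lambda>t. lam t + lam' t) (max T T') p w"
      by (simp add: wiener_sum_def sum.distrib inner_add_left)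
  qed
qed

lemma wiener_functionals_eval:
  "(\<lambda>w. s \<bullet> w (real j / 2 ^ m)) \<in> wiener_functionals"
proof (rule wiener_functionalsI[of "\<lambda>t. if t < real j / 2 ^ m then s else 0" "norm s" j m])
  show "norm (if t < real j / 2 ^ m then s else 0) \<le> norm s" for t by simp
  show "(if t < real j / 2 ^ m then s else 0) = 0" if "t \<ge> real j" for t
  proof -
    have "real j / 2 ^ m \<le> real j / 1" by (intro divide_left_mono) auto
    then show ?thesis using that by simp
  qed
  fix p and w :: "real \<Rightarrow> real^'a" assume p: "p \<ge> m" and w: "w 0 = 0"
  define J where "J = j * 2 ^ (p - m)"
  have J: "real J / 2 ^ p = real j / 2 ^ m"
    unfolding J_def using p by (auto simp: le_iff_add power_add)
  have J': "J \<le> j * 2 ^ p" unfolding J_def by (intro mult_left_mono power_increasing) auto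
  have lt: "real i / 2 ^ p < real j / 2 ^ m \<longleftrightarrow> i < J" for i
    unfolding J[symmetric] by (simp add: divide_less_cancel)
  have "wiener_sum (\<lambda>t. if t < real j / 2 ^ m then s else 0) j p w =
      (\<Sum>i<j * 2 ^ p. if i < J then s \<bullet> (w (real (Suc i) / 2 ^ p) - w (real i / 2 ^ p)) else 0)"
    unfolding wiener_sum_def by (intro sum.cong refl) (simp add: lt)
  also have "\<dots> = (\<Sum>i<J. s \<bullet> (w (real (Suc i) / 2 ^ p) - w (real i / 2 ^ p)))"
    by (rule sum.mono_neutral_cong_right) (use J' in auto)
  also have "\<dots> = s \<bullet> (\<Sum>i<J. w (real (Suc i) / 2 ^ p) - w (real i / 2 ^ p))"
    by (simp add: inner_sum_right)
  also have "\<dots> = s \<bullet> w (real j / 2 ^ m)"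
    using sum_lessThan_telescope[of "\<lambda>i. w (real i / 2 ^ p)" J] w J by simp
  finally show "s \<bullet> w (real j / 2 ^ m) = wiener_sum (\<lambda>t. if t < real j / 2 ^ m then s else 0) j p w" ..
qed

lemma wiener_sum_measurable [measurable]: "wiener_sum lam T p \<in> borel_measurable borel_path_space"
  unfolding wiener_sum_def by measurable

lemma wiener_functionals_measurable:
  assumes "l \<in> wiener_functionals" shows "l \<in> borel_measurable borel_path_space"
  using assms
proof (rule wiener_functionalsE)
  fix lam T n R assume "\<And>p w. p \<ge> n \<Longrightarrow> w 0 = 0 \<Longrightarrow> l w = wiener_sum lam T p w"
  then have "l w = wiener_sum lam T n w" if "w \<in> path_space" for w
    using path_spaceD(2)[OF that] by simp
  then show ?thesis
    by (subst measurable_cong[where g="wiener_sum lam T n"]) auto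
qed

text \<open>Sums of shifted cosines, since the mean of a shifted cosine over a Gaussian increment is again a
  shifted cosine, and products of shifted cosines are sums of shifted cosines.\<close>

inductive_set trig_polys :: "((real \<Rightarrow> real^'d) \<Rightarrow> real) set" where
  monomial: "l \<in> wiener_functionals \<Longrightarrow> (\<lambda>w. a * cos (c + l w)) \<in> trig_polys"
| add: "f \<in> trig_polys \<Longrightarrow> g \<in> trig_polys \<Longrightarrow> (\<lambda>w. f w + g w) \<in> trig_polys"

lemma trig_polys_const: "(\<lambda>_. c) \<in> trig_polys"
  using trig_polys.monomial[OF wiener_functionals_zero, of c 0] by simp

lemma trig_polys_mult:
  assumes "f \<in> trig_polys" "g \<in> trig_polys"
  shows "(\<lambda>w. f w * g w) \<in> trig_polys"
  using assms(1)
proof induction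
  case f: (monomial l a c)
  from assms(2) show ?case
  proof induction
    case g: (monomial l' a' c')
    have "(\<lambda>w. (a * a' / 2) * cos ((c - c') + (l w + - l' w)) + (a * a' / 2) * cos ((c + c') + (l w + l' w))) \<in> trig_polys"
      by (intro trig_polys.intros wiener_functionals_add wiener_functionals_uminus f g)
    also have "(\<lambda>w. (a * a' / 2) * cos ((c - c') + (l w + - l' w)) + (a * a' / 2) * cos ((c + c') + (l w + l' w))) =
        (\<lambda>w. a * cos (c + l w) * (a' * cos (c' + l' w)))"
    proof
      fix w
      have "cos (c + l w) * cos (c' + l' w) =
          (cos ((c - c') + (l w + - l' w)) + cos ((c + c') + (l w + l' w))) / 2"
        using cos_times_cos[of "c + l w" "c' + l' w"] by (simp add: algebra_simps)
      then have "a * cos (c + l w) * (a' * cos (c' + l' w)) =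
          a * a' * ((cos ((c - c') + (l w + - l' w)) + cos ((c + c') + (l w + l' w))) / 2)"
        by (metis mult.assoc mult.left_commute)
      then show "(a * a' / 2) * cos ((c - c') + (l w + - l' w)) + (a * a' / 2) * cos ((c + c') + (l w + l' w)) =
        a * cos (c + l w) * (a' * cos (c' + l' w))" by (simp only: distrib_left add_divide_distrib times_divide_eq_left times_divide_eq_right)
    qed
    finally show ?case .
  next
    case (add g g')
    then show ?case using trig_polys.add by (simp add: distrib_left)
  qed
next
  case (add f f')
  then show ?case using trig_polys.add by (simp add: distrib_right)
qed

lemma trig_polys_bounded:
  assumes "f \<in> trig_polys" shows "\<exists>C. \<forall>w. \<bar>f w\<bar> \<le> C"
  using assms
proof induction
  case (monomial l a c)
  have "\<bar>a * cos (c + l w)\<bar> \<le> \<bar>a\<bar>" for w by (simp add: abs_mult mult_left_le)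
  then show ?case by blast
next
  case (add f g)
  then obtain C C' where "\<forall>w. \<bar>f w\<bar> \<le> C" "\<forall>w. \<bar>g w\<bar> \<le> C'" by blast
  then have "\<bar>f w + g w\<bar> \<le> C + C'" for w using abs_triangle_ineq[of "f w" "g w"] by (meson add_mono order_trans)
  then show ?case by blast
qed

lemma trig_polys_measurable:
  assumes "f \<in> trig_polys" shows "f \<in> borel_measurable borel_path_space"
  using assms
proof induction
  case (monomial l a c)
  note [measurable] = wiener_functionals_measurable[OF monomial]
  show ?case by measurable
qed (rule borel_measurable_add)

lemma sum_lessThan_plus:
  fixes f :: "nat \<Rightarrow> 'a::comm_monoid_add"
  shows "(\<Sum>k<m + n. f k) = (\<Sum>k<m. f k) + (\<Sum>k<n. f (m + k))"
  by (induction n) (auto simp: add.assoc)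

text \<open>All frequencies of a trigonometric polynomial can be read on one dyadic grid, with bounds
  that do not depend on how fine the grid is.\<close>

definition trig_form :: "((real \<Rightarrow> real^'d) \<Rightarrow> real) \<Rightarrow> nat \<Rightarrow> (nat \<Rightarrow> real) \<Rightarrow> (nat \<Rightarrow> real) \<Rightarrow>
    (nat \<Rightarrow> real \<Rightarrow> real^'d) \<Rightarrow> nat \<Rightarrow> nat \<Rightarrow> real \<Rightarrow> bool" where
  "trig_form f K a c lam T n R \<longleftrightarrow>
    (\<forall>k t. norm (lam k t) \<le> R) \<and> (\<forall>k. \<forall>t\<ge>real T. lam k t = 0) \<and>
    (\<forall>p\<ge>n. \<forall>w. w 0 = 0 \<longrightarrow> f w = (\<Sum>k<K. a k * cos (c k + wiener_sum (lam k) T p w)))"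

lemma trig_polys_on_grid:
  assumes "f \<in> trig_polys"
  shows "\<exists>K a c lam T n R. trig_form f K a c lam T n R"
  using assms
proof induction
  case (monomial l a c)
  then obtain lam T n R where *: "\<And>t. norm (lam t) \<le> R" "\<And>t. t \<ge> real T \<Longrightarrow> lam t = 0"
    "\<And>p w. p \<ge> n \<Longrightarrow> w 0 = 0 \<Longrightarrow> l w = wiener_sum lam T p w"
    by (rule wiener_functionalsE) blast
  have "trig_form (\<lambda>w. a * cos (c + l w)) 1 (\<lambda>_. a) (\<lambda>_. c) (\<lambda>_. lam) T n R"
    unfolding trig_form_def by (simp add: *)
  then show ?case by blast
next
  case (add f f')
  from add.IH obtain K a c lam T n R K' a' c' lam' T' n' R' where
    "trig_form f K a c lam T n R" "trig_form f' K' a' c' lam' T' n' R'" by blast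
  note 1 = this(1)[unfolded trig_form_def] and 2 = this(2)[unfolded trig_form_def]
  let ?T = "max T T'" and ?n = "max n n'"
  let ?a = "\<lambda>k. if k < K then a k else a' (k - K)"
  let ?c = "\<lambda>k. if k < K then c k else c' (k - K)"
  let ?lam = "\<lambda>k. if k < K then lam k else lam' (k - K)"
  have "norm (?lam k t) \<le> max R R'" for k t using 1 2 by (auto simp: le_max_iff_disj)
  moreover have "?lam k t = 0" if "t \<ge> real ?T" for k t using that 1 2 by auto
  moreover have "f w + f' w = (\<Sum>k<K + K'. ?a k * cos (?c k + wiener_sum (?lam k) ?T p w))"
    if "p \<ge> ?n" "w 0 = 0" for p w
  proof -
    have "wiener_sum (lam k) ?T p w = wiener_sum (lam k) T p w" for k
      by (rule wiener_sum_extend) (use 1 in auto)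
    moreover have "wiener_sum (lam' k) ?T p w = wiener_sum (lam' k) T' p w" for k
      by (rule wiener_sum_extend) (use 2 in auto)
    moreover have "f w = (\<Sum>k<K. a k * cos (c k + wiener_sum (lam k) T p w))" using 1 that by simp
    moreover have "f' w = (\<Sum>k<K'. a' k * cos (c' k + wiener_sum (lam' k) T' p w))" using 2 that by simp
    ultimately show ?thesis
      unfolding sum_lessThan_plus by simp
  qed
  ultimately have "trig_form (\<lambda>w. f w + f' w) (K + K') ?a ?c ?lam ?T ?n (max R R')"
    unfolding trig_form_def by blast
  then show ?case by blast
qed

lemma scaled_sin_tendsto: "(\<lambda>n. real (Suc n) * sin (x / real (Suc n))) \<longlonglongrightarrow> x"
proof (cases "x = 0")
  case False
  have "((\<lambda>h. (sin (0 + h) - sin 0) / h) \<longlongrightarrow> cos 0) (at (0::real))"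
    using DERIV_sin[of "0::real"] unfolding DERIV_def .
  then have d: "((\<lambda>h. sin h / h) \<longlongrightarrow> 1) (at (0::real))" by simp
  have l0: "(\<lambda>n. x / real (Suc n)) \<longlonglongrightarrow> 0"
    using tendsto_mult_right_zero[OF LIMSEQ_inverse_real_of_nat, of x] by (simp add: field_simps)
  have "filterlim (\<lambda>n. x / real (Suc n)) (at 0) sequentially"
    unfolding filterlim_at using l0 False by auto
  from filterlim_compose[OF d this]
  have "(\<lambda>n. x * (sin (x / real (Suc n)) / (x / real (Suc n)))) \<longlonglongrightarrow> x * 1"
    by (rule tendsto_mult_left)
  moreover have "x * (sin (x / real (Suc n)) / (x / real (Suc n))) = real (Suc n) * sin (x / real (Suc n))" for n
    using False by simp
  ultimately show ?thesis by simp
qed simp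

text \<open>Trigonometric polynomials generate the Borel sets because \<open>m sin (x / m) \<longlonglongrightarrow> x\<close>
  recovers each coordinate of the path at a dyadic time.\<close>

theorem trig_polys_dense:
  fixes \<nu> :: "(real \<Rightarrow> real^'d) measure"
  assumes "finite_measure \<nu>" and sets: "sets \<nu> = sets borel_path_space"
    and F: "F \<in> borel_measurable borel_path_space" "\<And>w. w \<in> path_space \<Longrightarrow> a \<le> F w \<and> F w \<le> b"
    and "\<epsilon> > 0"
  shows "\<exists>f\<in>trig_polys. (\<forall>w\<in>path_space. a - \<epsilon> \<le> f w \<and> f w \<le> b + \<epsilon>) \<and> (\<integral>w. \<bar>f w - F w\<bar> \<partial>\<nu>) < \<epsilon>"
proof -
  have space: "space \<nu> = path_space" using sets_eq_imp_space_eq[OF sets] by simp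
  have meas: "borel_measurable \<nu> = borel_measurable borel_path_space"
    by (rule measurable_cong_sets[OF sets refl])
  let ?G = "{{x \<in> space \<nu>. f x \<le> a} | f a. f \<in> trig_polys}"
  let ?\<Sigma> = "sigma path_space ?G"
  have G: "?G \<subseteq> Pow path_space" by (auto simp: space)
  have sp: "space ?\<Sigma> = path_space" using G by (rule space_measure_of)
  have tm: "f \<in> borel_measurable ?\<Sigma>" if "f \<in> trig_polys" for f
    unfolding borel_measurable_iff_le sp using that by (auto simp: sets_measure_of[OF G] space)
  have ev: "(\<lambda>w. w (real i / 2 ^ n)) \<in> borel_measurable ?\<Sigma>" for i n
  proof (rule borel_measurable_euclidean_space[THEN iffD2], rule ballI)
    fix e :: "real^'d"
    show "(\<lambda>w. w (real i / 2 ^ n) \<bullet> e) \<in> borel_measurable ?\<Sigma>"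
    proof (rule borel_measurable_LIMSEQ_real)
      show "(\<lambda>m. real (Suc m) * sin ((w (real i / 2 ^ n) \<bullet> e) / real (Suc m))) \<longlonglongrightarrow> w (real i / 2 ^ n) \<bullet> e" for w
        by (rule scaled_sin_tendsto)
      fix m
      have "(\<lambda>w. real (Suc m) * cos (- (pi / 2) + ((1 / real (Suc m)) *\<^sub>R e) \<bullet> w (real i / 2 ^ n))) \<in> trig_polys"
        by (intro trig_polys.monomial wiener_functionals_eval)
      moreover have "cos (- (pi / 2) + x) = sin x" for x :: real
        by (simp only: cos_add cos_minus sin_minus cos_pi_half sin_pi_half)
      ultimately have "(\<lambda>w. real (Suc m) * sin ((w (real i / 2 ^ n) \<bullet> e) / real (Suc m))) \<in> trig_polys"
        by (simp add: inner_commute)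
      then show "(\<lambda>w. real (Suc m) * sin ((w (real i / 2 ^ n) \<bullet> e) / real (Suc m))) \<in> borel_measurable ?\<Sigma>"
        by (rule tm)
    qed
  qed
  have "sets borel_path_space \<subseteq> sets ?\<Sigma>" by (rule borel_path_space_dyadic[OF sp ev])
  also have "sets ?\<Sigma> = sigma_sets path_space ?G" by (rule sets_measure_of[OF G])
  finally have gen: "sets \<nu> \<subseteq> sigma_sets (space \<nu>) ?G" by (simp only: sets space)
  have "\<exists>f\<in>trig_polys. (\<forall>x\<in>space \<nu>. a - \<epsilon> \<le> f x \<and> f x \<le> b + \<epsilon>) \<and> (\<integral>x. \<bar>f x - F x\<bar> \<partial>\<nu>) < \<epsilon>"
  proof (intro bounded_algebra_dense_in_mean[where \<A>=trig_polys and \<nu>=\<nu>])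
    show "\<exists>C. \<forall>x\<in>space \<nu>. \<bar>f x\<bar> \<le> C" if "f \<in> trig_polys" for f
      using trig_polys_bounded[OF that] by blast
    show "f \<in> borel_measurable \<nu>" if "f \<in> trig_polys" for f
      unfolding meas by (rule trig_polys_measurable[OF that])
    show "F \<in> borel_measurable \<nu>" unfolding meas by (rule F(1))
    show "a \<le> F x \<and> F x \<le> b" if "x \<in> space \<nu>" for x using F(2) that unfolding space by blast
  qed (assumption | rule assms(1) assms(5) gen trig_polys_const trig_polys.add trig_polys_mult)+
  then show ?thesis unfolding space .
qed

section \<open>Gaussian integrals\<close>

definition gauss_density :: "real \<Rightarrow> real^'d \<Rightarrow> real" where
  "gauss_density h x = (\<Prod>i\<in>UNIV. normal_density 0 (sqrt h) (x $ i))"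

definition gauss :: "real \<Rightarrow> (real^'d) measure" where
  "gauss h = density lborel (\<lambda>x. ennreal (gauss_density h x))"

lemma gauss_density_measurable [measurable]: "gauss_density h \<in> borel_measurable borel"
  unfolding gauss_density_def by measurable

lemma sets_gauss [simp, measurable_cong]: "sets (gauss h) = sets borel"
  by (simp add: gauss_def)

lemma space_gauss [simp]: "space (gauss h) = UNIV"
  by (simp add: gauss_def)

lemma gauss_density_eq:
  assumes "0 < h"
  shows "gauss_density h (x :: real^'d) = (1 / sqrt (2 * pi * h)) ^ CARD('d) * exp (- (x \<bullet> x) / (2 * h))"
proof -
  have "gauss_density h x = (\<Prod>i\<in>UNIV. 1 / sqrt (2 * pi * h) * exp (- (x $ i)\<^sup>2 / (2 * h)))"
    using assms by (simp add: gauss_density_def normal_density_def)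
  also have "\<dots> = (1 / sqrt (2 * pi * h)) ^ CARD('d) * exp (\<Sum>i\<in>UNIV. - (x $ i)\<^sup>2 / (2 * h))"
    by (simp only: prod.distrib exp_sum[OF finite] prod_constant)
  also have "(\<Sum>i\<in>UNIV. - (x $ i)\<^sup>2 / (2 * h)) = - (x \<bullet> x) / (2 * h)"
    by (simp add: inner_vec_def power2_eq_square sum_negf sum_divide_distrib)
  finally show ?thesis .
qed

lemma gauss_density_shift:
  assumes "0 < h"
  shows "gauss_density h y * exp (- (u \<bullet> y) - h / 2 * (norm u)\<^sup>2) = gauss_density h (y + h *\<^sub>R u)"
proof -
  have "- (y \<bullet> y) / (2 * h) + (- (u \<bullet> y) - h / 2 * (u \<bullet> u)) = - ((y + h *\<^sub>R u) \<bullet> (y + h *\<^sub>R u)) / (2 * h)"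
    using assms by (simp add: inner_simps inner_commute field_simps)
  then have "exp (- (y \<bullet> y) / (2 * h)) * exp (- (u \<bullet> y) - h / 2 * (u \<bullet> u)) =
      exp (- ((y + h *\<^sub>R u) \<bullet> (y + h *\<^sub>R u)) / (2 * h))"
    by (simp only: exp_add[symmetric])
  then show ?thesis
    unfolding gauss_density_eq[OF assms] power2_norm_eq_inner by (simp only: mult.assoc)
qed

lemma gauss_density_uminus: "0 < h \<Longrightarrow> gauss_density h (- y) = gauss_density h y"
  by (simp add: gauss_density_eq)

lemma nn_integral_lborel_plus:
  fixes c :: "'a::euclidean_space"
  assumes [measurable]: "f \<in> borel_measurable borel"
  shows "(\<integral>\<^sup>+x. f (x + c) \<partial>lborel) = (\<integral>\<^sup>+x. f x \<partial>lborel)"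
proof -
  have "(\<integral>\<^sup>+x. f x \<partial>lborel) = (\<integral>\<^sup>+x. f x \<partial>distr lborel borel ((+) c))"
    by (simp add: lborel_distr_plus)
  also have "\<dots> = (\<integral>\<^sup>+x. f (x + c) \<partial>lborel)"
    by (subst nn_integral_distr) (auto simp: add.commute)
  finally show ?thesis by simp
qed

lemma nn_integral_lborel_uminus:
  fixes f :: "'a::euclidean_space \<Rightarrow> ennreal"
  assumes [measurable]: "f \<in> borel_measurable borel"
  shows "(\<integral>\<^sup>+x. f (- x) \<partial>lborel) = (\<integral>\<^sup>+x. f x \<partial>lborel)"
proof -
  have "(\<integral>\<^sup>+x. f x \<partial>lborel) = (\<integral>\<^sup>+x. f x \<partial>density (distr lborel borel (\<lambda>x. 0 + (-1) *\<^sub>R x)) (\<lambda>_. ennreal (\<bar>-1\<bar> ^ DIM('a))))"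
    using lborel_affine[of "-1" "0::'a"] by simp
  also have "\<dots> = (\<integral>\<^sup>+x. f (- x) \<partial>lborel)"
    by (subst nn_integral_density) (auto simp: nn_integral_distr)
  finally show ?thesis by simp
qed

lemma exp_minus_one_le:
  fixes x :: real assumes "0 \<le> x" shows "exp x - 1 - x \<le> x\<^sup>2 * exp x"
proof -
  have "1 + (-x) \<le> exp (-x)" by (rule exp_ge_add_one_self)
  then have "(1 - x) * exp x \<le> 1"
    by (metis add_uminus_conv_diff exp_ge_zero exp_minus_inverse mult.commute mult_right_mono)
  then have "exp x - 1 \<le> x * exp x" by (simp add: algebra_simps)
  then have "x * (exp x - 1) \<le> x * (x * exp x)" using assms by (rule mult_left_mono)
  with \<open>exp x - 1 \<le> x * exp x\<close> show ?thesis by (simp add: power2_eq_square algebra_simps)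
qed

text \<open>The loss in one step, divided by the squared step size. Here \<open>D\<close> is the dimension, \<open>A\<close> bounds
  the sum of the amplitudes and \<open>R\<close> the frequencies, and \<open>c\<^sub>0\<close> is a lower bound of the function, so
  that \<open>A * R / c\<^sub>0\<close> bounds the control and \<open>A / c\<^sub>0\<close> the inverse of the normalized function. The first
  summand is the linearization error of the shifted density, the second that of the function.\<close>

definition step_loss :: "real \<Rightarrow> real \<Rightarrow> real \<Rightarrow> real \<Rightarrow> real" where
  "step_loss D A R c\<^sub>0 = (A / c\<^sub>0) * (4 * (A * R / c\<^sub>0) ^ 4 * exp ((A * R / c\<^sub>0)\<^sup>2) +
     4 * (A * R\<^sup>2 / c\<^sub>0)\<^sup>2 * (48 * D\<^sup>2 + 1))"

locale gaussian = prob_space \<gamma> for \<gamma> :: "(real^'d) measure" +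
  fixes h :: real
  assumes gauss: "\<gamma> = gauss h" and h_pos: "0 < h"
begin

lemma sets_\<gamma> [simp, measurable_cong]: "sets \<gamma> = sets borel" by (simp add: gauss)

lemma space_\<gamma> [simp]: "space \<gamma> = UNIV" by (simp add: gauss)

lemma measurable_\<gamma> [simp]: "measurable \<gamma> N = measurable borel N"
  by (rule measurable_cong_sets) simp_all

lemma nn_integral_\<gamma>:
  assumes [measurable]: "f \<in> borel_measurable borel"
  shows "(\<integral>\<^sup>+y. f y \<partial>\<gamma>) = (\<integral>\<^sup>+y. ennreal (gauss_density h y) * f y \<partial>lborel)"
  unfolding gauss gauss_def by (subst nn_integral_density) auto

lemma gauss_density_nonneg: "0 \<le> gauss_density h y"
  unfolding gauss_density_def by (intro prod_nonneg) auto

text \<open>The finite-dimensional Cameron--Martin formula: by completing the square, the weight turns the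
  Gaussian density into the density at the shifted point, and Lebesgue measure is invariant under
  shifts.\<close>

lemma cameron_martin:
  assumes [measurable]: "f \<in> borel_measurable borel"
  shows "(\<integral>\<^sup>+y. f (y + h *\<^sub>R u) * ennreal (exp (- (u \<bullet> y) - h / 2 * (norm u)\<^sup>2)) \<partial>\<gamma>) = (\<integral>\<^sup>+y. f y \<partial>\<gamma>)"
proof -
  have "(\<integral>\<^sup>+y. f (y + h *\<^sub>R u) * ennreal (exp (- (u \<bullet> y) - h / 2 * (norm u)\<^sup>2)) \<partial>\<gamma>) =
      (\<integral>\<^sup>+y. ennreal (gauss_density h (y + h *\<^sub>R u)) * f (y + h *\<^sub>R u) \<partial>lborel)"
    by (subst nn_integral_\<gamma>, simp, intro nn_integral_cong)
       (simp add: gauss_density_nonneg gauss_density_shift[OF h_pos, symmetric] ennreal_mult mult_ac)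
  also have "\<dots> = (\<integral>\<^sup>+y. f y \<partial>\<gamma>)"
    by (subst nn_integral_lborel_plus[of "\<lambda>y. ennreal (gauss_density h y) * f y"]) (auto simp: nn_integral_\<gamma>)
  finally show ?thesis .
qed

lemma nn_integral_shift:
  assumes [measurable]: "f \<in> borel_measurable borel"
  shows "(\<integral>\<^sup>+y. f (y + h *\<^sub>R u) \<partial>\<gamma>) = (\<integral>\<^sup>+y. ennreal (exp (u \<bullet> y - h / 2 * (norm u)\<^sup>2)) * f y \<partial>\<gamma>)"
proof -
  have "(\<integral>\<^sup>+y. ennreal (exp (u \<bullet> y - h / 2 * (norm u)\<^sup>2)) * f y \<partial>\<gamma>) =
    (\<integral>\<^sup>+y. (ennreal (exp (u \<bullet> (y + h *\<^sub>R u) - h / 2 * (norm u)\<^sup>2)) * f (y + h *\<^sub>R u)) *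
       ennreal (exp (- (u \<bullet> y) - h / 2 * (norm u)\<^sup>2)) \<partial>\<gamma>)"
    by (rule cameron_martin[symmetric]) simp
  also have "\<dots> = (\<integral>\<^sup>+y. f (y + h *\<^sub>R u) \<partial>\<gamma>)"
  proof (rule nn_integral_cong)
    fix y
    let ?a = "exp (u \<bullet> (y + h *\<^sub>R u) - h / 2 * (norm u)\<^sup>2)" and ?b = "exp (- (u \<bullet> y) - h / 2 * (norm u)\<^sup>2)"
    have "?a * ?b = 1"
      unfolding exp_add[symmetric] by (simp add: inner_simps power2_norm_eq_inner)
    then have ab: "ennreal ?a * ennreal ?b = 1"
      by (simp add: ennreal_mult[symmetric])
    have "(ennreal ?a * f (y + h *\<^sub>R u)) * ennreal ?b = (ennreal ?a * ennreal ?b) * f (y + h *\<^sub>R u)"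
      by (simp only: mult_ac)
    also have "\<dots> = f (y + h *\<^sub>R u)" unfolding ab by (rule mult_1)
    finally show "(ennreal ?a * f (y + h *\<^sub>R u)) * ennreal ?b = f (y + h *\<^sub>R u)" .
  qed
  finally show ?thesis by simp
qed

lemma distr_shift:
  "distr \<gamma> borel (\<lambda>y. y + h *\<^sub>R u) = density \<gamma> (\<lambda>y. ennreal (exp (u \<bullet> y - h / 2 * (norm u)\<^sup>2)))"
proof (rule measure_eqI)
  fix A assume "A \<in> sets (distr \<gamma> borel (\<lambda>y. y + h *\<^sub>R u))"
  then have A [measurable]: "A \<in> sets borel" by simp
  have "emeasure (distr \<gamma> borel (\<lambda>y. y + h *\<^sub>R u)) A =
      (\<integral>\<^sup>+y. indicator A y \<partial>distr \<gamma> borel (\<lambda>y. y + h *\<^sub>R u))" by simp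
  also have "\<dots> = (\<integral>\<^sup>+y. indicator A (y + h *\<^sub>R u) \<partial>\<gamma>)" by (rule nn_integral_distr) auto
  also have "\<dots> = emeasure (density \<gamma> (\<lambda>y. ennreal (exp (u \<bullet> y - h / 2 * (norm u)\<^sup>2)))) A"
    by (subst nn_integral_shift) (auto simp: emeasure_density)
  finally show "emeasure (distr \<gamma> borel (\<lambda>y. y + h *\<^sub>R u)) A =
    emeasure (density \<gamma> (\<lambda>y. ennreal (exp (u \<bullet> y - h / 2 * (norm u)\<^sup>2)))) A" .
qed simp

lemma integral_shift:
  fixes f :: "real^'d \<Rightarrow> real"
  assumes [measurable]: "f \<in> borel_measurable borel"
  shows "(\<integral>y. f (y + h *\<^sub>R u) \<partial>\<gamma>) = (\<integral>y. exp (u \<bullet> y - h / 2 * (norm u)\<^sup>2) * f y \<partial>\<gamma>)"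
    and "integrable \<gamma> (\<lambda>y. f (y + h *\<^sub>R u)) \<longleftrightarrow> integrable \<gamma> (\<lambda>y. exp (u \<bullet> y - h / 2 * (norm u)\<^sup>2) * f y)"
proof -
  have "(\<integral>y. f (y + h *\<^sub>R u) \<partial>\<gamma>) = (\<integral>y. f y \<partial>distr \<gamma> borel (\<lambda>y. y + h *\<^sub>R u))"
    by (subst integral_distr) auto
  also have "\<dots> = (\<integral>y. exp (u \<bullet> y - h / 2 * (norm u)\<^sup>2) * f y \<partial>\<gamma>)"
    unfolding distr_shift by (subst integral_density) auto
  finally show "(\<integral>y. f (y + h *\<^sub>R u) \<partial>\<gamma>) = (\<integral>y. exp (u \<bullet> y - h / 2 * (norm u)\<^sup>2) * f y \<partial>\<gamma>)" .
  have "integrable \<gamma> (\<lambda>y. f (y + h *\<^sub>R u)) \<longleftrightarrow> integrable (distr \<gamma> borel (\<lambda>y. y + h *\<^sub>R u)) f"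
    by (subst integrable_distr_eq) auto
  also have "\<dots> \<longleftrightarrow> integrable \<gamma> (\<lambda>y. exp (u \<bullet> y - h / 2 * (norm u)\<^sup>2) * f y)"
    unfolding distr_shift by (subst integrable_density) auto
  finally show "integrable \<gamma> (\<lambda>y. f (y + h *\<^sub>R u)) \<longleftrightarrow> integrable \<gamma> (\<lambda>y. exp (u \<bullet> y - h / 2 * (norm u)\<^sup>2) * f y)" .
qed

lemma nn_integral_uminus:
  assumes [measurable]: "f \<in> borel_measurable borel"
  shows "(\<integral>\<^sup>+y. f (- y) \<partial>\<gamma>) = (\<integral>\<^sup>+y. f y \<partial>\<gamma>)"
  using nn_integral_lborel_uminus[of "\<lambda>y. ennreal (gauss_density h y) * f y"]
  by (simp add: nn_integral_\<gamma> gauss_density_uminus[OF h_pos])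

lemma distr_uminus: "distr \<gamma> borel uminus = \<gamma>"
proof (rule measure_eqI)
  fix A assume "A \<in> sets (distr \<gamma> borel uminus)"
  then have A [measurable]: "A \<in> sets borel" by simp
  have "emeasure (distr \<gamma> borel uminus) A = (\<integral>\<^sup>+y. indicator A y \<partial>distr \<gamma> borel uminus)" by simp
  also have "\<dots> = (\<integral>\<^sup>+y. indicator A (- y) \<partial>\<gamma>)" by (rule nn_integral_distr) auto
  also have "\<dots> = emeasure \<gamma> A" by (subst nn_integral_uminus) auto
  finally show "emeasure (distr \<gamma> borel uminus) A = emeasure \<gamma> A" .
qed simp

lemma integral_odd:
  fixes f :: "real^'d \<Rightarrow> real"
  assumes [measurable]: "f \<in> borel_measurable borel" and odd: "\<And>y. f (- y) = - f y"
  shows "(\<integral>y. f y \<partial>\<gamma>) = 0"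
proof -
  have "(\<integral>y. f y \<partial>\<gamma>) = (\<integral>y. f y \<partial>distr \<gamma> borel uminus)" by (simp add: distr_uminus)
  also have "\<dots> = (\<integral>y. f (- y) \<partial>\<gamma>)" by (subst integral_distr) auto
  also have "\<dots> = - (\<integral>y. f y \<partial>\<gamma>)" by (simp add: odd)
  finally show ?thesis by simp
qed

lemma exp_moment:
  shows "(\<integral>\<^sup>+y. ennreal (exp (u \<bullet> y)) \<partial>\<gamma>) = ennreal (exp (h / 2 * (norm u)\<^sup>2))"
    and integrable_exp: "integrable \<gamma> (\<lambda>y. exp (u \<bullet> y))"
    and integral_exp: "(\<integral>y. exp (u \<bullet> y) \<partial>\<gamma>) = exp (h / 2 * (norm u)\<^sup>2)"
proof -
  have "1 = (\<integral>\<^sup>+y. 1 * ennreal (exp (- ((-u) \<bullet> y) - h / 2 * (norm (-u))\<^sup>2)) \<partial>\<gamma>)"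
    by (subst cameron_martin[of "\<lambda>_. 1" "-u"]) (auto simp: emeasure_space_1[simplified])
  also have "\<dots> = (\<integral>\<^sup>+y. ennreal (exp (u \<bullet> y)) * ennreal (exp (- (h / 2 * (norm u)\<^sup>2))) \<partial>\<gamma>)"
    by (intro nn_integral_cong) (simp add: ennreal_mult'[symmetric] exp_add[symmetric] inner_minus_left)
  also have "\<dots> = (\<integral>\<^sup>+y. ennreal (exp (u \<bullet> y)) \<partial>\<gamma>) * ennreal (exp (- (h / 2 * (norm u)\<^sup>2)))"
    by (rule nn_integral_multc) simp
  finally have one: "1 = (\<integral>\<^sup>+y. ennreal (exp (u \<bullet> y)) \<partial>\<gamma>) * ennreal (exp (- (h / 2 * (norm u)\<^sup>2)))" .
  have inv: "ennreal (exp (- (h / 2 * (norm u)\<^sup>2))) * ennreal (exp (h / 2 * (norm u)\<^sup>2)) = 1"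
    by (simp add: ennreal_mult'[symmetric] exp_add[symmetric])
  have "ennreal (exp (h / 2 * (norm u)\<^sup>2)) = 1 * ennreal (exp (h / 2 * (norm u)\<^sup>2))" by simp
  also have "\<dots> = (\<integral>\<^sup>+y. ennreal (exp (u \<bullet> y)) \<partial>\<gamma>) *
      (ennreal (exp (- (h / 2 * (norm u)\<^sup>2))) * ennreal (exp (h / 2 * (norm u)\<^sup>2)))"
    by (subst one) (simp only: mult.assoc)
  finally show *: "(\<integral>\<^sup>+y. ennreal (exp (u \<bullet> y)) \<partial>\<gamma>) = ennreal (exp (h / 2 * (norm u)\<^sup>2))"
    by (simp only: inv mult_1_right)
  then show i: "integrable \<gamma> (\<lambda>y. exp (u \<bullet> y))"
    by (intro integrableI_nonneg) auto
  show "(\<integral>y. exp (u \<bullet> y) \<partial>\<gamma>) = exp (h / 2 * (norm u)\<^sup>2)"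
    by (rule integral_eq_nn_integral[THEN trans]) (auto simp: *)
qed

lemma cosh_bounds:
  fixes x :: real
  shows "x\<^sup>2 \<le> exp x + exp (-x) - 2" and "x ^ 4 \<le> 12 * (exp x + exp (-x))"
proof -
  have main: "1 + x\<^sup>2 / 2 + x ^ 4 / 24 \<le> cosh x" for x :: real
  proof -
    have "(\<Sum>n\<in>{0,2,4}. if even n then x ^ n /\<^sub>R fact n else 0) \<le> (\<Sum>n. if even n then x ^ n /\<^sub>R fact n else 0)"
      by (rule sum_le_suminf) (auto intro: sums_summable[OF cosh_converges[of x]] simp: zero_le_even_power)
    also have "\<dots> = cosh x" using cosh_converges[of x] by (simp add: sums_iff)
    finally show ?thesis by (simp add: fact_numeral field_simps)
  qed
  have c: "exp x + exp (-x) = 2 * cosh x" by (simp add: cosh_def)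
  have p: "0 \<le> x\<^sup>2" "0 \<le> x ^ 4" by simp_all
  show "x\<^sup>2 \<le> exp x + exp (-x) - 2" using main[of x] p unfolding c by linarith
  show "x ^ 4 \<le> 12 * (exp x + exp (-x))" using main[of x] p unfolding c by linarith
qed

text \<open>The second and fourth powers are Taylor terms of \<open>cosh\<close>, hence controlled by exponential
  moments.\<close>

lemma integrable_inner_power2: "integrable \<gamma> (\<lambda>y. (u \<bullet> y)\<^sup>2)"
  and integral_inner_power2: "(\<integral>y. (u \<bullet> y)\<^sup>2 \<partial>\<gamma>) \<le> 2 * (exp (h / 2 * (norm u)\<^sup>2) - 1)"
  and integrable_inner_power4: "integrable \<gamma> (\<lambda>y. (u \<bullet> y) ^ 4)"
  and integral_inner_power4: "(\<integral>y. (u \<bullet> y) ^ 4 \<partial>\<gamma>) \<le> 24 * exp (h / 2 * (norm u)\<^sup>2)"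
proof -
  have i: "integrable \<gamma> (\<lambda>y. exp (u \<bullet> y))" "integrable \<gamma> (\<lambda>y. exp (- (u \<bullet> y)))"
    using integrable_exp[of u] integrable_exp[of "-u"] by (auto simp: inner_minus_left)
  have e: "(\<integral>y. exp (u \<bullet> y) \<partial>\<gamma>) = exp (h / 2 * (norm u)\<^sup>2)" "(\<integral>y. exp (- (u \<bullet> y)) \<partial>\<gamma>) = exp (h / 2 * (norm u)\<^sup>2)"
    using integral_exp[of u] integral_exp[of "-u"] by (auto simp: inner_minus_left)
  have i': "integrable \<gamma> (\<lambda>y. exp (u \<bullet> y) + exp (- (u \<bullet> y)) - 2)"
    by (intro Bochner_Integration.integrable_diff Bochner_Integration.integrable_add i integrable_const)
  show 2: "integrable \<gamma> (\<lambda>y. (u \<bullet> y)\<^sup>2)"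
    by (rule Bochner_Integration.integrable_bound[OF i']) (auto intro!: AE_I2 order_trans[OF cosh_bounds(1)])
  show 4: "integrable \<gamma> (\<lambda>y. (u \<bullet> y) ^ 4)"
    by (rule Bochner_Integration.integrable_bound[where f="\<lambda>y. 12 * (exp (u \<bullet> y) + exp (- (u \<bullet> y)))"])
       (auto intro!: i AE_I2 order_trans[OF cosh_bounds(2)] Bochner_Integration.integrable_add)
  have "(\<integral>y. (u \<bullet> y)\<^sup>2 \<partial>\<gamma>) \<le> (\<integral>y. exp (u \<bullet> y) + exp (- (u \<bullet> y)) - 2 \<partial>\<gamma>)"
    by (rule integral_mono[OF 2 i']) (rule cosh_bounds)
  also have "\<dots> = 2 * (exp (h / 2 * (norm u)\<^sup>2) - 1)"
    using i e by (simp add: prob_space[simplified])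
  finally show "(\<integral>y. (u \<bullet> y)\<^sup>2 \<partial>\<gamma>) \<le> 2 * (exp (h / 2 * (norm u)\<^sup>2) - 1)" .
  have "(\<integral>y. (u \<bullet> y) ^ 4 \<partial>\<gamma>) \<le> (\<integral>y. 12 * (exp (u \<bullet> y) + exp (- (u \<bullet> y))) \<partial>\<gamma>)"
    using i by (intro integral_mono[OF 4] cosh_bounds integrable_mult_right Bochner_Integration.integrable_add)
  also have "\<dots> = 24 * exp (h / 2 * (norm u)\<^sup>2)"
    using i e by simp
  finally show "(\<integral>y. (u \<bullet> y) ^ 4 \<partial>\<gamma>) \<le> 24 * exp (h / 2 * (norm u)\<^sup>2)" .
qed

text \<open>Both moment bounds apply the exponential moment to the multiple of \<open>u\<close> at which the
  variance of the linear functional is one.\<close>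

lemma inner_power2_le: "(\<integral>y. (u \<bullet> y)\<^sup>2 \<partial>\<gamma>) \<le> 2 * h * (norm u)\<^sup>2"
  and inner_power4_le: "(\<integral>y. (u \<bullet> y) ^ 4 \<partial>\<gamma>) \<le> 48 * (h * (norm u)\<^sup>2)\<^sup>2"
proof -
  have half: "exp (1 / 2 :: real) \<le> 2"
  proof -
    have "exp (1/2::real) ^ 2 = exp 1" by (simp add: exp_of_nat_mult[symmetric])
    then have "exp (1/2::real) ^ 2 \<le> 2 ^ 2" using exp_le by simp
    then show ?thesis by (rule power2_le_imp_le) simp
  qed
  show "(\<integral>y. (u \<bullet> y)\<^sup>2 \<partial>\<gamma>) \<le> 2 * h * (norm u)\<^sup>2" "(\<integral>y. (u \<bullet> y) ^ 4 \<partial>\<gamma>) \<le> 48 * (h * (norm u)\<^sup>2)\<^sup>2"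
  proof -
    define r where "r = sqrt h * norm u"
    define v where "v = (1 / r) *\<^sub>R u"
    have r2: "r\<^sup>2 = h * (norm u)\<^sup>2" unfolding r_def using h_pos by (simp add: power_mult_distrib)
    have u: "u \<bullet> y = r * (v \<bullet> y)" for y
      using h_pos unfolding v_def r_def by (cases "u = 0") auto
    have "h / 2 * (norm v)\<^sup>2 \<le> 1 / 2"
      using h_pos unfolding v_def r_def by (cases "u = 0") (auto simp: power_mult_distrib power_divide field_simps)
    then have e: "exp (h / 2 * (norm v)\<^sup>2) \<le> 2" using half by (meson exp_le_cancel_iff order_trans)
    have "(\<integral>y. (u \<bullet> y)\<^sup>2 \<partial>\<gamma>) = r\<^sup>2 * (\<integral>y. (v \<bullet> y)\<^sup>2 \<partial>\<gamma>)"
      unfolding u by (simp add: power_mult_distrib)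
    also have "\<dots> \<le> r\<^sup>2 * 2" using integral_inner_power2[of v] e by (intro mult_left_mono) auto
    finally show "(\<integral>y. (u \<bullet> y)\<^sup>2 \<partial>\<gamma>) \<le> 2 * h * (norm u)\<^sup>2" using r2 by simp
    have "(\<integral>y. (u \<bullet> y) ^ 4 \<partial>\<gamma>) = (r\<^sup>2)\<^sup>2 * (\<integral>y. (v \<bullet> y) ^ 4 \<partial>\<gamma>)"
      unfolding u by (simp add: power_mult_distrib flip: power_mult)
    also have "\<dots> \<le> (r\<^sup>2)\<^sup>2 * 48" using integral_inner_power4[of v] e by (intro mult_left_mono) auto
    finally show "(\<integral>y. (u \<bullet> y) ^ 4 \<partial>\<gamma>) \<le> 48 * (h * (norm u)\<^sup>2)\<^sup>2" using r2 by simp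
  qed
qed

lemma norm_power4_le_sum: "(norm y) ^ 4 \<le> real CARD('d) * (\<Sum>i\<in>UNIV. (axis i 1 \<bullet> y) ^ 4)" for y :: "real^'d"
proof -
  have "(norm y) ^ 4 = (\<Sum>i\<in>UNIV. (y $ i)\<^sup>2)\<^sup>2"
  proof -
    have "(norm y) ^ 4 = ((norm y)\<^sup>2)\<^sup>2" by (simp flip: power_mult)
    also have "(norm y)\<^sup>2 = (\<Sum>i\<in>UNIV. (y $ i)\<^sup>2)"
      unfolding power2_norm_eq_inner inner_vec_def by (simp add: power2_eq_square)
    finally show ?thesis .
  qed
  also have "\<dots> \<le> (\<Sum>i\<in>UNIV. ((y $ i)\<^sup>2)\<^sup>2) * real CARD('d)"
    using sum_squared_le_sum_of_squares[of "\<lambda>i. (y $ i)\<^sup>2" UNIV] by simp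
  finally show ?thesis by (simp add: inner_axis' mult.commute flip: power_mult)
qed

lemma integrable_norm_power4: "integrable \<gamma> (\<lambda>y. (norm y) ^ 4)"
  and norm_power4_le: "(\<integral>y. (norm y) ^ 4 \<partial>\<gamma>) \<le> 48 * (real CARD('d))\<^sup>2 * h\<^sup>2"
proof -
  have i: "integrable \<gamma> (\<lambda>y. real CARD('d) * (\<Sum>i\<in>UNIV. (axis i 1 \<bullet> y) ^ 4))"
    by (intro integrable_mult_right Bochner_Integration.integrable_sum integrable_inner_power4)
  show n: "integrable \<gamma> (\<lambda>y. (norm y) ^ 4)"
    by (rule Bochner_Integration.integrable_bound[OF i]) (auto intro!: AE_I2 order_trans[OF norm_power4_le_sum])
  have "(\<integral>y. (norm y) ^ 4 \<partial>\<gamma>) \<le> (\<integral>y. real CARD('d) * (\<Sum>i\<in>UNIV. (axis i 1 \<bullet> y) ^ 4) \<partial>\<gamma>)"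
    by (rule integral_mono[OF n i]) (rule norm_power4_le_sum)
  also have "\<dots> = real CARD('d) * (\<Sum>i\<in>(UNIV::'d set). \<integral>y. (axis i 1 \<bullet> y) ^ 4 \<partial>\<gamma>)"
    by (simp add: integrable_inner_power4)
  also have "\<dots> \<le> real CARD('d) * (\<Sum>i\<in>(UNIV::'d set). 48 * h\<^sup>2)"
  proof (intro mult_left_mono sum_mono)
    fix i :: 'd
    show "(\<integral>y. (axis i 1 \<bullet> y) ^ 4 \<partial>\<gamma>) \<le> 48 * h\<^sup>2"
      using inner_power4_le[of "axis i 1"] by simp
  qed simp
  finally show "(\<integral>y. (norm y) ^ 4 \<partial>\<gamma>) \<le> 48 * (real CARD('d))\<^sup>2 * h\<^sup>2"
    by (simp add: power2_eq_square mult_ac)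
qed

lemma integrable_bounded:
  fixes f :: "real^'d \<Rightarrow> real"
  assumes "f \<in> borel_measurable borel" "\<And>y. \<bar>f y\<bar> \<le> C"
  shows "integrable \<gamma> f"
  using assms by (intro integrable_const_bound[where B=C]) auto

text \<open>Up to the phase, cosines are eigenfunctions of Gaussian averaging: the sine part is odd.\<close>

lemma integral_cos:
  "(\<integral>y. cos (\<theta> + l \<bullet> y) \<partial>\<gamma>) = (\<integral>y. cos (l \<bullet> y) \<partial>\<gamma>) * cos \<theta>"
proof -
  have i: "integrable \<gamma> (\<lambda>y. cos (l \<bullet> y))" "integrable \<gamma> (\<lambda>y. sin (l \<bullet> y))"
    by (auto intro!: integrable_bounded[where C=1])
  have "(\<integral>y. cos (\<theta> + l \<bullet> y) \<partial>\<gamma>) = cos \<theta> * (\<integral>y. cos (l \<bullet> y) \<partial>\<gamma>) - sin \<theta> * (\<integral>y. sin (l \<bullet> y) \<partial>\<gamma>)"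
    unfolding cos_add using i by simp
  also have "(\<integral>y. sin (l \<bullet> y) \<partial>\<gamma>) = 0"
    by (rule integral_odd) auto
  finally show ?thesis by simp
qed

lemma abs_cos_integral_le: "\<bar>\<integral>y. cos (l \<bullet> y) \<partial>\<gamma>\<bar> \<le> 1"
proof -
  have "\<bar>\<integral>y. cos (l \<bullet> y) \<partial>\<gamma>\<bar> \<le> (\<integral>y. \<bar>cos (l \<bullet> y)\<bar> \<partial>\<gamma>)" by (rule integral_abs_bound)
  also have "\<dots> \<le> (\<integral>y. 1 \<partial>\<gamma>)"
    by (rule integral_mono) (auto intro!: integrable_bounded[where C=1])
  finally show ?thesis by (simp add: prob_space[simplified])
qed

lemma one_minus_cos_integral_le: "1 - (\<integral>y. cos (l \<bullet> y) \<partial>\<gamma>) \<le> h * (norm l)\<^sup>2"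
proof -
  have i: "integrable \<gamma> (\<lambda>y. cos (l \<bullet> y))" by (auto intro!: integrable_bounded[where C=1])
  have c: "1 - cos x \<le> x\<^sup>2 / 2" for x :: real
  proof -
    have "1 - cos x = 2 * (sin (x / 2))\<^sup>2" using cos_double_sin[of "x / 2"] by simp
    also have "(sin (x / 2))\<^sup>2 \<le> (x / 2)\<^sup>2" using abs_sin_x_le_abs_x[of "x / 2"] by (simp only: abs_le_square_iff)
    finally show ?thesis by (simp add: power_divide)
  qed
  have "1 - (\<integral>y. cos (l \<bullet> y) \<partial>\<gamma>) = (\<integral>y. 1 - cos (l \<bullet> y) \<partial>\<gamma>)"
    using i by (simp add: prob_space[simplified])
  also have "\<dots> \<le> (\<integral>y. (l \<bullet> y)\<^sup>2 / 2 \<partial>\<gamma>)"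
  proof (rule integral_mono)
    show "1 - cos (l \<bullet> y) \<le> (l \<bullet> y)\<^sup>2 / 2" for y by (rule c)
  qed (use i integrable_inner_power2 in auto)
  also have "\<dots> \<le> h * (norm l)\<^sup>2" using inner_power2_le[of l] by simp
  finally show ?thesis .
qed

lemma abs_le_one_plus_square: "\<bar>x\<bar> \<le> 1 + x\<^sup>2" for x :: real
proof -
  have "0 \<le> (\<bar>x\<bar> - 1)\<^sup>2" by simp
  then have "2 * \<bar>x\<bar> \<le> 1 + x\<^sup>2" by (simp add: power2_diff)
  then show ?thesis by linarith
qed

text \<open>The density of a shifted Gaussian is \<open>1 + u \<bullet> y\<close> up to an error whose mean square is of order
  \<open>h\<^sup>2\<close>: after expanding the square the means of \<open>\<rho>\<close>, \<open>\<rho>\<^sup>2\<close> and \<open>\<rho> y * (u \<bullet> y)\<close> are explicit, and the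
  terms of first order in \<open>h\<close> cancel.\<close>

lemma shifted_density_linearization:
  assumes "h \<le> 1" and U: "norm u \<le> U"
  defines "\<rho> \<equiv> \<lambda>y. exp (u \<bullet> y - h / 2 * (norm u)\<^sup>2)"
  shows "integrable \<gamma> \<rho>" "(\<integral>y. \<rho> y \<partial>\<gamma>) = 1"
    and "integrable \<gamma> (\<lambda>y. \<rho> y * (u \<bullet> y))" "(\<integral>y. \<rho> y * (u \<bullet> y) \<partial>\<gamma>) = h * (norm u)\<^sup>2"
    and "integrable \<gamma> (\<lambda>y. (\<rho> y)\<^sup>2)"
    and "integrable \<gamma> (\<lambda>y. (\<rho> y - 1 - u \<bullet> y)\<^sup>2)" "(\<integral>y. (\<rho> y - 1 - u \<bullet> y)\<^sup>2 \<partial>\<gamma>) \<le> 2 * U ^ 4 * exp (U\<^sup>2) * h\<^sup>2"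
proof -
  define s where "s = h * (norm u)\<^sup>2"
  have s: "0 \<le> s" "s \<le> h * U\<^sup>2" "s \<le> U\<^sup>2"
  proof -
    show "0 \<le> s" unfolding s_def using h_pos by simp
    have "(norm u)\<^sup>2 \<le> U\<^sup>2" using U by (intro power_mono) auto
    then show "s \<le> h * U\<^sup>2" unfolding s_def using h_pos by (intro mult_left_mono) auto
    also have "\<dots> \<le> 1 * U\<^sup>2" using assms(1) by (intro mult_right_mono) auto
    finally show "s \<le> U\<^sup>2" by simp
  qed
  have \<rho>: "\<rho> y = exp (- (s / 2)) * exp (u \<bullet> y)" for y
    unfolding \<rho>_def s_def exp_add[symmetric] by simp
  show i1: "integrable \<gamma> \<rho>" unfolding \<rho> by (intro integrable_mult_right integrable_exp)
  show e1: "(\<integral>y. \<rho> y \<partial>\<gamma>) = 1"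
    unfolding \<rho> integral_mult_right_zero integral_exp by (simp add: s_def exp_add[symmetric])
  have \<rho>2: "(\<rho> y)\<^sup>2 = exp (- s) * exp ((2 *\<^sub>R u) \<bullet> y)" for y
    unfolding \<rho> power_mult_distrib by (simp add: exp_double[symmetric] power2_eq_square exp_add[symmetric])
  show i2: "integrable \<gamma> (\<lambda>y. (\<rho> y)\<^sup>2)" unfolding \<rho>2 by (intro integrable_mult_right integrable_exp)
  have e2: "(\<integral>y. (\<rho> y)\<^sup>2 \<partial>\<gamma>) = exp s"
    unfolding \<rho>2 integral_mult_right_zero integral_exp by (simp add: s_def power_mult_distrib exp_add[symmetric])
  have i3: "integrable \<gamma> (\<lambda>y. (u \<bullet> y)\<^sup>2)" by (rule integrable_inner_power2)
  have i3': "integrable \<gamma> (\<lambda>y. u \<bullet> y)"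
    by (rule Bochner_Integration.integrable_bound[where f="\<lambda>y. 1 + (u \<bullet> y)\<^sup>2"])
       (use i3 abs_le_one_plus_square in \<open>auto intro!: AE_I2\<close>)
  show i4: "integrable \<gamma> (\<lambda>y. \<rho> y * (u \<bullet> y))"
  proof (rule Bochner_Integration.integrable_bound[where f="\<lambda>y. (\<rho> y)\<^sup>2 + (u \<bullet> y)\<^sup>2"])
    show "AE y in \<gamma>. norm (\<rho> y * (u \<bullet> y)) \<le> norm ((\<rho> y)\<^sup>2 + (u \<bullet> y)\<^sup>2)"
    proof (rule AE_I2)
      fix y
      have "0 \<le> (\<bar>\<rho> y\<bar> - \<bar>u \<bullet> y\<bar>)\<^sup>2" by simp
      then have "2 * (\<bar>\<rho> y\<bar> * \<bar>u \<bullet> y\<bar>) \<le> (\<rho> y)\<^sup>2 + (u \<bullet> y)\<^sup>2" by (simp add: power2_diff)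
      moreover have "0 \<le> \<bar>\<rho> y\<bar> * \<bar>u \<bullet> y\<bar>" by simp
      ultimately have "\<bar>\<rho> y\<bar> * \<bar>u \<bullet> y\<bar> \<le> (\<rho> y)\<^sup>2 + (u \<bullet> y)\<^sup>2" by linarith
      then show "norm (\<rho> y * (u \<bullet> y)) \<le> norm ((\<rho> y)\<^sup>2 + (u \<bullet> y)\<^sup>2)"
        by (simp add: abs_mult)
    qed
  qed (use i2 i3 in \<open>auto simp: \<rho>_def\<close>)
  have "(\<integral>y. \<rho> y * (u \<bullet> y) \<partial>\<gamma>) = (\<integral>y. u \<bullet> (y + h *\<^sub>R u) \<partial>\<gamma>)"
    unfolding \<rho>_def by (rule integral_shift(1)[symmetric]) simp
  also have "\<dots> = (\<integral>y. u \<bullet> y \<partial>\<gamma>) + s"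
    using i3' by (simp add: inner_add_right s_def power2_norm_eq_inner prob_space[simplified])
  also have "(\<integral>y. u \<bullet> y \<partial>\<gamma>) = 0" by (rule integral_odd) auto
  finally have e4: "(\<integral>y. \<rho> y * (u \<bullet> y) \<partial>\<gamma>) = s" by simp
  then show "(\<integral>y. \<rho> y * (u \<bullet> y) \<partial>\<gamma>) = h * (norm u)\<^sup>2" by (simp add: s_def)
  have eq: "(\<rho> y - 1 - u \<bullet> y)\<^sup>2 = (\<rho> y)\<^sup>2 + 1 + (u \<bullet> y)\<^sup>2 - 2 * \<rho> y - 2 * (\<rho> y * (u \<bullet> y)) + 2 * (u \<bullet> y)" for y
    by (simp add: power2_eq_square algebra_simps)
  show i5: "integrable \<gamma> (\<lambda>y. (\<rho> y - 1 - u \<bullet> y)\<^sup>2)"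
    unfolding eq using i1 i2 i3 i3' i4 by simp
  have "(\<integral>y. (\<rho> y - 1 - u \<bullet> y)\<^sup>2 \<partial>\<gamma>) = exp s + 1 + (\<integral>y. (u \<bullet> y)\<^sup>2 \<partial>\<gamma>) - 2 - 2 * s"
    unfolding eq using i1 i2 i3 i3' i4 e1 e2 e4 integral_odd[of "\<lambda>y. u \<bullet> y"]
    by (simp add: prob_space[simplified])
  also have "\<dots> \<le> exp s + 1 + 2 * (exp (s / 2) - 1) - 2 - 2 * s"
    using integral_inner_power2[of u] by (simp add: s_def)
  also have "\<dots> = (exp s - 1 - s) + 2 * (exp (s / 2) - 1 - s / 2)" by simp
  also have "\<dots> \<le> s\<^sup>2 * exp s + 2 * ((s / 2)\<^sup>2 * exp (s / 2))"
    using s(1) by (intro add_mono mult_left_mono exp_minus_one_le) auto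
  also have "\<dots> \<le> s\<^sup>2 * exp s + 2 * ((s / 2)\<^sup>2 * exp s)"
    using s(1) by (intro add_left_mono mult_left_mono) auto
  also have "\<dots> \<le> 2 * s\<^sup>2 * exp s" by (simp add: power_divide)
  also have "\<dots> \<le> 2 * (h * U\<^sup>2)\<^sup>2 * exp (U\<^sup>2)"
    using s by (intro mult_mono power_mono) auto
  also have "\<dots> = 2 * U ^ 4 * exp (U\<^sup>2) * h\<^sup>2" by (simp add: power_mult_distrib mult_ac flip: power_mult)
  finally show "(\<integral>y. (\<rho> y - 1 - u \<bullet> y)\<^sup>2 \<partial>\<gamma>) \<le> 2 * U ^ 4 * exp (U\<^sup>2) * h\<^sup>2" .
qed

lemma cos_linearization: "\<bar>cos (\<theta> + z) - cos \<theta> + z * sin \<theta>\<bar> \<le> z\<^sup>2" for \<theta> z :: real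
proof -
  have 1: "\<bar>cos z - 1\<bar> \<le> z\<^sup>2 / 2" for z :: real
  proof -
    have "1 - cos z = 2 * (sin (z / 2))\<^sup>2" using cos_double_sin[of "z / 2"] by simp
    also have "(sin (z / 2))\<^sup>2 \<le> (z / 2)\<^sup>2" using abs_sin_x_le_abs_x[of "z / 2"] by (simp only: abs_le_square_iff)
    finally show ?thesis using cos_le_one[of z] by (simp add: power_divide)
  qed
  have 2: "\<bar>sin z - z\<bar> \<le> z\<^sup>2 / 2"
  proof -
    obtain t where "sin z = z + sin (t + pi) / 2 * z\<^sup>2"
      using Maclaurin_sin_expansion[of z 2] by (auto simp: eval_nat_numeral sin_coeff_def)
    then have "\<bar>sin z - z\<bar> = \<bar>sin (t + pi)\<bar> * (z\<^sup>2 / 2)" by (simp add: abs_mult)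
    also have "\<dots> \<le> 1 * (z\<^sup>2 / 2)" by (intro mult_right_mono) auto
    finally show ?thesis by simp
  qed
  have "cos (\<theta> + z) - cos \<theta> + z * sin \<theta> = cos \<theta> * (cos z - 1) - sin \<theta> * (sin z - z)"
    by (simp add: cos_add algebra_simps)
  also have "\<bar>\<dots>\<bar> \<le> \<bar>cos \<theta>\<bar> * \<bar>cos z - 1\<bar> + \<bar>sin \<theta>\<bar> * \<bar>sin z - z\<bar>"
    using abs_triangle_ineq4[of "cos \<theta> * (cos z - 1)" "sin \<theta> * (sin z - z)"] by (simp add: abs_mult)
  also have "\<dots> \<le> 1 * (z\<^sup>2 / 2) + 1 * (z\<^sup>2 / 2)"
    using 1 2 by (intro add_mono mult_mono) auto
  finally show ?thesis by simp
qed

text \<open>The loss of steering one Gaussian step by a constant is the relative entropy of the shifted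
  Gaussian, of density \<open>\<rho> y = exp (u \<bullet> y - h |u|\<^sup>2 / 2)\<close>, with respect to the measure of density
  \<open>G / m\<close>. Both densities are \<open>1 + u \<bullet> y\<close> up to errors whose mean squares are of order \<open>h\<^sup>2\<close>; this is
  what determines \<open>u\<close>. As \<open>G\<close> is bounded away from 0, the \<open>\<chi>\<^sup>2\<close>-distance of the densities is of order
  \<open>h\<^sup>2\<close>, and it dominates the entropy.\<close>

lemma gaussian_step:
  fixes b \<theta> :: "nat \<Rightarrow> real" and l :: "nat \<Rightarrow> real^'d" and K :: nat
  defines "G \<equiv> \<lambda>y. \<Sum>k<K. b k * cos (\<theta> k + l k \<bullet> y)"
  defines "m \<equiv> (\<integral>y. G y \<partial>\<gamma>)"
  defines "u \<equiv> (- (1 / m)) *\<^sub>R (\<Sum>k<K. (b k * sin (\<theta> k)) *\<^sub>R l k)"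
  assumes h1: "h \<le> 1" and A: "(\<Sum>k<K. \<bar>b k\<bar>) \<le> A" and R: "\<And>k. norm (l k) \<le> R"
    and c0: "0 < c\<^sub>0" and pos: "\<And>y. c\<^sub>0 \<le> G y"
  shows "norm u \<le> A * R / c\<^sub>0" and "c\<^sub>0 \<le> m" and "m \<le> A"
    and "ln m - step_loss (real CARD('d)) A R c\<^sub>0 * h\<^sup>2 \<le> (\<integral>y. ln (G (y + h *\<^sub>R u)) \<partial>\<gamma>) - h / 2 * (norm u)\<^sup>2"
proof -
  have R0: "0 \<le> R" using R[of 0] norm_ge_zero order_trans by blast
  have A0: "0 \<le> A" using A by (rule order_trans[rotated]) (simp add: sum_nonneg)
  have Gm [measurable]: "G \<in> borel_measurable borel" unfolding G_def by measurable
  have GA: "\<bar>G y\<bar> \<le> A" for y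
  proof -
    have "\<bar>G y\<bar> \<le> (\<Sum>k<K. \<bar>b k * cos (\<theta> k + l k \<bullet> y)\<bar>)" unfolding G_def by (rule sum_abs)
    also have "\<dots> \<le> (\<Sum>k<K. \<bar>b k\<bar>)" by (intro sum_mono) (simp add: abs_mult mult_left_le)
    finally show ?thesis using A by simp
  qed
  have Gi: "integrable \<gamma> G" by (rule integrable_bounded[OF Gm GA])
  have "c\<^sub>0 = (\<integral>y. c\<^sub>0 \<partial>\<gamma>)" by (simp add: prob_space[simplified])
  also have "\<dots> \<le> m" unfolding m_def by (rule integral_mono) (use Gi pos in auto)
  finally show m0: "c\<^sub>0 \<le> m" .
  have "m \<le> (\<integral>y. A \<partial>\<gamma>)" unfolding m_def by (rule integral_mono) (use Gi GA abs_le_D1 in auto)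
  then show mA: "m \<le> A" by (simp add: prob_space[simplified])
  have mp: "0 < m" using c0 m0 by simp
  have Ap: "0 < A" using mp mA by simp
  have "norm (\<Sum>k<K. (b k * sin (\<theta> k)) *\<^sub>R l k) \<le> (\<Sum>k<K. norm ((b k * sin (\<theta> k)) *\<^sub>R l k))"
    by (rule norm_sum)
  also have "\<dots> \<le> (\<Sum>k<K. \<bar>b k\<bar> * R)"
    using R R0 by (intro sum_mono) (auto simp: abs_mult mult.assoc intro!: mult_mono mult_left_mono intro: order_trans[OF mult_left_le_one_le])
  also have "\<dots> \<le> A * R" using A R0 by (simp add: sum_distrib_right[symmetric] mult_right_mono)
  finally have "norm u \<le> (A * R) / m" unfolding u_def using mp by (simp add: divide_right_mono)
  also have "\<dots> \<le> A * R / c\<^sub>0" using m0 c0 A0 R0 by (intro divide_left_mono) auto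
  finally show uU: "norm u \<le> A * R / c\<^sub>0" .
  define U where "U = A * R / c\<^sub>0"
  define \<rho> where "\<rho> y = exp (u \<bullet> y - h / 2 * (norm u)\<^sup>2)" for y
  note \<rho> = shifted_density_linearization[OF h1 uU[folded U_def], folded \<rho>_def]
  have \<rho>m [measurable]: "\<rho> \<in> borel_measurable borel" unfolding \<rho>_def by measurable
  define \<kappa> where "\<kappa> k = (\<integral>y. cos (l k \<bullet> y) \<partial>\<gamma>)" for k
  have m_eq: "m = (\<Sum>k<K. b k * (\<kappa> k * cos (\<theta> k)))"
    unfolding m_def G_def \<kappa>_def
    by (subst Bochner_Integration.integral_sum) (auto intro!: integrable_bounded[where C=1] simp: integral_cos)
  define g where "g y = G y / m" for y
  have lin: "\<bar>g y - 1 - u \<bullet> y\<bar> \<le> A * R\<^sup>2 / c\<^sub>0 * ((norm y)\<^sup>2 + h)" for y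
  proof -
    have uy: "u \<bullet> y = - ((\<Sum>k<K. b k * sin (\<theta> k) * (l k \<bullet> y)) / m)"
      unfolding u_def by (simp add: inner_sum_left)
    \<comment> \<open>A sum of Taylor remainders of cosines and of the defects \<open>1 - \<kappa> k\<close> of their eigenvalues.\<close>
    have "m * (g y - 1 - u \<bullet> y) = G y - m + (\<Sum>k<K. b k * sin (\<theta> k) * (l k \<bullet> y))"
      unfolding g_def uy using mp by (simp add: algebra_simps)
    also have "\<dots> = (\<Sum>k<K. b k * ((cos (\<theta> k + l k \<bullet> y) - cos (\<theta> k) + (l k \<bullet> y) * sin (\<theta> k)) + cos (\<theta> k) * (1 - \<kappa> k)))"
      unfolding m_eq G_def sum_subtractf[symmetric] sum.distrib[symmetric] by (intro sum.cong refl) (simp add: algebra_simps)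
    also have "\<bar>\<dots>\<bar> \<le> (\<Sum>k<K. \<bar>b k\<bar> * (R\<^sup>2 * ((norm y)\<^sup>2 + h)))"
    proof (rule order_trans[OF sum_abs], rule sum_mono)
      fix k
      have z: "(l k \<bullet> y)\<^sup>2 \<le> R\<^sup>2 * (norm y)\<^sup>2"
      proof -
        have "\<bar>l k \<bullet> y\<bar> \<le> R * norm y"
          using Cauchy_Schwarz_ineq2[of "l k" y] mult_right_mono[OF R[of k], of "norm y"] by simp
        then have "\<bar>l k \<bullet> y\<bar>\<^sup>2 \<le> (R * norm y)\<^sup>2" by (intro power_mono) auto
        then show ?thesis by (simp add: power_mult_distrib)
      qed
      have "h * (norm (l k))\<^sup>2 \<le> h * R\<^sup>2" using R[of k] h_pos by (intro mult_left_mono power_mono) auto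
      then have \<kappa>: "\<bar>1 - \<kappa> k\<bar> \<le> R\<^sup>2 * h"
        using one_minus_cos_integral_le[of "l k"] abs_cos_integral_le[of "l k"] unfolding \<kappa>_def[symmetric] by (simp add: mult.commute)
      have "\<bar>cos (\<theta> k) * (1 - \<kappa> k)\<bar> \<le> 1 * (R\<^sup>2 * h)" unfolding abs_mult using \<kappa> by (intro mult_mono) auto
      then have "\<bar>(cos (\<theta> k + l k \<bullet> y) - cos (\<theta> k) + (l k \<bullet> y) * sin (\<theta> k)) + cos (\<theta> k) * (1 - \<kappa> k)\<bar> \<le> R\<^sup>2 * ((norm y)\<^sup>2 + h)"
        using cos_linearization[of "\<theta> k" "l k \<bullet> y"] z by (simp add: distrib_left)
      then show "\<bar>b k * ((cos (\<theta> k + l k \<bullet> y) - cos (\<theta> k) + (l k \<bullet> y) * sin (\<theta> k)) + cos (\<theta> k) * (1 - \<kappa> k))\<bar>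
        \<le> \<bar>b k\<bar> * (R\<^sup>2 * ((norm y)\<^sup>2 + h))"
        unfolding abs_mult by (rule mult_left_mono) simp
    qed
    also have "\<dots> \<le> A * (R\<^sup>2 * ((norm y)\<^sup>2 + h))"
      unfolding sum_distrib_right[symmetric] using A h_pos by (intro mult_right_mono) auto
    finally have "m * \<bar>g y - 1 - u \<bullet> y\<bar> \<le> A * (R\<^sup>2 * ((norm y)\<^sup>2 + h))"
      using mp by (simp only: abs_mult abs_of_pos)
    then have "\<bar>g y - 1 - u \<bullet> y\<bar> \<le> A * (R\<^sup>2 * ((norm y)\<^sup>2 + h)) / m"
      unfolding pos_le_divide_eq[OF mp] by (simp only: mult.commute)
    also have "\<dots> \<le> A * (R\<^sup>2 * ((norm y)\<^sup>2 + h)) / c\<^sub>0"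
      using m0 c0 A0 h_pos by (intro divide_left_mono) auto
    finally show ?thesis by (simp add: mult.assoc)
  qed
  define q where "q = A * R\<^sup>2 / c\<^sub>0"
  define P where "P y = (\<rho> y - 1 - u \<bullet> y)\<^sup>2" for y
  define Q where "Q y = 2 * q\<^sup>2 * ((norm y) ^ 4 + h\<^sup>2)" for y :: "real^'d"
  have gQ: "(g y - 1 - u \<bullet> y)\<^sup>2 \<le> Q y" for y
  proof -
    have "\<bar>g y - 1 - u \<bullet> y\<bar>\<^sup>2 \<le> (q * ((norm y)\<^sup>2 + h))\<^sup>2"
      using lin[of y] unfolding q_def by (intro power_mono) auto
    also have "\<dots> = q\<^sup>2 * ((norm y)\<^sup>2 + h)\<^sup>2" by (simp add: power_mult_distrib)
    also have "\<dots> \<le> q\<^sup>2 * (2 * ((norm y) ^ 4 + h\<^sup>2))"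
    proof (rule mult_left_mono)
      have "0 \<le> ((norm y)\<^sup>2 - h)\<^sup>2" by simp
      then show "((norm y)\<^sup>2 + h)\<^sup>2 \<le> 2 * ((norm y) ^ 4 + h\<^sup>2)"
        by (simp add: power2_diff power2_sum flip: power_mult)
    qed simp
    finally show ?thesis unfolding Q_def by (simp only: power2_abs mult_ac)
  qed
  have Qi: "integrable \<gamma> Q" unfolding Q_def by (auto intro!: integrable_norm_power4)
  have Qe: "(\<integral>y. Q y \<partial>\<gamma>) \<le> 2 * q\<^sup>2 * (48 * (real CARD('d))\<^sup>2 + 1) * h\<^sup>2"
  proof -
    have "(\<integral>y. Q y \<partial>\<gamma>) = 2 * q\<^sup>2 * ((\<integral>y. (norm y) ^ 4 \<partial>\<gamma>) + h\<^sup>2)"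
      unfolding Q_def using integrable_norm_power4 by (simp add: prob_space[simplified])
    also have "\<dots> \<le> 2 * q\<^sup>2 * (48 * (real CARD('d))\<^sup>2 * h\<^sup>2 + h\<^sup>2)"
      using norm_power4_le by (intro mult_left_mono add_right_mono) auto
    finally show ?thesis by (simp add: algebra_simps)
  qed
  have gi: "integrable \<gamma> g" "(\<integral>y. g y \<partial>\<gamma>) = 1"
    unfolding g_def using Gi mp by (auto simp: m_def[symmetric])
  have gb: "c\<^sub>0 / A \<le> g y" for y
    unfolding g_def using pos[of y] mA mp c0 Ap by (intro frac_le) auto
  have gp: "0 < g y" for y using gb[of y] c0 Ap by (meson divide_pos_pos less_le_trans)
  define s where "s = h * (norm u)\<^sup>2"
  \<comment> \<open>The entropy is bounded by the \<open>\<chi>\<^sup>2\<close>-distance, from \<open>ln t \<le> t - 1\<close> at \<open>t = \<rho> y / g y\<close>.\<close>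
  have point: "\<rho> y * (u \<bullet> y) - s / 2 * \<rho> y - (A / c\<^sub>0) * (2 * P y + 2 * Q y) - \<rho> y + g y \<le> \<rho> y * ln (g y)" for y
  proof -
    have \<rho>p: "0 < \<rho> y" unfolding \<rho>_def by simp
    have ln\<rho>: "ln (\<rho> y) = u \<bullet> y - s / 2" unfolding \<rho>_def s_def by simp
    have "ln (\<rho> y / g y) \<le> \<rho> y / g y - 1" using \<rho>p gp by (intro ln_le_minus_one) auto
    then have "ln (\<rho> y) - ln (g y) \<le> \<rho> y / g y - 1" using \<rho>p gp[of y] by (simp add: ln_div)
    then have "\<rho> y * (ln (\<rho> y) - ln (g y)) \<le> \<rho> y * (\<rho> y / g y - 1)" using \<rho>p by (intro mult_left_mono) auto
    also have "\<dots> = (\<rho> y - g y)\<^sup>2 / g y + \<rho> y - g y"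
      using gp[of y] by (simp add: power2_eq_square field_simps)
    also have "(\<rho> y - g y)\<^sup>2 / g y \<le> (A / c\<^sub>0) * (2 * P y + 2 * Q y)"
    proof -
      have "(\<rho> y - g y)\<^sup>2 \<le> 2 * (\<rho> y - 1 - u \<bullet> y)\<^sup>2 + 2 * (g y - 1 - u \<bullet> y)\<^sup>2"
        using zero_le_power2[of "(\<rho> y - 1 - u \<bullet> y) + (g y - 1 - u \<bullet> y)"] by (simp add: power2_eq_square algebra_simps)
      also have "\<dots> \<le> 2 * P y + 2 * Q y" using gQ[of y] unfolding P_def by simp
      finally have 1: "(\<rho> y - g y)\<^sup>2 \<le> 2 * P y + 2 * Q y" .
      have 2: "1 / g y \<le> A / c\<^sub>0" using gb[of y] gp[of y] c0 Ap by (simp add: field_simps)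
      have "(1 / g y) * (\<rho> y - g y)\<^sup>2 \<le> (A / c\<^sub>0) * (2 * P y + 2 * Q y)"
        using 1 2 c0 Ap by (intro mult_mono) auto
      then show ?thesis by simp
    qed
    finally show ?thesis unfolding ln\<rho> by (simp add: algebra_simps)
  qed
  have lnG: "\<bar>ln (G y)\<bar> \<le> max \<bar>ln c\<^sub>0\<bar> \<bar>ln A\<bar>" for y
  proof -
    have "ln c\<^sub>0 \<le> ln (G y)" "ln (G y) \<le> ln A" using c0 pos[of y] abs_le_D1[OF GA[of y]] by auto
    then show ?thesis by linarith
  qed
  have "integrable \<gamma> (\<lambda>y. ln (G (y + h *\<^sub>R u)))"
    by (rule integrable_bounded[OF _ lnG]) measurable
  then have iG: "integrable \<gamma> (\<lambda>y. \<rho> y * ln (G y))"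
    using integral_shift(2)[of "\<lambda>y. ln (G y)" u] by (simp add: \<rho>_def)
  have ln_g: "\<rho> y * ln (g y) = \<rho> y * ln (G y) - ln m * \<rho> y" for y
    unfolding g_def using pos[of y] c0 mp by (simp add: ln_div algebra_simps)
  have "s - s / 2 * 1 - (A / c\<^sub>0) * (2 * (\<integral>y. P y \<partial>\<gamma>) + 2 * (\<integral>y. Q y \<partial>\<gamma>)) - 1 + 1 =
     (\<integral>y. \<rho> y * (u \<bullet> y) - s / 2 * \<rho> y - (A / c\<^sub>0) * (2 * P y + 2 * Q y) - \<rho> y + g y \<partial>\<gamma>)"
    using \<rho> gi Qi unfolding P_def s_def by simp
  also have "\<dots> \<le> (\<integral>y. \<rho> y * ln (g y) \<partial>\<gamma>)"
  proof (rule integral_mono)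
    show "integrable \<gamma> (\<lambda>y. \<rho> y * (u \<bullet> y) - s / 2 * \<rho> y - (A / c\<^sub>0) * (2 * P y + 2 * Q y) - \<rho> y + g y)"
      using \<rho> gi Qi unfolding P_def by simp
    show "integrable \<gamma> (\<lambda>y. \<rho> y * ln (g y))" unfolding ln_g using iG \<rho>(1) by simp
  qed (rule point)
  also have "\<dots> = (\<integral>y. \<rho> y * ln (G y) \<partial>\<gamma>) - ln m"
    unfolding ln_g using iG \<rho>(1,2) by simp
  also have "(\<integral>y. \<rho> y * ln (G y) \<partial>\<gamma>) = (\<integral>y. ln (G (y + h *\<^sub>R u)) \<partial>\<gamma>)"
    unfolding \<rho>_def by (rule integral_shift(1)[symmetric]) measurable
  finally have "ln m - (A / c\<^sub>0) * (2 * (\<integral>y. P y \<partial>\<gamma>) + 2 * (\<integral>y. Q y \<partial>\<gamma>)) \<le> (\<integral>y. ln (G (y + h *\<^sub>R u)) \<partial>\<gamma>) - s / 2"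
    by simp
  moreover have "(A / c\<^sub>0) * (2 * (\<integral>y. P y \<partial>\<gamma>) + 2 * (\<integral>y. Q y \<partial>\<gamma>)) \<le> step_loss (real CARD('d)) A R c\<^sub>0 * h\<^sup>2"
  proof -
    have "(A / c\<^sub>0) * (2 * (\<integral>y. P y \<partial>\<gamma>) + 2 * (\<integral>y. Q y \<partial>\<gamma>)) \<le>
        (A / c\<^sub>0) * (2 * (2 * U ^ 4 * exp (U\<^sup>2) * h\<^sup>2) + 2 * (2 * q\<^sup>2 * (48 * (real CARD('d))\<^sup>2 + 1) * h\<^sup>2))"
      using \<rho>(7) Qe Ap c0 unfolding P_def by (intro mult_left_mono add_mono) auto
    also have "\<dots> = step_loss (real CARD('d)) A R c\<^sub>0 * h\<^sup>2"
      unfolding step_loss_def U_def q_def by (simp add: algebra_simps)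
    finally show ?thesis .
  qed
  ultimately show "ln m - step_loss (real CARD('d)) A R c\<^sub>0 * h\<^sup>2 \<le> (\<integral>y. ln (G (y + h *\<^sub>R u)) \<partial>\<gamma>) - h / 2 * (norm u)\<^sup>2"
    unfolding s_def by simp
qed

end

section \<open>Increments are independent of the augmented past\<close>

lemma sets_Collect_mem:
  assumes "f \<in> measurable N K" "A \<in> sets K"
  shows "{x \<in> space N. f x \<in> A} \<in> sets N"
proof -
  have "{x \<in> space N. f x \<in> A} = f -` A \<inter> space N" by blast
  then show ?thesis using measurable_sets[OF assms] by simp
qed

context standard_brownian_motion
begin

abbreviation \<F> :: "real \<Rightarrow> 'o measure" where "\<F> \<equiv> augmented_filtration M B"

lemma filtration_generators:
  "{B s -` A \<inter> space M | s A. 0 \<le> s \<and> s \<le> t \<and> A \<in> sets borel} \<union> null_sets M \<subseteq> sets M"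
  using measurable_marginals by (auto intro: measurable_sets)

lemma filtration_generators_Pow:
  "{B s -` A \<inter> space M | s A. 0 \<le> s \<and> s \<le> t \<and> A \<in> sets borel} \<union> null_sets M \<subseteq> Pow (space M)"
  using filtration_generators sets.sets_into_space by blast

lemma space_filtration [simp]: "space (\<F> t) = space M"
  unfolding augmented_filtration_def using filtration_generators_Pow by (rule space_measure_of)

lemma sets_filtration:
  "sets (\<F> t) = sigma_sets (space M) ({B s -` A \<inter> space M | s A. 0 \<le> s \<and> s \<le> t \<and> A \<in> sets borel} \<union> null_sets M)"
  unfolding augmented_filtration_def using filtration_generators_Pow by (rule sets_measure_of)

lemma sets_filtration_subset: "sets (\<F> t) \<subseteq> sets M"
  unfolding sets_filtration by (rule sets.sigma_sets_subset[OF filtration_generators])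

lemma sets_filtration_mono: "s \<le> t \<Longrightarrow> sets (\<F> s) \<subseteq> sets (\<F> t)"
  unfolding sets_filtration by (rule sigma_sets_mono') (auto intro: order_trans)

lemma filtration_measurable_mono: "s \<le> t \<Longrightarrow> f \<in> measurable (\<F> s) N \<Longrightarrow> f \<in> measurable (\<F> t) N"
  using sets_filtration_mono[of s t] unfolding measurable_def space_filtration by blast

lemma filtration_measurable_M: "f \<in> measurable (\<F> s) N \<Longrightarrow> f \<in> measurable M N"
  using sets_filtration_subset[of s] unfolding measurable_def space_filtration by blast

lemma B_adapted: "0 \<le> s \<Longrightarrow> s \<le> t \<Longrightarrow> B s \<in> borel_measurable (\<F> t)"
proof -
  assume "0 \<le> s" "s \<le> t"
  then have "B s -` A \<inter> space M \<in> sets (\<F> t)" if "A \<in> sets borel" for A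
    unfolding sets_filtration using that by (intro sigma_sets.Basic) blast
  then show ?thesis unfolding measurable_def by auto
qed

lemma distr_increment: "0 \<le> s \<Longrightarrow> s < t \<Longrightarrow> distr M borel (\<lambda>\<omega>. B t \<omega> - B s \<omega>) = gauss (t - s)"
proof -
  assume "0 \<le> s" "s < t"
  then have "distr M lborel (\<lambda>\<omega>. B t \<omega> - B s \<omega>) = gauss (t - s)"
    using gaussian_increments unfolding distributed_def gauss_def gauss_density_def by blast
  moreover have "distr M lborel (\<lambda>\<omega>. B t \<omega> - B s \<omega>) = distr M borel (\<lambda>\<omega>. B t \<omega> - B s \<omega>)"
    by (rule distr_cong) auto
  ultimately show ?thesis by simp
qed

lemma gaussian_gauss: "0 < h \<Longrightarrow> gaussian (gauss h :: (real^'d) measure) h"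
proof -
  assume h: "0 < h"
  have "prob_space (distr M borel (\<lambda>\<omega>. B h \<omega> - B 0 \<omega>))"
    using h by (intro prob_space_distr borel_measurable_diff measurable_marginals) auto
  then show ?thesis
    using distr_increment[of 0 h] h unfolding gaussian_def gaussian_axioms_def by simp
qed

text \<open>A cylinder event of the past depends on finitely many values of \<open>B\<close>, that is, on the increments
  over a partition that ends at \<open>s\<close>; the next increment is independent of these.\<close>

lemma increment_indep_cylinder:
  assumes s: "0 \<le> s" "s < t" and I: "finite I" "I \<subseteq> {0..s}" and A: "\<And>r. r \<in> I \<Longrightarrow> A r \<in> sets borel"
    and C: "C \<in> sets borel"
  shows "prob ({\<omega> \<in> space M. \<forall>r\<in>I. B r \<omega> \<in> A r} \<inter> ((\<lambda>\<omega>. B t \<omega> - B s \<omega>) -` C \<inter> space M)) =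
    prob {\<omega> \<in> space M. \<forall>r\<in>I. B r \<omega> \<in> A r} * prob ((\<lambda>\<omega>. B t \<omega> - B s \<omega>) -` C \<inter> space M)"
proof -
  define xs where "xs = sorted_list_of_set (insert 0 (insert s I))"
  define n where "n = length xs"
  have fin: "finite (insert 0 (insert s I))" using I by simp
  have set_xs: "set xs = insert 0 (insert s I)" unfolding xs_def by (rule set_sorted_list_of_set[OF fin])
  have sorted: "sorted xs" unfolding xs_def by simp
  have n0: "0 < n" unfolding n_def using set_xs by (metis length_greater_0_conv list.set(1) insert_not_empty)
  have mem: "xs ! i \<in> {0..s}" if "i < n" for i
    using nth_mem[of i xs] that I s unfolding n_def set_xs by auto
  have hd: "xs ! 0 = 0"
  proof -
    obtain j where j: "j < n" "xs ! j = 0" using set_xs unfolding n_def by (metis in_set_conv_nth insertI1)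
    then have "xs ! 0 \<le> 0" using sorted_nth_mono[OF sorted, of 0 j] unfolding n_def by simp
    then show ?thesis using mem[OF n0] by simp
  qed
  have last: "xs ! (n - 1) = s"
  proof -
    obtain j where j: "j < n" "xs ! j = s" using set_xs unfolding n_def by (metis in_set_conv_nth insertI1 insertI2)
    then have "s \<le> xs ! (n - 1)" using sorted_nth_mono[OF sorted, of j "n - 1"] unfolding n_def by simp
    then show ?thesis using mem[of "n - 1"] n0 by simp
  qed
  define \<tau> where "\<tau> i = (if i < n then xs ! i else t)" for i
  have \<tau>mono: "mono \<tau>"
  proof (rule monoI)
    fix i j :: nat assume "i \<le> j"
    then show "\<tau> i \<le> \<tau> j"
      using sorted_nth_mono[OF sorted, of i j] mem[of i] s unfolding \<tau>_def n_def by auto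
  qed
  have \<tau>0: "\<tau> 0 = 0" unfolding \<tau>_def using n0 hd by simp
  define X where "X i \<omega> = B (\<tau> (Suc i)) \<omega> - B (\<tau> i) \<omega>" for i \<omega>
  have ind: "indep_vars (\<lambda>_. borel) X {..<n}"
    unfolding X_def by (rule independent_increments) (use \<tau>0 \<tau>mono in auto)
  have B_eq: "B (\<tau> j) \<omega> = (\<Sum>i<j. X i \<omega>)" if "\<omega> \<in> space M" for j \<omega>
    unfolding X_def sum_lessThan_telescope[of "\<lambda>i. B (\<tau> i) \<omega>" j] using starts_at_0[OF that] by (simp add: \<tau>0)
  have X_last: "X (n - Suc 0) \<omega> = B t \<omega> - B s \<omega>" for \<omega>
    unfolding X_def \<tau>_def using n0 last by simp
  have "\<exists>j<n. \<tau> j = r" if "r \<in> I" for r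
  proof -
    have "r \<in> set xs" using that set_xs by simp
    then show ?thesis unfolding in_set_conv_nth n_def[symmetric] \<tau>_def by auto
  qed
  then obtain j where j: "\<And>r. r \<in> I \<Longrightarrow> j r < n" "\<And>r. r \<in> I \<Longrightarrow> \<tau> (j r) = r" by metis
  let ?P = "PiM {..<n - 1} (\<lambda>_. borel :: (real^'d) measure)"
  let ?Q = "PiM {n - 1} (\<lambda>_. borel :: (real^'d) measure)"
  have iv: "indep_var ?P (\<lambda>\<omega>. restrict (\<lambda>i. X i \<omega>) {..<n - 1}) ?Q (\<lambda>\<omega>. restrict (\<lambda>i. X i \<omega>) {n - 1})"
    by (rule indep_var_restrict[OF ind]) (use n0 in auto)
  have m1: "(\<lambda>x. \<Sum>i<j r. x i) \<in> borel_measurable ?P" if "r \<in> I" for r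
    using j(1)[OF that] by (intro borel_measurable_sum measurable_component_singleton) auto
  define Xa where "Xa = {x \<in> space ?P. \<forall>r\<in>I. (\<Sum>i<j r. x i) \<in> A r}"
  have Xa: "Xa \<in> sets ?P"
    unfolding Xa_def by (intro sets.sets_Collect_finite_All I(1) sets_Collect_mem[OF m1 A])
  define Xb where "Xb = {x \<in> space ?Q. x (n - 1) \<in> C}"
  have Xb: "Xb \<in> sets ?Q"
    unfolding Xb_def by (rule sets_Collect_mem[OF _ C]) simp
  let ?U = "\<lambda>\<omega>. restrict (\<lambda>i. X i \<omega>) {..<n - 1}" and ?V = "\<lambda>\<omega>. restrict (\<lambda>i. X i \<omega>) {n - 1}"
  have Ua: "?U \<omega> \<in> Xa \<longleftrightarrow> (\<forall>r\<in>I. B r \<omega> \<in> A r)" if "\<omega> \<in> space M" for \<omega>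
  proof -
    have "(\<Sum>i<j r. ?U \<omega> i) = B r \<omega>" if "r \<in> I" for r
    proof -
      have "(\<Sum>i<j r. ?U \<omega> i) = (\<Sum>i<j r. X i \<omega>)"
        using j(1)[OF that] by (intro sum.cong refl) auto
      then show ?thesis using B_eq[OF \<open>\<omega> \<in> space M\<close>, of "j r"] j(2)[OF that] by simp
    qed
    then show ?thesis unfolding Xa_def by (auto simp: space_PiM)
  qed
  have Vb: "?V \<omega> \<in> Xb \<longleftrightarrow> B t \<omega> - B s \<omega> \<in> C" for \<omega>
    unfolding Xb_def by (auto simp: space_PiM X_last)
  have "prob ((\<lambda>\<omega>. (?U \<omega>, ?V \<omega>)) -` (Xa \<times> Xb) \<inter> space M) = prob (?U -` Xa \<inter> space M) * prob (?V -` Xb \<inter> space M)"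
    by (rule indep_varD[OF iv Xa Xb])
  also have "(\<lambda>\<omega>. (?U \<omega>, ?V \<omega>)) -` (Xa \<times> Xb) \<inter> space M =
      {\<omega> \<in> space M. \<forall>r\<in>I. B r \<omega> \<in> A r} \<inter> ((\<lambda>\<omega>. B t \<omega> - B s \<omega>) -` C \<inter> space M)"
    using Ua Vb by auto
  also have "?U -` Xa \<inter> space M = {\<omega> \<in> space M. \<forall>r\<in>I. B r \<omega> \<in> A r}" using Ua by auto
  also have "?V -` Xb \<inter> space M = (\<lambda>\<omega>. B t \<omega> - B s \<omega>) -` C \<inter> space M" using Vb by auto
  finally show ?thesis .
qed

text \<open>Cylinder events and null events together are stable under intersection and generate the
  augmented past; a null event is independent of everything.\<close>

lemma increment_indep_set:
  assumes s: "0 \<le> s" "s < t"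
  shows "indep_set (sets (\<F> s)) (sigma_sets (space M) {(\<lambda>\<omega>. B t \<omega> - B s \<omega>) -` C \<inter> space M | C. C \<in> sets borel})"
proof -
  let ?\<xi> = "\<lambda>\<omega>. B t \<omega> - B s \<omega>"
  let ?cyl = "{E. \<exists>I A. finite I \<and> I \<subseteq> {0..s} \<and> (\<forall>r\<in>I. A r \<in> sets borel) \<and> E = {\<omega> \<in> space M. \<forall>r\<in>I. B r \<omega> \<in> A r}}"
  let ?G = "?cyl \<union> null_sets M"
  let ?X = "{?\<xi> -` C \<inter> space M | C. C \<in> sets borel}"
  have \<xi>m: "?\<xi> \<in> borel_measurable M" using s by (intro borel_measurable_diff measurable_marginals) auto
  have cyl: "?cyl \<subseteq> sets M"
  proof safe
    fix I and A :: "real \<Rightarrow> (real^'d) set" assume "finite I" "I \<subseteq> {0..s}" "\<forall>r\<in>I. A r \<in> sets borel"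
    then show "{\<omega> \<in> space M. \<forall>r\<in>I. B r \<omega> \<in> A r} \<in> sets M"
      by (intro sets.sets_Collect_finite_All sets_Collect_mem[OF measurable_marginals]) auto
  qed
  have Xs: "?X \<subseteq> sets M" using \<xi>m by (auto intro: measurable_sets)
  have GX: "indep_set ?G ?X"
  proof (rule indep_setI)
    show "?G \<subseteq> events" using cyl by auto
    show "?X \<subseteq> events" by (rule Xs)
    fix a b assume a: "a \<in> ?G" and b: "b \<in> ?X"
    then obtain C where C: "b = ?\<xi> -` C \<inter> space M" "C \<in> sets borel" by blast
    from a show "prob (a \<inter> b) = prob a * prob b"
    proof
      assume "a \<in> ?cyl"
      then show ?thesis unfolding C(1) using increment_indep_cylinder[OF s _ _ _ C(2)] by blast
    next
      assume n: "a \<in> null_sets M"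
      then have "a \<inter> b \<in> null_sets M" using b Xs by (intro null_set_Int2) auto
      then show ?thesis using n by (simp add: measure_def null_setsD1)
    qed
  qed
  have "Int_stable ?G"
  proof (rule Int_stableI)
    fix a b assume ab: "a \<in> ?G" "b \<in> ?G"
    show "a \<inter> b \<in> ?G"
    proof (cases "a \<in> null_sets M \<or> b \<in> null_sets M")
      case True
      then have "a \<inter> b \<in> null_sets M" using ab cyl by (auto intro: null_set_Int1 null_set_Int2)
      then show ?thesis by blast
    next
      case False
      then have "a \<in> ?cyl" "b \<in> ?cyl" using ab by auto
      then obtain I A J A' where
        I: "finite I" "I \<subseteq> {0..s}" "\<forall>r\<in>I. A r \<in> sets borel" "a = {\<omega> \<in> space M. \<forall>r\<in>I. B r \<omega> \<in> A r}" and
        J: "finite J" "J \<subseteq> {0..s}" "\<forall>r\<in>J. A' r \<in> sets borel" "b = {\<omega> \<in> space M. \<forall>r\<in>J. B r \<omega> \<in> A' r}"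
        by blast
      let ?D = "\<lambda>r. (if r \<in> I then A r else UNIV) \<inter> (if r \<in> J then A' r else UNIV)"
      have "a \<inter> b = {\<omega> \<in> space M. \<forall>r\<in>I \<union> J. B r \<omega> \<in> ?D r}" unfolding I(4) J(4) by auto
      moreover have "\<forall>r\<in>I \<union> J. ?D r \<in> sets borel" using I(3) J(3) by auto
      moreover have "finite (I \<union> J)" "I \<union> J \<subseteq> {0..s}" using I J by auto
      ultimately have "a \<inter> b \<in> ?cyl" by (intro CollectI exI[of _ "I \<union> J"] exI[of _ ?D] conjI)
      then show ?thesis by blast
    qed
  qed
  moreover have "Int_stable ?X"
  proof (rule Int_stableI)
    fix a b assume "a \<in> ?X" "b \<in> ?X"
    then obtain C D where "a = ?\<xi> -` C \<inter> space M" "C \<in> sets borel" "b = ?\<xi> -` D \<inter> space M" "D \<in> sets borel" by blast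
    then show "a \<inter> b \<in> ?X" by (intro CollectI exI[of _ "C \<inter> D"]) auto
  qed
  ultimately have "indep_set (sigma_sets (space M) ?G) (sigma_sets (space M) ?X)"
    by (rule indep_set_sigma_sets[OF GX])
  moreover have "sigma_sets (space M) ?G = sets (\<F> s)"
  proof
    show "sigma_sets (space M) ?G \<subseteq> sets (\<F> s)"
    proof -
      have "E \<in> sets (\<F> s)" if "E \<in> ?cyl" for E
      proof -
        from that obtain I A where I: "finite I" "I \<subseteq> {0..s}" "\<forall>r\<in>I. A r \<in> sets borel" "E = {\<omega> \<in> space M. \<forall>r\<in>I. B r \<omega> \<in> A r}"
          by blast
        have "{\<omega> \<in> space (\<F> s). \<forall>r\<in>I. B r \<omega> \<in> A r} \<in> sets (\<F> s)"
          using I by (intro sets.sets_Collect_finite_All sets_Collect_mem[OF B_adapted]) auto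
        then show ?thesis unfolding I(4) by simp
      qed
      moreover have "null_sets M \<subseteq> sets (\<F> s)" unfolding sets_filtration by blast
      ultimately have "?G \<subseteq> sets (\<F> s)" by (intro Un_least) (rule subsetI)
      then have "sigma_sets (space (\<F> s)) ?G \<subseteq> sets (\<F> s)" by (rule sets.sigma_sets_subset)
      then show ?thesis by (simp only: space_filtration)
    qed
    show "sets (\<F> s) \<subseteq> sigma_sets (space M) ?G"
      unfolding sets_filtration
    proof (rule sigma_sets_mono', rule Un_mono)
      show "{B r -` A \<inter> space M | r A. 0 \<le> r \<and> r \<le> s \<and> A \<in> sets borel} \<subseteq> ?cyl"
      proof safe
        fix r and A :: "(real^'d) set" assume "0 \<le> r" "r \<le> s" "A \<in> sets borel"
        then show "\<exists>I A'. finite I \<and> I \<subseteq> {0..s} \<and> (\<forall>r\<in>I. A' r \<in> sets borel) \<and>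
            B r -` A \<inter> space M = {\<omega> \<in> space M. \<forall>r\<in>I. B r \<omega> \<in> A' r}"
          by (intro exI[of _ "{r}"] exI[of _ "\<lambda>_. A"]) auto
      qed
    qed simp
  qed
  ultimately show ?thesis by simp
qed

text \<open>Independence in the form in which it is used: the identity, as a map into the past, and the
  increment have a product law, so that Fubini's theorem integrates out the increment with the past
  frozen.\<close>

lemma freeze_increment:
  assumes s: "0 \<le> s" "s < t"
    and H: "(\<lambda>(\<omega>, y). H \<omega> y) \<in> borel_measurable (\<F> s \<Otimes>\<^sub>M borel)"
  shows "(\<integral>\<^sup>+\<omega>. H \<omega> (B t \<omega> - B s \<omega>) \<partial>M) = (\<integral>\<^sup>+\<omega>. (\<integral>\<^sup>+y. H \<omega> y \<partial>gauss (t - s)) \<partial>M)"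
proof -
  let ?\<xi> = "\<lambda>\<omega>. B t \<omega> - B s \<omega>"
  have \<xi>m: "?\<xi> \<in> borel_measurable M" using s by (intro borel_measurable_diff measurable_marginals) auto
  have idm: "(\<lambda>\<omega>. \<omega>) \<in> measurable M (\<F> s)" by (rule filtration_measurable_M[where s=s]) simp
  interpret g: gaussian "gauss (t - s) :: (real^'d) measure" "t - s" using s by (intro gaussian_gauss) simp
  interpret F: prob_space "distr M (\<F> s) (\<lambda>\<omega>. \<omega>)" by (rule prob_space_distr[OF idm])
  have joint: "distr M (\<F> s) (\<lambda>\<omega>. \<omega>) \<Otimes>\<^sub>M gauss (t - s) = distr M (\<F> s \<Otimes>\<^sub>M borel) (\<lambda>\<omega>. (\<omega>, ?\<xi> \<omega>))"
  proof (rule pair_measure_eqI)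
    show "sigma_finite_measure (distr M (\<F> s) (\<lambda>\<omega>. \<omega>))" "sigma_finite_measure (gauss (t - s) :: (real^'d) measure)"
      by unfold_locales
    show "sets (distr M (\<F> s) (\<lambda>\<omega>. \<omega>) \<Otimes>\<^sub>M (gauss (t - s) :: (real^'d) measure)) =
        sets (distr M (\<F> s \<Otimes>\<^sub>M borel) (\<lambda>\<omega>. (\<omega>, ?\<xi> \<omega>)))"
      by (simp cong: sets_pair_measure_cong)
    fix A and C :: "(real^'d) set"
    assume "A \<in> sets (distr M (\<F> s) (\<lambda>\<omega>. \<omega>))" "C \<in> sets (gauss (t - s))"
    then have A: "A \<in> sets (\<F> s)" and C: "C \<in> sets borel" by auto
    have AM: "A \<in> sets M" using A sets_filtration_subset by blast
    have A': "(\<lambda>\<omega>. \<omega>) -` A \<inter> space M = A" using sets.sets_into_space[OF AM] by auto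
    have CM: "?\<xi> -` C \<inter> space M \<in> sets M" using \<xi>m C by (rule measurable_sets)
    have "prob (A \<inter> (?\<xi> -` C \<inter> space M)) = prob A * prob (?\<xi> -` C \<inter> space M)"
      by (rule indep_setD[OF increment_indep_set[OF s] A]) (use C in blast)
    then have *: "emeasure M (A \<inter> (?\<xi> -` C \<inter> space M)) = emeasure M A * emeasure M (?\<xi> -` C \<inter> space M)"
      unfolding emeasure_eq_measure by (simp add: ennreal_mult)
    have "emeasure (distr M (\<F> s \<Otimes>\<^sub>M borel) (\<lambda>\<omega>. (\<omega>, ?\<xi> \<omega>))) (A \<times> C) =
        emeasure M ((\<lambda>\<omega>. (\<omega>, ?\<xi> \<omega>)) -` (A \<times> C) \<inter> space M)"
      using A C by (intro emeasure_distr measurable_Pair idm \<xi>m) auto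
    also have "(\<lambda>\<omega>. (\<omega>, ?\<xi> \<omega>)) -` (A \<times> C) \<inter> space M = A \<inter> (?\<xi> -` C \<inter> space M)"
      using sets.sets_into_space[OF AM] by auto
    also have "emeasure M \<dots> = emeasure (distr M (\<F> s) (\<lambda>\<omega>. \<omega>)) A * emeasure (gauss (t - s)) C"
      unfolding * distr_increment[OF s, symmetric] emeasure_distr[OF idm A] emeasure_distr[OF \<xi>m C] A' ..
    finally show "emeasure (distr M (\<F> s) (\<lambda>\<omega>. \<omega>)) A * emeasure (gauss (t - s)) C =
      emeasure (distr M (\<F> s \<Otimes>\<^sub>M borel) (\<lambda>\<omega>. (\<omega>, ?\<xi> \<omega>))) (A \<times> C)" ..
  qed
  have H': "(\<lambda>(\<omega>, y). H \<omega> y) \<in> borel_measurable (distr M (\<F> s) (\<lambda>\<omega>. \<omega>) \<Otimes>\<^sub>M gauss (t - s))"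
    using H by (simp cong: measurable_cong_sets sets_pair_measure_cong)
  have "(\<integral>\<^sup>+\<omega>. H \<omega> (?\<xi> \<omega>) \<partial>M) = (\<integral>\<^sup>+x. (case x of (\<omega>, y) \<Rightarrow> H \<omega> y) \<partial>distr M (\<F> s \<Otimes>\<^sub>M borel) (\<lambda>\<omega>. (\<omega>, ?\<xi> \<omega>)))"
    using H by (subst nn_integral_distr) (auto intro!: measurable_Pair idm \<xi>m)
  also have "\<dots> = (\<integral>\<^sup>+\<omega>. (\<integral>\<^sup>+y. H \<omega> y \<partial>gauss (t - s)) \<partial>distr M (\<F> s) (\<lambda>\<omega>. \<omega>))"
    unfolding joint[symmetric] using g.nn_integral_fst[OF H'] by simp
  also have "\<dots> = (\<integral>\<^sup>+\<omega>. (\<integral>\<^sup>+y. H \<omega> y \<partial>gauss (t - s)) \<partial>M)"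
    by (rule nn_integral_distr[OF idm])
      (use g.borel_measurable_nn_integral_fst[OF H'] in \<open>simp cong: measurable_cong_sets\<close>)
  finally show ?thesis .
qed

end

section \<open>Steering on a dyadic grid\<close>

abbreviation seq_space :: "(nat \<Rightarrow> real^'d) measure" where
  "seq_space \<equiv> PiM UNIV (\<lambda>_. borel)"

text \<open>Extension by zeros lets one space of sequences serve grids of every length.\<close>

definition trunc :: "nat \<Rightarrow> (nat \<Rightarrow> 'a) \<Rightarrow> nat \<Rightarrow> 'a::zero" where
  "trunc j x = (\<lambda>i. if i < j then x i else 0)"

lemma trunc_0: "trunc 0 x = (\<lambda>_. 0)"
  by (simp add: trunc_def)

lemma trunc_Suc: "trunc (Suc j) x = (trunc j x)(j := x j)"
  by (auto simp: trunc_def less_Suc_eq)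

lemma measurable_seq_space:
  assumes "\<And>i. (\<lambda>\<omega>. f \<omega> i) \<in> borel_measurable N"
  shows "f \<in> measurable N seq_space"
  using measurable_PiM_single'[of UNIV "\<lambda>i \<omega>. f \<omega> i" N "\<lambda>_. borel"] assms by auto

lemma measurable_seq_coordinate: "f \<in> measurable N seq_space \<Longrightarrow> (\<lambda>\<omega>. f \<omega> i) \<in> borel_measurable N"
  by (rule measurable_compose[OF _ measurable_component_singleton]) auto

lemma measurable_fun_upd_pair:
  assumes "f \<in> measurable N seq_space" "g \<in> borel_measurable N"
  shows "(\<lambda>\<omega>. (f \<omega>)(j := g \<omega>)) \<in> measurable N seq_space"
proof (rule measurable_seq_space)
  fix i
  show "(\<lambda>\<omega>. ((f \<omega>)(j := g \<omega>)) i) \<in> borel_measurable N"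
    using assms(2) measurable_seq_coordinate[OF assms(1), of i] by (cases "i = j") auto
qed

text \<open>The mean over the first \<open>j\<close> of a sequence of independent Gaussian increments, as an iterated
  integral that matches an induction along the grid.\<close>

primrec gauss_mean :: "nat \<Rightarrow> nat \<Rightarrow> ((nat \<Rightarrow> real^'d) \<Rightarrow> ennreal) \<Rightarrow> ennreal" where
  "gauss_mean p 0 \<Phi> = \<Phi> (\<lambda>_. 0)"
| "gauss_mean p (Suc j) \<Phi> = gauss_mean p j (\<lambda>x. \<integral>\<^sup>+y. \<Phi> (x(j := y)) \<partial>gauss (1 / 2 ^ p))"

context standard_brownian_motion
begin

definition noise :: "nat \<Rightarrow> nat \<Rightarrow> 'o \<Rightarrow> real^'d" where
  "noise p i \<omega> = B (real (Suc i) / 2 ^ p) \<omega> - B (real i / 2 ^ p) \<omega>"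

definition adapted :: "nat \<Rightarrow> (nat \<Rightarrow> 'o \<Rightarrow> real^'d) \<Rightarrow> bool" where
  "adapted p u \<longleftrightarrow> (\<forall>i. u i \<in> borel_measurable (\<F> (real i / 2 ^ p)))"

definition steered :: "nat \<Rightarrow> (nat \<Rightarrow> 'o \<Rightarrow> real^'d) \<Rightarrow> nat \<Rightarrow> 'o \<Rightarrow> real^'d" where
  "steered p u i \<omega> = noise p i \<omega> + (1 / 2 ^ p) *\<^sub>R u i \<omega>"

text \<open>The logarithm of the density of the law of the steered increments with respect to the law of
  the noise. It is evaluated at the steered increments, whence the positive sign of the quadratic
  term.\<close>

definition log_density :: "nat \<Rightarrow> (nat \<Rightarrow> 'o \<Rightarrow> real^'d) \<Rightarrow> nat \<Rightarrow> 'o \<Rightarrow> real" where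
  "log_density p u j \<omega> = (\<Sum>i<j. u i \<omega> \<bullet> noise p i \<omega> + 1 / 2 ^ p / 2 * (norm (u i \<omega>))\<^sup>2)"

lemma grid_step: "real (Suc i) / 2 ^ p - real i / 2 ^ p = 1 / 2 ^ p"
  by (simp add: field_simps)

lemma grid_mono: "i \<le> j \<Longrightarrow> real i / 2 ^ p \<le> real j / 2 ^ p"
  by (simp add: divide_right_mono)

lemma noise_adapted: "i < j \<Longrightarrow> noise p i \<in> borel_measurable (\<F> (real j / 2 ^ p))"
  unfolding noise_def[abs_def] using grid_mono[of "Suc i" j p] grid_mono[of i j p]
  by (intro borel_measurable_diff B_adapted) auto

lemma adaptedD: "adapted p u \<Longrightarrow> i \<le> j \<Longrightarrow> u i \<in> borel_measurable (\<F> (real j / 2 ^ p))"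
  unfolding adapted_def using filtration_measurable_mono[OF grid_mono[of i j p]] by blast

lemma steered_adapted: "adapted p u \<Longrightarrow> i < j \<Longrightarrow> steered p u i \<in> borel_measurable (\<F> (real j / 2 ^ p))"
  unfolding steered_def[abs_def]
  by (intro borel_measurable_add borel_measurable_scaleR borel_measurable_const noise_adapted adaptedD) auto

lemma log_density_adapted: "adapted p u \<Longrightarrow> log_density p u j \<in> borel_measurable (\<F> (real j / 2 ^ p))"
  unfolding log_density_def[abs_def]
  by (intro borel_measurable_sum borel_measurable_add borel_measurable_inner borel_measurable_times borel_measurable_power
      borel_measurable_const measurable_compose[OF _ borel_measurable_norm] noise_adapted adaptedD) auto

lemma trunc_adapted:
  assumes "\<And>i. i < j \<Longrightarrow> x i \<in> borel_measurable (\<F> (real j / 2 ^ p))"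
  shows "(\<lambda>\<omega>. trunc j (\<lambda>i. x i \<omega>)) \<in> measurable (\<F> (real j / 2 ^ p)) seq_space"
proof (rule measurable_seq_space)
  fix i show "(\<lambda>\<omega>. trunc j (\<lambda>i. x i \<omega>) i) \<in> borel_measurable (\<F> (real j / 2 ^ p))"
    using assms[of i] by (cases "i < j") (auto simp: trunc_def)
qed

lemma gaussian_step_noise: "gaussian (gauss (1 / 2 ^ p) :: (real^'d) measure) (1 / 2 ^ p)"
  by (rule gaussian_gauss) simp

lemma freeze_noise:
  assumes "(\<lambda>(\<omega>, y). H \<omega> y) \<in> borel_measurable (\<F> (real j / 2 ^ p) \<Otimes>\<^sub>M borel)"
  shows "(\<integral>\<^sup>+\<omega>. H \<omega> (noise p j \<omega>) \<partial>M) = (\<integral>\<^sup>+\<omega>. (\<integral>\<^sup>+y. H \<omega> y \<partial>gauss (1 / 2 ^ p)) \<partial>M)"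
  unfolding noise_def using freeze_increment[OF _ _ assms, of "real (Suc j) / 2 ^ p"] grid_step[of j p]
  by (simp add: divide_strict_right_mono)

lemma integrate_out_measurable:
  assumes "\<Phi> \<in> borel_measurable (seq_space :: (nat \<Rightarrow> real^'d) measure)"
  shows "(\<lambda>x. \<integral>\<^sup>+y. \<Phi> (x(j := y)) \<partial>gauss (1 / 2 ^ p)) \<in> borel_measurable seq_space"
proof -
  interpret g: gaussian "gauss (1 / 2 ^ p) :: (real^'d) measure" "1 / 2 ^ p" by (rule gaussian_step_noise)
  have "(\<lambda>z. (fst z)(j := snd z)) \<in> measurable (seq_space \<Otimes>\<^sub>M gauss (1 / 2 ^ p)) (seq_space :: (nat \<Rightarrow> real^'d) measure)"
    by (rule measurable_fun_upd_pair) (auto simp: measurable_cong_sets[OF refl sets_gauss[symmetric]])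
  from measurable_compose[OF this assms] show ?thesis
    by (intro g.borel_measurable_nn_integral) (simp add: split_beta')
qed

lemma noise_mean:
  assumes "\<Phi> \<in> borel_measurable seq_space"
  shows "(\<integral>\<^sup>+\<omega>. \<Phi> (trunc j (\<lambda>i. noise p i \<omega>)) \<partial>M) = gauss_mean p j \<Phi>"
  using assms
proof (induction j arbitrary: \<Phi>)
  case 0
  show ?case by (simp add: trunc_0 emeasure_space_1)
next
  case (Suc j)
  let ?H = "\<lambda>\<omega> y. \<Phi> ((trunc j (\<lambda>i. noise p i \<omega>))(j := y))"
  have "(\<lambda>z. (trunc j (\<lambda>i. noise p i (fst z)))(j := snd z)) \<in> measurable (\<F> (real j / 2 ^ p) \<Otimes>\<^sub>M borel) seq_space"
    by (intro measurable_fun_upd_pair measurable_compose[OF measurable_fst trunc_adapted] noise_adapted) auto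
  then have "(\<lambda>(\<omega>, y). ?H \<omega> y) \<in> borel_measurable (\<F> (real j / 2 ^ p) \<Otimes>\<^sub>M borel)"
    unfolding split_beta' by (rule measurable_compose[OF _ Suc.prems])
  then have "(\<integral>\<^sup>+\<omega>. ?H \<omega> (noise p j \<omega>) \<partial>M) = (\<integral>\<^sup>+\<omega>. (\<integral>\<^sup>+y. ?H \<omega> y \<partial>gauss (1 / 2 ^ p)) \<partial>M)"
    by (rule freeze_noise)
  also have "\<dots> = gauss_mean p (Suc j) \<Phi>"
    using Suc.IH[OF integrate_out_measurable[OF Suc.prems, where j=j and p=p]] by (simp only: gauss_mean.simps)
  finally show ?case by (simp only: trunc_Suc)
qed

text \<open>The weight of step \<open>j\<close> involves only the control of that step, which is known at its beginning.
  With the past frozen, \<open>cameron_martin\<close> removes the last shift together with its weight.\<close>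

theorem girsanov_grid:
  assumes u: "adapted p u" and "\<Phi> \<in> borel_measurable seq_space"
  shows "(\<integral>\<^sup>+\<omega>. \<Phi> (trunc j (\<lambda>i. steered p u i \<omega>)) * ennreal (exp (- log_density p u j \<omega>)) \<partial>M) = gauss_mean p j \<Phi>"
  using assms(2)
proof (induction j arbitrary: \<Phi>)
  case 0
  show ?case by (simp add: trunc_0 log_density_def emeasure_space_1)
next
  case (Suc j)
  interpret g: gaussian "gauss (1 / 2 ^ p) :: (real^'d) measure" "1 / 2 ^ p" by (rule gaussian_step_noise)
  let ?h = "1 / 2 ^ p :: real"
  let ?X = "\<lambda>\<omega>. trunc j (\<lambda>i. steered p u i \<omega>)"
  let ?w = "\<lambda>\<omega> y. ennreal (exp (- (u j \<omega> \<bullet> y) - ?h / 2 * (norm (u j \<omega>))\<^sup>2))"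
  let ?H = "\<lambda>\<omega> y. ennreal (exp (- log_density p u j \<omega>)) * (\<Phi> ((?X \<omega>)(j := y + ?h *\<^sub>R u j \<omega>)) * ?w \<omega> y)"
  have uj: "u j \<in> borel_measurable (\<F> (real j / 2 ^ p))" by (rule adaptedD[OF u order_refl])
  have Xm: "?X \<in> measurable (\<F> (real j / 2 ^ p)) seq_space" by (intro trunc_adapted steered_adapted[OF u])
  note [measurable] = uj Xm log_density_adapted[OF u, of j] Suc.prems
  have "(\<lambda>z. (?X (fst z))(j := snd z + ?h *\<^sub>R u j (fst z))) \<in> measurable (\<F> (real j / 2 ^ p) \<Otimes>\<^sub>M borel) seq_space"
    by (intro measurable_fun_upd_pair) measurable
  from measurable_compose[OF this Suc.prems]
  have [measurable]: "(\<lambda>z. \<Phi> ((?X (fst z))(j := snd z + ?h *\<^sub>R u j (fst z)))) \<in> borel_measurable (\<F> (real j / 2 ^ p) \<Otimes>\<^sub>M borel)" .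
  have "(\<integral>\<^sup>+\<omega>. \<Phi> (trunc (Suc j) (\<lambda>i. steered p u i \<omega>)) * ennreal (exp (- log_density p u (Suc j) \<omega>)) \<partial>M) =
      (\<integral>\<^sup>+\<omega>. ?H \<omega> (noise p j \<omega>) \<partial>M)"
  proof (rule nn_integral_cong)
    fix \<omega>
    have "exp (- log_density p u (Suc j) \<omega>) =
        exp (- log_density p u j \<omega>) * exp (- (u j \<omega> \<bullet> noise p j \<omega>) - ?h / 2 * (norm (u j \<omega>))\<^sup>2)"
      unfolding exp_add[symmetric] by (simp add: log_density_def)
    then show "\<Phi> (trunc (Suc j) (\<lambda>i. steered p u i \<omega>)) * ennreal (exp (- log_density p u (Suc j) \<omega>)) = ?H \<omega> (noise p j \<omega>)"
      by (simp add: trunc_Suc steered_def ennreal_mult mult_ac)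
  qed
  also have "\<dots> = (\<integral>\<^sup>+\<omega>. (\<integral>\<^sup>+y. ?H \<omega> y \<partial>gauss ?h) \<partial>M)"
    by (intro freeze_noise) (simp add: split_beta')
  also have "\<dots> = (\<integral>\<^sup>+\<omega>. (\<integral>\<^sup>+y. \<Phi> ((?X \<omega>)(j := y)) \<partial>gauss ?h) * ennreal (exp (- log_density p u j \<omega>)) \<partial>M)"
  proof (rule nn_integral_cong)
    fix \<omega>
    have "(\<lambda>y. (?X \<omega>)(j := y)) \<in> measurable borel seq_space"
      by (intro measurable_fun_upd_pair measurable_const) (auto simp: space_PiM)
    from measurable_compose[OF this Suc.prems]
    have m: "(\<lambda>y. \<Phi> ((?X \<omega>)(j := y))) \<in> borel_measurable borel" .
    then have [measurable]: "(\<lambda>y. \<Phi> ((?X \<omega>)(j := y + ?h *\<^sub>R u j \<omega>))) \<in> borel_measurable borel"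
      by (rule measurable_compose[rotated]) simp
    have "(\<integral>\<^sup>+y. ?H \<omega> y \<partial>gauss ?h) =
       ennreal (exp (- log_density p u j \<omega>)) * (\<integral>\<^sup>+y. \<Phi> ((?X \<omega>)(j := y + ?h *\<^sub>R u j \<omega>)) * ?w \<omega> y \<partial>gauss ?h)"
      by (rule nn_integral_cmult) simp
    also have "(\<integral>\<^sup>+y. \<Phi> ((?X \<omega>)(j := y + ?h *\<^sub>R u j \<omega>)) * ?w \<omega> y \<partial>gauss ?h) = (\<integral>\<^sup>+y. \<Phi> ((?X \<omega>)(j := y)) \<partial>gauss ?h)"
      using g.cameron_martin[OF m, of "u j \<omega>"] by simp
    finally show "(\<integral>\<^sup>+y. ?H \<omega> y \<partial>gauss ?h) = (\<integral>\<^sup>+y. \<Phi> ((?X \<omega>)(j := y)) \<partial>gauss ?h) * ennreal (exp (- log_density p u j \<omega>))"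
      by (rule trans[OF _ mult.commute])
  qed
  also have "\<dots> = gauss_mean p (Suc j) \<Phi>"
    using Suc.IH[OF integrate_out_measurable[OF Suc.prems, where j=j and p=p]] by (simp only: gauss_mean.simps)
  finally show ?case .
qed

text \<open>With the past frozen, the weight of one step is a Cameron--Martin weight and has mean one.\<close>

lemma weight_martingale:
  assumes u: "adapted p u" and G: "G \<in> sets (\<F> (real j / 2 ^ p))" and "j \<le> n"
  shows "(\<integral>\<^sup>+\<omega>. indicator G \<omega> * ennreal (exp (- log_density p u n \<omega>)) \<partial>M) =
    (\<integral>\<^sup>+\<omega>. indicator G \<omega> * ennreal (exp (- log_density p u j \<omega>)) \<partial>M)"
  using assms(3)
proof (induction n rule: dec_induct)
  case (step n)
  interpret g: gaussian "gauss (1 / 2 ^ p) :: (real^'d) measure" "1 / 2 ^ p" by (rule gaussian_step_noise)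
  let ?h = "1 / 2 ^ p :: real"
  let ?w = "\<lambda>\<omega> y. ennreal (exp (- (u n \<omega> \<bullet> y) - ?h / 2 * (norm (u n \<omega>))\<^sup>2))"
  let ?H = "\<lambda>\<omega> y. indicator G \<omega> * ennreal (exp (- log_density p u n \<omega>)) * ?w \<omega> y"
  have Gn [measurable]: "G \<in> sets (\<F> (real n / 2 ^ p))"
    using G sets_filtration_mono[OF grid_mono[OF step(1)]] by blast
  have [measurable]: "u n \<in> borel_measurable (\<F> (real n / 2 ^ p))" by (rule adaptedD[OF u order_refl])
  note [measurable] = log_density_adapted[OF u, of n]
  have "(\<integral>\<^sup>+\<omega>. indicator G \<omega> * ennreal (exp (- log_density p u (Suc n) \<omega>)) \<partial>M) = (\<integral>\<^sup>+\<omega>. ?H \<omega> (noise p n \<omega>) \<partial>M)"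
  proof (rule nn_integral_cong)
    fix \<omega>
    have "exp (- log_density p u (Suc n) \<omega>) =
        exp (- log_density p u n \<omega>) * exp (- (u n \<omega> \<bullet> noise p n \<omega>) - ?h / 2 * (norm (u n \<omega>))\<^sup>2)"
      unfolding exp_add[symmetric] by (simp add: log_density_def)
    then show "indicator G \<omega> * ennreal (exp (- log_density p u (Suc n) \<omega>)) = ?H \<omega> (noise p n \<omega>)"
      by (simp add: ennreal_mult mult_ac)
  qed
  also have "\<dots> = (\<integral>\<^sup>+\<omega>. (\<integral>\<^sup>+y. ?H \<omega> y \<partial>gauss ?h) \<partial>M)"
    by (intro freeze_noise) (simp add: split_beta')
  also have "\<dots> = (\<integral>\<^sup>+\<omega>. indicator G \<omega> * ennreal (exp (- log_density p u n \<omega>)) \<partial>M)"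
  proof (rule nn_integral_cong)
    fix \<omega>
    have "(\<integral>\<^sup>+y. ?w \<omega> y \<partial>gauss ?h) = 1"
      using g.cameron_martin[of "\<lambda>_. 1" "u n \<omega>"] g.emeasure_space_1 by simp
    then show "(\<integral>\<^sup>+y. ?H \<omega> y \<partial>gauss ?h) = indicator G \<omega> * ennreal (exp (- log_density p u n \<omega>))"
      by (subst nn_integral_cmult) auto
  qed
  also note step.IH
  finally show ?case .
qed simp

text \<open>No bound on \<open>u\<close> is available when a general drift is discretized. Freezing the past gives the
  second moment, and the symmetry of the Gaussian makes the positive and the negative part have equal
  means.\<close>

lemma noise_inner_integrable:
  assumes u: "u \<in> borel_measurable (\<F> (real j / 2 ^ p))" and i: "integrable M (\<lambda>\<omega>. (norm (u \<omega>))\<^sup>2)"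
  shows "integrable M (\<lambda>\<omega>. u \<omega> \<bullet> noise p j \<omega>)" "(\<integral>\<omega>. u \<omega> \<bullet> noise p j \<omega> \<partial>M) = 0"
proof -
  interpret g: gaussian "gauss (1 / 2 ^ p) :: (real^'d) measure" "1 / 2 ^ p" by (rule gaussian_step_noise)
  let ?h = "1 / 2 ^ p :: real"
  note [measurable] = u
  have um [measurable]: "u \<in> borel_measurable M" by (rule filtration_measurable_M[OF u])
  have nm [measurable]: "noise p j \<in> borel_measurable M"
    by (rule filtration_measurable_M[OF noise_adapted[of j "Suc j"]]) simp
  have "(\<integral>\<^sup>+\<omega>. ennreal ((u \<omega> \<bullet> noise p j \<omega>)\<^sup>2) \<partial>M) = (\<integral>\<^sup>+\<omega>. (\<integral>\<^sup>+y. ennreal ((u \<omega> \<bullet> y)\<^sup>2) \<partial>gauss ?h) \<partial>M)"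
    by (intro freeze_noise) simp
  also have "\<dots> \<le> (\<integral>\<^sup>+\<omega>. ennreal (2 * ?h * (norm (u \<omega>))\<^sup>2) \<partial>M)"
  proof (rule nn_integral_mono)
    fix \<omega>
    have "(\<integral>\<^sup>+y. ennreal ((u \<omega> \<bullet> y)\<^sup>2) \<partial>gauss ?h) = ennreal (\<integral>y. (u \<omega> \<bullet> y)\<^sup>2 \<partial>gauss ?h)"
      by (intro nn_integral_eq_integral g.integrable_inner_power2) auto
    then show "(\<integral>\<^sup>+y. ennreal ((u \<omega> \<bullet> y)\<^sup>2) \<partial>gauss ?h) \<le> ennreal (2 * ?h * (norm (u \<omega>))\<^sup>2)"
      using g.inner_power2_le[of "u \<omega>"] by (simp add: ennreal_leI)
  qed
  also have "\<dots> < \<infinity>"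
    using i by (subst nn_integral_eq_integral) auto
  finally have sq: "integrable M (\<lambda>\<omega>. (u \<omega> \<bullet> noise p j \<omega>)\<^sup>2)"
    by (intro integrableI_nonneg) auto
  show int: "integrable M (\<lambda>\<omega>. u \<omega> \<bullet> noise p j \<omega>)"
  proof (rule Bochner_Integration.integrable_bound[where f="\<lambda>\<omega>. 1 + (u \<omega> \<bullet> noise p j \<omega>)\<^sup>2"])
    show "AE \<omega> in M. norm (u \<omega> \<bullet> noise p j \<omega>) \<le> norm (1 + (u \<omega> \<bullet> noise p j \<omega>)\<^sup>2)"
      using g.abs_le_one_plus_square by (intro AE_I2) simp
  qed (use sq in auto)
  have pos: "(\<integral>\<^sup>+\<omega>. ennreal (u \<omega> \<bullet> noise p j \<omega>) \<partial>M) = (\<integral>\<^sup>+\<omega>. (\<integral>\<^sup>+y. ennreal (u \<omega> \<bullet> y) \<partial>gauss ?h) \<partial>M)"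
    by (intro freeze_noise) simp
  have neg: "(\<integral>\<^sup>+\<omega>. ennreal (- (u \<omega> \<bullet> noise p j \<omega>)) \<partial>M) = (\<integral>\<^sup>+\<omega>. (\<integral>\<^sup>+y. ennreal (- (u \<omega> \<bullet> y)) \<partial>gauss ?h) \<partial>M)"
    by (intro freeze_noise) simp
  have "(\<integral>\<^sup>+y. ennreal (- (u \<omega> \<bullet> y)) \<partial>gauss ?h) = (\<integral>\<^sup>+y. ennreal (u \<omega> \<bullet> y) \<partial>gauss ?h)" for \<omega>
    using g.nn_integral_uminus[of "\<lambda>y. ennreal (u \<omega> \<bullet> y)"] by simp
  then show "(\<integral>\<omega>. u \<omega> \<bullet> noise p j \<omega> \<partial>M) = 0"
    unfolding real_lebesgue_integral_def[OF int] pos neg by simp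
qed

text \<open>Jensen's inequality for the logarithm, in the tangent form \<open>ln x \<le> x / c - 1 + ln c\<close>. The mean
  of \<open>log_density\<close> is the cost of the control, since its linear terms have mean zero.\<close>

lemma steering_upper_bound:
  assumes u: "adapted p u" and i: "\<And>i. i < n \<Longrightarrow> integrable M (\<lambda>\<omega>. (norm (u i \<omega>))\<^sup>2)"
    and Y: "integrable M Y" and c: "0 < c"
    and le: "(\<integral>\<^sup>+\<omega>. ennreal (exp (Y \<omega>)) * ennreal (exp (- log_density p u n \<omega>)) \<partial>M) \<le> ennreal c"
  shows "(\<integral>\<omega>. Y \<omega> \<partial>M) - (\<Sum>i<n. 1 / 2 ^ p / 2 * (\<integral>\<omega>. (norm (u i \<omega>))\<^sup>2 \<partial>M)) \<le> ln c"
proof -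
  have ui: "integrable M (\<lambda>\<omega>. u i \<omega> \<bullet> noise p i \<omega>)" "(\<integral>\<omega>. u i \<omega> \<bullet> noise p i \<omega> \<partial>M) = 0" if "i < n" for i
    using noise_inner_integrable[OF adaptedD[OF u order_refl] i[OF that]] by auto
  have Li: "integrable M (log_density p u n)"
    unfolding log_density_def[abs_def] using ui i by (intro Bochner_Integration.integrable_sum Bochner_Integration.integrable_add integrable_mult_right) auto
  have LE: "(\<integral>\<omega>. log_density p u n \<omega> \<partial>M) = (\<Sum>i<n. 1 / 2 ^ p / 2 * (\<integral>\<omega>. (norm (u i \<omega>))\<^sup>2 \<partial>M))"
  proof -
    have "(\<integral>\<omega>. log_density p u n \<omega> \<partial>M) = (\<Sum>i<n. \<integral>\<omega>. u i \<omega> \<bullet> noise p i \<omega> + 1 / 2 ^ p / 2 * (norm (u i \<omega>))\<^sup>2 \<partial>M)"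
      unfolding log_density_def using ui i
      by (intro Bochner_Integration.integral_sum Bochner_Integration.integrable_add integrable_mult_right) auto
    also have "\<dots> = (\<Sum>i<n. 1 / 2 ^ p / 2 * (\<integral>\<omega>. (norm (u i \<omega>))\<^sup>2 \<partial>M))"
    proof (rule sum.cong[OF refl])
      fix k assume "k \<in> {..<n}"
      then show "(\<integral>\<omega>. u k \<omega> \<bullet> noise p k \<omega> + 1 / 2 ^ p / 2 * (norm (u k \<omega>))\<^sup>2 \<partial>M) = 1 / 2 ^ p / 2 * (\<integral>\<omega>. (norm (u k \<omega>))\<^sup>2 \<partial>M)"
        using ui[of k] i[of k] by (subst Bochner_Integration.integral_add) auto
    qed
    finally show ?thesis .
  qed
  define E where "E \<omega> = exp (Y \<omega>) * exp (- log_density p u n \<omega>)" for \<omega>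
  have Em: "E \<in> borel_measurable M" unfolding E_def using Y Li by measurable
  have En: "(\<integral>\<^sup>+\<omega>. ennreal (E \<omega>) \<partial>M) \<le> ennreal c"
    using le by (simp add: E_def ennreal_mult)
  then have Ei: "integrable M E" using Em by (intro integrableI_nonneg) (auto simp: E_def intro: le_less_trans)
  have "ennreal (\<integral>\<omega>. E \<omega> \<partial>M) = (\<integral>\<^sup>+\<omega>. ennreal (E \<omega>) \<partial>M)"
    by (rule nn_integral_eq_integral[symmetric, OF Ei]) (simp add: E_def)
  then have "ennreal (\<integral>\<omega>. E \<omega> \<partial>M) \<le> ennreal c" using En by simp
  then have Ec: "(\<integral>\<omega>. E \<omega> \<partial>M) \<le> c" using ennreal_le_iff[of c] c by simp
  have "(\<integral>\<omega>. Y \<omega> - log_density p u n \<omega> \<partial>M) \<le> (\<integral>\<omega>. E \<omega> / c - 1 + ln c \<partial>M)"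
  proof (rule integral_mono)
    fix \<omega>
    have Ep: "E \<omega> > 0" unfolding E_def by simp
    have "ln (E \<omega> / c) \<le> E \<omega> / c - 1" using c Ep by (intro ln_le_minus_one) auto
    then have "ln (E \<omega>) \<le> E \<omega> / c - 1 + ln c" using c Ep by (simp add: ln_div)
    moreover have "ln (E \<omega>) = Y \<omega> - log_density p u n \<omega>" unfolding E_def by (simp add: ln_mult)
    ultimately show "Y \<omega> - log_density p u n \<omega> \<le> E \<omega> / c - 1 + ln c" by simp
  qed (use Y Li Ei in auto)
  also have "\<dots> = (\<integral>\<omega>. E \<omega> \<partial>M) / c - 1 + ln c" using Ei by (simp add: prob_space)
  also have "\<dots> \<le> ln c" using Ec c by simp
  finally show ?thesis using Y Li LE by simp
qed

end

section \<open>The law of Brownian motion\<close>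

lemma sum_of_finite_measures:
  assumes "finite_measure \<mu>" "finite_measure \<nu>" and sets: "sets \<nu> = sets \<mu>"
  obtains \<kappa> where "finite_measure \<kappa>" "sets \<kappa> = sets \<mu>" "\<mu> \<le> \<kappa>" "\<nu> \<le> \<kappa>"
proof
  interpret \<mu>: finite_measure \<mu> by fact
  interpret \<nu>: finite_measure \<nu> by fact
  define \<kappa> where "\<kappa> = measure_of (space \<mu>) (sets \<mu>) (\<lambda>A. emeasure \<mu> A + emeasure \<nu> A)"
  show s: "sets \<kappa> = sets \<mu>" unfolding \<kappa>_def by simp
  have e: "emeasure \<kappa> A = emeasure \<mu> A + emeasure \<nu> A" if "A \<in> sets \<mu>" for A
    unfolding \<kappa>_def
  proof (rule emeasure_measure_of_sigma)
    show "sigma_algebra (space \<mu>) (sets \<mu>)" by (rule sets.sigma_algebra_axioms)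
    show "positive (sets \<mu>) (\<lambda>A. emeasure \<mu> A + emeasure \<nu> A)" by (simp add: positive_def)
    show "countably_additive (sets \<mu>) (\<lambda>A. emeasure \<mu> A + emeasure \<nu> A)"
    proof (rule countably_additiveI)
      fix A :: "nat \<Rightarrow> _" assume A: "range A \<subseteq> sets \<mu>" "disjoint_family A"
      have "(\<Sum>i. emeasure \<mu> (A i) + emeasure \<nu> (A i)) = (\<Sum>i. emeasure \<mu> (A i)) + (\<Sum>i. emeasure \<nu> (A i))"
        by (rule suminf_add[symmetric]) auto
      also have "\<dots> = emeasure \<mu> (\<Union>i. A i) + emeasure \<nu> (\<Union>i. A i)"
        using suminf_emeasure[OF A] suminf_emeasure[of A \<nu>] A sets by simp
      finally show "(\<Sum>i. emeasure \<mu> (A i) + emeasure \<nu> (A i)) = emeasure \<mu> (\<Union>i. A i) + emeasure \<nu> (\<Union>i. A i)" .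
    qed
    show "A \<in> sets \<mu>" by fact
  qed
  have sp: "space \<kappa> = space \<mu>" "space \<nu> = space \<mu>" using s sets by (auto dest: sets_eq_imp_space_eq)
  show "finite_measure \<kappa>"
    using e[of "space \<mu>"] \<mu>.emeasure_finite[of "space \<mu>"] \<nu>.emeasure_finite[of "space \<mu>"]
    by (intro finite_measureI) (simp add: sp)
  show "\<mu> \<le> \<kappa>" "\<nu> \<le> \<kappa>"
    using e by (auto simp: le_measure s sets)
qed

text \<open>Approximation in mean with respect to the sum of two measures is approximation with respect
  to both.\<close>

lemma trig_polys_dense_in_two_means:
  fixes \<mu> \<nu> :: "(real \<Rightarrow> real^'d) measure"
  assumes "finite_measure \<mu>" "sets \<mu> = sets borel_path_space"
    and "finite_measure \<nu>" "sets \<nu> = sets borel_path_space"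
    and F: "F \<in> borel_measurable borel_path_space" "\<And>w. w \<in> path_space \<Longrightarrow> a \<le> F w \<and> F w \<le> b"
    and e: "\<epsilon> > 0"
  shows "\<exists>f\<in>trig_polys. (\<forall>w\<in>path_space. a - \<epsilon> \<le> f w \<and> f w \<le> b + \<epsilon>) \<and>
    (\<integral>w. \<bar>f w - F w\<bar> \<partial>\<mu>) < \<epsilon> \<and> (\<integral>w. \<bar>f w - F w\<bar> \<partial>\<nu>) < \<epsilon>"
proof -
  obtain \<kappa> where \<kappa>: "finite_measure \<kappa>" "sets \<kappa> = sets \<mu>" "\<mu> \<le> \<kappa>" "\<nu> \<le> \<kappa>"
    using sum_of_finite_measures[OF assms(1,3)] assms(2,4) by auto
  interpret \<kappa>: finite_measure \<kappa> by fact
  obtain f where f: "f \<in> trig_polys" "\<forall>w\<in>path_space. a - \<epsilon> \<le> f w \<and> f w \<le> b + \<epsilon>" "(\<integral>w. \<bar>f w - F w\<bar> \<partial>\<kappa>) < \<epsilon>"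
    using trig_polys_dense[OF \<kappa>(1) _ F e] \<kappa>(2) assms(2) by auto
  have le: "(\<integral>w. \<bar>f w - F w\<bar> \<partial>\<nu>') < \<epsilon>"
    if *: "finite_measure \<nu>'" "sets \<nu>' = sets borel_path_space" "\<nu>' \<le> \<kappa>" for \<nu>' :: "(real \<Rightarrow> real^'d) measure"
  proof -
    interpret \<nu>': finite_measure \<nu>' by fact
    have bd: "\<bar>f w - F w\<bar> \<le> \<bar>b - a\<bar> + \<epsilon>" if "w \<in> path_space" for w
      using f(2) F(2)[OF that] that by fastforce
    have m: "(\<lambda>w. \<bar>f w - F w\<bar>) \<in> borel_measurable borel_path_space"
      using trig_polys_measurable[OF f(1)] F(1) by measurable
    have sp: "space \<nu>' = path_space" "space \<kappa> = path_space"
      using *(2) \<kappa>(2) assms(2) by (auto dest: sets_eq_imp_space_eq)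
    have m': "(\<lambda>w. \<bar>f w - F w\<bar>) \<in> borel_measurable \<nu>'" "(\<lambda>w. \<bar>f w - F w\<bar>) \<in> borel_measurable \<kappa>"
      using m *(2) \<kappa>(2) assms(2) by (auto cong: measurable_cong_sets)
    have i: "integrable \<nu>' (\<lambda>w. \<bar>f w - F w\<bar>)" "integrable \<kappa> (\<lambda>w. \<bar>f w - F w\<bar>)"
      using bd sp m' by (auto intro!: \<nu>'.integrable_const_bound[where B="\<bar>b - a\<bar> + \<epsilon>"] \<kappa>.integrable_const_bound[where B="\<bar>b - a\<bar> + \<epsilon>"] AE_I2)
    have "ennreal (\<integral>w. \<bar>f w - F w\<bar> \<partial>\<nu>') = (\<integral>\<^sup>+w. ennreal \<bar>f w - F w\<bar> \<partial>\<nu>')"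
      by (rule nn_integral_eq_integral[symmetric, OF i(1)]) simp
    also have "\<dots> \<le> (\<integral>\<^sup>+w. ennreal \<bar>f w - F w\<bar> \<partial>\<kappa>)"
      by (rule nn_integral_mono_measure) (use * \<kappa>(2) assms(2) in auto)
    also have "\<dots> = ennreal (\<integral>w. \<bar>f w - F w\<bar> \<partial>\<kappa>)"
      by (rule nn_integral_eq_integral[OF i(2)]) simp
    finally have "(\<integral>w. \<bar>f w - F w\<bar> \<partial>\<nu>') \<le> (\<integral>w. \<bar>f w - F w\<bar> \<partial>\<kappa>)"
      by (rule ennreal_le_iff[THEN iffD1, rotated]) simp
    then show ?thesis using f(3) by simp
  qed
  show ?thesis using f le assms \<kappa> by blast
qed

text \<open>A trigonometric polynomial as a function of the increments over the grid, through which alone it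
  depends on the path.\<close>

definition trig_eval :: "nat \<Rightarrow> (nat \<Rightarrow> real) \<Rightarrow> (nat \<Rightarrow> real) \<Rightarrow> (nat \<Rightarrow> real \<Rightarrow> real^'d) \<Rightarrow> nat \<Rightarrow> nat \<Rightarrow> (nat \<Rightarrow> real^'d) \<Rightarrow> real" where
  "trig_eval K a c lam T p x = (\<Sum>k<K. a k * cos (c k + (\<Sum>i<T * 2 ^ p. lam k (real i / 2 ^ p) \<bullet> x i)))"

lemma trig_eval_measurable [measurable]: "trig_eval K a c lam T p \<in> borel_measurable seq_space"
  unfolding trig_eval_def by measurable

lemma trig_form_increments:
  assumes "trig_form f K a c lam T n R" "n \<le> p" "w 0 = 0"
    and "\<And>i. i < T * 2 ^ p \<Longrightarrow> w (real (Suc i) / 2 ^ p) - w (real i / 2 ^ p) = x i"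
  shows "f w = trig_eval K a c lam T p (trunc (T * 2 ^ p) x)"
proof -
  have "f w = (\<Sum>k<K. a k * cos (c k + wiener_sum (lam k) T p w))"
    using assms(1-3) unfolding trig_form_def by blast
  moreover have "wiener_sum (lam k) T p w = (\<Sum>i<T * 2 ^ p. lam k (real i / 2 ^ p) \<bullet> trunc (T * 2 ^ p) x i)" for k
    unfolding wiener_sum_def using assms(4) by (intro sum.cong refl) (simp add: trunc_def)
  ultimately show ?thesis unfolding trig_eval_def by simp
qed

lemma sample_path_nonneg: "0 \<le> t \<Longrightarrow> sample_path X \<omega> t = X t \<omega>"
  by (simp add: sample_path_def)

context standard_brownian_motion
begin

lemma sample_path_in_path_space:
  assumes "\<omega> \<in> space M" shows "sample_path B \<omega> \<in> path_space"
proof -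
  have "continuous_on {0..} (sample_path B \<omega>)"
    using continuous_paths[OF assms] by (rule continuous_on_eq) (simp add: sample_path_nonneg)
  then show ?thesis
    unfolding path_space_def using starts_at_0[OF assms] by (simp add: sample_path_def)
qed

lemma sample_path_measurable: "sample_path B \<in> measurable M borel_path_space"
  by (rule measurable_into_path_space) (auto simp: sample_path_in_path_space sample_path_nonneg measurable_marginals)

lemma trig_form_mean:
  fixes g :: "real \<Rightarrow> ennreal"
  assumes "trig_form f K a c lam T n R" "n \<le> p" and g: "g \<in> borel_measurable borel"
  shows "(\<integral>\<^sup>+\<omega>. g (f (sample_path B \<omega>)) \<partial>M) = gauss_mean p (T * 2 ^ p) (\<lambda>x. g (trig_eval K a c lam T p x))"
proof -
  have "(\<integral>\<^sup>+\<omega>. g (f (sample_path B \<omega>)) \<partial>M) =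
    (\<integral>\<^sup>+\<omega>. g (trig_eval K a c lam T p (trunc (T * 2 ^ p) (\<lambda>i. noise p i \<omega>))) \<partial>M)"
  proof (rule nn_integral_cong)
    fix \<omega> assume "\<omega> \<in> space M"
    then have "f (sample_path B \<omega>) = trig_eval K a c lam T p (trunc (T * 2 ^ p) (\<lambda>i. noise p i \<omega>))"
      by (intro trig_form_increments[OF assms(1,2)]) (auto simp: sample_path_nonneg starts_at_0 noise_def)
    then show "g (f (sample_path B \<omega>)) = g (trig_eval K a c lam T p (trunc (T * 2 ^ p) (\<lambda>i. noise p i \<omega>)))" by simp
  qed
  also have "\<dots> = gauss_mean p (T * 2 ^ p) (\<lambda>x. g (trig_eval K a c lam T p x))"
    by (rule noise_mean) (rule measurable_compose[OF trig_eval_measurable g])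
  finally show ?thesis .
qed

lemma girsanov_trig_form:
  fixes g :: "real \<Rightarrow> ennreal"
  assumes f: "trig_form f K a c lam T n R" "n \<le> p" and g: "g \<in> borel_measurable borel"
    and u: "adapted p u"
    and X: "AE \<omega> in M. X 0 \<omega> = 0 \<and> (\<forall>i<T * 2 ^ p. X (real (Suc i) / 2 ^ p) \<omega> - X (real i / 2 ^ p) \<omega> = steered p u i \<omega>)"
  shows "(\<integral>\<^sup>+\<omega>. g (f (sample_path X \<omega>)) * ennreal (exp (- log_density p u (T * 2 ^ p) \<omega>)) \<partial>M) =
    (\<integral>\<^sup>+\<omega>. g (f (sample_path B \<omega>)) \<partial>M)"
proof -
  have "(\<integral>\<^sup>+\<omega>. g (f (sample_path X \<omega>)) * ennreal (exp (- log_density p u (T * 2 ^ p) \<omega>)) \<partial>M) =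
    (\<integral>\<^sup>+\<omega>. g (trig_eval K a c lam T p (trunc (T * 2 ^ p) (\<lambda>i. steered p u i \<omega>))) *
       ennreal (exp (- log_density p u (T * 2 ^ p) \<omega>)) \<partial>M)"
  proof (rule nn_integral_cong_AE)
    show "AE \<omega> in M. g (f (sample_path X \<omega>)) * ennreal (exp (- log_density p u (T * 2 ^ p) \<omega>)) =
      g (trig_eval K a c lam T p (trunc (T * 2 ^ p) (\<lambda>i. steered p u i \<omega>))) *
       ennreal (exp (- log_density p u (T * 2 ^ p) \<omega>))"
      using X
    proof eventually_elim
      fix \<omega> assume "X 0 \<omega> = 0 \<and> (\<forall>i<T * 2 ^ p. X (real (Suc i) / 2 ^ p) \<omega> - X (real i / 2 ^ p) \<omega> = steered p u i \<omega>)"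
      then have "f (sample_path X \<omega>) = trig_eval K a c lam T p (trunc (T * 2 ^ p) (\<lambda>i. steered p u i \<omega>))"
        by (intro trig_form_increments[OF f]) (auto simp: sample_path_nonneg)
      then show "g (f (sample_path X \<omega>)) * ennreal (exp (- log_density p u (T * 2 ^ p) \<omega>)) =
        g (trig_eval K a c lam T p (trunc (T * 2 ^ p) (\<lambda>i. steered p u i \<omega>))) *
         ennreal (exp (- log_density p u (T * 2 ^ p) \<omega>))" by simp
    qed
  qed
  also have "\<dots> = gauss_mean p (T * 2 ^ p) (\<lambda>x. g (trig_eval K a c lam T p x))"
    by (rule girsanov_grid[OF u]) (rule measurable_compose[OF trig_eval_measurable g])
  also have "\<dots> = (\<integral>\<^sup>+\<omega>. g (f (sample_path B \<omega>)) \<partial>M)"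
    by (rule trig_form_mean[OF f g, symmetric])
  finally show ?thesis .
qed

end

lemma abs_integral_minus_measure_le:
  assumes "finite_measure \<nu>" "A \<in> sets \<nu>" "integrable \<nu> (f :: 'a \<Rightarrow> real)"
  shows "\<bar>(\<integral>w. f w \<partial>\<nu>) - measure \<nu> A\<bar> \<le> (\<integral>w. \<bar>f w - indicator A w\<bar> \<partial>\<nu>)"
proof -
  interpret finite_measure \<nu> by fact
  have Ai: "integrable \<nu> (indicator A :: _ \<Rightarrow> real)"
    using assms(2) emeasure_finite[of A] by (intro integrable_real_indicator) (auto simp: less_top[symmetric])
  then have "(\<integral>w. f w \<partial>\<nu>) - measure \<nu> A = (\<integral>w. f w - indicator A w \<partial>\<nu>)"
    using assms(3) sets.sets_into_space[OF assms(2)] by (subst Bochner_Integration.integral_diff) (auto simp: Int_absorb2)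
  then show ?thesis using integral_abs_bound[of \<nu> "\<lambda>w. f w - indicator A w"] by simp
qed

lemma finite_measures_eq_if_trig_means_eq:
  fixes \<mu> \<nu> :: "(real \<Rightarrow> real^'d) measure"
  assumes "finite_measure \<mu>" "finite_measure \<nu>"
    and s: "sets \<mu> = sets borel_path_space" "sets \<nu> = sets borel_path_space"
    and eq: "\<And>f. f \<in> trig_polys \<Longrightarrow> (\<integral>w. f w \<partial>\<mu>) = (\<integral>w. f w \<partial>\<nu>)"
  shows "\<mu> = \<nu>"
proof (rule measure_eqI)
  show "sets \<mu> = sets \<nu>" using s by simp
  fix A assume "A \<in> sets \<mu>"
  then have A: "A \<in> sets borel_path_space" using s by simp
  interpret \<mu>: finite_measure \<mu> by fact
  interpret \<nu>: finite_measure \<nu> by fact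
  have "\<bar>measure \<mu> A - measure \<nu> A\<bar> \<le> 0 + e" if e: "e > 0" for e
  proof -
    have "indicator A \<in> borel_measurable (borel_path_space :: (real \<Rightarrow> real^'d) measure)" using A by simp
    then obtain f where f: "f \<in> trig_polys" "(\<integral>w. \<bar>f w - indicator A w\<bar> \<partial>\<mu>) < e/2" "(\<integral>w. \<bar>f w - indicator A w\<bar> \<partial>\<nu>) < e/2"
      using trig_polys_dense_in_two_means[OF assms(1) s(1) assms(2) s(2), of "indicator A" 0 1 "e/2"] e by (auto simp: indicator_def split: if_splits)
    obtain C where C: "\<And>w. \<bar>f w\<bar> \<le> C" using trig_polys_bounded[OF f(1)] by blast
    have fm: "f \<in> borel_measurable \<mu>" "f \<in> borel_measurable \<nu>"
      using trig_polys_measurable[OF f(1)] s by (auto cong: measurable_cong_sets)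
    have i: "integrable \<mu> f" "integrable \<nu> f"
      using fm C by (auto intro!: \<mu>.integrable_const_bound[where B=C] \<nu>.integrable_const_bound[where B=C])
    have "\<bar>(\<integral>w. f w \<partial>\<mu>) - measure \<mu> A\<bar> < e/2" "\<bar>(\<integral>w. f w \<partial>\<nu>) - measure \<nu> A\<bar> < e/2"
      using abs_integral_minus_measure_le[OF assms(1) _ i(1), of A] abs_integral_minus_measure_le[OF assms(2) _ i(2), of A] f(2,3) A s by auto
    then show ?thesis using eq[OF f(1)] by linarith
  qed
  then have "measure \<mu> A = measure \<nu> A" using field_le_epsilon[of "\<bar>measure \<mu> A - measure \<nu> A\<bar>" 0] by simp
  then show "emeasure \<mu> A = emeasure \<nu> A" by (simp add: \<mu>.emeasure_eq_measure \<nu>.emeasure_eq_measure)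
qed

text \<open>The coordinate process is a Brownian motion under \<open>W\<close>, so that \<open>trig_form_mean\<close> expresses the
  means of a trigonometric polynomial under both laws by the same Gaussian integral.\<close>

theorem distr_sample_path:
  fixes M :: "'o measure" and B :: "real \<Rightarrow> 'o \<Rightarrow> real^'d" and W :: "(real \<Rightarrow> real^'d) measure"
  assumes "standard_brownian_motion M B" "wiener_measure W"
  shows "distr M borel_path_space (sample_path B) = W"
proof -
  interpret B: standard_brownian_motion M B by fact
  interpret W: standard_brownian_motion W "\<lambda>t w. w t" using assms(2) unfolding wiener_measure_def by blast
  have sets: "sets W = sets borel_path_space" using assms(2) unfolding wiener_measure_def by blast
  have space: "space W = path_space" using sets_eq_imp_space_eq[OF sets] by simp
  have id: "sample_path (\<lambda>t w. w t) w = w" if "w \<in> space W" for w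
    using that path_spaceD(3)[of w] unfolding space sample_path_def by (simp add: extensional_restrict)
  interpret D: prob_space "distr M borel_path_space (sample_path B)"
    by (rule B.prob_space_distr[OF B.sample_path_measurable])
  show ?thesis
  proof (rule finite_measures_eq_if_trig_means_eq)
    fix f :: "(real \<Rightarrow> real^'d) \<Rightarrow> real" assume f: "f \<in> trig_polys"
    obtain K a c lam T n R where form: "trig_form f K a c lam T n R" using trig_polys_on_grid[OF f] by blast
    have fm: "f \<in> borel_measurable borel_path_space" by (rule trig_polys_measurable[OF f])
    have fW: "f \<in> borel_measurable W" using fm sets by (simp cong: measurable_cong_sets)
    obtain C where C: "\<And>w. \<bar>f w\<bar> \<le> C" using trig_polys_bounded[OF f] by blast
    have eq: "(\<integral>\<^sup>+w. g (f w) \<partial>distr M borel_path_space (sample_path B)) = (\<integral>\<^sup>+w. g (f w) \<partial>W)"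
      if g: "g \<in> borel_measurable borel" for g :: "real \<Rightarrow> ennreal"
    proof -
      have "(\<integral>\<^sup>+w. g (f w) \<partial>distr M borel_path_space (sample_path B)) = (\<integral>\<^sup>+\<omega>. g (f (sample_path B \<omega>)) \<partial>M)"
        by (rule nn_integral_distr[OF B.sample_path_measurable]) (use measurable_compose[OF fm g] in simp)
      also have "\<dots> = (\<integral>\<^sup>+w. g (f (sample_path (\<lambda>t w. w t) w)) \<partial>W)"
        unfolding B.trig_form_mean[OF form order_refl g] W.trig_form_mean[OF form order_refl g] ..
      also have "\<dots> = (\<integral>\<^sup>+w. g (f w) \<partial>W)" by (rule nn_integral_cong) (simp add: id)
      finally show ?thesis .
    qed
    have "integrable W f" using C fW by (intro W.integrable_const_bound[where B=C]) auto
    moreover have "integrable (distr M borel_path_space (sample_path B)) f"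
      using C fm by (intro D.integrable_const_bound[where B=C]) auto
    ultimately show "(\<integral>w. f w \<partial>distr M borel_path_space (sample_path B)) = (\<integral>w. f w \<partial>W)"
      using eq[of ennreal] eq[of "\<lambda>x. ennreal (- x)"] by (simp add: real_lebesgue_integral_def)
  qed (auto simp: sets intro: D.finite_measure_axioms W.finite_measure_axioms)
qed

section \<open>Paths driven by a drift of finite energy\<close>

lemma continuous_on_half_line:
  fixes g :: "real \<Rightarrow> 'b::topological_space"
  assumes "\<And>T. continuous_on {0..T} g"
  shows "continuous_on {0..} g"
  unfolding continuous_on_eq_continuous_within
proof
  fix x :: real assume x: "x \<in> {0..}"
  have "continuous (at x within {0..x + 1}) g"
    using assms[of "x + 1"] x unfolding continuous_on_eq_continuous_within by auto
  moreover have "at x within {0..x + 1} = at x within {0..}"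
    by (rule at_within_nhd[where S="{..<x + 1}"]) auto
  ultimately show "continuous (at x within {0..}) g" by simp
qed

context standard_brownian_motion
begin

lemma progressive_slice:
  assumes v: "progressively_measurable \<F> v" and b: "0 \<le> b"
    and A: "A \<in> sets borel" "A \<subseteq> {0..b}"
  shows "(\<lambda>(\<omega>, s). indicator A s *\<^sub>R v s \<omega>) \<in> borel_measurable (\<F> b \<Otimes>\<^sub>M borel)"
proof -
  let ?N = "borel \<Otimes>\<^sub>M \<F> b" and ?\<Omega> = "{0..b} \<times> space M"
  have \<Omega>: "?\<Omega> \<inter> space ?N \<in> sets ?N"
  proof -
    have "?\<Omega> \<in> sets ?N" using sets.top[of "\<F> b"] by (intro pair_measureI) auto
    then show ?thesis using sets.sets_into_space by (simp add: Int_absorb2)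
  qed
  have vm: "(\<lambda>(s, \<omega>). v s \<omega>) \<in> borel_measurable (restrict_space borel {0..b} \<Otimes>\<^sub>M \<F> b)"
    using v b unfolding progressively_measurable_def by blast
  have "(\<lambda>x. (fst x, snd x)) \<in> measurable (restrict_space ?N ?\<Omega>) (restrict_space borel {0..b} \<Otimes>\<^sub>M \<F> b)"
    by (intro measurable_Pair measurable_restrict_space2 measurable_restrict_space1 measurable_fst measurable_snd)
       (auto simp: space_restrict_space)
  from measurable_compose[OF this vm]
  have "(\<lambda>(s, \<omega>). v s \<omega>) \<in> borel_measurable (restrict_space ?N ?\<Omega>)" by (simp add: split_beta')
  then have "(\<lambda>x. indicator ?\<Omega> x *\<^sub>R (case x of (s, \<omega>) \<Rightarrow> v s \<omega>)) \<in> borel_measurable ?N"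
    by (subst (asm) borel_measurable_restrict_space_iff[OF \<Omega>])
  from measurable_compose[OF _ this, of "\<lambda>z. (snd z, fst z)" "\<F> b \<Otimes>\<^sub>M borel"]
  have "(\<lambda>z. indicator ?\<Omega> (snd z, fst z) *\<^sub>R v (snd z) (fst z)) \<in> borel_measurable (\<F> b \<Otimes>\<^sub>M borel)"
    by (simp only: prod.case measurable_Pair measurable_fst measurable_snd)
  moreover have "(\<lambda>z. indicator A (snd z) :: real) \<in> borel_measurable (\<F> b \<Otimes>\<^sub>M borel)"
    by (rule measurable_compose[OF measurable_snd borel_measurable_indicator[OF A(1)]])
  ultimately have "(\<lambda>z. indicator A (snd z) *\<^sub>R (indicator ?\<Omega> (snd z, fst z) *\<^sub>R v (snd z) (fst z))) \<in> borel_measurable (\<F> b \<Otimes>\<^sub>M borel)"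
    by (rule borel_measurable_scaleR[rotated])
  then show ?thesis
    by (rule measurable_cong[THEN iffD1, rotated])
       (use A(2) in \<open>auto simp: indicator_def space_pair_measure split: if_splits\<close>)
qed

lemma measurable_past_to_M:
  "f \<in> borel_measurable (\<F> b \<Otimes>\<^sub>M borel) \<Longrightarrow> f \<in> borel_measurable (M \<Otimes>\<^sub>M (borel :: real measure))"
proof -
  assume f: "f \<in> borel_measurable (\<F> b \<Otimes>\<^sub>M borel)"
  have "(\<lambda>\<omega>. \<omega>) \<in> measurable M (\<F> b)" by (rule filtration_measurable_M[where s=b]) simp
  then have "(\<lambda>z. (fst z, snd z)) \<in> measurable (M \<Otimes>\<^sub>M borel) (\<F> b \<Otimes>\<^sub>M (borel :: real measure))"
    by (intro measurable_Pair measurable_compose[OF measurable_fst] measurable_snd) auto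
  from measurable_compose[OF this f] show ?thesis by simp
qed

lemma progressive_joint:
  assumes v: "progressively_measurable \<F> v"
  shows "(\<lambda>(\<omega>, s). indicator {0..} s *\<^sub>R v s \<omega>) \<in> borel_measurable (M \<Otimes>\<^sub>M borel)"
proof (rule borel_measurable_LIMSEQ_metric)
  fix n :: nat
  show "(\<lambda>(\<omega>, s). indicator {0..real n} s *\<^sub>R v s \<omega>) \<in> borel_measurable (M \<Otimes>\<^sub>M borel)"
    by (rule measurable_past_to_M[OF progressive_slice[OF v, of "real n"]]) auto
next
  fix z :: "'o \<times> real"
  have ind: "(indicator {0..real n} s :: real) = indicator {0..} s" if "n \<ge> nat \<lceil>s\<rceil>" for n s
  proof -
    have "s \<le> real n" using that by linarith
    then show ?thesis by (simp add: indicator_def)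
  qed
  have "\<forall>\<^sub>F n in sequentially. indicator {0..real n} (snd z) *\<^sub>R v (snd z) (fst z) = indicator {0..} (snd z) *\<^sub>R v (snd z) (fst z)"
    using eventually_ge_at_top[of "nat \<lceil>snd z\<rceil>"] by eventually_elim (simp only: ind)
  then show "(\<lambda>n. case z of (\<omega>, s) \<Rightarrow> indicator {0..real n} s *\<^sub>R v s \<omega>) \<longlonglongrightarrow> (case z of (\<omega>, s) \<Rightarrow> indicator {0..} s *\<^sub>R v s \<omega>)"
    unfolding split_beta' by (rule tendsto_eventually)
qed

lemma energy_eq: "energy v \<omega> = (\<integral>\<^sup>+s. ennreal ((norm (indicator {0..} s *\<^sub>R v s \<omega>))\<^sup>2) \<partial>lborel)"
  unfolding energy_def by (intro nn_integral_cong) (simp add: indicator_def)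

lemma energy_measurable [measurable (raw)]:
  assumes v: "progressively_measurable \<F> v"
  shows "energy v \<in> borel_measurable M"
proof -
  note [measurable] = progressive_joint[OF v]
  have "(\<lambda>(\<omega>, s). ennreal ((norm (indicator {0..} s *\<^sub>R v s \<omega>))\<^sup>2)) \<in> borel_measurable (M \<Otimes>\<^sub>M lborel)"
    using measurable_compose[OF progressive_joint[OF v], of "\<lambda>x. ennreal ((norm x)\<^sup>2)" borel]
    by (simp add: split_beta' cong: measurable_cong_sets sets_pair_measure_cong)
  from lborel.borel_measurable_nn_integral[OF this] show ?thesis
    unfolding energy_eq[abs_def] .
qed

lemma slice_integrable:
  assumes v: "progressively_measurable \<F> v" and \<omega>: "\<omega> \<in> space M" and e: "energy v \<omega> < \<infinity>"
    and A: "A \<in> sets borel" "A \<subseteq> {0..T}"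
  shows "integrable lborel (\<lambda>s. indicator A s *\<^sub>R v s \<omega>)"
    and "integrable lborel (\<lambda>s. indicator A s * (norm (v s \<omega>))\<^sup>2)"
    and "(\<integral>\<^sup>+s. indicator A s * ennreal ((norm (v s \<omega>))\<^sup>2) \<partial>lborel) \<le> energy v \<omega>"
proof -
  have "(\<lambda>s. (\<omega>, s)) \<in> measurable borel (M \<Otimes>\<^sub>M borel)" using \<omega> by (intro measurable_Pair measurable_const) auto
  from measurable_compose[OF this progressive_joint[OF v]]
  have m: "(\<lambda>s. indicator {0..} s *\<^sub>R v s \<omega>) \<in> borel_measurable borel" by simp
  then have "(\<lambda>s. indicator A s *\<^sub>R (indicator {0..} s *\<^sub>R v s \<omega>)) \<in> borel_measurable borel"
    by (rule borel_measurable_scaleR[OF borel_measurable_indicator[OF A(1)]])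
  then have mA: "(\<lambda>s. indicator A s *\<^sub>R v s \<omega>) \<in> borel_measurable borel"
    by (rule measurable_cong[THEN iffD1, rotated]) (use A(2) in \<open>auto simp: indicator_def\<close>)
  have sq: "(norm (indicator A s *\<^sub>R v s \<omega>))\<^sup>2 = indicator A s * (norm (v s \<omega>))\<^sup>2" for s
    by (simp add: indicator_def)
  have m2: "(\<lambda>s. indicator A s * (norm (v s \<omega>))\<^sup>2) \<in> borel_measurable borel"
    unfolding sq[symmetric] using mA by measurable
  show le: "(\<integral>\<^sup>+s. indicator A s * ennreal ((norm (v s \<omega>))\<^sup>2) \<partial>lborel) \<le> energy v \<omega>"
    unfolding energy_eq using A(2) by (intro nn_integral_mono) (auto simp: indicator_def)
  have "(\<integral>\<^sup>+s. ennreal (norm (indicator A s * (norm (v s \<omega>))\<^sup>2)) \<partial>lborel) =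
      (\<integral>\<^sup>+s. indicator A s * ennreal ((norm (v s \<omega>))\<^sup>2) \<partial>lborel)"
    by (intro nn_integral_cong) (simp add: indicator_def)
  then show i2: "integrable lborel (\<lambda>s. indicator A s * (norm (v s \<omega>))\<^sup>2)"
    using le e m2 by (intro integrableI_bounded) (auto intro: le_less_trans)
  have iT: "integrable lborel (\<lambda>s. indicator {0..T} s :: real)"
    by (intro integrable_real_indicator) (auto simp: emeasure_lborel_Icc_eq)
  show "integrable lborel (\<lambda>s. indicator A s *\<^sub>R v s \<omega>)"
  proof (rule Bochner_Integration.integrable_bound[OF Bochner_Integration.integrable_add[OF iT i2]])
    show "AE s in lborel. norm (indicator A s *\<^sub>R v s \<omega>) \<le> norm (indicator {0..T} s + indicator A s * (norm (v s \<omega>))\<^sup>2)"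
    proof (rule AE_I2)
      fix s
      have "0 \<le> (norm (v s \<omega>) - 1)\<^sup>2" by simp
      then have "2 * norm (v s \<omega>) \<le> 1 + (norm (v s \<omega>))\<^sup>2" by (simp add: power2_diff)
      then have "norm (v s \<omega>) \<le> 1 + (norm (v s \<omega>))\<^sup>2" using norm_ge_zero[of "v s \<omega>"] by linarith
      then show "norm (indicator A s *\<^sub>R v s \<omega>) \<le> norm (indicator {0..T} s + indicator A s * (norm (v s \<omega>))\<^sup>2)"
        using A(2) by (auto simp: indicator_def)
    qed
  qed (use mA in simp)
qed

text \<open>Over half-open intervals displacements add up along a grid.\<close>

definition displacement :: "(real \<Rightarrow> 'o \<Rightarrow> real^'d) \<Rightarrow> real \<Rightarrow> real \<Rightarrow> 'o \<Rightarrow> real^'d" where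
  "displacement v a b \<omega> = (LINT s|lborel. indicator {a..<b} s *\<^sub>R v s \<omega>)"

lemma displacement_adapted:
  assumes v: "progressively_measurable \<F> v" and "0 \<le> a" "0 \<le> b" "b \<le> t"
  shows "displacement v a b \<in> borel_measurable (\<F> t)"
proof (rule filtration_measurable_mono[OF assms(4)])
  have "(\<lambda>(\<omega>, s). indicator {a..<b} s *\<^sub>R v s \<omega>) \<in> borel_measurable (\<F> b \<Otimes>\<^sub>M borel)"
    using assms by (intro progressive_slice[OF v]) auto
  then have "(\<lambda>(\<omega>, s). indicator {a..<b} s *\<^sub>R v s \<omega>) \<in> borel_measurable (\<F> b \<Otimes>\<^sub>M lborel)"
    by (simp cong: measurable_cong_sets sets_pair_measure_cong)
  from lborel.borel_measurable_lebesgue_integral[OF this]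
  show "displacement v a b \<in> borel_measurable (\<F> b)" unfolding displacement_def[abs_def] .
qed

lemma displacement_eq: "(LINT s:{0..t}|lborel. v s \<omega>) = displacement v 0 t \<omega>"
  if "(\<lambda>s. indicator {0..t} s *\<^sub>R v s \<omega>) \<in> borel_measurable lborel"
proof -
  have "(\<lambda>s. indicator {0..<t} s *\<^sub>R (indicator {0..t} s *\<^sub>R v s \<omega>)) \<in> borel_measurable lborel"
    by (rule borel_measurable_scaleR[OF borel_measurable_indicator that]) simp
  then have m: "(\<lambda>s. indicator {0..<t} s *\<^sub>R v s \<omega>) \<in> borel_measurable lborel"
    by (rule measurable_cong[THEN iffD1, rotated]) (auto simp: indicator_def)
  show ?thesis unfolding displacement_def set_lebesgue_integral_def
  proof (rule integral_cong_AE[OF that m])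
    show "AE s in lborel. indicator {0..t} s *\<^sub>R v s \<omega> = indicator {0..<t} s *\<^sub>R v s \<omega>"
      using AE_lborel_singleton[of t] by eventually_elim (auto simp: indicator_def)
  qed
qed

lemma displacement_add:
  assumes v: "progressively_measurable \<F> v" and \<omega>: "\<omega> \<in> space M" "energy v \<omega> < \<infinity>"
    and "0 \<le> a" "a \<le> b" "b \<le> c"
  shows "displacement v a c \<omega> = displacement v a b \<omega> + displacement v b c \<omega>"
proof -
  have "displacement v a c \<omega> = (LINT s|lborel. indicator {a..<b} s *\<^sub>R v s \<omega> + indicator {b..<c} s *\<^sub>R v s \<omega>)"
    unfolding displacement_def using assms by (intro Bochner_Integration.integral_cong) (auto simp: indicator_def)
  also have "\<dots> = displacement v a b \<omega> + displacement v b c \<omega>"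
    unfolding displacement_def using assms
    by (intro Bochner_Integration.integral_add slice_integrable(1)[OF v \<omega>, of _ c]) auto
  finally show ?thesis .
qed

text \<open>The Cauchy--Schwarz inequality on \<open>{a..<b}\<close>: averaging a drift over an interval does not
  increase its energy.\<close>

lemma displacement_energy:
  assumes v: "progressively_measurable \<F> v" and \<omega>: "\<omega> \<in> space M" "energy v \<omega> < \<infinity>"
    and ab: "0 \<le> a" "a < b"
  shows "ennreal ((norm (displacement v a b \<omega>))\<^sup>2 / (b - a)) \<le> (\<integral>\<^sup>+s. indicator {a..<b} s * ennreal ((norm (v s \<omega>))\<^sup>2) \<partial>lborel)"
proof -
  have "{a..<b} \<subseteq> {0..b}" using ab by auto
  note si = slice_integrable[OF v \<omega> _ this]
  have iv: "integrable lborel (\<lambda>s. indicator {a..<b} s *\<^sub>R v s \<omega>)" and i2: "integrable lborel (\<lambda>s. indicator {a..<b} s * (norm (v s \<omega>))\<^sup>2)"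
    using si ab by auto
  define D where "D = norm (displacement v a b \<omega>)"
  define E where "E = (\<integral>s. indicator {a..<b} s * (norm (v s \<omega>))\<^sup>2 \<partial>lborel)"
  have E0: "0 \<le> E" unfolding E_def by (intro Bochner_Integration.integral_nonneg) auto
  have "D\<^sup>2 / (b - a) \<le> E"
  proof (cases "D = 0")
    case True then show ?thesis using E0 by simp
  next
    case False
    then have D: "D > 0" unfolding D_def by simp
    \<comment> \<open>With this constant \<open>2 * x * \<alpha> \<le> x\<^sup>2 + \<alpha>\<^sup>2\<close> is sharp for a constant drift.\<close>
    define \<alpha> where "\<alpha> = D / (b - a)"
    have \<alpha>: "\<alpha> > 0" unfolding \<alpha>_def using D ab by simp
    have i1: "integrable lborel (\<lambda>s. indicator {a..<b} s :: real)"
      using ab by (intro integrable_real_indicator) (auto simp: emeasure_lborel_Ico)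
    have "D \<le> (\<integral>s. norm (indicator {a..<b} s *\<^sub>R v s \<omega>) \<partial>lborel)"
      unfolding D_def displacement_def by (rule integral_norm_bound)
    also have "\<dots> \<le> (\<integral>s. \<alpha> / 2 * indicator {a..<b} s + 1 / (2 * \<alpha>) * (indicator {a..<b} s * (norm (v s \<omega>))\<^sup>2) \<partial>lborel)"
    proof (rule integral_mono)
      fix s
      have "0 \<le> (norm (v s \<omega>) - \<alpha>)\<^sup>2" by simp
      then have "norm (v s \<omega>) * (2 * \<alpha>) \<le> \<alpha>\<^sup>2 + (norm (v s \<omega>))\<^sup>2"
        unfolding power2_diff by (simp only: mult_ac)
      then have "norm (v s \<omega>) \<le> (\<alpha>\<^sup>2 + (norm (v s \<omega>))\<^sup>2) / (2 * \<alpha>)"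
        using \<alpha> by (subst pos_le_divide_eq) auto
      also have "\<dots> = \<alpha> / 2 + 1 / (2 * \<alpha>) * (norm (v s \<omega>))\<^sup>2"
        using \<alpha> by (simp add: add_divide_distrib power2_eq_square)
      finally have "norm (v s \<omega>) \<le> \<alpha> / 2 + 1 / (2 * \<alpha>) * (norm (v s \<omega>))\<^sup>2" .
      then show "norm (indicator {a..<b} s *\<^sub>R v s \<omega>) \<le> \<alpha> / 2 * indicator {a..<b} s + 1 / (2 * \<alpha>) * (indicator {a..<b} s * (norm (v s \<omega>))\<^sup>2)"
        by (simp add: indicator_def)
    next
      show "integrable lborel (\<lambda>s. norm (indicator {a..<b} s *\<^sub>R v s \<omega>))" by (rule integrable_norm[OF iv])
    qed (use i1 i2 in auto)
    also have "\<dots> = \<alpha> / 2 * (b - a) + 1 / (2 * \<alpha>) * E"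
      using i1 i2 ab unfolding E_def by simp
    also have "\<dots> = D / 2 + (b - a) / (2 * D) * E"
    proof -
      have "\<alpha> / 2 * (b - a) = (\<alpha> * (b - a)) / 2" by simp
      also have "\<alpha> * (b - a) = D" unfolding \<alpha>_def using ab by simp
      finally have 1: "\<alpha> / 2 * (b - a) = D / 2" .
      have 2: "1 / (2 * \<alpha>) = (b - a) / (2 * D)" unfolding \<alpha>_def by simp
      show ?thesis unfolding 1 2 ..
    qed
    finally have "D / 2 \<le> (b - a) / (2 * D) * E" by linarith
    then have "D / 2 * (2 * D) \<le> (b - a) / (2 * D) * E * (2 * D)" using D by (intro mult_right_mono) auto
    then have "D * D \<le> (b - a) * E" using D by simp
    then show ?thesis using ab by (simp add: field_simps power2_eq_square)
  qed
  then have "ennreal (D\<^sup>2 / (b - a)) \<le> ennreal E" by (rule ennreal_leI)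
  also have "ennreal E = (\<integral>\<^sup>+s. ennreal (indicator {a..<b} s * (norm (v s \<omega>))\<^sup>2) \<partial>lborel)"
    unfolding E_def by (rule nn_integral_eq_integral[symmetric, OF i2]) auto
  also have "\<dots> = (\<integral>\<^sup>+s. indicator {a..<b} s * ennreal ((norm (v s \<omega>))\<^sup>2) \<partial>lborel)"
    by (intro nn_integral_cong) (simp add: indicator_def)
  finally show ?thesis unfolding D_def .
qed

lemma drifted_eq:
  assumes v: "progressively_measurable \<F> v" and \<omega>: "\<omega> \<in> space M" "energy v \<omega> < \<infinity>"
  shows "drifted B v t \<omega> = B t \<omega> + displacement v 0 t \<omega>"
  unfolding drifted_def
  by (subst displacement_eq) (use slice_integrable(1)[OF v \<omega>, of "{0..t}" t] in auto)

lemma drifted_continuous: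
  assumes v: "progressively_measurable \<F> v" and \<omega>: "\<omega> \<in> space M" "energy v \<omega> < \<infinity>"
  shows "continuous_on {0..} (\<lambda>t. drifted B v t \<omega>)"
  unfolding drifted_def
proof (intro continuous_on_add continuous_paths \<omega>(1) continuous_on_half_line)
  fix T :: real
  have si: "set_integrable lborel {0..t} (\<lambda>s. v s \<omega>)" for t
    unfolding set_integrable_def by (rule slice_integrable(1)[OF v \<omega>, of _ t]) auto
  have "continuous_on {0..T} (\<lambda>t. integral {0..t} (\<lambda>s. v s \<omega>))"
    by (intro indefinite_integral_continuous_1 set_borel_integral_eq_integral(1) si)
  then show "continuous_on {0..T} (\<lambda>t. LINT s:{0..t}|lborel. v s \<omega>)"
    using set_borel_integral_eq_integral(2)[OF si] by simp
qed

text \<open>The driven path, with a default value on the null set of infinite energy that makes it a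
  random element of path space.\<close>

definition steered_path :: "(real \<Rightarrow> 'o \<Rightarrow> real^'d) \<Rightarrow> 'o \<Rightarrow> real \<Rightarrow> real^'d" where
  "steered_path v \<omega> = (if energy v \<omega> < \<infinity> then sample_path (drifted B v) \<omega> else (\<lambda>t\<in>{0..}. 0))"

lemma steered_path_measurable:
  assumes v: "progressively_measurable \<F> v"
  shows "steered_path v \<in> measurable M borel_path_space"
proof (rule measurable_into_path_space)
  fix \<omega> assume \<omega>: "\<omega> \<in> space M"
  show "steered_path v \<omega> \<in> path_space"
  proof (cases "energy v \<omega> < \<infinity>")
    case True
    have "continuous_on {0..} (sample_path (drifted B v) \<omega>)"
      using drifted_continuous[OF v \<omega> True] by (rule continuous_on_eq) (simp add: sample_path_def)
    moreover have "sample_path (drifted B v) \<omega> 0 = 0"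
      using drifted_eq[OF v \<omega> True, of 0] starts_at_0[OF \<omega>] by (simp add: sample_path_def displacement_def)
    ultimately show ?thesis using True by (simp add: steered_path_def path_space_def sample_path_def)
  next
    case False
    have "continuous_on {0..} (\<lambda>t\<in>{0..}. 0 :: real^'d)"
      by (rule continuous_on_eq[OF continuous_on_const]) auto
    then show ?thesis using False by (simp add: steered_path_def path_space_def)
  qed
next
  fix t :: real assume t: "0 \<le> t"
  have em: "{\<omega> \<in> space M. energy v \<omega> < \<infinity>} \<in> sets M"
    using energy_measurable[OF v] by measurable
  have "(\<lambda>\<omega>. if energy v \<omega> < \<infinity> then B t \<omega> + displacement v 0 t \<omega> else 0) \<in> borel_measurable M"
    using t by (intro measurable_If em borel_measurable_add measurable_marginals borel_measurable_const
        filtration_measurable_M[OF displacement_adapted[OF v _ _ order_refl]]) auto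
  then show "(\<lambda>\<omega>. steered_path v \<omega> t) \<in> borel_measurable M"
    by (rule measurable_cong[THEN iffD1, rotated])
       (use t in \<open>auto simp: steered_path_def sample_path_def drifted_eq[OF v]\<close>)
qed

lemma finite_energy_driftsD:
  assumes "v \<in> finite_energy_drifts M B"
  shows "progressively_measurable \<F> v" "(\<integral>\<^sup>+\<omega>. energy v \<omega> \<partial>M) < \<infinity>" "AE \<omega> in M. energy v \<omega> < \<infinity>"
proof -
  show v: "progressively_measurable \<F> v" and e: "(\<integral>\<^sup>+\<omega>. energy v \<omega> \<partial>M) < \<infinity>"
    using assms unfolding finite_energy_drifts_def by auto
  have "AE \<omega> in M. energy v \<omega> \<noteq> \<infinity>"
    using e by (intro nn_integral_PInf_AE energy_measurable[OF v]) auto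
  then show "AE \<omega> in M. energy v \<omega> < \<infinity>" by (simp add: less_top)
qed

end

section \<open>The upper bound\<close>

lemma grid_cell_nonneg: "(s::real) \<in> {real i / 2 ^ p..<t} \<Longrightarrow> 0 \<le> s"
  by (rule order_trans[of _ "real i / 2 ^ p"]) auto

context standard_brownian_motion
begin

definition mean_energy :: "(real \<Rightarrow> 'o \<Rightarrow> real^'d) \<Rightarrow> real" where
  "mean_energy v = enn2real (\<integral>\<^sup>+\<omega>. energy v \<omega> \<partial>M)"

text \<open>Each cell repeats the displacement of the preceding cell, which is known when the cell begins.\<close>

definition delayed_control :: "(real \<Rightarrow> 'o \<Rightarrow> real^'d) \<Rightarrow> nat \<Rightarrow> nat \<Rightarrow> 'o \<Rightarrow> real^'d" where
  "delayed_control v p = case_nat (\<lambda>_. 0) (\<lambda>j \<omega>. 2 ^ p *\<^sub>R displacement v (real j / 2 ^ p) (real (Suc j) / 2 ^ p) \<omega>)"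

lemma delayed_control_adapted:
  assumes "progressively_measurable \<F> v"
  shows "adapted p (delayed_control v p)"
  unfolding adapted_def
proof
  fix i
  show "delayed_control v p i \<in> borel_measurable (\<F> (real i / 2 ^ p))"
  proof (cases i)
    case (Suc j)
    have "displacement v (real j / 2 ^ p) (real (Suc j) / 2 ^ p) \<in> borel_measurable (\<F> (real i / 2 ^ p))"
      unfolding Suc by (rule displacement_adapted[OF assms]) auto
    then show ?thesis unfolding Suc delayed_control_def by (simp add: borel_measurable_scaleR)
  qed (simp add: delayed_control_def)
qed

lemma delayed_control_energy:
  assumes v: "progressively_measurable \<F> v" and \<omega>: "\<omega> \<in> space M" "energy v \<omega> < \<infinity>"
  shows "(\<Sum>i<N. ennreal (1 / 2 ^ p * (norm (delayed_control v p i \<omega>))\<^sup>2)) \<le> energy v \<omega>"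
proof -
  let ?A = "\<lambda>j::nat. {real j / 2 ^ p..<real (Suc j) / 2 ^ p}"
  let ?g = "\<lambda>A s. indicator A s * ennreal ((norm (v s \<omega>))\<^sup>2)"
  have gm: "?g A \<in> borel_measurable lborel" if "A \<in> sets borel" "A \<subseteq> {0..t}" for A t
  proof -
    have "(\<lambda>s. indicator A s *\<^sub>R v s \<omega>) \<in> borel_measurable lborel"
      using slice_integrable(1)[OF v \<omega> that] by (rule borel_measurable_integrable)
    then have "(\<lambda>s. ennreal ((norm (indicator A s *\<^sub>R v s \<omega>))\<^sup>2)) \<in> borel_measurable lborel" by measurable
    then show ?thesis by (rule measurable_cong[THEN iffD1, rotated]) (simp add: indicator_def)
  qed
  have sub: "?A j \<subseteq> {0..real (Suc j) / 2 ^ p}" for j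
  proof
    fix s assume s: "s \<in> ?A j"
    show "s \<in> {0..real (Suc j) / 2 ^ p}" using grid_cell_nonneg[OF s] s by simp
  qed
  have cell: "ennreal (1 / 2 ^ p * (norm (delayed_control v p (Suc j) \<omega>))\<^sup>2) \<le> (\<integral>\<^sup>+s. ?g (?A j) s \<partial>lborel)" for j
  proof -
    have lt: "real j / 2 ^ p < real (Suc j) / 2 ^ p" by (simp add: divide_strict_right_mono)
    have "1 / 2 ^ p * (norm (delayed_control v p (Suc j) \<omega>))\<^sup>2 =
      (norm (displacement v (real j / 2 ^ p) (real (Suc j) / 2 ^ p) \<omega>))\<^sup>2 / (real (Suc j) / 2 ^ p - real j / 2 ^ p)"
      unfolding grid_step by (simp add: delayed_control_def power_mult_distrib power2_eq_square)
    then show ?thesis using displacement_energy[OF v \<omega> _ lt] by simp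
  qed
  have ind: "(\<Sum>j<m. \<integral>\<^sup>+s. ?g (?A j) s \<partial>lborel) = (\<integral>\<^sup>+s. ?g {0..<real m / 2 ^ p} s \<partial>lborel)" for m
  proof (induction m)
    case (Suc m)
    have "(\<Sum>j<Suc m. \<integral>\<^sup>+s. ?g (?A j) s \<partial>lborel) = (\<integral>\<^sup>+s. ?g {0..<real m / 2 ^ p} s \<partial>lborel) + (\<integral>\<^sup>+s. ?g (?A m) s \<partial>lborel)"
      using Suc by simp
    also have "\<dots> = (\<integral>\<^sup>+s. ?g {0..<real m / 2 ^ p} s + ?g (?A m) s \<partial>lborel)"
      by (rule nn_integral_add[symmetric]) (rule gm[of _ "real (Suc m) / 2 ^ p"]; use sub[of m] grid_mono[of m "Suc m" p] in auto)+
    also have "\<dots> = (\<integral>\<^sup>+s. ?g {0..<real (Suc m) / 2 ^ p} s \<partial>lborel)"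
    proof (rule nn_integral_cong)
      fix s :: real
      have "(indicator {0..<real m / 2 ^ p} s + indicator (?A m) s :: ennreal) = indicator {0..<real (Suc m) / 2 ^ p} s"
      proof -
        have "{0..<real (Suc m) / 2 ^ p} = {0..<real m / 2 ^ p} \<union> ?A m" "{0..<real m / 2 ^ p} \<inter> ?A m = {}"
          using grid_mono[of m "Suc m" p] grid_cell_nonneg[of _ m p "real (Suc m) / 2 ^ p"] by (fastforce, auto)
        then show ?thesis by (simp only: indicator_add)
      qed
      then show "?g {0..<real m / 2 ^ p} s + ?g (?A m) s = ?g {0..<real (Suc m) / 2 ^ p} s"
        by (metis distrib_right)
    qed
    finally show ?case .
  qed simp
  show ?thesis
  proof (cases N)
    case (Suc m)
    have "(\<Sum>i<N. ennreal (1 / 2 ^ p * (norm (delayed_control v p i \<omega>))\<^sup>2)) =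
       ennreal (1 / 2 ^ p * (norm (delayed_control v p 0 \<omega>))\<^sup>2) + (\<Sum>j<m. ennreal (1 / 2 ^ p * (norm (delayed_control v p (Suc j) \<omega>))\<^sup>2))"
      unfolding Suc by (rule sum.lessThan_Suc_shift)
    also have "\<dots> = (\<Sum>j<m. ennreal (1 / 2 ^ p * (norm (delayed_control v p (Suc j) \<omega>))\<^sup>2))"
      by (simp add: delayed_control_def)
    also have "\<dots> \<le> (\<Sum>j<m. \<integral>\<^sup>+s. ?g (?A j) s \<partial>lborel)" by (intro sum_mono cell)
    also have "\<dots> \<le> energy v \<omega>"
      unfolding ind by (rule slice_integrable(3)[OF v \<omega>, where T="real m / 2 ^ p"]) auto
    finally show ?thesis .
  qed simp
qed

text \<open>With delay \<open>h\<close>, the path \<open>B t + displacement v 0 (t - h)\<close> has the increments that the delayed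
  control steers, so that Girsanov's formula and Jensen's inequality apply. As \<open>h\<close> tends to 0 these
  paths converge at each time, and the trigonometric polynomial depends on finitely many times.\<close>

lemma upper_bound_trig:
  assumes v: "v \<in> finite_energy_drifts M B" and f: "f \<in> trig_polys"
  shows "(\<integral>\<omega>. f (steered_path v \<omega>) \<partial>M) - mean_energy v / 2 \<le> ln (\<integral>\<omega>. exp (f (sample_path B \<omega>)) \<partial>M)"
proof -
  note vp = finite_energy_driftsD(1)[OF v]
  obtain K a c lam T n R where form: "trig_form f K a c lam T n R" using trig_polys_on_grid[OF f] by blast
  obtain C where C: "\<And>w. \<bar>f w\<bar> \<le> C" using trig_polys_bounded[OF f] by blast
  have fm: "f \<in> borel_measurable borel_path_space" by (rule trig_polys_measurable[OF f])
  define Z where "Z = (\<integral>\<omega>. exp (f (sample_path B \<omega>)) \<partial>M)"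
  have fB: "(\<lambda>\<omega>. f (sample_path B \<omega>)) \<in> borel_measurable M" by (rule measurable_compose[OF sample_path_measurable fm])
  have Zi: "integrable M (\<lambda>\<omega>. exp (f (sample_path B \<omega>)))"
    using fB C abs_le_D1[OF C] by (intro integrable_const_bound[where B="exp C"]) auto
  have "exp (- C) = (\<integral>\<omega>. exp (- C) \<partial>M)" by (simp add: prob_space)
  also have "\<dots> \<le> Z" unfolding Z_def using abs_le_D2[OF C] by (intro integral_mono Zi) (auto simp: minus_le_iff)
  finally have Z0: "0 < Z" by (rule less_le_trans[rotated]) simp
  have Zn: "(\<integral>\<^sup>+\<omega>. ennreal (exp (f (sample_path B \<omega>))) \<partial>M) = ennreal Z"
    unfolding Z_def by (rule nn_integral_eq_integral[OF Zi]) simp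
  define X where "X p t \<omega> = B t \<omega> + displacement v 0 (t - 1 / 2 ^ p) \<omega>" for p t \<omega>
  define N where "N p = T * 2 ^ p" for p :: nat
  define u where "u p = delayed_control v p" for p
  have disp_neg: "displacement v 0 t \<omega> = 0" if "t \<le> 0" for t \<omega> using that by (simp add: displacement_def)
  have X0: "X p 0 \<omega> = 0" if "\<omega> \<in> space M" for p \<omega>
    using starts_at_0[OF that] disp_neg by (simp add: X_def)
  have incr: "X p (real (Suc i) / 2 ^ p) \<omega> - X p (real i / 2 ^ p) \<omega> = steered p (u p) i \<omega>"
    if \<omega>: "\<omega> \<in> space M" "energy v \<omega> < \<infinity>" for p i \<omega>
  proof -
    have s: "real (Suc j) / 2 ^ p - 1 / 2 ^ p = real j / 2 ^ p" for j by (simp add: field_simps)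
    have "displacement v 0 (real (Suc i) / 2 ^ p - 1 / 2 ^ p) \<omega> - displacement v 0 (real i / 2 ^ p - 1 / 2 ^ p) \<omega> = (1 / 2 ^ p) *\<^sub>R u p i \<omega>"
    proof (cases i)
      case 0 then show ?thesis by (simp add: disp_neg u_def delayed_control_def)
    next
      case (Suc j)
      have "displacement v 0 (real (Suc j) / 2 ^ p) \<omega> = displacement v 0 (real j / 2 ^ p) \<omega> + displacement v (real j / 2 ^ p) (real (Suc j) / 2 ^ p) \<omega>"
        by (rule displacement_add[OF vp \<omega>]) (simp, simp, rule grid_mono, simp)
      then show ?thesis unfolding Suc s by (simp add: u_def delayed_control_def)
    qed
    then show ?thesis unfolding X_def steered_def noise_def by simp
  qed
  have ad: "adapted p (u p)" for p unfolding u_def by (rule delayed_control_adapted[OF vp])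
  have um: "u p i \<in> borel_measurable M" for p i by (rule filtration_measurable_M[OF adaptedD[OF ad order_refl]])
  have AEgood: "AE \<omega> in M. \<omega> \<in> space M \<and> energy v \<omega> < \<infinity>" using finite_energy_driftsD(3)[OF v] AE_space by eventually_elim simp
  have en: "(\<Sum>i<N p. \<integral>\<^sup>+\<omega>. ennreal (1 / 2 ^ p * (norm (u p i \<omega>))\<^sup>2) \<partial>M) \<le> (\<integral>\<^sup>+\<omega>. energy v \<omega> \<partial>M)" for p
  proof -
    have "(\<Sum>i<N p. \<integral>\<^sup>+\<omega>. ennreal (1 / 2 ^ p * (norm (u p i \<omega>))\<^sup>2) \<partial>M) = (\<integral>\<^sup>+\<omega>. (\<Sum>i<N p. ennreal (1 / 2 ^ p * (norm (u p i \<omega>))\<^sup>2)) \<partial>M)"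
      by (rule nn_integral_sum[symmetric]) (use um in measurable)
    also have "\<dots> \<le> (\<integral>\<^sup>+\<omega>. energy v \<omega> \<partial>M)"
    proof (rule nn_integral_mono_AE)
      show "AE \<omega> in M. (\<Sum>i<N p. ennreal (1 / 2 ^ p * (norm (u p i \<omega>))\<^sup>2)) \<le> energy v \<omega>"
        using AEgood unfolding u_def by eventually_elim (use delayed_control_energy[OF vp] in blast)
    qed
    finally show ?thesis .
  qed
  have ui: "integrable M (\<lambda>\<omega>. (norm (u p i \<omega>))\<^sup>2)" if "i < N p" for p i
  proof -
    have "(\<integral>\<^sup>+\<omega>. ennreal (1 / 2 ^ p * (norm (u p i \<omega>))\<^sup>2) \<partial>M) \<le> (\<Sum>i<N p. \<integral>\<^sup>+\<omega>. ennreal (1 / 2 ^ p * (norm (u p i \<omega>))\<^sup>2) \<partial>M)"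
      using that by (intro member_le_sum) auto
    also have "\<dots> < \<infinity>" using en[of p] finite_energy_driftsD(2)[OF v] by (rule le_less_trans)
    finally have "integrable M (\<lambda>\<omega>. 1 / 2 ^ p * (norm (u p i \<omega>))\<^sup>2)"
      using um[of p i] by (intro integrableI_nonneg) auto
    from integrable_mult_right[OF this, of "2 ^ p"] show ?thesis by simp
  qed
  have cost: "(\<Sum>i<N p. 1 / 2 ^ p / 2 * (\<integral>\<omega>. (norm (u p i \<omega>))\<^sup>2 \<partial>M)) \<le> mean_energy v / 2" for p
  proof -
    have "ennreal (\<Sum>i<N p. 1 / 2 ^ p * (\<integral>\<omega>. (norm (u p i \<omega>))\<^sup>2 \<partial>M)) = (\<Sum>i<N p. \<integral>\<^sup>+\<omega>. ennreal (1 / 2 ^ p * (norm (u p i \<omega>))\<^sup>2) \<partial>M)"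
    proof (subst sum_ennreal[symmetric])
      show "(\<Sum>i<N p. ennreal (1 / 2 ^ p * (\<integral>\<omega>. (norm (u p i \<omega>))\<^sup>2 \<partial>M))) = (\<Sum>i<N p. \<integral>\<^sup>+\<omega>. ennreal (1 / 2 ^ p * (norm (u p i \<omega>))\<^sup>2) \<partial>M)"
        using ui by (intro sum.cong refl) (subst nn_integral_eq_integral, auto)
    qed (auto intro!: mult_nonneg_nonneg)
    also have "\<dots> \<le> (\<integral>\<^sup>+\<omega>. energy v \<omega> \<partial>M)" by (rule en)
    also have "\<dots> = ennreal (mean_energy v)"
      unfolding mean_energy_def using finite_energy_driftsD(2)[OF v] by simp
    finally have "(\<Sum>i<N p. 1 / 2 ^ p * (\<integral>\<omega>. (norm (u p i \<omega>))\<^sup>2 \<partial>M)) \<le> mean_energy v"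
      by (rule ennreal_le_iff[THEN iffD1, rotated]) (simp add: mean_energy_def)
    then show ?thesis by (simp add: sum_distrib_left[symmetric] flip: sum_divide_distrib)
  qed
  have X_meas: "X p t \<in> borel_measurable M" if "0 \<le> t" for p t
  proof (cases "t - 1 / 2 ^ p \<le> 0")
    case True
    then have "X p t = B t" unfolding X_def[abs_def] using disp_neg by auto
    then show ?thesis using measurable_marginals[OF that] by simp
  next
    case False
    then show ?thesis unfolding X_def[abs_def] using that
      by (intro borel_measurable_add measurable_marginals filtration_measurable_M[OF displacement_adapted[OF vp _ _ order_refl]]) auto
  qed
  have f_eq: "f (sample_path Y \<omega>) = (\<Sum>k<K. a k * cos (c k + (\<Sum>i<T * 2 ^ n. lam k (real i / 2 ^ n) \<bullet> (Y (real (Suc i) / 2 ^ n) \<omega> - Y (real i / 2 ^ n) \<omega>))))"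
    if "Y 0 \<omega> = 0" for Y \<omega>
  proof -
    have "sample_path Y \<omega> 0 = 0" using that by (simp add: sample_path_nonneg)
    then have "f (sample_path Y \<omega>) = (\<Sum>k<K. a k * cos (c k + wiener_sum (lam k) T n (sample_path Y \<omega>)))"
      using form unfolding trig_form_def by blast
    then show ?thesis unfolding wiener_sum_def by (simp add: sample_path_nonneg)
  qed
  have Ym: "(\<lambda>\<omega>. f (sample_path (X p) \<omega>)) \<in> borel_measurable M" for p
  proof -
    note [measurable] = X_meas
    have "(\<lambda>\<omega>. \<Sum>k<K. a k * cos (c k + (\<Sum>i<T * 2 ^ n. lam k (real i / 2 ^ n) \<bullet> (X p (real (Suc i) / 2 ^ n) \<omega> - X p (real i / 2 ^ n) \<omega>)))) \<in> borel_measurable M"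
      by measurable
    then show ?thesis by (rule measurable_cong[THEN iffD1, rotated]) (simp add: f_eq X0)
  qed
  have bound: "(\<integral>\<omega>. f (sample_path (X p) \<omega>) \<partial>M) \<le> ln Z + mean_energy v / 2" if p: "n \<le> p" for p
  proof -
    have "(\<integral>\<omega>. f (sample_path (X p) \<omega>) \<partial>M) - (\<Sum>i<N p. 1 / 2 ^ p / 2 * (\<integral>\<omega>. (norm (u p i \<omega>))\<^sup>2 \<partial>M)) \<le> ln Z"
    proof (rule steering_upper_bound[OF ad ui])
      show "integrable M (\<lambda>\<omega>. f (sample_path (X p) \<omega>))"
        using Ym C by (intro integrable_const_bound[where B=C]) auto
      have "(\<integral>\<^sup>+\<omega>. ennreal (exp (f (sample_path (X p) \<omega>))) * ennreal (exp (- log_density p (u p) (T * 2 ^ p) \<omega>)) \<partial>M) =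
        (\<integral>\<^sup>+\<omega>. ennreal (exp (f (sample_path B \<omega>))) \<partial>M)"
      proof (rule girsanov_trig_form[OF form p _ ad, where g="\<lambda>x. ennreal (exp x)"])
        show "AE \<omega> in M. X p 0 \<omega> = 0 \<and> (\<forall>i<T * 2 ^ p. X p (real (Suc i) / 2 ^ p) \<omega> - X p (real i / 2 ^ p) \<omega> = steered p (u p) i \<omega>)"
          using AEgood by eventually_elim (use X0 incr in auto)
      qed simp
      then show "(\<integral>\<^sup>+\<omega>. ennreal (exp (f (sample_path (X p) \<omega>))) * ennreal (exp (- log_density p (u p) (N p) \<omega>)) \<partial>M) \<le> ennreal Z"
        using Zn by (simp add: N_def)
    qed (use Z0 in auto)
    then show ?thesis using cost[of p] by linarith
  qed
  have "(\<lambda>p. \<integral>\<omega>. f (sample_path (X p) \<omega>) \<partial>M) \<longlonglongrightarrow> (\<integral>\<omega>. f (steered_path v \<omega>) \<partial>M)"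
  proof (rule integral_dominated_convergence[where w="\<lambda>_. C"])
    show "(\<lambda>\<omega>. f (steered_path v \<omega>)) \<in> borel_measurable M"
      by (rule measurable_compose[OF steered_path_measurable[OF vp] fm])
    show "AE \<omega> in M. (\<lambda>p. f (sample_path (X p) \<omega>)) \<longlonglongrightarrow> f (steered_path v \<omega>)"
      using AEgood
    proof eventually_elim
      fix \<omega> assume "\<omega> \<in> space M \<and> energy v \<omega> < \<infinity>"
      then have \<omega>: "\<omega> \<in> space M" "energy v \<omega> < \<infinity>" by auto
      have conv: "(\<lambda>p. X p t \<omega>) \<longlonglongrightarrow> drifted B v t \<omega>" if t: "0 \<le> t" for t
      proof -
        define s where "s p = max 0 (t - 1 / 2 ^ p)" for p :: nat
        have "(\<lambda>p. t - 1 / 2 ^ p) \<longlonglongrightarrow> t - 0"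
          by (intro tendsto_diff tendsto_const) (simp add: LIMSEQ_divide_realpow_zero)
        then have "s \<longlonglongrightarrow> max 0 (t - 0)" unfolding s_def by (intro tendsto_max tendsto_const)
        then have s: "s \<longlonglongrightarrow> t" using t by simp
        have s0: "s p \<in> {0..}" for p unfolding s_def by simp
        have X: "X p t \<omega> = B t \<omega> + (drifted B v (s p) \<omega> - B (s p) \<omega>)" for p
          unfolding X_def drifted_eq[OF vp \<omega>] s_def using disp_neg by (auto simp: max_def)
        have "(\<lambda>p. drifted B v (s p) \<omega>) \<longlonglongrightarrow> drifted B v t \<omega>"
          using drifted_continuous[OF vp \<omega>] s s0 t unfolding continuous_on_sequentially by (auto simp: comp_def)
        moreover have "(\<lambda>p. B (s p) \<omega>) \<longlonglongrightarrow> B t \<omega>"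
          using continuous_paths[OF \<omega>(1)] s s0 t unfolding continuous_on_sequentially by (auto simp: comp_def)
        ultimately have "(\<lambda>p. B t \<omega> + (drifted B v (s p) \<omega> - B (s p) \<omega>)) \<longlonglongrightarrow> B t \<omega> + (drifted B v t \<omega> - B t \<omega>)"
          by (intro tendsto_add tendsto_diff tendsto_const)
        then show ?thesis unfolding X by simp
      qed
      have d0: "drifted B v 0 \<omega> = 0" unfolding drifted_eq[OF vp \<omega>] using starts_at_0[OF \<omega>(1)] disp_neg by simp
      have "(\<lambda>p. f (sample_path (X p) \<omega>)) \<longlonglongrightarrow> f (sample_path (drifted B v) \<omega>)"
        unfolding f_eq[of "X p" \<omega> for p, OF X0[OF \<omega>(1)]] f_eq[of "drifted B v" \<omega>, OF d0]
        by (intro tendsto_sum tendsto_mult tendsto_cos tendsto_add tendsto_inner tendsto_diff tendsto_const conv) auto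
      then show "(\<lambda>p. f (sample_path (X p) \<omega>)) \<longlonglongrightarrow> f (steered_path v \<omega>)"
        using \<omega>(2) by (simp add: steered_path_def)
    qed
  qed (use Ym C in auto)
  then have "(\<integral>\<omega>. f (steered_path v \<omega>) \<partial>M) \<le> ln Z + mean_energy v / 2"
    by (rule LIMSEQ_le_const2) (use bound in blast)
  then show ?thesis unfolding Z_def by simp
qed

text \<open>The left-hand side is a mean under the law of the driven path and the right-hand side one under
  the law of \<open>B\<close>, so \<open>F\<close> is approximated under both laws by the same trigonometric polynomial.\<close>

theorem upper_bound_bounded:
  assumes v: "v \<in> finite_energy_drifts M B"
    and F: "F \<in> borel_measurable borel_path_space" "\<And>w. w \<in> path_space \<Longrightarrow> a \<le> F w \<and> F w \<le> b"
  shows "(\<integral>\<omega>. F (steered_path v \<omega>) \<partial>M) - mean_energy v / 2 \<le> ln (\<integral>\<omega>. exp (F (sample_path B \<omega>)) \<partial>M)"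
proof -
  note vp = finite_energy_driftsD(1)[OF v]
  let ?\<mu> = "distr M borel_path_space (steered_path v)" and ?\<nu> = "distr M borel_path_space (sample_path B)"
  interpret \<mu>: prob_space ?\<mu> by (rule prob_space_distr[OF steered_path_measurable[OF vp]])
  interpret \<nu>: prob_space ?\<nu> by (rule prob_space_distr[OF sample_path_measurable])
  have mI: "(\<integral>w. G w \<partial>?\<mu>) = (\<integral>\<omega>. G (steered_path v \<omega>) \<partial>M)" "(\<integral>w. G w \<partial>?\<nu>) = (\<integral>\<omega>. G (sample_path B \<omega>) \<partial>M)"
    if "G \<in> borel_measurable borel_path_space" for G :: "_ \<Rightarrow> real"
    using that steered_path_measurable[OF vp] sample_path_measurable by (auto intro!: integral_distr)
  define Z where "Z = (\<integral>w. exp (F w) \<partial>?\<nu>)"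
  have bi: "integrable ?\<mu> G" "integrable ?\<nu> G" if "G \<in> borel_measurable borel_path_space" "\<And>w. w \<in> path_space \<Longrightarrow> \<bar>G w\<bar> \<le> C" for G and C :: real
    using that by (auto intro!: \<mu>.integrable_const_bound[where B=C] \<nu>.integrable_const_bound[where B=C] AE_I2)
  have FI: "integrable ?\<mu> F" "integrable ?\<nu> F" by (rule bi[OF F(1), of "max \<bar>a\<bar> \<bar>b\<bar>"]; use F(2) in fastforce)+
  have eF: "integrable ?\<nu> (\<lambda>w. exp (F w))" using F by (intro bi(2)[of _ "exp b"]) auto
  have "exp a = (\<integral>w. exp a \<partial>?\<nu>)" by (simp add: \<nu>.prob_space[simplified])
  also have "\<dots> \<le> Z" unfolding Z_def by (intro integral_mono eF) (use F(2) in auto)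
  finally have Z0: "0 < Z" by (rule less_le_trans[rotated]) simp
  have step: "(\<integral>w. F w \<partial>?\<mu>) - mean_energy v / 2 \<le> e + ln (Z + exp (b + 1) * e)" if e: "0 < e" "e \<le> 1" for e
  proof -
    obtain f where f: "f \<in> trig_polys" "\<forall>w\<in>path_space. a - e \<le> f w \<and> f w \<le> b + e"
      "(\<integral>w. \<bar>f w - F w\<bar> \<partial>?\<mu>) < e" "(\<integral>w. \<bar>f w - F w\<bar> \<partial>?\<nu>) < e"
      using trig_polys_dense_in_two_means[OF \<mu>.finite_measure_axioms _ \<nu>.finite_measure_axioms _ F e(1)] by auto
    have fm: "f \<in> borel_measurable borel_path_space" by (rule trig_polys_measurable[OF f(1)])
    obtain C where C: "\<And>w. \<bar>f w\<bar> \<le> C" using trig_polys_bounded[OF f(1)] by blast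
    have fi: "integrable ?\<mu> f" "integrable ?\<nu> f" using bi[OF fm C] by auto
    have ef: "integrable ?\<nu> (\<lambda>w. exp (f w))" using fm abs_le_D1[OF C] by (intro bi(2)[of _ "exp C"]) auto
    have "(\<integral>w. F w - f w \<partial>?\<mu>) \<le> (\<integral>w. \<bar>f w - F w\<bar> \<partial>?\<mu>)"
      using FI fi by (intro integral_mono) auto
    then have 1: "(\<integral>w. F w \<partial>?\<mu>) \<le> (\<integral>w. f w \<partial>?\<mu>) + e" using FI fi f(3) by simp
    have "(\<integral>w. exp (f w) \<partial>?\<nu>) \<le> (\<integral>w. exp (F w) + exp (b + 1) * \<bar>f w - F w\<bar> \<partial>?\<nu>)"
    proof (rule integral_mono[OF ef])
      fix w assume "w \<in> space ?\<nu>"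
      then have w: "f w \<le> b + 1" using f(2) e(2) by auto
      have "exp (f w) * (1 + (F w - f w)) \<le> exp (f w) * exp (F w - f w)"
        by (intro mult_left_mono exp_ge_add_one_self) auto
      also have "\<dots> = exp (F w)" by (simp add: exp_add[symmetric])
      finally have "exp (f w) \<le> exp (F w) + exp (f w) * (f w - F w)" by (simp add: algebra_simps)
      also have "exp (f w) * (f w - F w) \<le> exp (f w) * \<bar>f w - F w\<bar>" by (intro mult_left_mono) auto
      also have "exp (f w) * \<bar>f w - F w\<bar> \<le> exp (b + 1) * \<bar>f w - F w\<bar>" using w by (intro mult_right_mono) auto
      finally show "exp (f w) \<le> exp (F w) + exp (b + 1) * \<bar>f w - F w\<bar>" by simp
    qed (use eF FI fi in auto)
    also have "\<dots> = Z + exp (b + 1) * (\<integral>w. \<bar>f w - F w\<bar> \<partial>?\<nu>)"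
      unfolding Z_def using eF FI fi by simp
    also have "\<dots> \<le> Z + exp (b + 1) * e" using f(4) by simp
    finally have 2: "(\<integral>w. exp (f w) \<partial>?\<nu>) \<le> Z + exp (b + 1) * e" .
    have "exp (- C) = (\<integral>w. exp (- C) \<partial>?\<nu>)" by (simp add: \<nu>.prob_space[simplified])
    also have "\<dots> \<le> (\<integral>w. exp (f w) \<partial>?\<nu>)" using abs_le_D2[OF C] by (intro integral_mono ef) (auto simp: minus_le_iff)
    finally have 3: "0 < (\<integral>w. exp (f w) \<partial>?\<nu>)" by (rule less_le_trans[rotated]) simp
    have "(\<integral>w. f w \<partial>?\<mu>) - mean_energy v / 2 \<le> ln (\<integral>w. exp (f w) \<partial>?\<nu>)"
      using upper_bound_trig[OF v f(1)] mI(1)[OF fm] mI(2)[of "\<lambda>w. exp (f w)"] fm by simp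
    also have "\<dots> \<le> ln (Z + exp (b + 1) * e)" using 2 3 by simp
    finally show ?thesis using 1 by linarith
  qed
  have "(\<lambda>n. 1 / real (Suc n) + ln (Z + exp (b + 1) * (1 / real (Suc n)))) \<longlonglongrightarrow> 0 + ln (Z + exp (b + 1) * 0)"
    using Z0 LIMSEQ_inverse_real_of_nat by (intro tendsto_intros) (auto simp: inverse_eq_divide)
  then have "(\<integral>w. F w \<partial>?\<mu>) - mean_energy v / 2 \<le> 0 + ln (Z + exp (b + 1) * 0)"
    by (rule LIMSEQ_le_const) (intro exI[of _ 0] allI impI step, auto)
  then show ?thesis using mI(1)[OF F(1)] mI(2)[of "\<lambda>w. exp (F w)"] F(1) unfolding Z_def by simp
qed

end

section \<open>Near-optimal grid controls for trigonometric polynomials\<close>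

lemma grid_cell_iff:
  assumes "0 \<le> (s::real)"
  shows "s \<in> {real i / 2 ^ p..<real (Suc i) / 2 ^ p} \<longleftrightarrow> i = nat \<lfloor>s * 2 ^ p\<rfloor>"
proof -
  have "s \<in> {real i / 2 ^ p..<real (Suc i) / 2 ^ p} \<longleftrightarrow> real i \<le> s * 2 ^ p \<and> s * 2 ^ p < real i + 1"
    by (auto simp: field_simps)
  also have "\<dots> \<longleftrightarrow> i = nat \<lfloor>s * 2 ^ p\<rfloor>"
    using assms by (auto simp: floor_eq_iff nat_eq_iff eq_nat_nat_iff le_nat_iff) linarith+
  finally show ?thesis .
qed

lemma grid_cell_indicator:
  assumes "0 \<le> (s::real)"
  shows "indicator {real i / 2 ^ p..<real (Suc i) / 2 ^ p} s = (if i = nat \<lfloor>s * 2 ^ p\<rfloor> then 1 else 0)"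
  by (simp only: indicator_def grid_cell_iff[OF assms] of_bool_def)

text \<open>The polygon through the partial sums. It turns a lower bound of a functional on path space into
  a lower bound for arbitrary increments.\<close>

lemma path_with_increments:
  fixes x :: "nat \<Rightarrow> real^'d"
  obtains w where "w \<in> path_space" "\<And>i. i < N \<Longrightarrow> w (real (Suc i) / 2 ^ p) - w (real i / 2 ^ p) = x i"
proof
  define cl where "cl r = max 0 (min 1 r)" for r :: real
  define w where "w = (\<lambda>t\<in>{0..}. \<Sum>i<N. cl (t * 2 ^ p - real i) *\<^sub>R x i)"
  have "continuous_on {0..} (\<lambda>t. \<Sum>i<N. cl (t * 2 ^ p - real i) *\<^sub>R x i)"
    unfolding cl_def by (intro continuous_intros)
  then have "continuous_on {0..} w" by (rule continuous_on_eq) (simp add: w_def)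
  moreover have "w 0 = 0" by (simp add: w_def cl_def)
  ultimately show "w \<in> path_space" by (simp add: path_space_def w_def)
  have cl: "cl (real j - real i) = (if i < j then 1 else 0)" for i j :: nat
    unfolding cl_def by auto
  have w: "w (real j / 2 ^ p) = (\<Sum>i<N. if i < j then x i else 0)" for j
    unfolding w_def by (simp add: cl if_distrib[of "\<lambda>r. r *\<^sub>R _"] cong: if_cong)
  fix i assume i: "i < N"
  have "w (real (Suc i) / 2 ^ p) - w (real i / 2 ^ p) = (\<Sum>k<N. if k = i then x k else 0)"
    unfolding w sum_subtractf[symmetric] by (intro sum.cong refl) auto
  then show "w (real (Suc i) / 2 ^ p) - w (real i / 2 ^ p) = x i" using i by simp
qed

context standard_brownian_motion
begin

definition step_drift :: "nat \<Rightarrow> nat \<Rightarrow> (nat \<Rightarrow> 'o \<Rightarrow> real^'d) \<Rightarrow> real \<Rightarrow> 'o \<Rightarrow> real^'d" where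
  "step_drift p N u t \<omega> = (\<Sum>i<N. indicator {real i / 2 ^ p..<real (Suc i) / 2 ^ p} t *\<^sub>R u i \<omega>)"

lemma step_drift_progressive:
  assumes u: "adapted p u"
  shows "progressively_measurable \<F> (step_drift p N u)"
  unfolding progressively_measurable_def
proof (intro allI impI)
  fix t :: real assume t: "0 \<le> t"
  let ?N = "restrict_space borel {0..t} \<Otimes>\<^sub>M \<F> t"
  have "(\<lambda>z. indicator {real i / 2 ^ p..<real (Suc i) / 2 ^ p} (fst z) *\<^sub>R u i (snd z)) \<in> borel_measurable ?N" for i
  proof (cases "real i / 2 ^ p \<le> t")
    case True
    have "u i \<in> borel_measurable (\<F> t)"
      by (rule filtration_measurable_mono[OF True adaptedD[OF u order_refl]])
    then have "(\<lambda>z. u i (snd z)) \<in> borel_measurable ?N" by (rule measurable_compose[OF measurable_snd])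
    moreover have "(\<lambda>s. indicator {real i / 2 ^ p..<real (Suc i) / 2 ^ p} s :: real) \<in> borel_measurable (restrict_space borel {0..t})"
      by (rule measurable_restrict_space1) simp
    then have "(\<lambda>z. indicator {real i / 2 ^ p..<real (Suc i) / 2 ^ p} (fst z) :: real) \<in> borel_measurable ?N"
      by (rule measurable_compose[OF measurable_fst])
    ultimately show ?thesis by (rule borel_measurable_scaleR[rotated])
  next
    case False
    have "(\<lambda>z. 0 :: real^'d) \<in> borel_measurable ?N" by simp
    then show ?thesis
      by (rule measurable_cong[THEN iffD1, rotated]) (use False in \<open>auto simp: space_pair_measure space_restrict_space indicator_def\<close>)
  qed
  then have "(\<lambda>z. \<Sum>i<N. indicator {real i / 2 ^ p..<real (Suc i) / 2 ^ p} (fst z) *\<^sub>R u i (snd z)) \<in> borel_measurable ?N"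
    by (intro borel_measurable_sum)
  then show "(\<lambda>(s, \<omega>). step_drift p N u s \<omega>) \<in> borel_measurable ?N"
    by (simp add: step_drift_def split_beta')
qed

lemma step_drift_eq:
  assumes "0 \<le> s"
  shows "step_drift p N u s \<omega> = (if nat \<lfloor>s * 2 ^ p\<rfloor> < N then u (nat \<lfloor>s * 2 ^ p\<rfloor>) \<omega> else 0)"
proof -
  have "step_drift p N u s \<omega> = (\<Sum>i<N. if i = nat \<lfloor>s * 2 ^ p\<rfloor> then u i \<omega> else 0)"
    unfolding step_drift_def by (intro sum.cong refl) (simp only: grid_cell_indicator[OF assms] split: if_split, simp)
  then show ?thesis by simp
qed

lemma emeasure_grid_cell: "emeasure lborel {real i / 2 ^ p..<real (Suc i) / 2 ^ p} = ennreal (1 / 2 ^ p)"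
  using grid_mono[of i "Suc i" p] grid_step[of i p] by (subst emeasure_lborel_Ico) auto

lemma step_drift_energy:
  "energy (step_drift p N u) \<omega> = (\<Sum>i<N. ennreal (1 / 2 ^ p * (norm (u i \<omega>))\<^sup>2))"
proof -
  have "energy (step_drift p N u) \<omega> =
      (\<integral>\<^sup>+s. (\<Sum>i<N. ennreal ((norm (u i \<omega>))\<^sup>2) * indicator {real i / 2 ^ p..<real (Suc i) / 2 ^ p} s) \<partial>lborel)"
    unfolding energy_def
  proof (rule nn_integral_cong)
    fix s :: real
    show "ennreal ((norm (step_drift p N u s \<omega>))\<^sup>2) * indicator {0..} s =
      (\<Sum>i<N. ennreal ((norm (u i \<omega>))\<^sup>2) * indicator {real i / 2 ^ p..<real (Suc i) / 2 ^ p} s)"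
    proof (cases "0 \<le> s")
      case True
      have "(\<Sum>i<N. ennreal ((norm (u i \<omega>))\<^sup>2) * indicator {real i / 2 ^ p..<real (Suc i) / 2 ^ p} s) =
        (\<Sum>i<N. if i = nat \<lfloor>s * 2 ^ p\<rfloor> then ennreal ((norm (u i \<omega>))\<^sup>2) else 0)"
        by (intro sum.cong refl) (simp only: grid_cell_indicator[OF True] split: if_split, simp)
      then show ?thesis using True by (simp add: step_drift_eq)
    next
      case False
      have "s \<notin> {real i / 2 ^ p..<real (Suc i) / 2 ^ p}" for i
        using False grid_cell_nonneg by blast
      then show ?thesis using False by simp
    qed
  qed
  also have "\<dots> = (\<Sum>i<N. \<integral>\<^sup>+s. ennreal ((norm (u i \<omega>))\<^sup>2) * indicator {real i / 2 ^ p..<real (Suc i) / 2 ^ p} s \<partial>lborel)"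
    by (rule nn_integral_sum) simp
  also have "\<dots> = (\<Sum>i<N. ennreal (1 / 2 ^ p * (norm (u i \<omega>))\<^sup>2))"
    by (intro sum.cong refl, subst nn_integral_cmult_indicator, simp, subst emeasure_grid_cell)
      (simp add: ennreal_mult'[symmetric])
  finally show ?thesis .
qed

lemma step_drift_energy_finite: "energy (step_drift p N u) \<omega> < \<infinity>"
  unfolding step_drift_energy by simp

lemma step_drift_displacement:
  assumes "r \<le> N"
  shows "displacement (step_drift p N u) 0 (real r / 2 ^ p) \<omega> = (\<Sum>i<r. (1 / 2 ^ p) *\<^sub>R u i \<omega>)"
proof -
  have "indicator {0..<real r / 2 ^ p} s *\<^sub>R step_drift p N u s \<omega> =
      (\<Sum>i<r. indicator {real i / 2 ^ p..<real (Suc i) / 2 ^ p} s *\<^sub>R u i \<omega>)" for s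
  proof (cases "0 \<le> s")
    case True
    have "s < real r / 2 ^ p \<longleftrightarrow> nat \<lfloor>s * 2 ^ p\<rfloor> < r"
      using True by (simp add: pos_less_divide_eq nat_less_iff floor_less_iff)
    moreover have "(\<Sum>i<r. indicator {real i / 2 ^ p..<real (Suc i) / 2 ^ p} s *\<^sub>R u i \<omega>) =
        (if nat \<lfloor>s * 2 ^ p\<rfloor> < r then u (nat \<lfloor>s * 2 ^ p\<rfloor>) \<omega> else 0)"
      using step_drift_eq[OF True, of p r u \<omega>] unfolding step_drift_def .
    ultimately show ?thesis using True assms by (auto simp: step_drift_eq[OF True] indicator_def)
  next
    case False
    have "s \<notin> {real i / 2 ^ p..<real (Suc i) / 2 ^ p}" for i
      using False grid_cell_nonneg by blast
    then show ?thesis using False by simp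
  qed
  then have "displacement (step_drift p N u) 0 (real r / 2 ^ p) \<omega> =
      (LINT s|lborel. (\<Sum>i<r. indicator {real i / 2 ^ p..<real (Suc i) / 2 ^ p} s *\<^sub>R u i \<omega>))"
    unfolding displacement_def by simp
  also have "\<dots> = (\<Sum>i<r. LINT s|lborel. indicator {real i / 2 ^ p..<real (Suc i) / 2 ^ p} s *\<^sub>R u i \<omega>)"
    by (intro Bochner_Integration.integral_sum integrable_scaleR_left integrable_real_indicator) (auto simp: emeasure_grid_cell[simplified])
  also have "\<dots> = (\<Sum>i<r. (1 / 2 ^ p) *\<^sub>R u i \<omega>)"
  proof (rule sum.cong[OF refl])
    fix i
    have "measure lborel {real i / 2 ^ p..<real (Suc i) / 2 ^ p} = 1 / 2 ^ p"
      unfolding measure_def emeasure_grid_cell by simp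
    then have "(LINT s|lborel. (indicator {real i / 2 ^ p..<real (Suc i) / 2 ^ p} s :: real)) = 1 / 2 ^ p" by simp
    moreover have "integrable lborel (\<lambda>s. indicator {real i / 2 ^ p..<real (Suc i) / 2 ^ p} s :: real)"
      by (intro integrable_real_indicator) (auto simp: emeasure_grid_cell[simplified])
    ultimately show "(LINT s|lborel. indicator {real i / 2 ^ p..<real (Suc i) / 2 ^ p} s *\<^sub>R u i \<omega>) = (1 / 2 ^ p) *\<^sub>R u i \<omega>"
      by (subst integral_scaleR_left) auto
  qed
  finally show ?thesis .
qed

lemma steered_path_step_drift:
  assumes u: "adapted p u" and \<omega>: "\<omega> \<in> space M"
  shows "steered_path (step_drift p N u) \<omega> 0 = 0"
    and "i < N \<Longrightarrow> steered_path (step_drift p N u) \<omega> (real (Suc i) / 2 ^ p) -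
      steered_path (step_drift p N u) \<omega> (real i / 2 ^ p) = steered p u i \<omega>"
proof -
  note d = drifted_eq[OF step_drift_progressive[OF u] \<omega> step_drift_energy_finite, of N]
  have s: "steered_path (step_drift p N u) \<omega> t = B t \<omega> + displacement (step_drift p N u) 0 t \<omega>" if "0 \<le> t" for t
    using that step_drift_energy_finite by (simp add: steered_path_def sample_path_nonneg d)
  show "steered_path (step_drift p N u) \<omega> 0 = 0"
    using starts_at_0[OF \<omega>] by (simp add: s displacement_def)
  show "steered_path (step_drift p N u) \<omega> (real (Suc i) / 2 ^ p) -
      steered_path (step_drift p N u) \<omega> (real i / 2 ^ p) = steered p u i \<omega>" if "i < N"
    using that step_drift_displacement[of "Suc i" N p u \<omega>] step_drift_displacement[of i N p u \<omega>]
    by (simp add: s steered_def noise_def del: of_nat_Suc)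
qed

lemma freeze_noise_bounded:
  fixes H :: "'o \<Rightarrow> real^'d \<Rightarrow> real"
  assumes H: "(\<lambda>(\<omega>, y). H \<omega> y) \<in> borel_measurable (\<F> (real j / 2 ^ p) \<Otimes>\<^sub>M borel)" and C: "\<And>\<omega> y. \<omega> \<in> space M \<Longrightarrow> \<bar>H \<omega> y\<bar> \<le> C"
  shows "(\<integral>\<omega>. H \<omega> (noise p j \<omega>) \<partial>M) = (\<integral>\<omega>. (\<integral>y. H \<omega> y \<partial>gauss (1 / 2 ^ p)) \<partial>M)"
    and "(\<lambda>\<omega>. \<integral>y. H \<omega> y \<partial>gauss (1 / 2 ^ p)) \<in> borel_measurable M"
    and "\<omega> \<in> space M \<Longrightarrow> \<bar>\<integral>y. H \<omega> y \<partial>gauss (1 / 2 ^ p)\<bar> \<le> C"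
proof -
  interpret g: gaussian "gauss (1 / 2 ^ p) :: (real^'d) measure" "1 / 2 ^ p" by (rule gaussian_step_noise)
  have H': "(\<lambda>(\<omega>, y). H \<omega> y) \<in> borel_measurable (\<F> (real j / 2 ^ p) \<Otimes>\<^sub>M gauss (1 / 2 ^ p))"
    using H by (simp cong: measurable_cong_sets sets_pair_measure_cong)
  show m: "(\<lambda>\<omega>. \<integral>y. H \<omega> y \<partial>gauss (1 / 2 ^ p)) \<in> borel_measurable M"
    by (rule filtration_measurable_M[OF g.borel_measurable_lebesgue_integral[OF H']])
  have sec: "H \<omega> \<in> borel_measurable borel" if "\<omega> \<in> space M" for \<omega>
  proof -
    have "(\<lambda>y. (\<omega>, y)) \<in> measurable borel (\<F> (real j / 2 ^ p) \<Otimes>\<^sub>M borel)"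
      using that by (intro measurable_Pair measurable_const) auto
    from measurable_compose[OF this H] show ?thesis by simp
  qed
  have Hi: "integrable (gauss (1 / 2 ^ p)) (H \<omega>)" if "\<omega> \<in> space M" for \<omega>
    by (rule g.integrable_bounded[OF sec[OF that] C[OF that]])
  show b: "\<bar>\<integral>y. H \<omega> y \<partial>gauss (1 / 2 ^ p)\<bar> \<le> C" if "\<omega> \<in> space M" for \<omega>
  proof -
    have "\<bar>\<integral>y. H \<omega> y \<partial>gauss (1 / 2 ^ p)\<bar> \<le> (\<integral>y. \<bar>H \<omega> y\<bar> \<partial>gauss (1 / 2 ^ p))" by (rule integral_abs_bound)
    also have "\<dots> \<le> (\<integral>y. C \<partial>(gauss (1 / 2 ^ p) :: (real^'d) measure))" using Hi[OF that] C[OF that] by (intro integral_mono) auto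
    finally show ?thesis by (simp add: g.prob_space[simplified])
  qed
  have Ip: "integrable M (\<lambda>\<omega>. \<integral>y. H \<omega> y \<partial>gauss (1 / 2 ^ p))"
    using m b by (intro integrable_const_bound[where B=C]) (auto intro: AE_I2)
  have nm: "(\<lambda>\<omega>. (\<omega>, noise p j \<omega>)) \<in> measurable M (\<F> (real j / 2 ^ p) \<Otimes>\<^sub>M borel)"
    by (intro measurable_Pair filtration_measurable_M[where s="real j / 2 ^ p"] filtration_measurable_M[OF noise_adapted[of j "Suc j"]]) auto
  have Hm: "(\<lambda>\<omega>. H \<omega> (noise p j \<omega>)) \<in> borel_measurable M"
    using measurable_compose[OF nm H] by simp
  have Hn: "integrable M (\<lambda>\<omega>. H \<omega> (noise p j \<omega>))"
    using Hm C by (intro integrable_const_bound[where B=C]) (auto intro: AE_I2)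
  have C0: "0 \<le> H \<omega> y + C" if "\<omega> \<in> space M" for \<omega> y using C[OF that, of y] by linarith
  have "ennreal (\<integral>\<omega>. H \<omega> (noise p j \<omega>) + C \<partial>M) = (\<integral>\<^sup>+\<omega>. ennreal (H \<omega> (noise p j \<omega>) + C) \<partial>M)"
    using Hn C0 by (intro nn_integral_eq_integral[symmetric]) (auto intro: AE_I2)
  also have "\<dots> = (\<integral>\<^sup>+\<omega>. (\<integral>\<^sup>+y. ennreal (H \<omega> y + C) \<partial>gauss (1 / 2 ^ p)) \<partial>M)"
    by (rule freeze_noise) (use H in \<open>simp add: split_beta'\<close>)
  also have "\<dots> = (\<integral>\<^sup>+\<omega>. ennreal (\<integral>y. H \<omega> y + C \<partial>gauss (1 / 2 ^ p)) \<partial>M)"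
    using Hi C0 by (intro nn_integral_cong nn_integral_eq_integral) auto
  also have "\<dots> = (\<integral>\<^sup>+\<omega>. ennreal ((\<integral>y. H \<omega> y \<partial>gauss (1 / 2 ^ p)) + C) \<partial>M)"
    using Hi by (intro nn_integral_cong) (simp add: g.prob_space[simplified])
  also have "\<dots> = ennreal (\<integral>\<omega>. (\<integral>y. H \<omega> y \<partial>gauss (1 / 2 ^ p)) + C \<partial>M)"
  proof (rule nn_integral_eq_integral)
    show "AE \<omega> in M. 0 \<le> (\<integral>y. H \<omega> y \<partial>gauss (1 / 2 ^ p)) + C"
      using b by (intro AE_I2) (metis abs_le_D2 add.commute diff_ge_0_iff_ge diff_minus_eq_add minus_le_iff)
  qed (use Ip in simp)
  finally have "ennreal (\<integral>\<omega>. H \<omega> (noise p j \<omega>) + C \<partial>M) = ennreal (\<integral>\<omega>. (\<integral>y. H \<omega> y \<partial>gauss (1 / 2 ^ p)) + C \<partial>M)" .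
  moreover have "0 \<le> (\<integral>\<omega>. H \<omega> (noise p j \<omega>) + C \<partial>M)" using C0 by (intro integral_nonneg_AE AE_I2) auto
  moreover have "0 \<le> (\<integral>\<omega>. (\<integral>y. H \<omega> y \<partial>gauss (1 / 2 ^ p)) + C \<partial>M)"
    using b by (intro integral_nonneg_AE AE_I2) (metis abs_le_D2 add.commute diff_ge_0_iff_ge diff_minus_eq_add minus_le_iff)
  ultimately have "(\<integral>\<omega>. H \<omega> (noise p j \<omega>) + C \<partial>M) = (\<integral>\<omega>. (\<integral>y. H \<omega> y \<partial>gauss (1 / 2 ^ p)) + C \<partial>M)"
    by simp
  then show "(\<integral>\<omega>. H \<omega> (noise p j \<omega>) \<partial>M) = (\<integral>\<omega>. (\<integral>y. H \<omega> y \<partial>gauss (1 / 2 ^ p)) \<partial>M)"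
    using Hn Ip by (simp add: prob_space)
qed

text \<open>Dynamic programming backwards along the grid. The conditional mean \<open>G i\<close> of \<open>f\<close> given the first
  \<open>i\<close> increments is again a sum of shifted cosines, with the same bounds. The control at step \<open>i\<close> is
  the gradient of \<open>G (Suc i)\<close> in the next increment, at 0, divided by \<open>G i\<close>. By \<open>gaussian_step\<close> each step
  loses at most a fixed multiple of the squared step size, and the number of steps is inversely
  proportional to the step size.\<close>

theorem lower_bound_trig:
  assumes form: "trig_form f K a c lam T n R" and c0: "0 < c\<^sub>0" and pos: "\<And>w. w \<in> path_space \<Longrightarrow> c\<^sub>0 \<le> f w"
    and \<epsilon>: "0 < \<epsilon>"
  obtains p u U where "n \<le> p" "adapted p u" "\<And>i \<omega>. norm (u i \<omega>) \<le> U"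
    "\<And>i \<omega>. T * 2 ^ p \<le> i \<Longrightarrow> u i \<omega> = 0"
    "ln (\<integral>\<omega>. f (sample_path B \<omega>) \<partial>M) - \<epsilon> \<le>
      (\<integral>\<omega>. ln (f (steered_path (step_drift p (T * 2 ^ p) u) \<omega>)) \<partial>M) -
      (\<Sum>i<T * 2 ^ p. 1 / 2 ^ p / 2 * (\<integral>\<omega>. (norm (u i \<omega>))\<^sup>2 \<partial>M))"
proof -
  define A where "A = (\<Sum>k<K. \<bar>a k\<bar>)"
  define L where "L = step_loss (real CARD('d)) A R c\<^sub>0"
  obtain p where p: "n \<le> p" "real T * L / 2 ^ p \<le> \<epsilon>"
  proof -
    have "(\<lambda>p. real T * L / 2 ^ p) \<longlonglongrightarrow> 0" by (rule LIMSEQ_divide_realpow_zero) simp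
    then have "\<forall>\<^sub>F p in sequentially. real T * L / 2 ^ p < \<epsilon>" using \<epsilon> by (rule order_tendstoD)
    then have "\<forall>\<^sub>F p in sequentially. real T * L / 2 ^ p < \<epsilon> \<and> n \<le> p"
      using eventually_ge_at_top by (rule eventually_conj)
    then obtain p where "real T * L / 2 ^ p < \<epsilon>" "n \<le> p" unfolding eventually_sequentially by blast
    then show thesis using that by simp
  qed
  interpret g: gaussian "gauss (1 / 2 ^ p) :: (real^'d) measure" "1 / 2 ^ p" by (rule gaussian_step_noise)
  let ?\<gamma> = "gauss (1 / 2 ^ p) :: (real^'d) measure"
  define h :: real where "h = 1 / 2 ^ p"
  define N where "N = T * 2 ^ p"
  have R: "norm (lam k t) \<le> R" for k t using form unfolding trig_form_def by blast
  define l where "l i k = lam k (real i / 2 ^ p)" for i k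
  define \<kappa> where "\<kappa> i k = (\<integral>y. cos (l i k \<bullet> y) \<partial>?\<gamma>)" for i k
  define b where "b i k = a k * (\<Prod>j\<in>{i..<N}. \<kappa> j k)" for i k
  have b_step: "b i k = \<kappa> i k * b (Suc i) k" if "i < N" for i k
    unfolding b_def by (subst prod.atLeast_Suc_lessThan[OF that]) simp
  have b_N: "b N k = a k" for k unfolding b_def by simp
  have \<kappa>1: "\<bar>\<kappa> i k\<bar> \<le> 1" for i k unfolding \<kappa>_def by (rule g.abs_cos_integral_le)
  have b_le: "\<bar>b i k\<bar> \<le> \<bar>a k\<bar>" for i k
  proof -
    have "\<bar>\<Prod>j\<in>{i..<N}. \<kappa> j k\<bar> \<le> 1" unfolding abs_prod using \<kappa>1 by (intro prod_le_1) auto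
    then show ?thesis unfolding b_def abs_mult by (simp add: mult_left_le)
  qed
  have b_A: "(\<Sum>k<K. \<bar>b i k\<bar>) \<le> A" for i unfolding A_def using b_le by (intro sum_mono)
  define G where "G i \<theta> = (\<Sum>k<K. b i k * cos (\<theta> k))" for i and \<theta> :: "nat \<Rightarrow> real"
  have G_step: "(\<integral>y. G (Suc i) (\<lambda>k. \<theta> k + l i k \<bullet> y) \<partial>?\<gamma>) = G i \<theta>" if "i < N" for i \<theta>
    unfolding G_def
    by (subst Bochner_Integration.integral_sum)
       (auto intro!: g.integrable_bounded[where C=1] simp: g.integral_cos b_step[OF that] \<kappa>_def[symmetric] mult_ac)
  \<comment> \<open>The phases of the cosines after \<open>i\<close> increments; they carry all that the control needs of the past.\<close>
  define \<Theta> where "\<Theta> i x k = c k + (\<Sum>j<i. l j k \<bullet> x j)" for i k and x :: "nat \<Rightarrow> real^'d"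
  have f_G: "f w = G N (\<Theta> N x)"
    if "w 0 = 0" "\<And>i. i < N \<Longrightarrow> w (real (Suc i) / 2 ^ p) - w (real i / 2 ^ p) = x i" for w x
  proof -
    have "f w = trig_eval K a c lam T p (trunc N x)"
      unfolding N_def by (rule trig_form_increments[where w=w, OF form p(1) that(1) that(2)[unfolded N_def]])
    then show ?thesis unfolding trig_eval_def G_def b_N \<Theta>_def l_def N_def[symmetric] by (simp add: trunc_def)
  qed
  have G_pos: "i \<le> N \<Longrightarrow> c\<^sub>0 \<le> G i (\<Theta> i x)" for i x
  proof (induction "N - i" arbitrary: i x)
    case 0
    then have i: "i = N" by simp
    obtain w where w: "w \<in> path_space" "\<And>i. i < N \<Longrightarrow> w (real (Suc i) / 2 ^ p) - w (real i / 2 ^ p) = x i"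
      using path_with_increments[of N p x] by blast
    show ?case unfolding i using pos[OF w(1)] f_G[OF path_spaceD(2)[OF w(1)] w(2)] by simp
  next
    case (Suc m)
    then have i: "i < N" by simp
    have \<Theta>: "\<Theta> (Suc i) (x(i := y)) = (\<lambda>k. \<Theta> i x k + l i k \<bullet> y)" for y
      unfolding \<Theta>_def by (auto intro!: sum.cong)
    have "c\<^sub>0 \<le> G (Suc i) (\<lambda>k. \<Theta> i x k + l i k \<bullet> y)" for y
      using Suc.hyps(1)[of "Suc i" "x(i := y)"] Suc.hyps(2) i unfolding \<Theta> by simp
    moreover have "integrable ?\<gamma> (\<lambda>y. G (Suc i) (\<lambda>k. \<Theta> i x k + l i k \<bullet> y))"
      unfolding G_def by (intro Bochner_Integration.integrable_sum integrable_mult_right g.integrable_bounded[where C=1]) auto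
    ultimately have "(\<integral>y. c\<^sub>0 \<partial>?\<gamma>) \<le> (\<integral>y. G (Suc i) (\<lambda>k. \<Theta> i x k + l i k \<bullet> y) \<partial>?\<gamma>)"
      by (intro integral_mono) auto
    then show ?case unfolding G_step[OF i] by (simp add: g.prob_space[simplified])
  qed
  have G_A: "G i \<theta> \<le> A" "\<bar>G i \<theta>\<bar> \<le> A" for i \<theta>
  proof -
    have "\<bar>G i \<theta>\<bar> \<le> (\<Sum>k<K. \<bar>b i k * cos (\<theta> k)\<bar>)" unfolding G_def by (rule sum_abs)
    also have "\<dots> \<le> (\<Sum>k<K. \<bar>b i k\<bar>)" by (intro sum_mono) (simp add: abs_mult mult_left_le)
    finally show "\<bar>G i \<theta>\<bar> \<le> A" using b_A[of i] by simp
    then show "G i \<theta> \<le> A" by simp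
  qed
  define lb where "lb = max \<bar>ln c\<^sub>0\<bar> \<bar>ln A\<bar>"
  have lnG: "\<bar>ln (G i (\<Theta> i x))\<bar> \<le> lb" if "i \<le> N" for i x
  proof -
    have "c\<^sub>0 \<le> G i (\<Theta> i x)" by (rule G_pos[OF that])
    then have "ln c\<^sub>0 \<le> ln (G i (\<Theta> i x))" "ln (G i (\<Theta> i x)) \<le> ln A" using c0 G_A(1)[of i "\<Theta> i x"] by auto
    then show ?thesis unfolding lb_def by linarith
  qed
  define ctl where "ctl i \<theta> = (- (1 / G i \<theta>)) *\<^sub>R (\<Sum>k<K. (b (Suc i) k * sin (\<theta> k)) *\<^sub>R l i k)" for i \<theta>
  have h: "0 < h" "h \<le> 1" unfolding h_def by (auto simp: divide_le_eq one_le_power)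
  have step: "norm (ctl i (\<Theta> i x)) \<le> A * R / c\<^sub>0"
    "ln (G i (\<Theta> i x)) - L * h\<^sup>2 \<le> (\<integral>y. ln (G (Suc i) (\<lambda>k. \<Theta> i x k + l i k \<bullet> (y + h *\<^sub>R ctl i (\<Theta> i x)))) \<partial>?\<gamma>) - h / 2 * (norm (ctl i (\<Theta> i x)))\<^sup>2"
    if i: "i < N" for i x
  proof -
    have \<Theta>: "\<Theta> (Suc i) (x(i := y)) = (\<lambda>k. \<Theta> i x k + l i k \<bullet> y)" for y
      unfolding \<Theta>_def by (auto intro!: sum.cong)
    have pos': "c\<^sub>0 \<le> (\<Sum>k<K. b (Suc i) k * cos (\<Theta> i x k + l i k \<bullet> y))" for y
      using G_pos[of "Suc i" "x(i := y)"] i unfolding \<Theta> unfolding G_def by simp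
    have m: "(\<integral>y. (\<Sum>k<K. b (Suc i) k * cos (\<Theta> i x k + l i k \<bullet> y)) \<partial>?\<gamma>) = G i (\<Theta> i x)"
      using G_step[OF i, of "\<Theta> i x"] unfolding G_def .
    have lR: "norm (l i k) \<le> R" for k unfolding l_def by (rule R)
    note st = g.gaussian_step[OF h(2)[unfolded h_def] b_A lR c0 pos', unfolded m]
    show "norm (ctl i (\<Theta> i x)) \<le> A * R / c\<^sub>0" using st(1) unfolding ctl_def .
    show "ln (G i (\<Theta> i x)) - L * h\<^sup>2 \<le> (\<integral>y. ln (G (Suc i) (\<lambda>k. \<Theta> i x k + l i k \<bullet> (y + h *\<^sub>R ctl i (\<Theta> i x)))) \<partial>?\<gamma>) - h / 2 * (norm (ctl i (\<Theta> i x)))\<^sup>2"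
      using st(4) unfolding L_def h_def ctl_def G_def .
  qed
  \<comment> \<open>The steered increments so far. The control depends on them, so they are built along with it.\<close>
  define X where "X = rec_nat (\<lambda>_ _. 0 :: real^'d)
    (\<lambda>i x \<omega>. (x \<omega>)(i := noise p i \<omega> + h *\<^sub>R ctl i (\<Theta> i (x \<omega>))))"
  have X_Suc: "X (Suc i) \<omega> = (X i \<omega>)(i := noise p i \<omega> + h *\<^sub>R ctl i (\<Theta> i (X i \<omega>)))" for i \<omega>
    unfolding X_def by simp
  define u where "u i \<omega> = (if i < N then ctl i (\<Theta> i (X i \<omega>)) else 0)" for i \<omega>
  have \<Theta>_Suc: "\<Theta> (Suc i) (X (Suc i) \<omega>) = (\<lambda>k. \<Theta> i (X i \<omega>) k + l i k \<bullet> (noise p i \<omega> + h *\<^sub>R ctl i (\<Theta> i (X i \<omega>))))" for i \<omega>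
    unfolding \<Theta>_def X_Suc by (auto intro!: sum.cong)
  have \<Theta>m: "(\<lambda>\<omega>. \<Theta> i (X i \<omega>) k) \<in> borel_measurable (\<F> (real i / 2 ^ p))" for i k
  proof (induction i arbitrary: k)
    case 0 show ?case by (simp add: \<Theta>_def)
  next
    case (Suc i)
    have IH: "(\<lambda>\<omega>. \<Theta> i (X i \<omega>) k) \<in> borel_measurable (\<F> (real (Suc i) / 2 ^ p))" for k
      by (rule filtration_measurable_mono[OF grid_mono Suc.IH]) simp
    have nm: "noise p i \<in> borel_measurable (\<F> (real (Suc i) / 2 ^ p))" by (rule noise_adapted) simp
    note [measurable] = IH nm
    show ?case unfolding \<Theta>_Suc ctl_def G_def by measurable
  qed
  have um: "adapted p u"
    unfolding adapted_def
  proof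
    fix i
    note [measurable] = \<Theta>m[of i]
    have "(\<lambda>\<omega>. ctl i (\<Theta> i (X i \<omega>))) \<in> borel_measurable (\<F> (real i / 2 ^ p))"
      unfolding ctl_def G_def by measurable
    then show "u i \<in> borel_measurable (\<F> (real i / 2 ^ p))" unfolding u_def[abs_def] by (cases "i < N") auto
  qed
  have AR0: "0 \<le> A * R / c\<^sub>0"
  proof -
    have "0 \<le> R" using R[of 0 0] norm_ge_zero order_trans by blast
    then show ?thesis using c0 unfolding A_def by (intro divide_nonneg_nonneg mult_nonneg_nonneg sum_nonneg) auto
  qed
  have uU: "norm (u i \<omega>) \<le> A * R / c\<^sub>0" for i \<omega>
    using step(1) AR0 by (simp add: u_def)
  have X_eq: "X i \<omega> j = steered p u j \<omega>" if "j < i" "i \<le> N" for i j \<omega>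
    using that
  proof (induction i)
    case (Suc i)
    show ?case
    proof (cases "j = i")
      case True
      then show ?thesis using Suc.prems by (simp add: X_Suc steered_def u_def h_def)
    next
      case False
      then show ?thesis using Suc by (simp add: X_Suc)
    qed
  qed simp
  let ?V = "\<lambda>i. \<integral>\<omega>. ln (G i (\<Theta> i (X i \<omega>))) \<partial>M"
  have ui: "integrable M (\<lambda>\<omega>. (norm (u i \<omega>))\<^sup>2)" for i
  proof (rule integrable_const_bound[where B="(A * R / c\<^sub>0)\<^sup>2"])
    show "AE \<omega> in M. norm ((norm (u i \<omega>))\<^sup>2) \<le> (A * R / c\<^sub>0)\<^sup>2" using uU by (intro AE_I2) (simp add: power_mono)
    show "(\<lambda>\<omega>. (norm (u i \<omega>))\<^sup>2) \<in> borel_measurable M"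
      using filtration_measurable_M[OF adaptedD[OF um order_refl, of i]] by measurable
  qed
  have V_step: "?V i - L * h\<^sup>2 \<le> ?V (Suc i) - h / 2 * (\<integral>\<omega>. (norm (u i \<omega>))\<^sup>2 \<partial>M)" if i: "i < N" for i
  proof -
    let ?H = "\<lambda>\<omega> y. ln (G (Suc i) (\<lambda>k. \<Theta> i (X i \<omega>) k + l i k \<bullet> (y + h *\<^sub>R ctl i (\<Theta> i (X i \<omega>)))))"
    have \<Theta>': "\<Theta> (Suc i) ((X i \<omega>)(i := z)) = (\<lambda>k. \<Theta> i (X i \<omega>) k + l i k \<bullet> z)" for z \<omega>
      unfolding \<Theta>_def by (auto intro!: sum.cong)
    have Hb: "\<bar>?H \<omega> y\<bar> \<le> lb" for \<omega> y
      using lnG[of "Suc i" "(X i \<omega>)(i := y + h *\<^sub>R ctl i (\<Theta> i (X i \<omega>)))"] i unfolding \<Theta>' by simp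
    have Hm: "(\<lambda>(\<omega>, y). ?H \<omega> y) \<in> borel_measurable (\<F> (real i / 2 ^ p) \<Otimes>\<^sub>M borel)"
    proof -
      note [measurable] = \<Theta>m[of i]
      show ?thesis unfolding ctl_def G_def by measurable
    qed
    note fr = freeze_noise_bounded[OF Hm Hb]
    have Vi: "integrable M (\<lambda>\<omega>. ln (G i (\<Theta> i (X i \<omega>))))"
    proof (rule integrable_const_bound[where B=lb])
      show "AE \<omega> in M. norm (ln (G i (\<Theta> i (X i \<omega>)))) \<le> lb" using lnG i by (intro AE_I2) simp
      have "(\<lambda>\<omega>. ln (G i (\<Theta> i (X i \<omega>)))) \<in> borel_measurable (\<F> (real i / 2 ^ p))"
      proof -
        note [measurable] = \<Theta>m[of i]
        show ?thesis unfolding G_def by measurable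
      qed
      then show "(\<lambda>\<omega>. ln (G i (\<Theta> i (X i \<omega>)))) \<in> borel_measurable M" by (rule filtration_measurable_M)
    qed
    have Ii: "integrable M (\<lambda>\<omega>. \<integral>y. ?H \<omega> y \<partial>?\<gamma>)"
      using fr(2,3) by (intro integrable_const_bound[where B=lb]) (auto intro: AE_I2)
    have "?V i - L * h\<^sup>2 = (\<integral>\<omega>. ln (G i (\<Theta> i (X i \<omega>))) - L * h\<^sup>2 \<partial>M)"
      using Vi by (simp add: prob_space)
    also have "\<dots> \<le> (\<integral>\<omega>. (\<integral>y. ?H \<omega> y \<partial>?\<gamma>) - h / 2 * (norm (u i \<omega>))\<^sup>2 \<partial>M)"
    proof (rule integral_mono)
      fix \<omega>
      show "ln (G i (\<Theta> i (X i \<omega>))) - L * h\<^sup>2 \<le> (\<integral>y. ?H \<omega> y \<partial>?\<gamma>) - h / 2 * (norm (u i \<omega>))\<^sup>2"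
        using step(2)[OF i, of "X i \<omega>"] i by (simp add: u_def)
    qed (use Vi Ii ui in auto)
    also have "\<dots> = (\<integral>\<omega>. (\<integral>y. ?H \<omega> y \<partial>?\<gamma>) \<partial>M) - h / 2 * (\<integral>\<omega>. (norm (u i \<omega>))\<^sup>2 \<partial>M)"
      using Ii ui by simp
    also have "(\<integral>\<omega>. (\<integral>y. ?H \<omega> y \<partial>?\<gamma>) \<partial>M) = ?V (Suc i)"
      unfolding \<Theta>_Suc by (rule fr(1)[symmetric])
    finally show ?thesis .
  qed
  have V_all: "?V 0 - real i * (L * h\<^sup>2) \<le> ?V i - (\<Sum>j<i. h / 2 * (\<integral>\<omega>. (norm (u j \<omega>))\<^sup>2 \<partial>M))" if "i \<le> N" for i
    using that
  proof (induction i)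
    case (Suc i)
    then show ?case using V_step[of i] by (simp add: algebra_simps)
  qed simp
  have G0: "G 0 (\<Theta> 0 x) = (\<integral>\<omega>. f (sample_path B \<omega>) \<partial>M)" for x
  proof -
    let ?Y = "\<lambda>\<omega> i. noise p i \<omega>"
    have "(\<integral>\<omega>. G i (\<Theta> i (?Y \<omega>)) \<partial>M) = G 0 (\<Theta> 0 x)" if "i \<le> N" for i
      using that
    proof (induction i)
      case 0 show ?case by (simp add: \<Theta>_def prob_space)
    next
      case (Suc i)
      have \<Theta>S: "\<Theta> (Suc i) (?Y \<omega>) = (\<lambda>k. \<Theta> i (?Y \<omega>) k + l i k \<bullet> noise p i \<omega>)" for \<omega> unfolding \<Theta>_def by (auto)
      have Ym: "(\<lambda>\<omega>. \<Theta> i (?Y \<omega>) k) \<in> borel_measurable (\<F> (real i / 2 ^ p))" for k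
        unfolding \<Theta>_def by (intro borel_measurable_add borel_measurable_const borel_measurable_sum borel_measurable_inner noise_adapted) auto
      have Hm: "(\<lambda>(\<omega>, y). G (Suc i) (\<lambda>k. \<Theta> i (?Y \<omega>) k + l i k \<bullet> y)) \<in> borel_measurable (\<F> (real i / 2 ^ p) \<Otimes>\<^sub>M borel)"
      proof -
        note [measurable] = Ym
        show ?thesis unfolding G_def by measurable
      qed
      have "(\<integral>\<omega>. G (Suc i) (\<Theta> (Suc i) (?Y \<omega>)) \<partial>M) = (\<integral>\<omega>. (\<integral>y. G (Suc i) (\<lambda>k. \<Theta> i (?Y \<omega>) k + l i k \<bullet> y) \<partial>?\<gamma>) \<partial>M)"
        unfolding \<Theta>S by (rule freeze_noise_bounded(1)[OF Hm G_A(2)])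
      also have "\<dots> = G 0 (\<Theta> 0 x)" using Suc by (simp add: G_step)
      finally show ?case .
    qed
    then have "(\<integral>\<omega>. G N (\<Theta> N (?Y \<omega>)) \<partial>M) = G 0 (\<Theta> 0 x)" by simp
    moreover have "(\<integral>\<omega>. f (sample_path B \<omega>) \<partial>M) = (\<integral>\<omega>. G N (\<Theta> N (?Y \<omega>)) \<partial>M)"
      by (rule Bochner_Integration.integral_cong[OF refl], rule f_G)
         (auto simp: sample_path_nonneg starts_at_0 noise_def)
    ultimately show ?thesis by simp
  qed
  have V0: "?V 0 = ln (\<integral>\<omega>. f (sample_path B \<omega>) \<partial>M)" by (simp add: G0 prob_space)
  have VN: "?V N = (\<integral>\<omega>. ln (f (steered_path (step_drift p N u) \<omega>)) \<partial>M)"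
  proof (rule Bochner_Integration.integral_cong[OF refl])
    fix \<omega> assume \<omega>: "\<omega> \<in> space M"
    have "f (steered_path (step_drift p N u) \<omega>) = G N (\<Theta> N (X N \<omega>))"
      by (rule f_G) (use steered_path_step_drift[OF um \<omega>] X_eq in auto)
    then show "ln (G N (\<Theta> N (X N \<omega>))) = ln (f (steered_path (step_drift p N u) \<omega>))" by simp
  qed
  have loss: "real N * (L * h\<^sup>2) = real T * L / 2 ^ p"
    unfolding N_def h_def by (simp add: power2_eq_square)
  have "ln (\<integral>\<omega>. f (sample_path B \<omega>) \<partial>M) - \<epsilon> \<le>
      (\<integral>\<omega>. ln (f (steered_path (step_drift p N u) \<omega>)) \<partial>M) - (\<Sum>i<N. h / 2 * (\<integral>\<omega>. (norm (u i \<omega>))\<^sup>2 \<partial>M))"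
    using V_all[OF order_refl] p(2) loss unfolding V0 VN by linarith
  moreover have "u i \<omega> = 0" if "T * 2 ^ p \<le> i" for i \<omega> using that by (simp add: u_def N_def)
  ultimately show thesis using that[OF p(1) um uU] unfolding N_def h_def by blast
qed

end

section \<open>Stopping a control when its density becomes large\<close>

lemma trig_form_extend:
  assumes "trig_form f K a c lam T n R" "T \<le> T'"
  shows "trig_form f K a c lam T' n R"
proof -
  have z: "lam k t = 0" if "t \<ge> real T" for k t using assms(1) that unfolding trig_form_def by blast
  have "wiener_sum (lam k) T' p w = wiener_sum (lam k) T p w" for k p w
    by (rule wiener_sum_extend[OF z assms(2)])
  moreover have "lam k t = 0" if "t \<ge> real T'" for k t using z that assms(2) by simp
  ultimately show ?thesis using assms(1) unfolding trig_form_def by simp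
qed

definition refine :: "nat \<Rightarrow> (nat \<Rightarrow> 'a) \<Rightarrow> nat \<Rightarrow> 'a" where
  "refine m u i = u (i div 2 ^ m)"

lemma refine_Suc: "refine (Suc m) u (2 * i) = refine m u i" "refine (Suc m) u (Suc (2 * i)) = refine m u i"
  unfolding refine_def by (simp_all add: div_mult2_eq)

lemma floor_refine:
  assumes "0 \<le> (s::real)"
  shows "nat \<lfloor>s * 2 ^ (p + m)\<rfloor> div 2 ^ m = nat \<lfloor>s * 2 ^ p\<rfloor>"
proof -
  let ?k = "nat \<lfloor>s * 2 ^ p\<rfloor>" and ?j = "nat \<lfloor>s * 2 ^ (p + m)\<rfloor>"
  have k: "real ?k \<le> s * 2 ^ p" "s * 2 ^ p < real ?k + 1" using assms by auto
  have e: "s * 2 ^ (p + m) = s * 2 ^ p * 2 ^ m" by (simp add: power_add)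
  have "real (?k * 2 ^ m) \<le> s * 2 ^ (p + m)" unfolding e using k(1) by simp
  then have 1: "?k * 2 ^ m \<le> ?j" by (rule le_nat_floor)
  have "s * 2 ^ (p + m) < (real ?k + 1) * 2 ^ m" unfolding e using k(2) by simp
  moreover have "real ?j \<le> s * 2 ^ (p + m)" using assms by simp
  ultimately have "real ?j < real (Suc ?k * 2 ^ m)" by (simp add: algebra_simps)
  then have 2: "?j < Suc ?k * 2 ^ m" by (simp only: of_nat_less_iff)
  show ?thesis using 1 2 by (intro div_nat_eqI) (simp_all add: mult.commute)
qed

context standard_brownian_motion
begin

definition stopped :: "real \<Rightarrow> nat \<Rightarrow> (nat \<Rightarrow> 'o \<Rightarrow> real^'d) \<Rightarrow> nat \<Rightarrow> 'o \<Rightarrow> real^'d" where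
  "stopped \<kappa> p u i \<omega> = (if \<forall>l\<le>i. log_density p u l \<omega> < \<kappa> then u i \<omega> else 0)"

lemma adapted_refine:
  assumes "adapted p u" shows "adapted (p + m) (refine m u)"
  unfolding adapted_def refine_def
proof
  fix i :: nat
  have "real (i div 2 ^ m * 2 ^ m) \<le> real i" by (rule of_nat_mono) (rule div_times_less_eq_dividend)
  then have "real (i div 2 ^ m) * 2 ^ m \<le> real i" by simp
  then have "real (i div 2 ^ m) / 2 ^ p \<le> real i / 2 ^ (p + m)"
    by (simp add: power_add field_simps)
  then show "u (i div 2 ^ m) \<in> borel_measurable (\<F> (real i / 2 ^ (p + m)))"
    by (rule filtration_measurable_mono[OF _ adaptedD[OF assms order_refl]])
qed

lemma step_drift_refine:
  "step_drift (p + m) (N * 2 ^ m) (refine m u) s \<omega> = step_drift p N u s \<omega>" if "0 \<le> s"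
proof -
  have "nat \<lfloor>s * 2 ^ (p + m)\<rfloor> < N * 2 ^ m \<longleftrightarrow> nat \<lfloor>s * 2 ^ p\<rfloor> < N"
    unfolding floor_refine[OF that, of p m, symmetric] by (simp add: div_less_iff_less_mult)
  then show ?thesis unfolding step_drift_eq[OF that] refine_def floor_refine[OF that] by simp
qed

text \<open>On the two halves of a cell the noise adds up to the noise of the cell and the costs to its cost.
  Thus the density at a time of a grid does not depend on the finer grid on which it is computed.\<close>

lemma log_density_refine_Suc:
  "log_density (Suc q) (refine (Suc m) u) (2 * l) \<omega> = log_density q (refine m u) l \<omega>"
proof -
  have e: "noise (Suc q) (2 * i) \<omega> + noise (Suc q) (Suc (2 * i)) \<omega> = noise q i \<omega>" for i
  proof -
    have "real (Suc (Suc (2 * i))) / 2 ^ Suc q = real (Suc i) / 2 ^ q" "real (2 * i) / 2 ^ Suc q = real i / 2 ^ q"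
      by (simp_all add: field_simps)
    then show ?thesis unfolding noise_def by simp
  qed
  show ?thesis
  proof (induction l)
    case (Suc l)
    have "log_density (Suc q) (refine (Suc m) u) (2 * Suc l) \<omega> = log_density (Suc q) (refine (Suc m) u) (2 * l) \<omega> +
      refine m u l \<omega> \<bullet> (noise (Suc q) (2 * l) \<omega> + noise (Suc q) (Suc (2 * l)) \<omega>) + 1 / 2 ^ q / 2 * (norm (refine m u l \<omega>))\<^sup>2"
      by (simp add: log_density_def refine_Suc inner_add_right)
    then show ?case unfolding Suc e by (simp add: log_density_def)
  qed (simp add: log_density_def)
qed

lemma adapted_stopped:
  assumes "adapted p u" shows "adapted p (stopped \<kappa> p u)"
  unfolding adapted_def
proof
  fix i
  let ?F = "\<F> (real i / 2 ^ p)"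
  have Lm: "log_density p u l \<in> borel_measurable ?F" if "l \<le> i" for l
    by (rule filtration_measurable_mono[OF grid_mono[OF that] log_density_adapted[OF assms]])
  have "{\<omega> \<in> space ?F. \<forall>l\<in>{..i}. log_density p u l \<omega> \<in> {..<\<kappa>}} \<in> sets ?F"
    using Lm by (intro sets.sets_Collect_finite_All sets_Collect_mem[where K=borel]) auto
  then have "{\<omega> \<in> space ?F. \<forall>l\<le>i. log_density p u l \<omega> < \<kappa>} \<in> sets ?F" by (simp only: Ball_def atMost_iff lessThan_iff)
  from measurable_If[OF adaptedD[OF assms order_refl] borel_measurable_const this, of 0]
  show "stopped \<kappa> p u i \<in> borel_measurable ?F" by (simp only: stopped_def[abs_def])
qed

text \<open>Before the last active step the density is below \<open>e\<^sup>\<kappa>\<close>, and after it the density does not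
  change; \<open>r\<close> bounds the overshoot in that step.\<close>

lemma log_density_stopped:
  assumes "0 < \<kappa>" and r: "0 \<le> r" "\<And>i. i < n \<Longrightarrow> u i \<omega> \<bullet> noise p i \<omega> + 1 / 2 ^ p / 2 * (norm (u i \<omega>))\<^sup>2 \<le> r"
  shows "log_density p (stopped \<kappa> p u) n \<omega> \<le> \<kappa> + r"
proof -
  have "j \<le> n \<Longrightarrow> ((\<forall>l\<le>j. log_density p u l \<omega> < \<kappa>) \<longrightarrow> log_density p (stopped \<kappa> p u) j \<omega> = log_density p u j \<omega>) \<and>
      log_density p (stopped \<kappa> p u) j \<omega> \<le> \<kappa> + r" for j
  proof (induction j)
    case 0 show ?case using assms(1) r(1) by (simp add: log_density_def)
  next
    case (Suc j)
    then have IH: "(\<forall>l\<le>j. log_density p u l \<omega> < \<kappa>) \<longrightarrow> log_density p (stopped \<kappa> p u) j \<omega> = log_density p u j \<omega>"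
      "log_density p (stopped \<kappa> p u) j \<omega> \<le> \<kappa> + r" by auto
    have S: "log_density p w (Suc j) \<omega> = log_density p w j \<omega> + (w j \<omega> \<bullet> noise p j \<omega> + 1 / 2 ^ p / 2 * (norm (w j \<omega>))\<^sup>2)" for w
      by (simp add: log_density_def)
    show ?case
    proof (cases "\<forall>l\<le>j. log_density p u l \<omega> < \<kappa>")
      case True
      then have s: "stopped \<kappa> p u j \<omega> = u j \<omega>" by (simp add: stopped_def)
      have eq: "log_density p (stopped \<kappa> p u) (Suc j) \<omega> = log_density p u (Suc j) \<omega>"
        unfolding S s using IH(1) True by simp
      have "log_density p u (Suc j) \<omega> \<le> \<kappa> + r"
        unfolding S using True r(2)[of j] Suc.prems by (smt (verit) Suc_le_lessD order_refl)
      then show ?thesis using eq by simp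
    next
      case False
      then have "stopped \<kappa> p u j \<omega> = 0" by (auto simp: stopped_def)
      then have "log_density p (stopped \<kappa> p u) (Suc j) \<omega> = log_density p (stopped \<kappa> p u) j \<omega>" unfolding S by simp
      moreover have "\<not> (\<forall>l\<le>Suc j. log_density p u l \<omega> < \<kappa>)" using False by (meson le_SucI)
      ultimately show ?thesis using IH(2) by (intro conjI impI) (blast, simp)
    qed
  qed
  then show ?thesis by blast
qed

lemma step_drift_truncate:
  assumes "N \<le> N'" "\<And>i. N \<le> i \<Longrightarrow> u i \<omega> = 0"
  shows "step_drift p N' u s \<omega> = step_drift p N u s \<omega>"
  unfolding step_drift_def by (rule sum.mono_neutral_right) (use assms in auto)

lemma mean_energy_step_drift:
  assumes "adapted p u" "\<And>i \<omega>. norm (u i \<omega>) \<le> U"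
  shows "integrable M (\<lambda>\<omega>. (norm (u i \<omega>))\<^sup>2)"
    and "(\<integral>\<^sup>+\<omega>. energy (step_drift p N u) \<omega> \<partial>M) = ennreal (\<Sum>i<N. 1 / 2 ^ p * (\<integral>\<omega>. (norm (u i \<omega>))\<^sup>2 \<partial>M))"
    and "mean_energy (step_drift p N u) = (\<Sum>i<N. 1 / 2 ^ p * (\<integral>\<omega>. (norm (u i \<omega>))\<^sup>2 \<partial>M))"
    and "step_drift p N u \<in> finite_energy_drifts M B"
proof -
  have um: "(\<lambda>\<omega>. (norm (u i \<omega>))\<^sup>2) \<in> borel_measurable M" for i
    using filtration_measurable_M[OF adaptedD[OF assms(1) order_refl, of i]] by measurable
  show ui: "integrable M (\<lambda>\<omega>. (norm (u i \<omega>))\<^sup>2)" for i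
    using um assms(2) by (intro integrable_const_bound[where B="U\<^sup>2"]) (auto intro!: AE_I2 power_mono)
  have "(\<integral>\<^sup>+\<omega>. energy (step_drift p N u) \<omega> \<partial>M) = (\<Sum>i<N. \<integral>\<^sup>+\<omega>. ennreal (1 / 2 ^ p * (norm (u i \<omega>))\<^sup>2) \<partial>M)"
    unfolding step_drift_energy using um by (intro nn_integral_sum) auto
  also have "\<dots> = (\<Sum>i<N. ennreal (1 / 2 ^ p * (\<integral>\<omega>. (norm (u i \<omega>))\<^sup>2 \<partial>M)))"
    using ui by (intro sum.cong refl) (subst nn_integral_eq_integral, auto)
  also have "\<dots> = ennreal (\<Sum>i<N. 1 / 2 ^ p * (\<integral>\<omega>. (norm (u i \<omega>))\<^sup>2 \<partial>M))"
    by (rule sum_ennreal) (simp add: mult_nonneg_nonneg)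
  finally show e: "(\<integral>\<^sup>+\<omega>. energy (step_drift p N u) \<omega> \<partial>M) = ennreal (\<Sum>i<N. 1 / 2 ^ p * (\<integral>\<omega>. (norm (u i \<omega>))\<^sup>2 \<partial>M))" .
  then show "mean_energy (step_drift p N u) = (\<Sum>i<N. 1 / 2 ^ p * (\<integral>\<omega>. (norm (u i \<omega>))\<^sup>2 \<partial>M))"
    unfolding mean_energy_def e by (intro enn2real_ennreal sum_nonneg) auto
  show "step_drift p N u \<in> finite_energy_drifts M B"
    unfolding finite_energy_drifts_def using step_drift_progressive[OF assms(1)] e by auto
qed

text \<open>Adding to \<open>ln f\<close> the indicator of the event that the level is reached raises the mean reward by
  the probability \<open>P\<close> of the event. It raises the weighted mean of the exponential by at most
  \<open>(e - 1) * C * exp (- \<kappa>) * P\<close>, because at the first passage the weight is at most \<open>exp (- \<kappa>)\<close> and the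
  weight is a martingale. By the assumption on \<open>\<kappa>\<close> this is at most the fraction \<open>(e - 1) / 2 * P\<close> of the
  mean of \<open>f\<close>. As \<open>(e - 1) / 2 < 1\<close>, a control that is optimal up to \<open>\<epsilon>\<close> leaves room only for a small
  \<open>P\<close>.\<close>

lemma stopping_probability:
  assumes u: "adapted p u" "\<And>i \<omega>. norm (u i \<omega>) \<le> U" and np: "n \<le> p"
    and form: "trig_form f K a c lam T n R"
    and f: "0 < c\<^sub>0" "\<And>w. w \<in> path_space \<Longrightarrow> c\<^sub>0 \<le> f w \<and> f w \<le> C"
    and \<kappa>: "C * exp (- \<kappa>) \<le> (\<integral>\<omega>. f (sample_path B \<omega>) \<partial>M) / 2"
    and opt: "ln (\<integral>\<omega>. f (sample_path B \<omega>) \<partial>M) - \<epsilon> \<le>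
      (\<integral>\<omega>. ln (f (steered_path (step_drift p (T * 2 ^ p) u) \<omega>)) \<partial>M) -
      (\<Sum>i<T * 2 ^ p. 1 / 2 ^ p / 2 * (\<integral>\<omega>. (norm (u i \<omega>))\<^sup>2 \<partial>M))"
  shows "prob {\<omega> \<in> space M. \<exists>l\<le>T * 2 ^ p. \<kappa> \<le> log_density p u l \<omega>} \<le> 8 * \<epsilon>"
proof -
  define N where "N = T * 2 ^ p"
  define X where "X = steered_path (step_drift p N u)"
  define Z where "Z = (\<integral>\<omega>. f (sample_path B \<omega>) \<partial>M)"
  have sd: "progressively_measurable \<F> (step_drift p N u)" by (rule step_drift_progressive[OF u(1)])
  have Xm: "X \<in> measurable M borel_path_space" unfolding X_def by (rule steered_path_measurable[OF sd])
  have XP: "X \<omega> \<in> path_space" if "\<omega> \<in> space M" for \<omega> using measurable_space[OF Xm that] by simp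
  have fm: "f \<in> borel_measurable borel_path_space"
  proof -
    have "f w = (\<Sum>k<K. a k * cos (c k + wiener_sum (lam k) T n w))" if "w \<in> path_space" for w
      using form path_spaceD(2)[OF that] unfolding trig_form_def by blast
    then show ?thesis
      by (subst measurable_cong[where g="\<lambda>w. \<Sum>k<K. a k * cos (c k + wiener_sum (lam k) T n w)"]) auto
  qed
  have fX: "(\<lambda>\<omega>. f (X \<omega>)) \<in> borel_measurable M" by (rule measurable_compose[OF Xm fm])
  have fB: "(\<lambda>\<omega>. f (sample_path B \<omega>)) \<in> borel_measurable M" by (rule measurable_compose[OF sample_path_measurable fm])
  obtain \<omega>\<^sub>0 where "\<omega>\<^sub>0 \<in> space M" using not_empty by blast
  then have C0: "c\<^sub>0 \<le> C" using f(2)[OF sample_path_in_path_space] by force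
  have Bi: "integrable M (\<lambda>\<omega>. f (sample_path B \<omega>))"
  proof (rule integrable_const_bound[where B=C])
    show "AE \<omega> in M. norm (f (sample_path B \<omega>)) \<le> C"
    proof (rule AE_I2)
      fix \<omega> assume "\<omega> \<in> space M"
      from f(2)[OF sample_path_in_path_space[OF this]] f(1) show "norm (f (sample_path B \<omega>)) \<le> C"
        unfolding real_norm_def by linarith
    qed
  qed (rule fB)
  have "(\<integral>\<omega>. c\<^sub>0 \<partial>M) \<le> Z" unfolding Z_def using Bi f sample_path_in_path_space by (intro integral_mono) auto
  then have Z0: "0 < Z" using f(1) by (simp add: prob_space)
  have Zn: "(\<integral>\<^sup>+\<omega>. ennreal (f (sample_path B \<omega>)) \<partial>M) = ennreal Z"
    unfolding Z_def using f sample_path_in_path_space by (intro nn_integral_eq_integral Bi AE_I2) force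
  define A where "A = {\<omega> \<in> space M. \<exists>l\<le>N. \<kappa> \<le> log_density p u l \<omega>}"
  \<comment> \<open>First passage at step \<open>l\<close>, an event of the past of that step.\<close>
  define \<tau> where "\<tau> l = {\<omega> \<in> space M. \<kappa> \<le> log_density p u l \<omega> \<and> (\<forall>l'<l. log_density p u l' \<omega> < \<kappa>)}" for l
  have \<tau>F: "\<tau> l \<in> sets (\<F> (real l / 2 ^ p))" for l
  proof -
    let ?F = "\<F> (real l / 2 ^ p)"
    have Lm: "log_density p u l' \<in> borel_measurable ?F" if "l' \<le> l" for l'
      by (rule filtration_measurable_mono[OF grid_mono[OF that] log_density_adapted[OF u(1)]])
    have "{\<omega> \<in> space ?F. \<forall>l'\<in>{..<l}. log_density p u l' \<omega> \<in> {..<\<kappa>}} \<in> sets ?F"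
      using Lm by (intro sets.sets_Collect_finite_All sets_Collect_mem[where K=borel]) auto
    moreover have "{\<omega> \<in> space ?F. log_density p u l \<omega> \<in> {\<kappa>..}} \<in> sets ?F"
      by (rule sets_Collect_mem[OF Lm, where A="{\<kappa>..}"]) auto
    moreover have "\<tau> l = {\<omega> \<in> space ?F. log_density p u l \<omega> \<in> {\<kappa>..}} \<inter> {\<omega> \<in> space ?F. \<forall>l'\<in>{..<l}. log_density p u l' \<omega> \<in> {..<\<kappa>}}"
      unfolding \<tau>_def by auto
    ultimately show ?thesis by (simp only: sets.Int)
  qed
  have \<tau>M: "\<tau> l \<in> sets M" for l using \<tau>F sets_filtration_subset by blast
  have A_eq: "A = (\<Union>l\<in>{..N}. \<tau> l)"
  proof
    show "(\<Union>l\<in>{..N}. \<tau> l) \<subseteq> A" unfolding A_def \<tau>_def by auto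
    show "A \<subseteq> (\<Union>l\<in>{..N}. \<tau> l)"
    proof
      fix \<omega> assume "\<omega> \<in> A"
      then obtain l where l: "\<omega> \<in> space M" "l \<le> N" "\<kappa> \<le> log_density p u l \<omega>" unfolding A_def by blast
      define m where "m = (LEAST l. \<kappa> \<le> log_density p u l \<omega>)"
      have "\<kappa> \<le> log_density p u m \<omega>" "m \<le> l" unfolding m_def using l(3) by (auto intro: LeastI Least_le)
      moreover have "log_density p u l' \<omega> < \<kappa>" if "l' < m" for l' using not_less_Least[of l' "\<lambda>l. \<kappa> \<le> log_density p u l \<omega>"] that unfolding m_def by auto
      ultimately show "\<omega> \<in> (\<Union>l\<in>{..N}. \<tau> l)" using l unfolding \<tau>_def by (auto intro!: bexI[of _ m])
    qed
  qed
  have disj: "disjoint_family_on \<tau> {..N}"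
    unfolding disjoint_family_on_def
  proof (intro ballI impI)
    fix l l' :: nat assume "l \<noteq> l'"
    then consider "l < l'" | "l' < l" by linarith
    then show "\<tau> l \<inter> \<tau> l' = {}" unfolding \<tau>_def by cases fastforce+
  qed
  have AM [measurable]: "A \<in> sets M" unfolding A_eq using \<tau>M by auto
  have indA: "indicator A \<omega> = (\<Sum>l\<le>N. indicator (\<tau> l) \<omega> :: ennreal)" for \<omega>
    unfolding A_eq by (rule indicator_UN_disjoint[OF _ disj]) simp
  let ?z = "\<lambda>j \<omega>. ennreal (exp (- log_density p u j \<omega>))"
  have Lm [measurable]: "log_density p u j \<in> borel_measurable M" for j
    by (rule filtration_measurable_M[OF log_density_adapted[OF u(1)]])
  have wA: "(\<integral>\<^sup>+\<omega>. indicator A \<omega> * ?z N \<omega> \<partial>M) \<le> ennreal (exp (- \<kappa>)) * emeasure M A"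
  proof -
    have "(\<integral>\<^sup>+\<omega>. indicator A \<omega> * ?z N \<omega> \<partial>M) = (\<Sum>l\<le>N. \<integral>\<^sup>+\<omega>. indicator (\<tau> l) \<omega> * ?z N \<omega> \<partial>M)"
      unfolding indA sum_distrib_right using \<tau>M by (intro nn_integral_sum) auto
    also have "\<dots> = (\<Sum>l\<le>N. \<integral>\<^sup>+\<omega>. indicator (\<tau> l) \<omega> * ?z l \<omega> \<partial>M)"
      by (intro sum.cong refl weight_martingale[OF u(1) \<tau>F]) auto
    also have "\<dots> \<le> (\<Sum>l\<le>N. \<integral>\<^sup>+\<omega>. ennreal (exp (- \<kappa>)) * indicator (\<tau> l) \<omega> \<partial>M)"
      by (intro sum_mono nn_integral_mono) (auto simp: \<tau>_def indicator_def intro: ennreal_leI)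
    also have "\<dots> = ennreal (exp (- \<kappa>)) * (\<Sum>l\<le>N. emeasure M (\<tau> l))"
      using \<tau>M by (simp add: nn_integral_cmult_indicator sum_distrib_left)
    also have "(\<Sum>l\<le>N. emeasure M (\<tau> l)) = emeasure M A"
      unfolding A_eq using \<tau>M by (intro sum_emeasure disj) auto
    finally show ?thesis .
  qed
  define P where "P = prob A"
  define Y where "Y \<omega> = ln (f (X \<omega>)) + indicator A \<omega>" for \<omega>
  have fXp: "c\<^sub>0 \<le> f (X \<omega>)" "f (X \<omega>) \<le> C" if "\<omega> \<in> space M" for \<omega> using f(2) XP[OF that] by auto
  have lnXi: "integrable M (\<lambda>\<omega>. ln (f (X \<omega>)))"
  proof (rule integrable_const_bound[where B="max \<bar>ln c\<^sub>0\<bar> \<bar>ln C\<bar>"])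
    show "AE \<omega> in M. norm (ln (f (X \<omega>))) \<le> max \<bar>ln c\<^sub>0\<bar> \<bar>ln C\<bar>"
    proof (rule AE_I2)
      fix \<omega> assume "\<omega> \<in> space M"
      from fXp[OF this] f(1) have "ln c\<^sub>0 \<le> ln (f (X \<omega>))" "ln (f (X \<omega>)) \<le> ln C" by auto
      then show "norm (ln (f (X \<omega>))) \<le> max \<bar>ln c\<^sub>0\<bar> \<bar>ln C\<bar>" unfolding real_norm_def by linarith
    qed
  qed (use fX in measurable)
  have Ai: "integrable M (indicator A :: _ \<Rightarrow> real)" using AM by (intro integrable_real_indicator) (auto simp: less_top[symmetric])
  have Yi: "integrable M Y" unfolding Y_def using lnXi Ai by auto
  have YE: "(\<integral>\<omega>. Y \<omega> \<partial>M) = (\<integral>\<omega>. ln (f (X \<omega>)) \<partial>M) + P"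
    unfolding Y_def P_def using lnXi Ai AM by simp
  let ?c = "Z + (exp 1 - 1) * (C * (exp (- \<kappa>) * P))"
  have e1: "(1::real) \<le> exp 1" by simp
  have Cp: "0 \<le> C" using C0 f(1) by simp
  have P0: "0 \<le> P" unfolding P_def by simp
  have le: "(\<integral>\<^sup>+\<omega>. ennreal (exp (Y \<omega>)) * ?z N \<omega> \<partial>M) \<le> ennreal ?c"
  proof -
    have "(\<integral>\<^sup>+\<omega>. ennreal (exp (Y \<omega>)) * ?z N \<omega> \<partial>M) \<le>
        (\<integral>\<^sup>+\<omega>. ennreal (f (X \<omega>)) * ?z N \<omega> + ennreal ((exp 1 - 1) * C) * (indicator A \<omega> * ?z N \<omega>) \<partial>M)"
    proof (rule nn_integral_mono)
      fix \<omega> assume \<omega>: "\<omega> \<in> space M"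
      have "exp (Y \<omega>) = f (X \<omega>) * exp (indicator A \<omega>)" unfolding Y_def exp_add using fXp(1)[OF \<omega>] f(1) by simp
      also have "\<dots> = f (X \<omega>) + (exp 1 - 1) * f (X \<omega>) * indicator A \<omega>" by (simp add: indicator_def algebra_simps)
      also have "\<dots> \<le> f (X \<omega>) + (exp 1 - 1) * C * indicator A \<omega>"
        using fXp(2)[OF \<omega>] by (intro add_left_mono mult_right_mono mult_left_mono) auto
      finally have "ennreal (exp (Y \<omega>)) \<le> ennreal (f (X \<omega>) + (exp 1 - 1) * C * indicator A \<omega>)" by (rule ennreal_leI)
      also have "\<dots> = ennreal (f (X \<omega>)) + ennreal ((exp 1 - 1) * C) * indicator A \<omega>"
        using fXp(1)[OF \<omega>] f(1) Cp by (auto simp: indicator_def intro!: ennreal_plus)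
      finally have "ennreal (exp (Y \<omega>)) * ?z N \<omega> \<le> (ennreal (f (X \<omega>)) + ennreal ((exp 1 - 1) * C) * indicator A \<omega>) * ?z N \<omega>"
        by (rule mult_right_mono) simp
      then show "ennreal (exp (Y \<omega>)) * ?z N \<omega> \<le> ennreal (f (X \<omega>)) * ?z N \<omega> + ennreal ((exp 1 - 1) * C) * (indicator A \<omega> * ?z N \<omega>)"
        by (simp add: distrib_right mult.assoc)
    qed
    also have "\<dots> = (\<integral>\<^sup>+\<omega>. ennreal (f (X \<omega>)) * ?z N \<omega> \<partial>M) + ennreal ((exp 1 - 1) * C) * (\<integral>\<^sup>+\<omega>. indicator A \<omega> * ?z N \<omega> \<partial>M)"
      using fX by (subst nn_integral_add) (auto simp: nn_integral_cmult)
    also have "(\<integral>\<^sup>+\<omega>. ennreal (f (X \<omega>)) * ?z N \<omega> \<partial>M) = ennreal Z"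
    proof -
      have sp: "sample_path (\<lambda>t \<omega>. X \<omega> t) \<omega> = X \<omega>" if "\<omega> \<in> space M" for \<omega>
        using path_spaceD(3)[OF XP[OF that]] unfolding sample_path_def by (simp add: extensional_restrict)
      have "(\<integral>\<^sup>+\<omega>. ennreal (f (X \<omega>)) * ?z N \<omega> \<partial>M) = (\<integral>\<^sup>+\<omega>. ennreal (f (sample_path (\<lambda>t \<omega>. X \<omega> t) \<omega>)) * ?z (T * 2 ^ p) \<omega> \<partial>M)"
        unfolding N_def by (intro nn_integral_cong) (simp add: sp)
      also have "\<dots> = (\<integral>\<^sup>+\<omega>. ennreal (f (sample_path B \<omega>)) \<partial>M)"
      proof (rule girsanov_trig_form[OF form np _ u(1)])
        show "AE \<omega> in M. X \<omega> 0 = 0 \<and> (\<forall>i<T * 2 ^ p. X \<omega> (real (Suc i) / 2 ^ p) - X \<omega> (real i / 2 ^ p) = steered p u i \<omega>)"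
          unfolding X_def N_def by (intro AE_I2 conjI allI impI steered_path_step_drift[OF u(1)])
      qed simp
      finally show ?thesis using Zn by simp
    qed
    also have "ennreal ((exp 1 - 1) * C) * (\<integral>\<^sup>+\<omega>. indicator A \<omega> * ?z N \<omega> \<partial>M) \<le> ennreal ((exp 1 - 1) * C) * (ennreal (exp (- \<kappa>)) * emeasure M A)"
      by (intro mult_left_mono wA) simp
    also have "ennreal Z + ennreal ((exp 1 - 1) * C) * (ennreal (exp (- \<kappa>)) * emeasure M A) = ennreal ?c"
      unfolding emeasure_eq_measure P_def[symmetric] using Z0 Cp P0 e1
      by (subst ennreal_plus) (auto simp: ennreal_mult mult.assoc intro!: mult_nonneg_nonneg)
    finally show ?thesis by (simp add: add_left_mono)
  qed
  have c_pos: "0 < ?c" using Z0 Cp P0 e1 by (intro add_pos_nonneg mult_nonneg_nonneg) auto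
  have "(\<integral>\<omega>. Y \<omega> \<partial>M) - (\<Sum>i<N. 1 / 2 ^ p / 2 * (\<integral>\<omega>. (norm (u i \<omega>))\<^sup>2 \<partial>M)) \<le> ln ?c"
    by (rule steering_upper_bound[OF u(1) mean_energy_step_drift(1)[OF u] Yi c_pos le])
  then have "ln Z - \<epsilon> + P \<le> ln ?c" using opt unfolding YE X_def N_def Z_def by linarith
  also have "ln ?c \<le> ln (Z * (1 + (exp 1 - 1) / 2 * P))"
  proof -
    have "(exp 1 - 1) * (C * (exp (- \<kappa>) * P)) = (exp 1 - 1) * P * (C * exp (- \<kappa>))" by simp
    also have "\<dots> \<le> (exp 1 - 1) * P * (Z / 2)" using \<kappa> P0 e1 unfolding Z_def by (intro mult_left_mono) auto
    finally have "(exp 1 - 1) * (C * (exp (- \<kappa>) * P)) \<le> (exp 1 - 1) * P * (Z / 2)" .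
    moreover have "Z * (1 + (exp 1 - 1) / 2 * P) = Z + (exp 1 - 1) * P * (Z / 2)" by (simp add: distrib_left)
    ultimately have "?c \<le> Z * (1 + (exp 1 - 1) / 2 * P)" by linarith
    then show ?thesis using c_pos by simp
  qed
  also have "\<dots> = ln Z + ln (1 + (exp 1 - 1) / 2 * P)"
  proof (rule ln_mult_pos[OF Z0])
    show "0 < 1 + (exp 1 - 1) / 2 * P" using P0 e1 by (intro add_pos_nonneg mult_nonneg_nonneg) auto
  qed
  also have "ln (1 + (exp 1 - 1) / 2 * P) \<le> (exp 1 - 1) / 2 * P"
    using P0 e1 by (intro ln_add_one_self_le_self) auto
  finally have "P * (1 - (exp 1 - 1) / 2) \<le> \<epsilon>" by (simp add: algebra_simps)
  \<comment> \<open>As \<open>e < 2.72\<close>, the factor on the right is at least 0.14.\<close>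
  moreover have "P * (1 / 8) \<le> P * (1 - (exp 1 - 1) / 2)"
    using P0 e_less_272 by (intro mult_left_mono) auto
  ultimately show ?thesis unfolding P_def A_def N_def by simp
qed

end

lemma refine_bound: "(\<And>i \<omega>. norm (u i \<omega>) \<le> U) \<Longrightarrow> norm (refine m u i \<omega>) \<le> U"
  by (simp add: refine_def)

context standard_brownian_motion
begin

lemma energy_cong: "(\<And>s. 0 \<le> s \<Longrightarrow> v s \<omega> = w s \<omega>) \<Longrightarrow> energy v \<omega> = energy w \<omega>"
  unfolding energy_def by (intro nn_integral_cong) (simp add: indicator_def)

lemma steered_path_cong:
  assumes "\<And>s. 0 \<le> s \<Longrightarrow> v s \<omega> = w s \<omega>"
  shows "steered_path v \<omega> = steered_path w \<omega>"
proof -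
  have "drifted B v t \<omega> = drifted B w t \<omega>" for t
    unfolding drifted_def set_lebesgue_integral_def
    by (intro arg_cong2[where f="(+)"] refl Bochner_Integration.integral_cong) (simp add: indicator_def assms)
  moreover have "energy v \<omega> = energy w \<omega>" by (rule energy_cong) (rule assms)
  ultimately show ?thesis unfolding steered_path_def sample_path_def by simp
qed

lemma stopped_bound:
  assumes "\<And>i \<omega>. norm (u i \<omega>) \<le> U"
  shows "norm (stopped \<kappa> p u i \<omega>) \<le> U"
proof -
  have "0 \<le> U" using assms norm_ge_zero order_trans by blast
  then show ?thesis using assms by (simp add: stopped_def)
qed

text \<open>The drift is switched off at the first dyadic time, of any level from \<open>p\<close> on, at which the density
  reaches \<open>e\<^sup>\<kappa>\<close>. On a single grid the density would overshoot by the increment of one cell.\<close>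

definition stopped_drift :: "real \<Rightarrow> nat \<Rightarrow> nat \<Rightarrow> (nat \<Rightarrow> 'o \<Rightarrow> real^'d) \<Rightarrow> real \<Rightarrow> 'o \<Rightarrow> real^'d" where
  "stopped_drift \<kappa> p N u s \<omega> =
    (if 0 \<le> s \<and> (\<forall>m. \<forall>l\<le>nat \<lfloor>s * 2 ^ (p + m)\<rfloor>. log_density (p + m) (refine m u) l \<omega> < \<kappa>)
     then step_drift p N u s \<omega> else 0)"

text \<open>Stopping on one grid. The drifts for finer and finer grids converge to \<open>stopped_drift\<close>, because
  passages seen on a grid are seen on every finer grid.\<close>

definition stopped_step_drift :: "real \<Rightarrow> nat \<Rightarrow> nat \<Rightarrow> (nat \<Rightarrow> 'o \<Rightarrow> real^'d) \<Rightarrow> nat \<Rightarrow> real \<Rightarrow> 'o \<Rightarrow> real^'d" where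
  "stopped_step_drift \<kappa> p N u m = step_drift (p + m) (N * 2 ^ m) (stopped \<kappa> (p + m) (refine m u))"

lemma step_drift_negative: "s < 0 \<Longrightarrow> step_drift p N u s \<omega> = 0"
  unfolding step_drift_def using grid_cell_nonneg[of s] by (intro sum.neutral) (force simp: indicator_def)

lemma stopped_step_drift_eq:
  "stopped_step_drift \<kappa> p N u m s \<omega> =
    (if 0 \<le> s \<and> (\<forall>l\<le>nat \<lfloor>s * 2 ^ (p + m)\<rfloor>. log_density (p + m) (refine m u) l \<omega> < \<kappa>) then step_drift p N u s \<omega> else 0)"
proof (cases "0 \<le> s")
  case True
  have "stopped_step_drift \<kappa> p N u m s \<omega> =
      (if \<forall>l\<le>nat \<lfloor>s * 2 ^ (p + m)\<rfloor>. log_density (p + m) (refine m u) l \<omega> < \<kappa>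
       then step_drift (p + m) (N * 2 ^ m) (refine m u) s \<omega> else 0)"
    unfolding stopped_step_drift_def step_drift_eq[OF True] stopped_def by auto
  then show ?thesis unfolding step_drift_refine[OF True] using True by (simp only: simp_thms)
qed (simp add: stopped_step_drift_def step_drift_negative)

lemma stopped_step_drift_tendsto:
  "(\<lambda>m. stopped_step_drift \<kappa> p N u m s \<omega>) \<longlonglongrightarrow> stopped_drift \<kappa> p N u s \<omega>"
proof (rule tendsto_eventually)
  let ?ok = "\<lambda>m. \<forall>l\<le>nat \<lfloor>s * 2 ^ (p + m)\<rfloor>. log_density (p + m) (refine m u) l \<omega> < \<kappa>"
  show "\<forall>\<^sub>F m in sequentially. stopped_step_drift \<kappa> p N u m s \<omega> = stopped_drift \<kappa> p N u s \<omega>"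
  proof (cases "0 \<le> s \<and> \<not> (\<forall>m. ?ok m)")
    case True
    then have s: "0 \<le> s" by simp
    have mono: "?ok m" if "?ok (Suc m)" for m
    proof (intro allI impI)
      fix l assume l: "l \<le> nat \<lfloor>s * 2 ^ (p + m)\<rfloor>"
      have "nat \<lfloor>s * 2 ^ (p + m + 1)\<rfloor> div 2 ^ 1 = nat \<lfloor>s * 2 ^ (p + m)\<rfloor>" by (rule floor_refine[OF s])
      then have "2 * l \<le> nat \<lfloor>s * 2 ^ (p + Suc m)\<rfloor>" using l by simp
      then have "log_density (p + Suc m) (refine (Suc m) u) (2 * l) \<omega> < \<kappa>" using that by blast
      then show "log_density (p + m) (refine m u) l \<omega> < \<kappa>" using log_density_refine_Suc[of "p + m" m u l \<omega>] by simp
    qed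
    obtain m0 where m0: "\<not> ?ok m0" using True by blast
    have "\<not> ?ok m" if "m0 \<le> m" for m
      using that by (induction m rule: dec_induct) (use m0 mono in blast)+
    then have "stopped_step_drift \<kappa> p N u m s \<omega> = stopped_drift \<kappa> p N u s \<omega>" if "m0 \<le> m" for m
      unfolding stopped_step_drift_eq stopped_drift_def using that m0 by auto
    then show ?thesis unfolding eventually_sequentially by blast
  next
    case False
    then show ?thesis unfolding stopped_step_drift_eq stopped_drift_def by (auto intro!: always_eventually)
  qed
qed

lemma stopped_drift_progressive:
  assumes "adapted p u" shows "progressively_measurable \<F> (stopped_drift \<kappa> p N u)"
  unfolding progressively_measurable_def
proof (intro allI impI)
  fix t :: real assume t: "0 \<le> t"
  show "(\<lambda>(s, \<omega>). stopped_drift \<kappa> p N u s \<omega>) \<in> borel_measurable (restrict_space borel {0..t} \<Otimes>\<^sub>M \<F> t)"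
    unfolding split_beta'
  proof (rule borel_measurable_LIMSEQ_metric)
    show "(\<lambda>m. stopped_step_drift \<kappa> p N u m (fst z) (snd z)) \<longlonglongrightarrow> stopped_drift \<kappa> p N u (fst z) (snd z)" for z
      by (rule stopped_step_drift_tendsto)
    fix m
    have "progressively_measurable \<F> (stopped_step_drift \<kappa> p N u m)"
      unfolding stopped_step_drift_def by (intro step_drift_progressive adapted_stopped adapted_refine assms)
    then show "(\<lambda>z. stopped_step_drift \<kappa> p N u m (fst z) (snd z)) \<in> borel_measurable (restrict_space borel {0..t} \<Otimes>\<^sub>M \<F> t)"
      using t unfolding progressively_measurable_def split_beta' by blast
  qed
qed

lemma stopped_drift_energy_le: "energy (stopped_drift \<kappa> p N u) \<omega> \<le> energy (step_drift p N u) \<omega>"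
  unfolding energy_def by (intro nn_integral_mono) (auto simp: stopped_drift_def indicator_def)

lemma stopped_drift_energy_finite: "energy (stopped_drift \<kappa> p N u) \<omega> < \<infinity>"
  using stopped_drift_energy_le step_drift_energy_finite by (rule le_less_trans)

lemma step_drift_bound:
  assumes "\<And>i \<omega>. norm (u i \<omega>) \<le> U" shows "norm (step_drift p N u s \<omega>) \<le> U"
proof -
  have "0 \<le> U" using assms norm_ge_zero order_trans by blast
  then show ?thesis using assms by (cases "0 \<le> s") (auto simp: step_drift_eq step_drift_negative)
qed

lemma stopped_path_tendsto:
  assumes u: "adapted p u" "\<And>i \<omega>. norm (u i \<omega>) \<le> U" and \<omega>: "\<omega> \<in> space M" and t: "0 \<le> t"
  shows "(\<lambda>m. steered_path (stopped_step_drift \<kappa> p N u m) \<omega> t) \<longlonglongrightarrow> steered_path (stopped_drift \<kappa> p N u) \<omega> t"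
proof -
  have pv: "progressively_measurable \<F> (stopped_step_drift \<kappa> p N u m)" for m
    unfolding stopped_step_drift_def by (intro step_drift_progressive adapted_stopped adapted_refine u)
  have e: "energy (stopped_step_drift \<kappa> p N u m) \<omega> < \<infinity>" for m
    unfolding stopped_step_drift_def by (rule step_drift_energy_finite)
  note pv' = stopped_drift_progressive[OF u(1), of \<kappa> N] and e' = stopped_drift_energy_finite[of \<kappa> p N u \<omega>]
  have s1: "steered_path (stopped_step_drift \<kappa> p N u m) \<omega> t = B t \<omega> + displacement (stopped_step_drift \<kappa> p N u m) 0 t \<omega>" for m
    using e t by (simp add: steered_path_def sample_path_nonneg drifted_eq[OF pv \<omega> e])
  have s2: "steered_path (stopped_drift \<kappa> p N u) \<omega> t = B t \<omega> + displacement (stopped_drift \<kappa> p N u) 0 t \<omega>"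
    using e' t by (simp add: steered_path_def sample_path_nonneg drifted_eq[OF pv' \<omega> e'])
  have sub: "{0..<t} \<subseteq> {0..t}" by auto
  have "(\<lambda>m. displacement (stopped_step_drift \<kappa> p N u m) 0 t \<omega>) \<longlonglongrightarrow> displacement (stopped_drift \<kappa> p N u) 0 t \<omega>"
    unfolding displacement_def
  proof (rule integral_dominated_convergence[where w="\<lambda>s. U * indicator {0..<t} s"])
    show "(\<lambda>s. indicator {0..<t} s *\<^sub>R stopped_drift \<kappa> p N u s \<omega>) \<in> borel_measurable lborel"
      using slice_integrable(1)[OF pv' \<omega> e' _ sub] by (intro borel_measurable_integrable) auto
    show "(\<lambda>s. indicator {0..<t} s *\<^sub>R stopped_step_drift \<kappa> p N u m s \<omega>) \<in> borel_measurable lborel" for m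
      using slice_integrable(1)[OF pv \<omega> e _ sub] by (intro borel_measurable_integrable) auto
    show "integrable lborel (\<lambda>s. U * indicator {0..<t} s)"
      using t by (intro integrable_mult_right integrable_real_indicator) (auto simp: emeasure_lborel_Ico)
    show "AE s in lborel. (\<lambda>m. indicator {0..<t} s *\<^sub>R stopped_step_drift \<kappa> p N u m s \<omega>) \<longlonglongrightarrow> indicator {0..<t} s *\<^sub>R stopped_drift \<kappa> p N u s \<omega>"
      by (intro AE_I2 tendsto_scaleR tendsto_const stopped_step_drift_tendsto)
    show "AE s in lborel. norm (indicator {0..<t} s *\<^sub>R stopped_step_drift \<kappa> p N u m s \<omega>) \<le> U * indicator {0..<t} s" for m
    proof (rule AE_I2)
      fix s
      have "norm (stopped_step_drift \<kappa> p N u m s \<omega>) \<le> U"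
        unfolding stopped_step_drift_def by (intro step_drift_bound stopped_bound refine_bound u)
      then show "norm (indicator {0..<t} s *\<^sub>R stopped_step_drift \<kappa> p N u m s \<omega>) \<le> U * indicator {0..<t} s"
        by (simp add: indicator_def)
    qed
  qed
  then show ?thesis unfolding s1 s2 by (intro tendsto_add tendsto_const)
qed

text \<open>The event that a control bounded by \<open>U\<close> may let \<open>log_density\<close> grow by more than \<open>\<rho>\<close> in one step.\<close>

definition large_increment :: "real \<Rightarrow> real \<Rightarrow> nat \<Rightarrow> nat \<Rightarrow> 'o set" where
  "large_increment \<rho> U T p = {\<omega> \<in> space M. \<exists>l<T * 2 ^ p. \<rho> < U * norm (noise p l \<omega>) + 1 / 2 ^ p / 2 * U\<^sup>2}"

lemma large_increment_sets: "large_increment \<rho> U T p \<in> sets M"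
proof -
  have [measurable]: "noise p l \<in> borel_measurable M" for l
    by (rule filtration_measurable_M[OF noise_adapted[of l "Suc l"]]) simp
  show ?thesis unfolding large_increment_def by measurable
qed

text \<open>A path is uniformly continuous on compact intervals, so an outcome lies in only finitely
  many of these events.\<close>

lemma large_increment_vanishes:
  assumes \<rho>: "0 < \<rho>" and U: "0 \<le> U"
  shows "(\<lambda>m. prob (large_increment \<rho> U T (p + m))) \<longlonglongrightarrow> 0"
proof -
  have "(\<lambda>m. \<integral>\<omega>. (indicator (large_increment \<rho> U T (p + m)) \<omega> :: real) \<partial>M) \<longlonglongrightarrow> (\<integral>\<omega>. 0 \<partial>M)"
  proof (rule integral_dominated_convergence[where w="\<lambda>_. 1"])
    show "AE \<omega> in M. (\<lambda>m. indicator (large_increment \<rho> U T (p + m)) \<omega> :: real) \<longlonglongrightarrow> 0"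
    proof (intro AE_I2 tendsto_eventually)
      fix \<omega> assume \<omega>: "\<omega> \<in> space M"
      have "continuous_on {0..real T} (\<lambda>t. B t \<omega>)"
        using continuous_paths[OF \<omega>] by (rule continuous_on_subset) auto
      then have uc: "uniformly_continuous_on {0..real T} (\<lambda>t. B t \<omega>)"
        by (rule compact_uniformly_continuous) auto
      have "0 < \<rho> / 2 / (U + 1)" using \<rho> U by simp
      then obtain d where d: "0 < d" "\<And>s t. s \<in> {0..real T} \<Longrightarrow> t \<in> {0..real T} \<Longrightarrow> dist s t < d \<Longrightarrow> dist (B s \<omega>) (B t \<omega>) < \<rho> / 2 / (U + 1)"
        using uc unfolding uniformly_continuous_on_def by metis
      have z: "(\<lambda>m. 1 / 2 ^ (p + m) :: real) \<longlonglongrightarrow> 0"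
        using LIMSEQ_ignore_initial_segment[OF LIMSEQ_divide_realpow_zero[of 2 1], of p] by (simp add: add.commute)
      have e1: "\<forall>\<^sub>F m in sequentially. (1 / 2 ^ (p + m) :: real) < d" using order_tendstoD(2)[OF z d(1)] .
      have "(\<lambda>m. 1 / 2 ^ (p + m) * (U\<^sup>2 / 2)) \<longlonglongrightarrow> 0 * (U\<^sup>2 / 2)" by (intro tendsto_mult z tendsto_const)
      then have e2: "\<forall>\<^sub>F m in sequentially. 1 / 2 ^ (p + m) * (U\<^sup>2 / 2) < \<rho> / 2"
        using \<rho> by (intro order_tendstoD(2)) auto
      show "\<forall>\<^sub>F m in sequentially. indicator (large_increment \<rho> U T (p + m)) \<omega> = (0 :: real)"
        using e1 e2
      proof eventually_elim
        fix m assume m: "(1 / 2 ^ (p + m) :: real) < d" "1 / 2 ^ (p + m) * (U\<^sup>2 / 2) < \<rho> / 2"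
        have "U * norm (noise (p + m) l \<omega>) + 1 / 2 ^ (p + m) / 2 * U\<^sup>2 \<le> \<rho>" if l: "l < T * 2 ^ (p + m)" for l
        proof -
          have "real (Suc l) \<le> real (T * 2 ^ (p + m))" using l by (intro of_nat_mono) simp
          then have lT: "real (Suc l) / 2 ^ (p + m) \<le> real T" by (simp add: field_simps)
          have "dist (B (real (Suc l) / 2 ^ (p + m)) \<omega>) (B (real l / 2 ^ (p + m)) \<omega>) < \<rho> / 2 / (U + 1)"
          proof (rule d(2))
            show "real (Suc l) / 2 ^ (p + m) \<in> {0..real T}" using lT by simp
            have "real l / 2 ^ (p + m) \<le> real T" using grid_mono[of l "Suc l" "p + m"] lT by linarith
            then show "real l / 2 ^ (p + m) \<in> {0..real T}" by simp
            show "dist (real (Suc l) / 2 ^ (p + m)) (real l / 2 ^ (p + m)) < d"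
              unfolding dist_real_def grid_step using m(1) by simp
          qed
          then have "norm (noise (p + m) l \<omega>) \<le> \<rho> / 2 / (U + 1)" unfolding noise_def dist_norm by simp
          then have "U * norm (noise (p + m) l \<omega>) \<le> U * (\<rho> / 2 / (U + 1))" using U by (rule mult_left_mono)
          also have "\<dots> \<le> (U + 1) * (\<rho> / 2 / (U + 1))" using U \<rho> by (intro mult_right_mono) auto
          also have "\<dots> = \<rho> / 2"
          proof -
            have "U + 1 \<noteq> 0" using U by simp
            then show ?thesis by (subst times_divide_eq_right) (rule nonzero_mult_div_cancel_left)
          qed
          finally show ?thesis using m(2) by simp
        qed
        then have "\<omega> \<notin> large_increment \<rho> U T (p + m)" unfolding large_increment_def by force
        then show "indicator (large_increment \<rho> U T (p + m)) \<omega> = (0 :: real)" by simp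
      qed
    qed
  qed (use large_increment_sets in auto)
  then show ?thesis using large_increment_sets by simp
qed

text \<open>Stopping on a fine grid bounds the Girsanov weight from below by \<open>exp (- \<kappa> - \<rho>)\<close> off the event that
  some increment is large, and the probability of this event vanishes as the grid is refined. The
  summand \<open>e\<close> makes the functional nonnegative, since trigonometric polynomials that approximate
  an indicator may be slightly negative.\<close>

lemma stopped_law_trig:
  assumes u: "adapted p u" "\<And>i \<omega>. norm (u i \<omega>) \<le> U" "\<And>i \<omega>. T * 2 ^ p \<le> i \<Longrightarrow> u i \<omega> = 0"
    and \<kappa>: "0 < \<kappa>" and f: "f \<in> trig_polys" "\<And>w. w \<in> path_space \<Longrightarrow> - e \<le> f w"
  shows "(\<integral>\<omega>. f (steered_path (stopped_drift \<kappa> p (T * 2 ^ p) u) \<omega>) \<partial>M) + e \<le> exp \<kappa> * ((\<integral>\<omega>. f (sample_path B \<omega>) \<partial>M) + e)"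
proof -
  have U0: "0 \<le> U" using u(2) norm_ge_zero order_trans by blast
  obtain K a c lam T1 n R where form1: "trig_form f K a c lam T1 n R" using trig_polys_on_grid[OF f(1)] by blast
  define T2 where "T2 = max T T1"
  have form: "trig_form f K a c lam T2 n R" using trig_form_extend[OF form1] unfolding T2_def by simp
  obtain C where C: "\<And>w. \<bar>f w\<bar> \<le> C" using trig_polys_bounded[OF f(1)] by blast
  have fm: "f \<in> borel_measurable borel_path_space" by (rule trig_polys_measurable[OF f(1)])
  define v where "v = stopped_drift \<kappa> p (T * 2 ^ p) u"
  define vm where "vm = stopped_step_drift \<kappa> p (T * 2 ^ p) u"
  define q where "q m = p + m" for m
  define w where "w m = stopped \<kappa> (q m) (refine m u)" for m
  have wb: "norm (w m i \<omega>) \<le> U" for m i \<omega> unfolding w_def by (intro stopped_bound refine_bound u)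
  have wa: "adapted (q m) (w m)" for m unfolding w_def q_def by (intro adapted_stopped adapted_refine u)
  have w0: "w m i \<omega> = 0" if "T * 2 ^ q m \<le> i" for m i \<omega>
  proof -
    have "T * 2 ^ p * 2 ^ m \<le> i" using that unfolding q_def by (simp add: power_add mult.assoc)
    then have "T * 2 ^ p \<le> i div 2 ^ m" by (simp add: less_eq_div_iff_mult_less_eq)
    then have "refine m u i \<omega> = 0" unfolding refine_def by (rule u(3))
    then show ?thesis unfolding w_def stopped_def by simp
  qed
  have vm_eq: "vm m = step_drift (q m) (T * 2 ^ q m) (w m)" for m
    unfolding vm_def stopped_step_drift_def w_def q_def by (simp add: power_add mult.assoc)
  have vm_eq2: "steered_path (vm m) \<omega> = steered_path (step_drift (q m) (T2 * 2 ^ q m) (w m)) \<omega>" for m \<omega>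
    unfolding vm_eq by (intro steered_path_cong step_drift_truncate[symmetric] w0) (simp_all add: T2_def)
  have pm: "progressively_measurable \<F> (vm m)" for m unfolding vm_eq by (rule step_drift_progressive[OF wa])
  have Xm: "steered_path (vm m) \<in> measurable M borel_path_space" for m by (rule steered_path_measurable[OF pm])
  have X: "steered_path v \<in> measurable M borel_path_space"
    unfolding v_def by (intro steered_path_measurable stopped_drift_progressive u)
  have fXm: "(\<lambda>\<omega>. f (steered_path (vm m) \<omega>)) \<in> borel_measurable M" for m by (rule measurable_compose[OF Xm fm])
  have fX: "(\<lambda>\<omega>. f (steered_path v \<omega>)) \<in> borel_measurable M" by (rule measurable_compose[OF X fm])
  have fB: "(\<lambda>\<omega>. f (sample_path B \<omega>)) \<in> borel_measurable M" by (rule measurable_compose[OF sample_path_measurable fm])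
  have iXm: "integrable M (\<lambda>\<omega>. f (steered_path (vm m) \<omega>))" for m using fXm C by (intro integrable_const_bound[where B=C]) auto
  have iB: "integrable M (\<lambda>\<omega>. f (sample_path B \<omega>))" using fB C by (intro integrable_const_bound[where B=C]) auto
  have posXm: "0 \<le> f (steered_path (vm m) \<omega>) + e" if "\<omega> \<in> space M" for m \<omega>
    using f(2)[OF measurable_space[OF Xm that, simplified], of m] by simp
  have posB: "0 \<le> f (sample_path B \<omega>) + e" if "\<omega> \<in> space M" for \<omega>
    using f(2)[OF sample_path_in_path_space[OF that]] by simp
  obtain \<omega>\<^sub>0 where \<omega>\<^sub>0: "\<omega>\<^sub>0 \<in> space M" using not_empty by blast
  have Ce: "0 \<le> C + e" using posB[OF \<omega>\<^sub>0] abs_le_D1[OF C] by (smt (verit))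
  let ?Q = "(\<integral>\<omega>. f (sample_path B \<omega>) \<partial>M) + e"
  have Q0: "0 \<le> ?Q"
  proof -
    have "0 \<le> (\<integral>\<omega>. f (sample_path B \<omega>) + e \<partial>M)" using posB by (intro integral_nonneg_AE AE_I2) auto
    then show ?thesis using iB by (simp add: prob_space)
  qed
  have step: "(\<integral>\<omega>. f (steered_path (vm m) \<omega>) \<partial>M) + e \<le> exp (\<kappa> + \<rho>) * ?Q + (C + e) * prob (large_increment \<rho> U T2 (q m))"
    if \<rho>: "0 < \<rho>" and nm: "n \<le> q m" for \<rho> m
  proof -
    let ?D = "large_increment \<rho> U T2 (q m)"
    let ?g = "\<lambda>\<omega>. f (steered_path (vm m) \<omega>) + e"
    let ?L = "log_density (q m) (w m) (T2 * 2 ^ q m)"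
    let ?z = "\<lambda>\<omega>. ennreal (exp (- ?L \<omega>))"
    have Dm [measurable]: "?D \<in> sets M" by (rule large_increment_sets)
    have Lm [measurable]: "?L \<in> borel_measurable M" by (rule filtration_measurable_M[OF log_density_adapted[OF wa]])
    note [measurable] = fXm
    have over: "?L \<omega> \<le> \<kappa> + \<rho>" if "\<omega> \<in> space M" "\<omega> \<notin> ?D" for \<omega>
      unfolding w_def
    proof (rule log_density_stopped[OF \<kappa> less_imp_le[OF \<rho>]])
      fix i assume i: "i < T2 * 2 ^ q m"
      have r: "norm (refine m u i \<omega>) \<le> U" by (rule refine_bound[OF u(2)])
      have "refine m u i \<omega> \<bullet> noise (q m) i \<omega> \<le> norm (refine m u i \<omega>) * norm (noise (q m) i \<omega>)" by (rule norm_cauchy_schwarz)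
      also have "\<dots> \<le> U * norm (noise (q m) i \<omega>)" using r by (intro mult_right_mono) auto
      finally have 1: "refine m u i \<omega> \<bullet> noise (q m) i \<omega> \<le> U * norm (noise (q m) i \<omega>)" .
      have 2: "1 / 2 ^ q m / 2 * (norm (refine m u i \<omega>))\<^sup>2 \<le> 1 / 2 ^ q m / 2 * U\<^sup>2"
        using r by (intro mult_left_mono power_mono) auto
      have "U * norm (noise (q m) i \<omega>) + 1 / 2 ^ q m / 2 * U\<^sup>2 \<le> \<rho>"
        using that i unfolding large_increment_def by force
      then show "refine m u i \<omega> \<bullet> noise (q m) i \<omega> + 1 / 2 ^ q m / 2 * (norm (refine m u i \<omega>))\<^sup>2 \<le> \<rho>"
        using 1 2 by linarith
    qed
    have "ennreal (\<integral>\<omega>. ?g \<omega> \<partial>M) = (\<integral>\<^sup>+\<omega>. ennreal (?g \<omega>) \<partial>M)"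
      using iXm posXm by (intro nn_integral_eq_integral[symmetric]) (auto intro: AE_I2)
    also have "\<dots> \<le> (\<integral>\<^sup>+\<omega>. ennreal (exp (\<kappa> + \<rho>)) * (ennreal (?g \<omega>) * ?z \<omega>) + ennreal (C + e) * indicator ?D \<omega> \<partial>M)"
    proof (rule nn_integral_mono)
      fix \<omega> assume \<omega>: "\<omega> \<in> space M"
      show "ennreal (?g \<omega>) \<le> ennreal (exp (\<kappa> + \<rho>)) * (ennreal (?g \<omega>) * ?z \<omega>) + ennreal (C + e) * indicator ?D \<omega>"
      proof (cases "\<omega> \<in> ?D")
        case True
        have "ennreal (?g \<omega>) \<le> ennreal (C + e)" using abs_le_D1[OF C] by (intro ennreal_leI) simp
        then show ?thesis using True by (simp add: add_increasing)
      next
        case False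
        have "1 \<le> exp (\<kappa> + \<rho>) * exp (- ?L \<omega>)" unfolding exp_add[symmetric] using over[OF \<omega> False] by simp
        then have "?g \<omega> * 1 \<le> ?g \<omega> * (exp (\<kappa> + \<rho>) * exp (- ?L \<omega>))" using posXm[OF \<omega>] by (rule mult_left_mono)
        then have "?g \<omega> \<le> exp (\<kappa> + \<rho>) * (?g \<omega> * exp (- ?L \<omega>))" by (simp add: mult_ac)
        then have "ennreal (?g \<omega>) \<le> ennreal (exp (\<kappa> + \<rho>) * (?g \<omega> * exp (- ?L \<omega>)))" by (rule ennreal_leI)
        also have "\<dots> = ennreal (exp (\<kappa> + \<rho>)) * (ennreal (?g \<omega>) * ?z \<omega>)"
          using posXm[OF \<omega>] by (simp add: ennreal_mult)
        finally show ?thesis using False by simp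
      qed
    qed
    also have "\<dots> = ennreal (exp (\<kappa> + \<rho>)) * (\<integral>\<^sup>+\<omega>. ennreal (?g \<omega>) * ?z \<omega> \<partial>M) + ennreal (C + e) * emeasure M ?D"
      by (subst nn_integral_add) (auto simp: nn_integral_cmult nn_integral_cmult_indicator)
    also have "(\<integral>\<^sup>+\<omega>. ennreal (?g \<omega>) * ?z \<omega> \<partial>M) = (\<integral>\<^sup>+\<omega>. ennreal (f (sample_path B \<omega>) + e) \<partial>M)"
    proof -
      let ?X = "\<lambda>t \<omega>. steered_path (vm m) \<omega> t"
      have sp: "sample_path ?X \<omega> = steered_path (vm m) \<omega>" if "\<omega> \<in> space M" for \<omega>
        using path_spaceD(3)[OF measurable_space[OF Xm that, simplified]] unfolding sample_path_def by (simp add: extensional_restrict)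
      have "(\<integral>\<^sup>+\<omega>. ennreal (?g \<omega>) * ?z \<omega> \<partial>M) = (\<integral>\<^sup>+\<omega>. ennreal (f (sample_path ?X \<omega>) + e) * ?z \<omega> \<partial>M)"
        by (intro nn_integral_cong) (simp add: sp)
      also have "\<dots> = (\<integral>\<^sup>+\<omega>. ennreal (f (sample_path B \<omega>) + e) \<partial>M)"
      proof (rule girsanov_trig_form[OF form nm _ wa, where g="\<lambda>x. ennreal (x + e)"])
        show "AE \<omega> in M. ?X 0 \<omega> = 0 \<and> (\<forall>i<T2 * 2 ^ q m. ?X (real (Suc i) / 2 ^ q m) \<omega> - ?X (real i / 2 ^ q m) \<omega> = steered (q m) (w m) i \<omega>)"
          unfolding vm_eq2 by (intro AE_I2 conjI allI impI steered_path_step_drift[OF wa])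
      qed simp
      finally show ?thesis .
    qed
    also have "(\<integral>\<^sup>+\<omega>. ennreal (f (sample_path B \<omega>) + e) \<partial>M) = ennreal ?Q"
    proof -
      have "(\<integral>\<^sup>+\<omega>. ennreal (f (sample_path B \<omega>) + e) \<partial>M) = ennreal (\<integral>\<omega>. f (sample_path B \<omega>) + e \<partial>M)"
        using iB posB by (intro nn_integral_eq_integral) (auto intro: AE_I2)
      then show ?thesis using iB by (simp add: prob_space)
    qed
    also have "ennreal (exp (\<kappa> + \<rho>)) * ennreal ?Q + ennreal (C + e) * emeasure M ?D = ennreal (exp (\<kappa> + \<rho>) * ?Q + (C + e) * prob ?D)"
      unfolding emeasure_eq_measure using Q0 Ce by (subst ennreal_plus) (auto simp: ennreal_mult)
    finally have "(\<integral>\<omega>. ?g \<omega> \<partial>M) \<le> exp (\<kappa> + \<rho>) * ?Q + (C + e) * prob ?D"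
      by (rule ennreal_le_iff[THEN iffD1, rotated]) (use Q0 Ce in \<open>auto intro!: add_nonneg_nonneg mult_nonneg_nonneg\<close>)
    then show ?thesis using iXm by (simp add: prob_space)
  qed
  have f_eq: "f w = (\<Sum>k<K. a k * cos (c k + (\<Sum>i<T2 * 2 ^ n. lam k (real i / 2 ^ n) \<bullet> (w (real (Suc i) / 2 ^ n) - w (real i / 2 ^ n)))))"
    if "w \<in> path_space" for w
    using form path_spaceD(2)[OF that] unfolding trig_form_def wiener_sum_def by blast
  have lim: "(\<lambda>m. \<integral>\<omega>. f (steered_path (vm m) \<omega>) \<partial>M) \<longlonglongrightarrow> (\<integral>\<omega>. f (steered_path v \<omega>) \<partial>M)"
  proof (rule integral_dominated_convergence[where w="\<lambda>_. C"])
    show "AE \<omega> in M. (\<lambda>m. f (steered_path (vm m) \<omega>)) \<longlonglongrightarrow> f (steered_path v \<omega>)"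
    proof (rule AE_I2)
      fix \<omega> assume \<omega>: "\<omega> \<in> space M"
      have conv: "(\<lambda>m. steered_path (vm m) \<omega> t) \<longlonglongrightarrow> steered_path v \<omega> t" if "0 \<le> t" for t
        unfolding vm_def v_def by (rule stopped_path_tendsto[OF u(1,2) \<omega> that])
      show "(\<lambda>m. f (steered_path (vm m) \<omega>)) \<longlonglongrightarrow> f (steered_path v \<omega>)"
        unfolding f_eq[OF measurable_space[OF Xm \<omega>, simplified]] f_eq[OF measurable_space[OF X \<omega>, simplified]]
        by (intro tendsto_sum tendsto_mult tendsto_cos tendsto_add tendsto_inner tendsto_diff tendsto_const conv) auto
    qed
  qed (use fX fXm C in auto)
  have lim2: "(\<integral>\<omega>. f (steered_path v \<omega>) \<partial>M) + e \<le> exp (\<kappa> + \<rho>) * ?Q" if \<rho>: "0 < \<rho>" for \<rho>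
  proof -
    have "(\<lambda>m. exp (\<kappa> + \<rho>) * ?Q + (C + e) * prob (large_increment \<rho> U T2 (q m))) \<longlonglongrightarrow> exp (\<kappa> + \<rho>) * ?Q + (C + e) * 0"
      unfolding q_def by (intro tendsto_intros large_increment_vanishes[OF \<rho> U0])
    moreover have "(\<lambda>m. (\<integral>\<omega>. f (steered_path (vm m) \<omega>) \<partial>M) + e) \<longlonglongrightarrow> (\<integral>\<omega>. f (steered_path v \<omega>) \<partial>M) + e"
      by (intro tendsto_add lim tendsto_const)
    moreover have "(\<integral>\<omega>. f (steered_path (vm m) \<omega>) \<partial>M) + e \<le> exp (\<kappa> + \<rho>) * ?Q + (C + e) * prob (large_increment \<rho> U T2 (q m))" if "n \<le> m" for m
      using that by (intro step[OF \<rho>]) (simp add: q_def)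
    ultimately have "(\<integral>\<omega>. f (steered_path v \<omega>) \<partial>M) + e \<le> exp (\<kappa> + \<rho>) * ?Q + (C + e) * 0"
      by (intro LIMSEQ_le) blast+
    then show ?thesis by simp
  qed
  have "(\<lambda>k. exp (\<kappa> + inverse (real (Suc k))) * ?Q) \<longlonglongrightarrow> exp (\<kappa> + 0) * ?Q"
    by (intro tendsto_intros LIMSEQ_inverse_real_of_nat)
  then have "(\<integral>\<omega>. f (steered_path v \<omega>) \<partial>M) + e \<le> exp (\<kappa> + 0) * ?Q"
    by (rule LIMSEQ_le_const) (intro exI[of _ 0] allI impI lim2, simp)
  then show ?thesis unfolding v_def by simp
qed

lemma stopped_law:
  assumes u: "adapted p u" "\<And>i \<omega>. norm (u i \<omega>) \<le> U" "\<And>i \<omega>. T * 2 ^ p \<le> i \<Longrightarrow> u i \<omega> = 0"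
    and \<kappa>: "0 < \<kappa>" and A: "A \<in> sets borel_path_space"
  shows "measure (distr M borel_path_space (steered_path (stopped_drift \<kappa> p (T * 2 ^ p) u))) A \<le>
    exp \<kappa> * measure (distr M borel_path_space (sample_path B)) A"
proof -
  let ?X = "steered_path (stopped_drift \<kappa> p (T * 2 ^ p) u)"
  let ?\<mu> = "distr M borel_path_space ?X" and ?\<nu> = "distr M borel_path_space (sample_path B)"
  have X: "?X \<in> measurable M borel_path_space" by (intro steered_path_measurable stopped_drift_progressive u)
  interpret \<mu>: prob_space ?\<mu> by (rule prob_space_distr[OF X])
  interpret \<nu>: prob_space ?\<nu> by (rule prob_space_distr[OF sample_path_measurable])
  have step: "measure ?\<mu> A \<le> exp \<kappa> * (measure ?\<nu> A + 2 * e) + 0 * e" if e: "0 < e" for e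
  proof -
    have "indicator A \<in> borel_measurable (borel_path_space :: (real \<Rightarrow> real^'d) measure)" using A by simp
    then obtain f where f: "f \<in> trig_polys" "\<forall>w\<in>path_space. 0 - e \<le> f w \<and> f w \<le> 1 + e"
      "(\<integral>w. \<bar>f w - indicator A w\<bar> \<partial>?\<mu>) < e" "(\<integral>w. \<bar>f w - indicator A w\<bar> \<partial>?\<nu>) < e"
      using trig_polys_dense_in_two_means[OF \<mu>.finite_measure_axioms _ \<nu>.finite_measure_axioms _ _ _ e, of "indicator A" 0 1]
      by (auto simp: indicator_def split: if_splits)
    have fm: "f \<in> borel_measurable borel_path_space" by (rule trig_polys_measurable[OF f(1)])
    obtain C where C: "\<And>w. \<bar>f w\<bar> \<le> C" using trig_polys_bounded[OF f(1)] by blast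
    have i: "integrable ?\<mu> f" "integrable ?\<nu> f"
      using fm C by (auto intro!: \<mu>.integrable_const_bound[where B=C] \<nu>.integrable_const_bound[where B=C])
    have 1: "measure ?\<mu> A \<le> (\<integral>w. f w \<partial>?\<mu>) + e"
      using abs_integral_minus_measure_le[OF \<mu>.finite_measure_axioms _ i(1), of A] A f(3) by simp
    have 2: "(\<integral>w. f w \<partial>?\<nu>) \<le> measure ?\<nu> A + e"
      using abs_integral_minus_measure_le[OF \<nu>.finite_measure_axioms _ i(2), of A] A f(4) by simp
    have "(\<integral>w. f w \<partial>?\<mu>) + e \<le> exp \<kappa> * ((\<integral>w. f w \<partial>?\<nu>) + e)"
      using stopped_law_trig[OF u \<kappa> f(1), where e=e] f(2) integral_distr[OF X fm] integral_distr[OF sample_path_measurable fm] by simp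
    also have "\<dots> \<le> exp \<kappa> * (measure ?\<nu> A + 2 * e)" using 2 by (intro mult_left_mono) auto
    finally show ?thesis using 1 by simp
  qed
  have "(\<lambda>k. exp \<kappa> * (measure ?\<nu> A + 2 * inverse (real (Suc k)))) \<longlonglongrightarrow> exp \<kappa> * (measure ?\<nu> A + 2 * 0)"
    by (intro tendsto_intros LIMSEQ_inverse_real_of_nat)
  then have "measure ?\<mu> A \<le> exp \<kappa> * (measure ?\<nu> A + 2 * 0)"
    by (rule LIMSEQ_le_const) (use step in auto)
  then show ?thesis by simp
qed

text \<open>A nearly optimal grid control, stopped. The passage events increase with the level of the grid and
  have probability at most \<open>8 \<epsilon>\<^sub>1\<close> each, hence so has their union \<open>E\<close>; off \<open>E\<close> the stopped drift is the
  original one, and on \<open>E\<close> the value of \<open>ln f\<close> changes by at most its oscillation.\<close>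

theorem bounded_density_drift:
  assumes f: "f \<in> trig_polys" "0 < c\<^sub>0" "\<And>w. w \<in> path_space \<Longrightarrow> c\<^sub>0 \<le> f w \<and> f w \<le> C"
    and \<epsilon>: "0 < \<epsilon>" and \<kappa>: "0 < \<kappa>" "C * exp (- \<kappa>) \<le> (\<integral>\<omega>. f (sample_path B \<omega>) \<partial>M) / 2"
  obtains v where "v \<in> finite_energy_drifts M B"
    "\<And>A. A \<in> sets borel_path_space \<Longrightarrow> measure (distr M borel_path_space (steered_path v)) A \<le>
      exp \<kappa> * measure (distr M borel_path_space (sample_path B)) A"
    "ln (\<integral>\<omega>. f (sample_path B \<omega>) \<partial>M) - \<epsilon> \<le> (\<integral>\<omega>. ln (f (steered_path v \<omega>)) \<partial>M) - mean_energy v / 2"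
proof -
  obtain K a c lam T n R where form: "trig_form f K a c lam T n R" using trig_polys_on_grid[OF f(1)] by blast
  have fm: "f \<in> borel_measurable borel_path_space" by (rule trig_polys_measurable[OF f(1)])
  obtain \<omega>\<^sub>0 where "\<omega>\<^sub>0 \<in> space M" using not_empty by blast
  then have c0C: "c\<^sub>0 \<le> C" using f(3)[OF sample_path_in_path_space] by force
  define osc where "osc = ln C - ln c\<^sub>0"
  have osc: "0 \<le> osc" unfolding osc_def using c0C f(2) by simp
  define \<epsilon>\<^sub>1 where "\<epsilon>\<^sub>1 = \<epsilon> / (1 + 8 * osc)"
  have \<epsilon>1: "0 < \<epsilon>\<^sub>1" "\<epsilon>\<^sub>1 + osc * (8 * \<epsilon>\<^sub>1) = \<epsilon>"
  proof -
    have "0 < 1 + 8 * osc" using osc by simp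
    then show "0 < \<epsilon>\<^sub>1" "\<epsilon>\<^sub>1 + osc * (8 * \<epsilon>\<^sub>1) = \<epsilon>"
      unfolding \<epsilon>\<^sub>1_def using \<epsilon> by (auto simp: divide_simps) (simp add: algebra_simps)
  qed
  have pos: "c\<^sub>0 \<le> f w" if "w \<in> path_space" for w using f(3)[OF that] by blast
  obtain p u U where u: "n \<le> p" "adapted p u" "\<And>i \<omega>. norm (u i \<omega>) \<le> U" "\<And>i \<omega>. T * 2 ^ p \<le> i \<Longrightarrow> u i \<omega> = 0"
    and opt: "ln (\<integral>\<omega>. f (sample_path B \<omega>) \<partial>M) - \<epsilon>\<^sub>1 \<le>
      (\<integral>\<omega>. ln (f (steered_path (step_drift p (T * 2 ^ p) u) \<omega>)) \<partial>M) -
      (\<Sum>i<T * 2 ^ p. 1 / 2 ^ p / 2 * (\<integral>\<omega>. (norm (u i \<omega>))\<^sup>2 \<partial>M))"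
  proof (rule lower_bound_trig[OF form f(2) pos \<epsilon>1(1)], goal_cases)
    case (2 p u U)
    show ?case by (rule 2(1)[OF 2(2-)])
  qed simp
  define v\<^sub>0 where "v\<^sub>0 = step_drift p (T * 2 ^ p) u"
  define v where "v = stopped_drift \<kappa> p (T * 2 ^ p) u"
  have me0: "mean_energy v\<^sub>0 / 2 = (\<Sum>i<T * 2 ^ p. 1 / 2 ^ p / 2 * (\<integral>\<omega>. (norm (u i \<omega>))\<^sup>2 \<partial>M))"
    unfolding v\<^sub>0_def mean_energy_step_drift(3)[OF u(2,3)] by (simp add: sum_divide_distrib)
  define A where "A m = {\<omega> \<in> space M. \<exists>l\<le>T * 2 ^ (p + m). \<kappa> \<le> log_density (p + m) (refine m u) l \<omega>}" for m
  have TN: "T * 2 ^ (p + m) = T * 2 ^ p * 2 ^ m" for m by (simp add: power_add)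
  have PA: "prob (A m) \<le> 8 * \<epsilon>\<^sub>1" for m
    unfolding A_def
  proof (rule stopping_probability[OF adapted_refine[OF u(2)] refine_bound[OF u(3)] _ form f(2,3) \<kappa>(2)])
    show "n \<le> p + m" using u(1) by simp
    let ?v = "step_drift (p + m) (T * 2 ^ (p + m)) (refine m u)"
    have eq: "?v s \<omega> = v\<^sub>0 s \<omega>" if "0 \<le> s" for s \<omega> unfolding TN v\<^sub>0_def by (rule step_drift_refine[OF that])
    have sp: "steered_path ?v \<omega> = steered_path v\<^sub>0 \<omega>" for \<omega> by (rule steered_path_cong[OF eq])
    have "mean_energy ?v = mean_energy v\<^sub>0"
      unfolding mean_energy_def by (intro arg_cong[where f=enn2real] nn_integral_cong energy_cong eq)
    then have "(\<Sum>i<T * 2 ^ (p + m). 1 / 2 ^ (p + m) / 2 * (\<integral>\<omega>. (norm (refine m u i \<omega>))\<^sup>2 \<partial>M)) = mean_energy v\<^sub>0 / 2"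
      unfolding mean_energy_step_drift(3)[OF adapted_refine[OF u(2)] refine_bound[OF u(3)]] by (simp add: sum_divide_distrib[symmetric])
    then show "ln (\<integral>\<omega>. f (sample_path B \<omega>) \<partial>M) - \<epsilon>\<^sub>1 \<le> (\<integral>\<omega>. ln (f (steered_path ?v \<omega>)) \<partial>M) -
      (\<Sum>i<T * 2 ^ (p + m). 1 / 2 ^ (p + m) / 2 * (\<integral>\<omega>. (norm (refine m u i \<omega>))\<^sup>2 \<partial>M))"
      using opt unfolding sp me0[symmetric] v\<^sub>0_def by simp
  qed
  have AM: "A m \<in> sets M" for m
  proof -
    have [measurable]: "log_density (p + m) (refine m u) l \<in> borel_measurable M" for l
      by (rule filtration_measurable_M[OF log_density_adapted[OF adapted_refine[OF u(2)]]])
    show ?thesis unfolding A_def by measurable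
  qed
  have incA: "incseq A"
  proof (rule incseq_SucI, rule subsetI)
    fix m \<omega> assume "\<omega> \<in> A m"
    then obtain l where l: "\<omega> \<in> space M" "l \<le> T * 2 ^ (p + m)" "\<kappa> \<le> log_density (p + m) (refine m u) l \<omega>" unfolding A_def by blast
    have "2 * l \<le> T * 2 ^ (p + Suc m)" using l(2) by simp
    moreover have "\<kappa> \<le> log_density (p + Suc m) (refine (Suc m) u) (2 * l) \<omega>"
      using l(3) log_density_refine_Suc[of "p + m" m u l \<omega>] by simp
    ultimately show "\<omega> \<in> A (Suc m)" unfolding A_def using l(1) by blast
  qed
  define E where "E = (\<Union>m. A m)"
  have EM: "E \<in> sets M" unfolding E_def using AM by blast
  have PE: "prob E \<le> 8 * \<epsilon>\<^sub>1"
    unfolding E_def by (rule LIMSEQ_le_const2[OF finite_Lim_measure_incseq[OF _ incA]]) (use AM PA in auto)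
  have same: "steered_path v \<omega> = steered_path v\<^sub>0 \<omega>" if \<omega>: "\<omega> \<in> space M" "\<omega> \<notin> E" for \<omega>
  proof (rule steered_path_cong)
    fix s :: real assume s: "0 \<le> s"
    show "v s \<omega> = v\<^sub>0 s \<omega>"
    proof (cases "nat \<lfloor>s * 2 ^ p\<rfloor> < T * 2 ^ p")
      case True
      have "log_density (p + m) (refine m u) l \<omega> < \<kappa>" if l: "l \<le> nat \<lfloor>s * 2 ^ (p + m)\<rfloor>" for m l
      proof -
        have "nat \<lfloor>s * 2 ^ (p + m)\<rfloor> div 2 ^ m < T * 2 ^ p" unfolding floor_refine[OF s] by (rule True)
        then have "nat \<lfloor>s * 2 ^ (p + m)\<rfloor> < T * 2 ^ (p + m)" unfolding TN by (simp add: div_less_iff_less_mult)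
        then have "l \<le> T * 2 ^ (p + m)" using l by simp
        then show ?thesis using \<omega> unfolding E_def A_def by force
      qed
      then show ?thesis using s unfolding v_def v\<^sub>0_def stopped_drift_def by auto
    next
      case False
      then show ?thesis using s unfolding v_def v\<^sub>0_def stopped_drift_def by (simp add: step_drift_eq)
    qed
  qed
  have vp: "progressively_measurable \<F> v" unfolding v_def by (rule stopped_drift_progressive[OF u(2)])
  have v0V: "v\<^sub>0 \<in> finite_energy_drifts M B" unfolding v\<^sub>0_def by (rule mean_energy_step_drift(4)[OF u(2,3)])
  have ele: "(\<integral>\<^sup>+\<omega>. energy v \<omega> \<partial>M) \<le> (\<integral>\<^sup>+\<omega>. energy v\<^sub>0 \<omega> \<partial>M)"
    unfolding v_def v\<^sub>0_def by (intro nn_integral_mono stopped_drift_energy_le)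
  have e0: "(\<integral>\<^sup>+\<omega>. energy v\<^sub>0 \<omega> \<partial>M) < \<infinity>" by (rule finite_energy_driftsD(2)[OF v0V])
  have vV: "v \<in> finite_energy_drifts M B" unfolding finite_energy_drifts_def using vp le_less_trans[OF ele e0] by simp
  have mele: "mean_energy v \<le> mean_energy v\<^sub>0" unfolding mean_energy_def using ele e0 by (intro enn2real_mono) auto
  have Xm: "steered_path v \<in> measurable M borel_path_space" "steered_path v\<^sub>0 \<in> measurable M borel_path_space"
    using vp finite_energy_driftsD(1)[OF v0V] by (auto intro: steered_path_measurable)
  have bd: "ln c\<^sub>0 \<le> ln (f (X \<omega>)) \<and> ln (f (X \<omega>)) \<le> ln C"
    if "X \<in> measurable M borel_path_space" "\<omega> \<in> space M" for X \<omega>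
    using f(3)[OF measurable_space[OF that, simplified]] f(2) by auto
  have li: "integrable M (\<lambda>\<omega>. ln (f (X \<omega>)))" if X: "X \<in> measurable M borel_path_space" for X
  proof (rule integrable_const_bound[where B="max \<bar>ln c\<^sub>0\<bar> \<bar>ln C\<bar>"])
    show "AE \<omega> in M. norm (ln (f (X \<omega>))) \<le> max \<bar>ln c\<^sub>0\<bar> \<bar>ln C\<bar>"
    proof (rule AE_I2)
      fix \<omega> assume "\<omega> \<in> space M"
      from bd[OF X this] show "norm (ln (f (X \<omega>))) \<le> max \<bar>ln c\<^sub>0\<bar> \<bar>ln C\<bar>" unfolding real_norm_def by linarith
    qed
    show "(\<lambda>\<omega>. ln (f (X \<omega>))) \<in> borel_measurable M" using measurable_compose[OF X fm] by measurable
  qed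
  have Ei: "integrable M (indicator E :: _ \<Rightarrow> real)" using EM by (intro integrable_real_indicator) (auto simp: less_top[symmetric])
  have "(\<integral>\<omega>. ln (f (steered_path v\<^sub>0 \<omega>)) - osc * indicator E \<omega> \<partial>M) \<le> (\<integral>\<omega>. ln (f (steered_path v \<omega>)) \<partial>M)"
  proof (rule integral_mono)
    fix \<omega> assume \<omega>: "\<omega> \<in> space M"
    show "ln (f (steered_path v\<^sub>0 \<omega>)) - osc * indicator E \<omega> \<le> ln (f (steered_path v \<omega>))"
    proof (cases "\<omega> \<in> E")
      case True
      then show ?thesis using bd[OF Xm(1) \<omega>] bd[OF Xm(2) \<omega>] unfolding osc_def by simp
    next
      case False
      then show ?thesis using same[OF \<omega>] by simp
    qed
  qed (use li Xm Ei in auto)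
  then have "(\<integral>\<omega>. ln (f (steered_path v\<^sub>0 \<omega>)) \<partial>M) - osc * prob E \<le> (\<integral>\<omega>. ln (f (steered_path v \<omega>)) \<partial>M)"
    using li[OF Xm(2)] Ei EM by simp
  moreover have "osc * prob E \<le> osc * (8 * \<epsilon>\<^sub>1)" using PE osc by (rule mult_left_mono)
  ultimately have "ln (\<integral>\<omega>. f (sample_path B \<omega>) \<partial>M) - \<epsilon> \<le> (\<integral>\<omega>. ln (f (steered_path v \<omega>)) \<partial>M) - mean_energy v / 2"
    using opt mele \<epsilon>1(2) unfolding me0[symmetric] v\<^sub>0_def[symmetric] by linarith
  moreover have "measure (distr M borel_path_space (steered_path v)) A \<le>
      exp \<kappa> * measure (distr M borel_path_space (sample_path B)) A" if "A \<in> sets borel_path_space" for A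
    unfolding v_def by (rule stopped_law[OF u(2) _ _ \<kappa>(1) that]) (use u(3,4) in auto)
  ultimately show thesis by (intro that[OF vV])
qed

end

lemma nn_integral_le_if_measure_le:
  assumes "finite_measure \<mu>" "finite_measure \<nu>" "sets \<mu> = sets \<nu>" "0 \<le> c"
    and le: "\<And>A. A \<in> sets \<nu> \<Longrightarrow> measure \<mu> A \<le> c * measure \<nu> A"
    and g: "g \<in> borel_measurable \<nu>"
  shows "(\<integral>\<^sup>+x. g x \<partial>\<mu>) \<le> ennreal c * (\<integral>\<^sup>+x. g x \<partial>\<nu>)"
proof -
  interpret \<mu>: finite_measure \<mu> by fact
  interpret \<nu>: finite_measure \<nu> by fact
  have "\<mu> \<le> scale_measure (ennreal c) \<nu>"
    using le assms(3,4) by (simp add: le_measure \<mu>.emeasure_eq_measure \<nu>.emeasure_eq_measure ennreal_mult[symmetric] ennreal_leI)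
  then have "(\<integral>\<^sup>+x. g x \<partial>\<mu>) \<le> (\<integral>\<^sup>+x. g x \<partial>scale_measure (ennreal c) \<nu>)"
    using assms(3) by (intro nn_integral_mono_measure) auto
  also have "\<dots> = ennreal c * (\<integral>\<^sup>+x. g x \<partial>\<nu>)" by (rule nn_integral_scale_measure[OF g])
  finally show ?thesis .
qed

section \<open>The variational formula\<close>

lemma extended_expectation_integrable:
  assumes "integrable M r"
  shows "extended_expectation M (\<lambda>\<omega>. ereal (r \<omega>)) = ereal (\<integral>\<omega>. r \<omega> \<partial>M)"
proof -
  have "(\<integral>\<^sup>+\<omega>. ennreal (r \<omega>) \<partial>M) < \<infinity>" "(\<integral>\<^sup>+\<omega>. ennreal (- r \<omega>) \<partial>M) < \<infinity>"
    using assms unfolding real_integrable_def by (auto simp: less_top)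
  moreover have "enn2ereal a = ereal (enn2real a)" if "a < \<infinity>" for a
    using that by (cases a) (auto simp: enn2ereal_ennreal)
  ultimately show ?thesis
    unfolding extended_expectation_def real_lebesgue_integral_def[OF assms] by (simp add: e2ennreal_ereal)
qed

lemma extended_expectation_eq_minus_infinity:
  assumes "(\<integral>\<^sup>+\<omega>. ennreal (r \<omega>) \<partial>M) < \<infinity>" "(\<integral>\<^sup>+\<omega>. ennreal (- r \<omega>) \<partial>M) = \<infinity>"
  shows "extended_expectation M (\<lambda>\<omega>. ereal (r \<omega>)) = - \<infinity>"
proof -
  obtain a where "(\<integral>\<^sup>+\<omega>. ennreal (r \<omega>) \<partial>M) = ennreal a" "0 \<le> a"
    using assms(1) by (cases "\<integral>\<^sup>+\<omega>. ennreal (r \<omega>) \<partial>M") auto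
  then show ?thesis
    unfolding extended_expectation_def using assms(2) by (simp add: e2ennreal_ereal enn2ereal_ennreal)
qed

lemma abs_ln_diff_le:
  fixes x y c :: real
  assumes "0 < c" "c \<le> x" "c \<le> y"
  shows "\<bar>ln x - ln y\<bar> \<le> \<bar>x - y\<bar> / c"
proof -
  have le: "ln s - ln t \<le> \<bar>s - t\<bar> / c" if "c \<le> s" "c \<le> t" for s t
  proof -
    have "ln s - ln t = ln (s / t)" using assms(1) that by (simp add: ln_div)
    also have "\<dots> \<le> s / t - 1" using assms(1) that by (intro ln_le_minus_one) simp
    also have "\<dots> = (s - t) / t" using assms(1) that by (simp add: field_simps)
    also have "\<dots> \<le> \<bar>s - t\<bar> / t" using assms(1) that by (intro divide_right_mono) auto
    also have "\<dots> \<le> \<bar>s - t\<bar> / c" using assms(1) that by (intro divide_left_mono) auto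
    finally show ?thesis .
  qed
  show ?thesis using le[OF assms(2,3)] le[OF assms(3,2)] by (simp add: abs_le_iff abs_minus_commute)
qed

context standard_brownian_motion
begin

lemma
  assumes v: "v \<in> finite_energy_drifts M B"
  shows integrable_energy: "integrable M (\<lambda>\<omega>. enn2real (energy v \<omega>))"
    and integral_energy: "(\<integral>\<omega>. enn2real (energy v \<omega>) \<partial>M) = mean_energy v"
proof -
  note [measurable] = energy_measurable[OF finite_energy_driftsD(1)[OF v]]
  have eq: "(\<integral>\<^sup>+\<omega>. ennreal (enn2real (energy v \<omega>)) \<partial>M) = (\<integral>\<^sup>+\<omega>. energy v \<omega> \<partial>M)"
  proof (rule nn_integral_cong_AE)
    show "AE \<omega> in M. ennreal (enn2real (energy v \<omega>)) = energy v \<omega>"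
      using finite_energy_driftsD(3)[OF v] by eventually_elim simp
  qed
  show "integrable M (\<lambda>\<omega>. enn2real (energy v \<omega>))"
    using eq finite_energy_driftsD(2)[OF v] by (intro integrableI_nonneg) auto
  show "(\<integral>\<omega>. enn2real (energy v \<omega>) \<partial>M) = mean_energy v"
    unfolding mean_energy_def eq[symmetric] by (rule integral_eq_nn_integral) auto
qed

text \<open>The expectation does not depend on the values on the null event of infinite energy, and off this
  event the integrand is finite.\<close>

lemma drifted_value:
  assumes v: "v \<in> finite_energy_drifts M B"
  shows "extended_expectation M
      (\<lambda>\<omega>. ereal (F (sample_path (drifted B v) \<omega>)) - ereal (1 / 2) * enn2ereal (energy v \<omega>)) =
    extended_expectation M (\<lambda>\<omega>. ereal (F (steered_path v \<omega>) - enn2real (energy v \<omega>) / 2))"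
proof -
  have ae: "AE \<omega> in M. ereal (F (sample_path (drifted B v) \<omega>)) - ereal (1 / 2) * enn2ereal (energy v \<omega>) =
      ereal (F (steered_path v \<omega>) - enn2real (energy v \<omega>) / 2)"
    using finite_energy_driftsD(3)[OF v]
  proof eventually_elim
    case (elim \<omega>)
    then obtain e where "energy v \<omega> = ennreal e" "0 \<le> e" by (cases "energy v \<omega>") auto
    then show ?case unfolding steered_path_def by (simp add: enn2ereal_ennreal)
  qed
  show ?thesis
    unfolding extended_expectation_def
    by (intro arg_cong2[where f="(-)"] arg_cong[where f=enn2ereal] nn_integral_cong_AE)
      (use ae in \<open>eventually_elim, simp\<close>)+
qed

text \<open>The upper bound for the truncations of \<open>F\<^sub>+\<close>, whose exponentials are at most \<open>1 + e\<^sup>F\<close>.\<close>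

lemma positive_part_finite:
  assumes v: "v \<in> finite_energy_drifts M B" and F: "F \<in> borel_measurable borel_path_space"
    and expF: "integrable M (\<lambda>\<omega>. exp (F (sample_path B \<omega>)))"
  shows "(\<integral>\<^sup>+\<omega>. ennreal (F (steered_path v \<omega>)) \<partial>M) < \<infinity>"
proof -
  have X: "steered_path v \<in> measurable M borel_path_space"
    by (rule steered_path_measurable[OF finite_energy_driftsD(1)[OF v]])
  have FX [measurable]: "(\<lambda>\<omega>. F (steered_path v \<omega>)) \<in> borel_measurable M" by (rule measurable_compose[OF X F])
  have FB [measurable]: "(\<lambda>\<omega>. F (sample_path B \<omega>)) \<in> borel_measurable M" by (rule measurable_compose[OF sample_path_measurable F])
  define G where "G k w = max 0 (min (real k) (F w))" for k w
  define Z where "Z = (\<integral>\<omega>. exp (F (sample_path B \<omega>)) \<partial>M)"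
  define L where "L = ln (1 + Z) + mean_energy v / 2"
  have bound: "(\<integral>\<^sup>+\<omega>. ennreal (G k (steered_path v \<omega>)) \<partial>M) \<le> ennreal L" for k
  proof -
    have Gm: "G k \<in> borel_measurable borel_path_space" unfolding G_def[abs_def] using F by measurable
    have G0: "0 \<le> G k w \<and> G k w \<le> real k" for w unfolding G_def by auto
    have ei: "integrable M (\<lambda>\<omega>. exp (G k (sample_path B \<omega>)))"
      using G0 measurable_compose[OF sample_path_measurable Gm] by (intro integrable_const_bound[where B="exp (real k)"]) auto
    have "(1 :: real) = (\<integral>\<omega>. 1 \<partial>M)" by (simp add: prob_space)
    also have "\<dots> \<le> (\<integral>\<omega>. exp (G k (sample_path B \<omega>)) \<partial>M)" using ei G0 by (intro integral_mono) auto
    finally have pos: "1 \<le> (\<integral>\<omega>. exp (G k (sample_path B \<omega>)) \<partial>M)" .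
    have "(\<integral>\<omega>. exp (G k (sample_path B \<omega>)) \<partial>M) \<le> (\<integral>\<omega>. 1 + exp (F (sample_path B \<omega>)) \<partial>M)"
      using ei expF by (intro integral_mono) (auto simp: G_def max_def min_def add_increasing)
    also have "\<dots> = 1 + Z" using expF unfolding Z_def by (simp add: prob_space)
    finally have "ln (\<integral>\<omega>. exp (G k (sample_path B \<omega>)) \<partial>M) \<le> ln (1 + Z)" using pos by simp
    then have "(\<integral>\<omega>. G k (steered_path v \<omega>) \<partial>M) \<le> L"
      using upper_bound_bounded[OF v Gm, of 0 "real k"] G0 unfolding L_def by simp
    moreover have "(\<integral>\<^sup>+\<omega>. ennreal (G k (steered_path v \<omega>)) \<partial>M) = ennreal (\<integral>\<omega>. G k (steered_path v \<omega>) \<partial>M)"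
      using G0 measurable_compose[OF X Gm] by (intro nn_integral_eq_integral integrable_const_bound[where B="real k"]) auto
    ultimately show ?thesis by (simp add: ennreal_leI)
  qed
  have "(\<lambda>k. \<integral>\<^sup>+\<omega>. ennreal (G k (steered_path v \<omega>)) \<partial>M) \<longlonglongrightarrow> (\<integral>\<^sup>+\<omega>. ennreal (F (steered_path v \<omega>)) \<partial>M)"
  proof (rule nn_integral_LIMSEQ)
    show "incseq (\<lambda>k \<omega>. ennreal (G k (steered_path v \<omega>)))"
      by (auto simp: incseq_def le_fun_def G_def intro!: ennreal_leI)
    show "(\<lambda>\<omega>. ennreal (G k (steered_path v \<omega>))) \<in> borel_measurable M" for k unfolding G_def by measurable
    show "(\<lambda>k. ennreal (G k (steered_path v \<omega>))) \<longlonglongrightarrow> ennreal (F (steered_path v \<omega>))" for \<omega>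
    proof (rule tendsto_eventually)
      show "\<forall>\<^sub>F k in sequentially. ennreal (G k (steered_path v \<omega>)) = ennreal (F (steered_path v \<omega>))"
        using eventually_ge_at_top[of "nat \<lceil>F (steered_path v \<omega>)\<rceil>"]
      proof eventually_elim
        case (elim k)
        then have "F (steered_path v \<omega>) \<le> real k" by linarith
        then show ?case unfolding G_def by (simp add: min_absorb2 max_def ennreal_neg)
      qed
    qed
  qed
  then have "(\<integral>\<^sup>+\<omega>. ennreal (F (steered_path v \<omega>)) \<partial>M) \<le> ennreal L"
    by (rule LIMSEQ_le_const2) (use bound in auto)
  then show ?thesis by (simp add: le_less_trans)
qed

lemma upper_bound_integrable:
  assumes v: "v \<in> finite_energy_drifts M B" and F: "F \<in> borel_measurable borel_path_space"
    and expF: "integrable M (\<lambda>\<omega>. exp (F (sample_path B \<omega>)))"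
    and FX: "integrable M (\<lambda>\<omega>. F (steered_path v \<omega>))"
  shows "(\<integral>\<omega>. F (steered_path v \<omega>) \<partial>M) - mean_energy v / 2 \<le> ln (\<integral>\<omega>. exp (F (sample_path B \<omega>)) \<partial>M)"
proof -
  have [measurable]: "(\<lambda>\<omega>. F (sample_path B \<omega>)) \<in> borel_measurable M" by (rule measurable_compose[OF sample_path_measurable F])
  have FXm [measurable]: "(\<lambda>\<omega>. F (steered_path v \<omega>)) \<in> borel_measurable M" using FX by auto
  define G where "G k w = max (- real k) (min (real k) (F w))" for k w
  have lim: "(\<lambda>k. G k w) \<longlonglongrightarrow> F w" for w
  proof (rule tendsto_eventually)
    show "\<forall>\<^sub>F k in sequentially. G k w = F w"
      using eventually_ge_at_top[of "nat \<lceil>\<bar>F w\<bar>\<rceil>"]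
    proof eventually_elim
      case (elim k)
      then have "\<bar>F w\<bar> \<le> real k" by linarith
      then show ?case unfolding G_def by auto
    qed
  qed
  have l: "(\<lambda>k. \<integral>\<omega>. G k (steered_path v \<omega>) \<partial>M) \<longlonglongrightarrow> (\<integral>\<omega>. F (steered_path v \<omega>) \<partial>M)"
  proof (rule integral_dominated_convergence[where w="\<lambda>\<omega>. \<bar>F (steered_path v \<omega>)\<bar>"])
    show "AE \<omega> in M. norm (G k (steered_path v \<omega>)) \<le> \<bar>F (steered_path v \<omega>)\<bar>" for k
      by (rule AE_I2) (auto simp: G_def)
  qed (use FX lim in \<open>auto simp: G_def\<close>)
  have r: "(\<lambda>k. \<integral>\<omega>. exp (G k (sample_path B \<omega>)) \<partial>M) \<longlonglongrightarrow> (\<integral>\<omega>. exp (F (sample_path B \<omega>)) \<partial>M)"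
  proof (rule integral_dominated_convergence[where w="\<lambda>\<omega>. 1 + exp (F (sample_path B \<omega>))"])
    show "AE \<omega> in M. norm (exp (G k (sample_path B \<omega>))) \<le> 1 + exp (F (sample_path B \<omega>))" for k
    proof (rule AE_I2)
      fix \<omega>
      have "G k (sample_path B \<omega>) \<le> max 0 (F (sample_path B \<omega>))" unfolding G_def by auto
      then have "exp (G k (sample_path B \<omega>)) \<le> exp (max 0 (F (sample_path B \<omega>)))" by simp
      also have "\<dots> \<le> 1 + exp (F (sample_path B \<omega>))" by (simp add: max_def add_increasing)
      finally show "norm (exp (G k (sample_path B \<omega>))) \<le> 1 + exp (F (sample_path B \<omega>))" by simp
    qed
    show "AE \<omega> in M. (\<lambda>k. exp (G k (sample_path B \<omega>))) \<longlonglongrightarrow> exp (F (sample_path B \<omega>))"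
      by (rule AE_I2) (intro tendsto_exp lim)
  qed (use expF in \<open>auto simp: G_def\<close>)
  have "0 < (\<integral>\<omega>. exp (F (sample_path B \<omega>)) \<partial>M)" using expF by (intro expectation_greater) auto
  with r have r': "(\<lambda>k. ln (\<integral>\<omega>. exp (G k (sample_path B \<omega>)) \<partial>M)) \<longlonglongrightarrow> ln (\<integral>\<omega>. exp (F (sample_path B \<omega>)) \<partial>M)"
    by (intro tendsto_ln) auto
  show ?thesis
  proof (rule LIMSEQ_le[OF tendsto_diff[OF l tendsto_const] r'], intro exI allI impI)
    fix k
    have "G k \<in> borel_measurable borel_path_space" unfolding G_def[abs_def] using F by measurable
    then show "(\<integral>\<omega>. G k (steered_path v \<omega>) \<partial>M) - mean_energy v / 2 \<le> ln (\<integral>\<omega>. exp (G k (sample_path B \<omega>)) \<partial>M)"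
      by (rule upper_bound_bounded[OF v, of _ "- real k" "real k"]) (auto simp: G_def)
  qed
qed

lemma drifted_value_integrable:
  assumes v: "v \<in> finite_energy_drifts M B" and FX: "integrable M (\<lambda>\<omega>. F (steered_path v \<omega>))"
  shows "extended_expectation M
      (\<lambda>\<omega>. ereal (F (sample_path (drifted B v) \<omega>)) - ereal (1 / 2) * enn2ereal (energy v \<omega>)) =
    ereal ((\<integral>\<omega>. F (steered_path v \<omega>) \<partial>M) - mean_energy v / 2)"
  unfolding drifted_value[OF v]
  using FX integrable_energy[OF v] by (subst extended_expectation_integrable) (auto simp: integral_energy[OF v])

theorem upper_bound:
  assumes v: "v \<in> finite_energy_drifts M B" and F: "F \<in> borel_measurable borel_path_space"
    and expF: "integrable M (\<lambda>\<omega>. exp (F (sample_path B \<omega>)))"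
  shows "extended_expectation M
      (\<lambda>\<omega>. ereal (F (sample_path (drifted B v) \<omega>)) - ereal (1 / 2) * enn2ereal (energy v \<omega>)) \<le>
    ereal (ln (\<integral>\<omega>. exp (F (sample_path B \<omega>)) \<partial>M))"
proof (cases "(\<integral>\<^sup>+\<omega>. ennreal (- F (steered_path v \<omega>)) \<partial>M) = \<infinity>")
  case True
  let ?r = "\<lambda>\<omega>. F (steered_path v \<omega>) - enn2real (energy v \<omega>) / 2"
  have "(\<integral>\<^sup>+\<omega>. ennreal (?r \<omega>) \<partial>M) \<le> (\<integral>\<^sup>+\<omega>. ennreal (F (steered_path v \<omega>)) \<partial>M)"
    by (intro nn_integral_mono ennreal_leI) simp
  also have "\<dots> < \<infinity>" by (rule positive_part_finite[OF v F expF])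
  finally have "(\<integral>\<^sup>+\<omega>. ennreal (?r \<omega>) \<partial>M) < \<infinity>" .
  moreover have "(\<integral>\<^sup>+\<omega>. ennreal (- F (steered_path v \<omega>)) \<partial>M) \<le> (\<integral>\<^sup>+\<omega>. ennreal (- ?r \<omega>) \<partial>M)"
    by (intro nn_integral_mono ennreal_leI) simp
  ultimately show ?thesis
    unfolding drifted_value[OF v] using True by (subst extended_expectation_eq_minus_infinity) (auto simp: top_unique)
next
  case False
  have "(\<lambda>\<omega>. F (steered_path v \<omega>)) \<in> borel_measurable M"
    by (rule measurable_compose[OF steered_path_measurable[OF finite_energy_driftsD(1)[OF v]] F])
  then have FX: "integrable M (\<lambda>\<omega>. F (steered_path v \<omega>))"
    using False positive_part_finite[OF v F expF] unfolding real_integrable_def by (auto simp: less_top)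
  show ?thesis unfolding drifted_value_integrable[OF v FX] using upper_bound_integrable[OF v F expF FX] by simp
qed

text \<open>The constants are chosen in this order. The upper truncation level \<open>n\<close> keeps the logarithm of the
  exponential mean up to \<open>\<delta>\<close> and determines \<open>\<kappa>\<close>. The lower level \<open>m\<close> makes the mean of \<open>h m\<close>, the part of \<open>F\<close> below \<open>- m\<close>,
  small even after multiplication by the density bound \<open>e\<^sup>\<kappa>\<close>; the lower truncation only raises the
  exponential mean, so \<open>\<kappa>\<close> remains admissible. Then \<open>f\<close> approximates the exponential of the truncation
  \<open>G\<close> so well that \<open>ln f\<close> and \<open>G\<close> are close under every law of density at most \<open>e\<^sup>\<kappa>\<close>. One \<open>\<delta>\<close> is lost in
  each of: the upper truncation, the approximation of \<open>e\<^sup>G\<close> by \<open>f\<close>, the choice of the drift, the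
  comparison of \<open>ln f\<close> with \<open>G\<close>, and the lower truncation.\<close>

theorem near_optimal_drift:
  assumes F: "F \<in> borel_measurable borel_path_space"
    and expF: "integrable M (\<lambda>\<omega>. exp (F (sample_path B \<omega>)))"
    and neg: "(\<integral>\<^sup>+\<omega>. ennreal (- F (sample_path B \<omega>)) \<partial>M) < \<infinity>"
    and \<delta>: "0 < \<delta>"
  obtains v where "v \<in> finite_energy_drifts M B" "integrable M (\<lambda>\<omega>. F (steered_path v \<omega>))"
    "ln (\<integral>\<omega>. exp (F (sample_path B \<omega>)) \<partial>M) - 5 * \<delta> \<le> (\<integral>\<omega>. F (steered_path v \<omega>) \<partial>M) - mean_energy v / 2"
proof -
  let ?Y = "sample_path B"
  let ?\<nu> = "distr M borel_path_space ?Y"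
  have Ym: "?Y \<in> measurable M borel_path_space" by (rule sample_path_measurable)
  have FY [measurable]: "(\<lambda>\<omega>. F (?Y \<omega>)) \<in> borel_measurable M" by (rule measurable_compose[OF Ym F])
  define Z where "Z = (\<integral>\<omega>. exp (F (?Y \<omega>)) \<partial>M)"
  have Z: "0 < Z" unfolding Z_def using expF by (intro expectation_greater) auto
  have "(\<lambda>k. \<integral>\<omega>. exp (min (F (?Y \<omega>)) (real k)) \<partial>M) \<longlonglongrightarrow> Z"
    unfolding Z_def
  proof (rule integral_dominated_convergence[where w="\<lambda>\<omega>. exp (F (?Y \<omega>))"])
    show "AE \<omega> in M. (\<lambda>k. exp (min (F (?Y \<omega>)) (real k))) \<longlonglongrightarrow> exp (F (?Y \<omega>))"
    proof (rule AE_I2, rule tendsto_eventually)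
      fix \<omega>
      show "\<forall>\<^sub>F k in sequentially. exp (min (F (?Y \<omega>)) (real k)) = exp (F (?Y \<omega>))"
        using eventually_ge_at_top[of "nat \<lceil>F (?Y \<omega>)\<rceil>"]
      proof eventually_elim
        case (elim k)
        then have "F (?Y \<omega>) \<le> real k" by linarith
        then show ?case by (simp add: min_absorb1)
      qed
    qed
  qed (use expF in auto)
  moreover have "Z * exp (- \<delta>) < Z" using Z \<delta> by simp
  ultimately have "\<forall>\<^sub>F k in sequentially. Z * exp (- \<delta>) < (\<integral>\<omega>. exp (min (F (?Y \<omega>)) (real k)) \<partial>M)"
    by (rule order_tendstoD(1))
  then obtain n where n: "Z * exp (- \<delta>) < (\<integral>\<omega>. exp (min (F (?Y \<omega>)) (real n)) \<partial>M)"
    by (auto simp: eventually_sequentially)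
  define Z' where "Z' = (\<integral>\<omega>. exp (min (F (?Y \<omega>)) (real n)) \<partial>M)"
  have Z': "Z * exp (- \<delta>) < Z'" using n unfolding Z'_def .
  then have Z'0: "0 < Z'" using Z by (meson exp_gt_zero less_trans mult_pos_pos)
  define C where "C = exp (real n) + 1"
  have C0: "0 < C" unfolding C_def by (simp add: add_pos_pos)
  define \<kappa> where "\<kappa> = max 1 (ln (4 * C / Z'))"
  have \<kappa>: "0 < \<kappa>" "C * exp (- \<kappa>) \<le> Z' / 4"
  proof -
    have "4 * C / Z' = exp (ln (4 * C / Z'))" using C0 Z'0 by simp
    also have "\<dots> \<le> exp \<kappa>" unfolding \<kappa>_def by simp
    finally show "C * exp (- \<kappa>) \<le> Z' / 4" using Z'0 by (simp add: exp_minus field_simps)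
  qed (simp add: \<kappa>_def)
  have negi: "integrable M (\<lambda>\<omega>. max 0 (- F (?Y \<omega>)))"
  proof (rule integrableI_nonneg)
    have "(\<integral>\<^sup>+\<omega>. ennreal (max 0 (- F (?Y \<omega>))) \<partial>M) = (\<integral>\<^sup>+\<omega>. ennreal (- F (?Y \<omega>)) \<partial>M)"
      by (intro nn_integral_cong) (simp add: max_def ennreal_neg)
    then show "(\<integral>\<^sup>+\<omega>. ennreal (max 0 (- F (?Y \<omega>))) \<partial>M) < \<infinity>" using neg by simp
  qed auto
  define h where "h k w = max 0 (- F w - real k)" for k w
  have hm: "h k \<in> borel_measurable borel_path_space" for k unfolding h_def[abs_def] using F by measurable
  have hi: "integrable M (\<lambda>\<omega>. h k (?Y \<omega>))" for k
    by (rule Bochner_Integration.integrable_bound[OF negi]) (auto simp: h_def)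
  have "(\<lambda>k. \<integral>\<omega>. h k (?Y \<omega>) \<partial>M) \<longlonglongrightarrow> (\<integral>\<omega>. 0 \<partial>M)"
  proof (rule integral_dominated_convergence[where w="\<lambda>\<omega>. max 0 (- F (?Y \<omega>))"])
    show "AE \<omega> in M. (\<lambda>k. h k (?Y \<omega>)) \<longlonglongrightarrow> 0"
    proof (rule AE_I2, rule tendsto_eventually)
      fix \<omega>
      show "\<forall>\<^sub>F k in sequentially. h k (?Y \<omega>) = 0"
        using eventually_ge_at_top[of "nat \<lceil>- F (?Y \<omega>)\<rceil>"]
      proof eventually_elim
        case (elim k)
        then have "- F (?Y \<omega>) \<le> real k" by linarith
        then show ?case unfolding h_def by simp
      qed
    qed
  qed (use negi in \<open>auto simp: h_def\<close>)
  then have "\<forall>\<^sub>F k in sequentially. (\<integral>\<omega>. h k (?Y \<omega>) \<partial>M) < \<delta> / exp \<kappa>"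
    by (rule order_tendstoD(2)) (use \<delta> in simp)
  then obtain m where m: "(\<integral>\<omega>. h m (?Y \<omega>) \<partial>M) < \<delta> / exp \<kappa>" by (auto simp: eventually_sequentially)
  define G where "G w = max (min (F w) (real n)) (- real m)" for w
  have Gb: "- real m \<le> G w" "G w \<le> real n" for w unfolding G_def by auto
  have Gm: "G \<in> borel_measurable borel_path_space" unfolding G_def[abs_def] using F by measurable
  have GY [measurable]: "(\<lambda>\<omega>. G (?Y \<omega>)) \<in> borel_measurable M" by (rule measurable_compose[OF Ym Gm])
  \<comment> \<open>In turn: \<open>f\<close> is bounded below by \<open>exp (- m) / 2\<close>; \<open>f\<close> is at most \<open>C\<close>; the mean of \<open>f\<close> is at
    least \<open>Z' * exp (- \<delta>)\<close>; it is at least \<open>Z' / 2\<close>, as the choice of \<open>\<kappa>\<close> presupposes; and \<open>ln f\<close> is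
    close to \<open>G\<close> under the law of the driven path.\<close>
  define \<eta> where "\<eta> = Min {exp (- real m) / 2, 1, Z' * (1 - exp (- \<delta>)), Z' / 2, \<delta> * exp (- real m) / (2 * exp \<kappa>)}"
  have \<eta>: "0 < \<eta>" "\<eta> \<le> exp (- real m) / 2" "\<eta> \<le> 1" "\<eta> \<le> Z' * (1 - exp (- \<delta>))" "\<eta> \<le> Z' / 2"
    "\<eta> \<le> \<delta> * exp (- real m) / (2 * exp \<kappa>)"
    unfolding \<eta>_def using Z'0 \<delta> by (auto simp: min_le_iff_disj)
  interpret \<nu>: prob_space ?\<nu> by (rule prob_space_distr[OF Ym])
  have eGm: "(\<lambda>w. exp (G w)) \<in> borel_measurable borel_path_space" using Gm by measurable
  obtain f where f: "f \<in> trig_polys" "\<forall>w\<in>path_space. exp (- real m) - \<eta> \<le> f w \<and> f w \<le> exp (real n) + \<eta>"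
    "(\<integral>w. \<bar>f w - exp (G w)\<bar> \<partial>?\<nu>) < \<eta>"
    using trig_polys_dense_in_two_means[OF \<nu>.finite_measure_axioms _ \<nu>.finite_measure_axioms _ eGm _ \<eta>(1), of "exp (- real m)" "exp (real n)"] Gb
    by auto
  have fm: "f \<in> borel_measurable borel_path_space" by (rule trig_polys_measurable[OF f(1)])
  define c\<^sub>0 where "c\<^sub>0 = exp (- real m) / 2"
  have c0: "0 < c\<^sub>0" unfolding c\<^sub>0_def by simp
  have fb: "c\<^sub>0 \<le> f w \<and> f w \<le> C" if "w \<in> path_space" for w
    using bspec[OF f(2) that] \<eta>(2,3) unfolding c\<^sub>0_def C_def by (intro conjI) linarith+
  have Yp: "?Y \<omega> \<in> path_space" if "\<omega> \<in> space M" for \<omega> using sample_path_in_path_space[OF that] .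
  have fi: "integrable M (\<lambda>\<omega>. f (?Y \<omega>))"
  proof (rule integrable_const_bound[OF AE_I2 measurable_compose[OF Ym fm], of C])
    show "norm (f (?Y \<omega>)) \<le> C" if "\<omega> \<in> space M" for \<omega> using fb[OF Yp[OF that]] c0 by auto
  qed
  have ei: "integrable M (\<lambda>\<omega>. exp (G (?Y \<omega>)))"
    using Gb by (intro integrable_const_bound[where B="exp (real n)"]) auto
  have d\<nu>: "(\<integral>\<omega>. \<bar>f (?Y \<omega>) - exp (G (?Y \<omega>))\<bar> \<partial>M) < \<eta>"
    using f(3) fm eGm by (subst (asm) integral_distr[OF Ym]) auto
  define Zf where "Zf = (\<integral>\<omega>. f (?Y \<omega>) \<partial>M)"
  have "Z' \<le> (\<integral>\<omega>. exp (G (?Y \<omega>)) \<partial>M)"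
    unfolding Z'_def using ei
  proof (rule integral_mono[rotated])
    show "integrable M (\<lambda>\<omega>. exp (min (F (?Y \<omega>)) (real n)))"
      by (intro integrable_const_bound[where B="exp (real n)"]) auto
  qed (auto simp: G_def)
  moreover have "(\<integral>\<omega>. exp (G (?Y \<omega>)) - f (?Y \<omega>) \<partial>M) \<le> (\<integral>\<omega>. \<bar>f (?Y \<omega>) - exp (G (?Y \<omega>))\<bar> \<partial>M)"
    using ei fi by (intro integral_mono) auto
  ultimately have Zf: "Z' - \<eta> \<le> Zf" using d\<nu> ei fi unfolding Zf_def by simp
  have Zf2: "C * exp (- \<kappa>) \<le> Zf / 2" using \<kappa>(2) Zf \<eta>(5) by linarith
  have "Z' * exp (- \<delta>) \<le> Zf" using Zf \<eta>(4) by (simp add: right_diff_distrib)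
  then have "Z * exp (- \<delta>) * exp (- \<delta>) \<le> Zf" using Z' by (meson exp_ge_zero less_imp_le mult_right_mono order_trans)
  then have "ln (Z * exp (- \<delta>) * exp (- \<delta>)) \<le> ln Zf" using Z by (subst ln_le_cancel_iff) (auto intro: less_le_trans[rotated])
  then have lnZ: "ln Z - 2 * \<delta> \<le> ln Zf" using Z by (simp add: ln_mult)
  obtain v where v: "v \<in> finite_energy_drifts M B"
    and dens: "\<And>A. A \<in> sets borel_path_space \<Longrightarrow> measure (distr M borel_path_space (steered_path v)) A \<le> exp \<kappa> * measure ?\<nu> A"
    and val: "ln Zf - \<delta> \<le> (\<integral>\<omega>. ln (f (steered_path v \<omega>)) \<partial>M) - mean_energy v / 2"
    unfolding Zf_def
  proof (rule bounded_density_drift[OF f(1) c0 fb \<delta> \<kappa>(1)], goal_cases)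
    case (3 v)
    show ?case by (rule 3(1)[OF 3(2-)])
  qed (use Zf2 in \<open>auto simp: Zf_def\<close>)
  let ?X = "steered_path v"
  let ?\<mu> = "distr M borel_path_space ?X"
  have Xm: "?X \<in> measurable M borel_path_space" by (rule steered_path_measurable[OF finite_energy_driftsD(1)[OF v]])
  have Xp: "?X \<omega> \<in> path_space" if "\<omega> \<in> space M" for \<omega> using measurable_space[OF Xm that] by simp
  have FX [measurable]: "(\<lambda>\<omega>. F (?X \<omega>)) \<in> borel_measurable M" by (rule measurable_compose[OF Xm F])
  interpret \<mu>: prob_space ?\<mu> by (rule prob_space_distr[OF Xm])
  have nn: "(\<integral>\<^sup>+\<omega>. g (?X \<omega>) \<partial>M) \<le> ennreal (exp \<kappa>) * (\<integral>\<^sup>+\<omega>. g (?Y \<omega>) \<partial>M)"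
    if g: "g \<in> borel_measurable borel_path_space" for g :: "(real \<Rightarrow> real^'d) \<Rightarrow> ennreal"
  proof -
    have "(\<integral>\<^sup>+w. g w \<partial>?\<mu>) \<le> ennreal (exp \<kappa>) * (\<integral>\<^sup>+w. g w \<partial>?\<nu>)"
      by (rule nn_integral_le_if_measure_le[OF \<mu>.finite_measure_axioms \<nu>.finite_measure_axioms]) (use dens g in auto)
    then show ?thesis using g by (simp add: nn_integral_distr[OF Xm] nn_integral_distr[OF Ym])
  qed
  have transfer: "integrable M (\<lambda>\<omega>. g (?X \<omega>)) \<and> (\<integral>\<omega>. g (?X \<omega>) \<partial>M) \<le> exp \<kappa> * (\<integral>\<omega>. g (?Y \<omega>) \<partial>M)"
    if g: "g \<in> borel_measurable borel_path_space" "\<And>w. 0 \<le> g w" "integrable M (\<lambda>\<omega>. g (?Y \<omega>))" for g :: "(real \<Rightarrow> real^'d) \<Rightarrow> real"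
  proof -
    have gX: "(\<lambda>\<omega>. g (?X \<omega>)) \<in> borel_measurable M" by (rule measurable_compose[OF Xm g(1)])
    have "(\<integral>\<^sup>+\<omega>. ennreal (g (?X \<omega>)) \<partial>M) \<le> ennreal (exp \<kappa>) * (\<integral>\<^sup>+\<omega>. ennreal (g (?Y \<omega>)) \<partial>M)"
      by (rule nn) (use g(1) in measurable)
    also have "(\<integral>\<^sup>+\<omega>. ennreal (g (?Y \<omega>)) \<partial>M) = ennreal (\<integral>\<omega>. g (?Y \<omega>) \<partial>M)"
      using g by (intro nn_integral_eq_integral) auto
    also have "ennreal (exp \<kappa>) * \<dots> = ennreal (exp \<kappa> * (\<integral>\<omega>. g (?Y \<omega>) \<partial>M))"
      using g(2) by (simp add: ennreal_mult)
    finally have le: "(\<integral>\<^sup>+\<omega>. ennreal (g (?X \<omega>)) \<partial>M) \<le> ennreal (exp \<kappa> * (\<integral>\<omega>. g (?Y \<omega>) \<partial>M))" .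
    have i: "integrable M (\<lambda>\<omega>. g (?X \<omega>))"
      using gX g(2) le by (intro integrableI_nonneg) (auto intro: le_less_trans)
    have "ennreal (\<integral>\<omega>. g (?X \<omega>) \<partial>M) \<le> ennreal (exp \<kappa> * (\<integral>\<omega>. g (?Y \<omega>) \<partial>M))"
      using le i g(2) by (subst nn_integral_eq_integral[symmetric]) auto
    then show ?thesis using i g(2) by (subst (asm) ennreal_le_iff) (auto intro!: mult_nonneg_nonneg integral_nonneg)
  qed
  have "(\<integral>\<^sup>+\<omega>. ennreal (- F (?X \<omega>)) \<partial>M) \<le> ennreal (exp \<kappa>) * (\<integral>\<^sup>+\<omega>. ennreal (- F (?Y \<omega>)) \<partial>M)"
    by (rule nn) (use F in measurable)
  also have "\<dots> < \<infinity>" using neg by (simp add: ennreal_mult_less_top)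
  finally have FXi: "integrable M (\<lambda>\<omega>. F (?X \<omega>))"
    using positive_part_finite[OF v F expF] FX unfolding real_integrable_def by (auto simp: less_top)
  have GXm: "(\<lambda>\<omega>. G (?X \<omega>)) \<in> borel_measurable M" by (rule measurable_compose[OF Xm Gm])
  have GXi: "integrable M (\<lambda>\<omega>. G (?X \<omega>))"
  proof (rule integrable_const_bound[OF AE_I2 GXm, of "real n + real m"])
    show "norm (G (?X \<omega>)) \<le> real n + real m" for \<omega> using Gb[of "?X \<omega>"] by auto
  qed
  define D where "D w = \<bar>f w - exp (G w)\<bar> / c\<^sub>0" for w
  have Dm: "D \<in> borel_measurable borel_path_space" unfolding D_def[abs_def] using fm Gm by measurable
  have DY: "integrable M (\<lambda>\<omega>. D (?Y \<omega>))" unfolding D_def using fi ei by auto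
  have DX: "integrable M (\<lambda>\<omega>. D (?X \<omega>))" "(\<integral>\<omega>. D (?X \<omega>) \<partial>M) \<le> exp \<kappa> * (\<integral>\<omega>. D (?Y \<omega>) \<partial>M)"
    using transfer[OF Dm _ DY] c0 by (auto simp: D_def)
  have "(\<integral>\<omega>. D (?Y \<omega>) \<partial>M) \<le> \<eta> / c\<^sub>0" using d\<nu> c0 unfolding D_def by (simp add: divide_right_mono)
  then have "exp \<kappa> * (\<integral>\<omega>. D (?Y \<omega>) \<partial>M) \<le> exp \<kappa> * (\<eta> / c\<^sub>0)" by (rule mult_left_mono) simp
  also have "\<dots> \<le> exp \<kappa> * (\<delta> * exp (- real m) / (2 * exp \<kappa>) / c\<^sub>0)"
    using \<eta>(6) c0 by (intro mult_left_mono divide_right_mono) auto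
  also have "\<dots> = \<delta>" unfolding c\<^sub>0_def by simp
  finally have ED: "(\<integral>\<omega>. D (?X \<omega>) \<partial>M) \<le> \<delta>" using DX(2) by simp
  have hX: "integrable M (\<lambda>\<omega>. h m (?X \<omega>))" "(\<integral>\<omega>. h m (?X \<omega>) \<partial>M) \<le> exp \<kappa> * (\<integral>\<omega>. h m (?Y \<omega>) \<partial>M)"
    using transfer[OF hm _ hi, of m] by (auto simp: h_def)
  have "exp \<kappa> * (\<integral>\<omega>. h m (?Y \<omega>) \<partial>M) \<le> \<delta>" using m by (simp add: field_simps)
  with hX(2) have Eh: "(\<integral>\<omega>. h m (?X \<omega>) \<partial>M) \<le> \<delta>" by simp
  have lnD: "\<bar>ln (f w) - G w\<bar> \<le> D w" if "w \<in> path_space" for w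
  proof -
    have "c\<^sub>0 \<le> exp (- real m)" unfolding c\<^sub>0_def by simp
    also have "\<dots> \<le> exp (G w)" using Gb(1) by simp
    finally have "\<bar>ln (f w) - ln (exp (G w))\<bar> \<le> D w"
      unfolding D_def using fb[OF that] c0 by (intro abs_ln_diff_le) auto
    then show ?thesis by simp
  qed
  have "(\<integral>\<omega>. ln (f (?X \<omega>)) \<partial>M) \<le> (\<integral>\<omega>. F (?X \<omega>) + h m (?X \<omega>) + D (?X \<omega>) \<partial>M)"
  proof (rule integral_mono)
    show "integrable M (\<lambda>\<omega>. ln (f (?X \<omega>)))"
    proof (rule Bochner_Integration.integrable_bound[OF Bochner_Integration.integrable_add[OF integrable_abs[OF GXi] DX(1)]])
      show "(\<lambda>\<omega>. ln (f (?X \<omega>))) \<in> borel_measurable M" using measurable_compose[OF Xm fm] by measurable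
      show "AE \<omega> in M. norm (ln (f (?X \<omega>))) \<le> norm (\<bar>G (?X \<omega>)\<bar> + D (?X \<omega>))"
      proof (rule AE_I2)
        fix \<omega> assume "\<omega> \<in> space M"
        then show "norm (ln (f (?X \<omega>))) \<le> norm (\<bar>G (?X \<omega>)\<bar> + D (?X \<omega>))" using lnD[OF Xp] by fastforce
      qed
    qed
    show "integrable M (\<lambda>\<omega>. F (?X \<omega>) + h m (?X \<omega>) + D (?X \<omega>))" using FXi hX(1) DX(1) by auto
    show "ln (f (?X \<omega>)) \<le> F (?X \<omega>) + h m (?X \<omega>) + D (?X \<omega>)" if "\<omega> \<in> space M" for \<omega>
    proof -
      have "G (?X \<omega>) \<le> F (?X \<omega>) + h m (?X \<omega>)" unfolding G_def h_def by auto
      then show ?thesis using lnD[OF Xp[OF that]] by linarith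
    qed
  qed
  also have "\<dots> = (\<integral>\<omega>. F (?X \<omega>) \<partial>M) + (\<integral>\<omega>. h m (?X \<omega>) \<partial>M) + (\<integral>\<omega>. D (?X \<omega>) \<partial>M)"
    using FXi hX(1) DX(1) by simp
  finally have "ln Z - 5 * \<delta> \<le> (\<integral>\<omega>. F (?X \<omega>) \<partial>M) - mean_energy v / 2"
    using Eh ED val lnZ by linarith
  then show thesis using that[OF v FXi] unfolding Z_def by simp
qed

end

theorem theorem1p1:
  fixes M :: "'o measure" and B :: "real \<Rightarrow> 'o \<Rightarrow> real^'d"
    and W :: "(real \<Rightarrow> real^'d) measure" and F :: "(real \<Rightarrow> real^'d) \<Rightarrow> real"
  assumes "standard_brownian_motion M B"
    and "wiener_measure W"
    and "F \<in> borel_measurable borel_path_space"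
    and "(\<integral>\<^sup>+w. ennreal (exp (F w)) \<partial>W) < \<infinity>"
    and "(\<integral>\<^sup>+w. ennreal (max (- F w) 0) \<partial>W) < \<infinity>"
  shows "ereal (ln (\<integral>\<omega>. exp (F (sample_path B \<omega>)) \<partial>M)) =
    (SUP v\<in>finite_energy_drifts M B. extended_expectation M
      (\<lambda>\<omega>. ereal (F (sample_path (drifted B v) \<omega>)) - ereal (1 / 2) * enn2ereal (energy v \<omega>)))"
proof -
  interpret standard_brownian_motion M B by fact
  have W: "distr M borel_path_space (sample_path B) = W" by (rule distr_sample_path) fact+
  note F = assms(3)
  have FY [measurable]: "(\<lambda>\<omega>. F (sample_path B \<omega>)) \<in> borel_measurable M" by (rule measurable_compose[OF sample_path_measurable F])
  have nnW: "(\<integral>\<^sup>+w. g w \<partial>W) = (\<integral>\<^sup>+\<omega>. g (sample_path B \<omega>) \<partial>M)" if "g \<in> borel_measurable borel_path_space" for g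
    unfolding W[symmetric] by (rule nn_integral_distr[OF sample_path_measurable]) (use that in simp)
  have "(\<integral>\<^sup>+w. ennreal (exp (F w)) \<partial>W) = (\<integral>\<^sup>+\<omega>. ennreal (exp (F (sample_path B \<omega>))) \<partial>M)"
    by (rule nnW) (use F in measurable)
  then have expF: "integrable M (\<lambda>\<omega>. exp (F (sample_path B \<omega>)))"
    using assms(4) by (intro integrableI_nonneg) auto
  have "(\<integral>\<^sup>+w. ennreal (max (- F w) 0) \<partial>W) = (\<integral>\<^sup>+\<omega>. ennreal (max (- F (sample_path B \<omega>)) 0) \<partial>M)"
    by (rule nnW) (use F in measurable)
  also have "\<dots> = (\<integral>\<^sup>+\<omega>. ennreal (- F (sample_path B \<omega>)) \<partial>M)"
    by (intro nn_integral_cong) (simp add: max_def ennreal_neg)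
  finally have neg: "(\<integral>\<^sup>+\<omega>. ennreal (- F (sample_path B \<omega>)) \<partial>M) < \<infinity>" using assms(5) by simp
  show ?thesis
  proof (rule antisym)
    show "(SUP v\<in>finite_energy_drifts M B. extended_expectation M
        (\<lambda>\<omega>. ereal (F (sample_path (drifted B v) \<omega>)) - ereal (1 / 2) * enn2ereal (energy v \<omega>))) \<le>
      ereal (ln (\<integral>\<omega>. exp (F (sample_path B \<omega>)) \<partial>M))"
      by (rule SUP_least) (rule upper_bound[OF _ F expF])
    show "ereal (ln (\<integral>\<omega>. exp (F (sample_path B \<omega>)) \<partial>M)) \<le> (SUP v\<in>finite_energy_drifts M B. extended_expectation M
        (\<lambda>\<omega>. ereal (F (sample_path (drifted B v) \<omega>)) - ereal (1 / 2) * enn2ereal (energy v \<omega>)))" (is "_ \<le> ?S")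
    proof (rule ereal_le_epsilon2)
      fix e :: real assume "0 < e"
      then have e: "0 < e / 5" by simp
      obtain v where v: "v \<in> finite_energy_drifts M B" "integrable M (\<lambda>\<omega>. F (steered_path v \<omega>))"
        "ln (\<integral>\<omega>. exp (F (sample_path B \<omega>)) \<partial>M) - 5 * (e / 5) \<le> (\<integral>\<omega>. F (steered_path v \<omega>) \<partial>M) - mean_energy v / 2"
        using near_optimal_drift[OF F expF neg e] .
      have "ereal ((\<integral>\<omega>. F (steered_path v \<omega>) \<partial>M) - mean_energy v / 2) \<le> ?S"
        unfolding drifted_value_integrable[OF v(1,2), symmetric] by (rule SUP_upper[OF v(1)])
      then have "ereal ((\<integral>\<omega>. F (steered_path v \<omega>) \<partial>M) - mean_energy v / 2) + ereal e \<le> ?S + ereal e"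
        by (rule add_right_mono)
      moreover have "ereal (ln (\<integral>\<omega>. exp (F (sample_path B \<omega>)) \<partial>M)) \<le>
          ereal ((\<integral>\<omega>. F (steered_path v \<omega>) \<partial>M) - mean_energy v / 2) + ereal e"
        using v(3) by simp
      ultimately show "ereal (ln (\<integral>\<omega>. exp (F (sample_path B \<omega>)) \<partial>M)) \<le> ?S + ereal e" by (rule order_trans[rotated])
    qed
  qed
qed

end
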